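(* Let $X$ be a smooth complete intersection of codimension $c\ge1$ in the projective space $\mathbf{P}^N$ over an algebraically closed field of characteristic zero, and let $\lambda=(\lambda_1\ge\dots\ge\lambda_k>0)$ be a partition with $k\ge 1$ parts such that $(1+k)c<N$. Then the Schur power $\mathsf{S}^\lambda\Omega_X$ of the cotangent bundle of $X$ is not ample.
   Context: Ampleness of vector bundles: for a vector bundle $E$ on a variety, $\mathbf{P}(E^\vee)$ is the projective bundle of lines in $E^\vee$; $E$ is ample if the Serre line bundle $\mathcal{O}_{\mathbf{P}(E^\vee)}(1)$ is ample on $\mathbf{P}(E^\vee)$. Schur powers: a partition $\lambda=(\lambda_1\ge\dots\ge\lambda_k>0)$ has a jump sequence $s=(s_1>\dots>s_t)$, the set of indices $i\in\{1,\dots,k\}$ with $\lambda_i>\lambda_{i+1}$ (convention $\lambda_{k+1}=0$, so $s_1=k$). For a vector bundle $E$ of rank $n\ge k$ on a variety $Y$, let $\pi:\mathrm{Flag}_s(E^\vee)\to Y$ be the bundle of flags $E_y^\vee\supseteq F_1\supsetneq\dots\supsetneq F_t\supsetneq 0$ with $\dim F_i=s_i$, with universal subbundles $U_{s_1}\supsetneq\dots\supsetneq U_{s_t}$ (and $U_{s_{t+1}}:=0$). Put $\mathcal{L}_\lambda(E^\vee):=\bigotimes_{i=1}^t\det\bigl((U_{s_i}/U_{s_{i+1}})^\vee\bigr)^{\lambda_{s_i}}$. The Schur power is $\mathsf{S}^\lambda E:=\pi_*\mathcal{L}_\lambda(E^\vee)$; thus $\mathsf{S}^{(m)}E$ is the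 $m$-th symmetric power and $\mathsf{S}^{(1^k)}E=\Lambda^kE$. *)

theory Defs
  imports
    "HOL-Analysis.Analysis"
    "HOL-Library.Function_Algebras"
    "HOL-Computational_Algebra.Computational_Algebra"
begin

section \<open>Vector spaces of functions\<close>

text \<open>Every vector space below is a subspace of a function space \<open>'v \<Rightarrow> 'k\<close> with pointwise
  operations (addition comes from \<^theory>\<open>HOL-Library.Function_Algebras\<close>).\<close>

definition fscale :: "'k::field \<Rightarrow> ('v \<Rightarrow> 'k) \<Rightarrow> 'v \<Rightarrow> 'k" where
  "fscale c f = (\<lambda>v. c * f v)"

interpretation fvs: vector_space "fscale :: 'k::field \<Rightarrow> ('v \<Rightarrow> 'k) \<Rightarrow> 'v \<Rightarrow> 'k"
  by unfold_locales (auto simp: fscale_def fun_eq_iff algebra_simps)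


section \<open>Spaces with functions\<close>

text \<open>Classical varieties over an algebraically closed field \<open>k\<close>, as topological spaces together
  with a sheaf of \<open>k\<close>-valued regular functions. Points are the closed points. Functions are total;
  whether a function is regular on \<open>U\<close> depends only on its values on \<open>U\<close>, and \<open>regs M U\<close> is
  meaningful for open \<open>U\<close> only.\<close>

record ('p, 'k) fspace =
  opens :: "'p topology"
  regs :: "'p set \<Rightarrow> ('p \<Rightarrow> 'k) set"

definition points :: "('p, 'k) fspace \<Rightarrow> 'p set" where
  "points M = topspace (opens M)"

inductive_set alg_gen :: "('z \<Rightarrow> 'k::comm_ring_1) set \<Rightarrow> ('z \<Rightarrow> 'k) set"
  for G :: "('z \<Rightarrow> 'k) set" where
  const: "(\<lambda>_. c) \<in> alg_gen G"
| gen: "g \<in> G \<Longrightarrow> g \<in> alg_gen G"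
| add: "g \<in> alg_gen G \<Longrightarrow> h \<in> alg_gen G \<Longrightarrow> g + h \<in> alg_gen G"
| mult: "g \<in> alg_gen G \<Longrightarrow> h \<in> alg_gen G \<Longrightarrow> g * h \<in> alg_gen G"

text \<open>The space whose basic open sets are the non-vanishing loci of the functions \<open>h\<close> with
  \<open>(D, h) \<in> A\<close> (\<open>h\<close> being considered on \<open>D\<close> only), and whose regular functions are locally
  quotients of such functions.\<close>

definition generated_space :: "('z set \<times> ('z \<Rightarrow> 'k::field)) set \<Rightarrow> ('z, 'k) fspace" where
  "generated_space A =
    \<lparr> opens = topology_generated_by {{z \<in> D. h z \<noteq> 0} |D h. (D, h) \<in> A},
      regs = (\<lambda>W. {f. \<forall>z\<in>W. \<exists>D g h. (D, g) \<in> A \<and> (D, h) \<in> A \<and> z \<in> D \<and> h z \<noteq> 0 \<and>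
                        (\<forall>w \<in> W \<inter> D. h w \<noteq> 0 \<longrightarrow> f w = g w / h w)}) \<rparr>"

definition sub_fspace :: "('p, 'k) fspace \<Rightarrow> 'p set \<Rightarrow> ('p, 'k) fspace" where
  "sub_fspace M S =
    \<lparr> opens = subtopology (opens M) S,
      regs = (\<lambda>W. {f. \<forall>x\<in>W. \<exists>U g. openin (opens M) U \<and> x \<in> U \<and> g \<in> regs M U \<and>
                        (\<forall>y \<in> U \<inter> W. f y = g y)}) \<rparr>"

definition quotient_fspace :: "('z \<Rightarrow> 'p) \<Rightarrow> ('z, 'k) fspace \<Rightarrow> 'p set \<Rightarrow> ('p, 'k) fspace" where
  "quotient_fspace q M Q =
    \<lparr> opens = topology (\<lambda>U. U \<subseteq> Q \<and> openin (opens M) {z \<in> points M. q z \<in> U}),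
      regs = (\<lambda>U. {f. f \<circ> q \<in> regs M {z \<in> points M. q z \<in> U}}) \<rparr>"

definition fspace_morphism ::
  "('p, 'k) fspace \<Rightarrow> ('q, 'k) fspace \<Rightarrow> ('p \<Rightarrow> 'q) \<Rightarrow> bool" where
  "fspace_morphism M N f \<longleftrightarrow>
    continuous_map (opens M) (opens N) f \<and>
    (\<forall>U g. openin (opens N) U \<and> g \<in> regs N U \<longrightarrow> g \<circ> f \<in> regs M {x \<in> points M. f x \<in> U})"

definition fspace_isomorphic :: "('p, 'k) fspace \<Rightarrow> ('q, 'k) fspace \<Rightarrow> bool" where
  "fspace_isomorphic M N \<longleftrightarrow>
    (\<exists>f g. fspace_morphism M N f \<and> fspace_morphism N M g \<and>
           (\<forall>x \<in> points M. g (f x) = x) \<and> (\<forall>y \<in> points N. f (g y) = y))"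

definition coord_space :: "nat \<Rightarrow> (nat \<Rightarrow> 'k::zero) set" where
  "coord_space n = {x. \<forall>i\<ge>n. x i = 0}"

text \<open>Over an infinite field, polynomials in \<open>n\<close> variables are the same as polynomial functions.\<close>

definition polyfun :: "nat \<Rightarrow> ((nat \<Rightarrow> 'k::comm_ring_1) \<Rightarrow> 'k) set" where
  "polyfun n = alg_gen {(\<lambda>x. x i) |i. i < n}"

definition affine_fspace :: "nat \<Rightarrow> (nat \<Rightarrow> 'k::field, 'k) fspace" where
  "affine_fspace n = generated_space {(coord_space n, p) |p. p \<in> polyfun n}"

definition is_affine :: "('p, 'k::field) fspace \<Rightarrow> bool" where
  "is_affine M \<longleftrightarrow>
    (\<exists>n Z. closedin (opens (affine_fspace n)) Z \<and> fspace_isomorphic M (sub_fspace (affine_fspace n) Z))"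


section \<open>Dimension, tangent spaces, smoothness\<close>

definition irreducible_closed :: "'p topology \<Rightarrow> 'p set \<Rightarrow> bool" where
  "irreducible_closed T Z \<longleftrightarrow>
    closedin T Z \<and> Z \<noteq> {} \<and>
    (\<forall>A B. closedin T A \<and> closedin T B \<and> Z \<subseteq> A \<union> B \<longrightarrow> Z \<subseteq> A \<or> Z \<subseteq> B)"

definition irreducible_chain :: "'p topology \<Rightarrow> nat \<Rightarrow> (nat \<Rightarrow> 'p set) \<Rightarrow> bool" where
  "irreducible_chain T n C \<longleftrightarrow>
    (\<forall>i\<le>n. irreducible_closed T (C i)) \<and> (\<forall>i<n. C i \<subset> C (Suc i))"

definition has_dim :: "'p topology \<Rightarrow> nat \<Rightarrow> bool" where
  "has_dim T n \<longleftrightarrow> (\<exists>C. irreducible_chain T n C) \<and> \<not> (\<exists>C. irreducible_chain T (Suc n) C)"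

text \<open>The Krull dimension of the local ring at \<open>x\<close>: its prime ideals correspond to the irreducible
  closed sets through \<open>x\<close>.\<close>

definition has_local_dim :: "'p topology \<Rightarrow> 'p \<Rightarrow> nat \<Rightarrow> bool" where
  "has_local_dim T x n \<longleftrightarrow>
    (\<exists>C. irreducible_chain T n C \<and> x \<in> C 0) \<and> \<not> (\<exists>C. irreducible_chain T (Suc n) C \<and> x \<in> C 0)"

definition regular_at :: "('p, 'k) fspace \<Rightarrow> 'p \<Rightarrow> ('p \<Rightarrow> 'k) \<Rightarrow> bool" where
  "regular_at M x f \<longleftrightarrow> (\<exists>U. openin (opens M) U \<and> x \<in> U \<and> f \<in> regs M U)"

text \<open>The \<open>k\<close>-linear derivations \<open>O\<^sub>x \<rightarrow> k = O\<^sub>x/m\<^sub>x\<close>, that is, the dual of \<open>m\<^sub>x/m\<^sub>x\<^sup>2\<close>; they are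
  viewed as functions of representatives of germs.\<close>

definition tangent_space :: "('p, 'k::field) fspace \<Rightarrow> 'p \<Rightarrow> (('p \<Rightarrow> 'k) \<Rightarrow> 'k) set" where
  "tangent_space M x = {D.
     (\<forall>f. \<not> regular_at M x f \<longrightarrow> D f = 0) \<and>
     (\<forall>f g. regular_at M x f \<and> regular_at M x g \<and>
        (\<exists>U. openin (opens M) U \<and> x \<in> U \<and> (\<forall>y\<in>U. f y = g y)) \<longrightarrow> D f = D g) \<and>
     (\<forall>f g. regular_at M x f \<and> regular_at M x g \<longrightarrow> D (f + g) = D f + D g) \<and>
     (\<forall>c f. regular_at M x f \<longrightarrow> D (fscale c f) = c * D f) \<and>
     (\<forall>f g. regular_at M x f \<and> regular_at M x g \<longrightarrow> D (f * g) = f x * D g + g x * D f)}"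

text \<open>Over an algebraically closed field, smooth means that all local rings are regular.\<close>

definition smooth_fspace :: "('p, 'k::field) fspace \<Rightarrow> bool" where
  "smooth_fspace M \<longleftrightarrow>
    (\<forall>x \<in> points M. \<exists>n. has_local_dim (opens M) x n \<and> fvs.dim (tangent_space M x) = n)"


section \<open>Complete intersections in projective space\<close>

definition proj_fspace :: "nat \<Rightarrow> ((nat \<Rightarrow> 'k::field) set, 'k) fspace" where
  "proj_fspace N = quotient_fspace (\<lambda>v. fvs.span {v})
     (sub_fspace (affine_fspace (Suc N)) (coord_space (Suc N) - {0}))
     {l. \<exists>v \<in> coord_space (Suc N) - {0}. l = fvs.span {v}}"

definition proj_subvariety :: "nat \<Rightarrow> (nat \<Rightarrow> 'k::field) set set \<Rightarrow> ((nat \<Rightarrow> 'k) set, 'k) fspace" where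
  "proj_subvariety N X = sub_fspace (proj_fspace N) X"

definition homogeneous :: "nat \<Rightarrow> nat \<Rightarrow> ((nat \<Rightarrow> 'k::field) \<Rightarrow> 'k) \<Rightarrow> bool" where
  "homogeneous n d p \<longleftrightarrow> p \<in> polyfun n \<and> (\<forall>c x. p (fscale c x) = c ^ d * p x)"

definition vanishing_ideal :: "nat \<Rightarrow> (nat \<Rightarrow> 'k::field) set set \<Rightarrow> ((nat \<Rightarrow> 'k) \<Rightarrow> 'k) set" where
  "vanishing_ideal N X = {p \<in> polyfun (Suc N). \<forall>l\<in>X. \<forall>v\<in>l. p v = 0}"

definition complete_intersection :: "nat \<Rightarrow> nat \<Rightarrow> (nat \<Rightarrow> 'k::field) set set \<Rightarrow> bool" where
  "complete_intersection N c X \<longleftrightarrow>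
    closedin (opens (proj_fspace N)) X \<and>
    (\<exists>n. has_dim (opens (proj_subvariety N X)) n \<and> n + c = N) \<and>
    (\<exists>f d. (\<forall>i<c. 0 < d i \<and> homogeneous (Suc N) (d i) (f i)) \<and>
       vanishing_ideal N X = {\<Sum>i<c. a i * f i |a. \<forall>i<c. a i \<in> polyfun (Suc N)})"


section \<open>Vector bundles as sheaves of fibrewise functions\<close>

text \<open>A bundle on \<open>M\<close> is given by its sheaf of sections. The fibre at each point is a vector space
  of functions \<open>'v \<Rightarrow> 'k\<close>, and a section over \<open>U\<close> assigns to each point of \<open>U\<close> an element of the
  fibre. As for functions, the values of a section outside of \<open>U\<close> are irrelevant.\<close>

type_synonym ('p, 'v, 'k) fbundle = "'p set \<Rightarrow> ('p \<Rightarrow> 'v \<Rightarrow> 'k) set"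

definition fibre :: "('p, 'k) fspace \<Rightarrow> ('p, 'v, 'k) fbundle \<Rightarrow> 'p \<Rightarrow> ('v \<Rightarrow> 'k) set" where
  "fibre M E y = {s y |s U. openin (opens M) U \<and> y \<in> U \<and> s \<in> E U}"

text \<open>The value at \<open>x\<close> of the differential of \<open>g\<close>, as an element of the dual of the tangent space.\<close>

definition differential ::
  "('p, 'k::field) fspace \<Rightarrow> ('p \<Rightarrow> 'k) \<Rightarrow> 'p \<Rightarrow> (('p \<Rightarrow> 'k) \<Rightarrow> 'k) \<Rightarrow> 'k" where
  "differential M g x = (\<lambda>D. if D \<in> tangent_space M x then D g else 0)"

definition cotangent_bundle ::
  "('p, 'k::field) fspace \<Rightarrow> ('p, ('p \<Rightarrow> 'k) \<Rightarrow> 'k, 'k) fbundle" where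
  "cotangent_bundle M U = {\<omega>. \<forall>x\<in>U. \<exists>V (m::nat) a g. openin (opens M) V \<and> x \<in> V \<and> V \<subseteq> U \<and>
     (\<forall>i<m. a i \<in> regs M V \<and> g i \<in> regs M V) \<and>
     (\<forall>y\<in>V. \<omega> y = (\<Sum>i<m. fscale (a i y) (differential M (g i) y)))}"

text \<open>Pure tensors, and tensor products of bundles, realised in the space of functions on lists:
  for spaces of functions, the canonical map from the tensor product is injective.\<close>

definition pure_tensor :: "('v \<Rightarrow> 'k::field) list \<Rightarrow> 'v list \<Rightarrow> 'k" where
  "pure_tensor es = (\<lambda>vs. if length vs = length es then \<Prod>i<length es. (es ! i) (vs ! i) else 0)"

definition tensor_bundle ::
  "('p, 'k::field) fspace \<Rightarrow> ('p, 'v, 'k) fbundle list \<Rightarrow> ('p, 'v list, 'k) fbundle" where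
  "tensor_bundle M Es U = {\<tau>. \<forall>x\<in>U. \<exists>V (m::nat) a \<sigma>. openin (opens M) V \<and> x \<in> V \<and> V \<subseteq> U \<and>
     (\<forall>j<m. a j \<in> regs M V \<and> (\<forall>i<length Es. \<sigma> j i \<in> (Es ! i) V)) \<and>
     (\<forall>y\<in>V. \<tau> y = (\<Sum>j<m. fscale (a j y) (pure_tensor (map (\<lambda>i. \<sigma> j i y) [0..<length Es]))))}"

text \<open>Direct image along \<open>\<pi>\<close>: the value at \<open>y\<close> of a section is its restriction to the preimage of
  \<open>y\<close>.\<close>

definition direct_image ::
  "('z, 'k::field) fspace \<Rightarrow> ('z \<Rightarrow> 'p) \<Rightarrow> ('z, 'v, 'k) fbundle \<Rightarrow> ('p, 'z \<times> 'v, 'k) fbundle" where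
  "direct_image Z \<pi> L U =
    {(\<lambda>y (z, v). if z \<in> points Z \<and> \<pi> z = y then \<sigma> z v else 0) |\<sigma>.
       \<sigma> \<in> L {z \<in> points Z. \<pi> z \<in> U}}"


section \<open>Flag bundles of the dual\<close>

definition dual_fibre ::
  "('p, 'k::field) fspace \<Rightarrow> ('p, 'v, 'k) fbundle \<Rightarrow> 'p \<Rightarrow> (('v \<Rightarrow> 'k) \<Rightarrow> 'k) set" where
  "dual_fibre M E y = {\<phi>.
     (\<forall>e. e \<notin> fibre M E y \<longrightarrow> \<phi> e = 0) \<and>
     (\<forall>e \<in> fibre M E y. \<forall>e' \<in> fibre M E y. \<phi> (e + e') = \<phi> e + \<phi> e') \<and>
     (\<forall>c. \<forall>e \<in> fibre M E y. \<phi> (fscale c e) = c * \<phi> e)}"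

text \<open>The total space of the \<open>k\<close>-fold fibre product of the dual of \<open>E\<close> (for \<open>k = 1\<close>, the spectrum
  of the symmetric algebra of \<open>E\<close>): functions are generated by functions on the base and by the
  linear functions that sections of \<open>E\<close> define on each of the \<open>k\<close> factors.\<close>

definition dual_tuples_over ::
  "('p, 'k::field) fspace \<Rightarrow> ('p, 'v, 'k) fbundle \<Rightarrow> nat \<Rightarrow> 'p set \<Rightarrow> ('p \<times> (('v \<Rightarrow> 'k) \<Rightarrow> 'k) list) set" where
  "dual_tuples_over M E k U = {(y, \<phi>s). y \<in> U \<and> length \<phi>s = k \<and> set \<phi>s \<subseteq> dual_fibre M E y}"

definition dual_tuples ::
  "('p, 'k::field) fspace \<Rightarrow> ('p, 'v, 'k) fbundle \<Rightarrow> nat \<Rightarrow> ('p \<times> (('v \<Rightarrow> 'k) \<Rightarrow> 'k) list, 'k) fspace" where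
  "dual_tuples M E k = generated_space {(dual_tuples_over M E k U, h) |U h.
     openin (opens M) U \<and>
     h \<in> alg_gen ({(\<lambda>(y, \<phi>s). a y) |a. a \<in> regs M U} \<union>
                   {(\<lambda>(y, \<phi>s). (\<phi>s ! j) (s y)) |j s. j < k \<and> s \<in> E U})}"

definition frame_bundle ::
  "('p, 'k::field) fspace \<Rightarrow> ('p, 'v, 'k) fbundle \<Rightarrow> nat \<Rightarrow> ('p \<times> (('v \<Rightarrow> 'k) \<Rightarrow> 'k) list, 'k) fspace" where
  "frame_bundle M E k = sub_fspace (dual_tuples M E k)
     {(y, \<phi>s) \<in> points (dual_tuples M E k). distinct \<phi>s \<and> fvs.independent (set \<phi>s)}"

definition flags ::
  "('p, 'k::field) fspace \<Rightarrow> ('p, 'v, 'k) fbundle \<Rightarrow> nat list \<Rightarrow> ('p \<times> (('v \<Rightarrow> 'k) \<Rightarrow> 'k) set list) set" where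
  "flags M E s = {(y, F). y \<in> points M \<and> length F = length s \<and>
     (\<forall>i<length s. fvs.subspace (F ! i) \<and> F ! i \<subseteq> dual_fibre M E y \<and> fvs.dim (F ! i) = s ! i) \<and>
     (\<forall>i<length s. \<forall>j<length s. i < j \<longrightarrow> F ! j \<subset> F ! i)}"

definition flag_of ::
  "nat list \<Rightarrow> 'p \<times> (('v \<Rightarrow> 'k::field) \<Rightarrow> 'k) list \<Rightarrow> 'p \<times> (('v \<Rightarrow> 'k) \<Rightarrow> 'k) set list" where
  "flag_of s = (\<lambda>(y, \<phi>s). (y, map (\<lambda>d. fvs.span (set (take d \<phi>s))) s))"

text \<open>For a strictly decreasing sequence \<open>s\<close> of positive numbers: the bundle of flags of type \<open>s\<close> in
  the dual of \<open>E\<close>, with the structure of a quotient of the bundle of frames of its largest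
  member.\<close>

definition flag_bundle ::
  "('p, 'k::field) fspace \<Rightarrow> ('p, 'v, 'k) fbundle \<Rightarrow> nat list \<Rightarrow>
   ('p \<times> (('v \<Rightarrow> 'k) \<Rightarrow> 'k) set list, 'k) fspace" where
  "flag_bundle M E s = quotient_fspace (flag_of s) (frame_bundle M E (hd s)) (flags M E s)"

text \<open>Alternating \<open>d\<close>-linear forms on \<open>V/V'\<close>; when \<open>d\<close> is the dimension of \<open>V/V'\<close>, this is the
  determinant of the dual of \<open>V/V'\<close>.\<close>

definition alternating_forms ::
  "nat \<Rightarrow> ('u \<Rightarrow> 'k::field) set \<Rightarrow> ('u \<Rightarrow> 'k) set \<Rightarrow> (('u \<Rightarrow> 'k) list \<Rightarrow> 'k) set" where
  "alternating_forms d V V' = {\<omega>.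
     (\<forall>us. \<not> (length us = d \<and> set us \<subseteq> V) \<longrightarrow> \<omega> us = 0) \<and>
     (\<forall>us j c u v. length us = d \<and> set us \<subseteq> V \<and> j < d \<and> u \<in> V \<and> v \<in> V \<longrightarrow>
        \<omega> (us[j := fscale c u + v]) = c * \<omega> (us[j := u]) + \<omega> (us[j := v])) \<and>
     (\<forall>us i j. length us = d \<and> set us \<subseteq> V \<and> i < j \<and> j < d \<and> us ! i = us ! j \<longrightarrow> \<omega> us = 0) \<and>
     (\<forall>us. length us = d \<and> set us \<subseteq> V \<and> set us \<inter> V' \<noteq> {} \<longrightarrow> \<omega> us = 0)}"

text \<open>With indices starting from \<open>0\<close>: the line bundle \<open>det ((U\<^sub>i / U\<^sub>i\<^sub>+\<^sub>1)\<^sup>\<or>)\<close> on the flag bundle, for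
  the universal subbundles \<open>U\<^sub>0 \<supset> U\<^sub>1 \<supset> \<dots>\<close>, of ranks \<open>s ! 0 > s ! 1 > \<dots>\<close>, followed by the zero
  bundle. A section is regular if it becomes so when evaluated on adapted frames.\<close>

definition nth_rank :: "nat list \<Rightarrow> nat \<Rightarrow> nat" where
  "nth_rank s i = (if i < length s then s ! i else 0)"

definition nth_sub :: "('u \<Rightarrow> 'k::field) set list \<Rightarrow> nat \<Rightarrow> ('u \<Rightarrow> 'k) set" where
  "nth_sub F i = (if i < length F then F ! i else {0})"

definition det_dual_quotient ::
  "('p, 'k::field) fspace \<Rightarrow> ('p, 'v, 'k) fbundle \<Rightarrow> nat list \<Rightarrow> nat \<Rightarrow>
   ('p \<times> (('v \<Rightarrow> 'k) \<Rightarrow> 'k) set list, (('v \<Rightarrow> 'k) \<Rightarrow> 'k) list, 'k) fbundle" where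
  "det_dual_quotient M E s i W = {\<sigma>.
     (\<forall>(y, F) \<in> W. \<sigma> (y, F) \<in>
        alternating_forms (nth_rank s i - nth_rank s (Suc i)) (nth_sub F i) (nth_sub F (Suc i))) \<and>
     (\<lambda>(y, \<phi>s). \<sigma> (flag_of s (y, \<phi>s)) (drop (nth_rank s (Suc i)) (take (nth_rank s i) \<phi>s)))
       \<in> regs (frame_bundle M E (hd s))
           {z \<in> points (frame_bundle M E (hd s)). flag_of s z \<in> W}}"


section \<open>Schur powers\<close>

definition is_partition :: "nat list \<Rightarrow> bool" where
  "is_partition lam \<longleftrightarrow> (\<forall>i j. i < j \<and> j < length lam \<longrightarrow> lam ! j \<le> lam ! i) \<and> (\<forall>x \<in> set lam. 0 < x)"

definition part :: "nat list \<Rightarrow> nat \<Rightarrow> nat" where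
  "part lam i = (if 1 \<le> i \<and> i \<le> length lam then lam ! (i - 1) else 0)"

definition jump_sequence :: "nat list \<Rightarrow> nat list" where
  "jump_sequence lam = rev (filter (\<lambda>i. part lam i > part lam (Suc i)) [1..<Suc (length lam)])"

definition schur_line_bundle ::
  "('p, 'k::field) fspace \<Rightarrow> ('p, 'v, 'k) fbundle \<Rightarrow> nat list \<Rightarrow>
   ('p \<times> (('v \<Rightarrow> 'k) \<Rightarrow> 'k) set list, (('v \<Rightarrow> 'k) \<Rightarrow> 'k) list list, 'k) fbundle" where
  "schur_line_bundle M E lam =
    (let s = jump_sequence lam in
     tensor_bundle (flag_bundle M E s)
       (concat (map (\<lambda>i. replicate (part lam (s ! i)) (det_dual_quotient M E s i)) [0..<length s])))"

definition schur_power ::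
  "('p, 'k::field) fspace \<Rightarrow> ('p, 'v, 'k) fbundle \<Rightarrow> nat list \<Rightarrow>
   ('p, ('p \<times> (('v \<Rightarrow> 'k) \<Rightarrow> 'k) set list) \<times> (('v \<Rightarrow> 'k) \<Rightarrow> 'k) list list, 'k) fbundle" where
  "schur_power M E lam =
    direct_image (flag_bundle M E (jump_sequence lam)) fst (schur_line_bundle M E lam)"


section \<open>Ampleness\<close>

text \<open>A line bundle \<open>L\<close> is ample if the space is quasi-compact and every point lies in an affine
  non-vanishing locus of a section of some power of \<open>L\<close> (EGA II 4.5.2, Stacks 01PS).\<close>

definition ample_line_bundle :: "('z, 'k::field) fspace \<Rightarrow> ('z, 'v, 'k) fbundle \<Rightarrow> bool" where
  "ample_line_bundle Z L \<longleftrightarrow>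
    compact_space (opens Z) \<and>
    (\<forall>x \<in> points Z. \<exists>m\<ge>1. \<exists>\<sigma> \<in> tensor_bundle Z (replicate m L) (points Z).
       \<sigma> x \<noteq> 0 \<and> is_affine (sub_fspace Z {y \<in> points Z. \<sigma> y \<noteq> 0}))"

text \<open>The bundle of lines in the dual of \<open>E\<close> is the bundle of flags of type \<open>[1]\<close>, and its Serre line
  bundle \<open>O(1)\<close> is the dual of the universal line subbundle.\<close>

definition proj_bundle ::
  "('p, 'k::field) fspace \<Rightarrow> ('p, 'v, 'k) fbundle \<Rightarrow> ('p \<times> (('v \<Rightarrow> 'k) \<Rightarrow> 'k) set list, 'k) fspace" where
  "proj_bundle M E = flag_bundle M E [1]"

definition serre_line_bundle ::
  "('p, 'k::field) fspace \<Rightarrow> ('p, 'v, 'k) fbundle \<Rightarrow>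
   ('p \<times> (('v \<Rightarrow> 'k) \<Rightarrow> 'k) set list, (('v \<Rightarrow> 'k) \<Rightarrow> 'k) list, 'k) fbundle" where
  "serre_line_bundle M E = det_dual_quotient M E [1] 0"

definition ample_bundle :: "('p, 'k::field) fspace \<Rightarrow> ('p, 'v, 'k) fbundle \<Rightarrow> bool" where
  "ample_bundle M E \<longleftrightarrow> ample_line_bundle (proj_bundle M E) (serre_line_bundle M E)"

end

theory Submission
  imports Defs
begin

text \<open>Let \<open>f\<^sub>1, \<dots>, f\<^sub>c\<close> be the equations of \<open>X\<close>, and fix constant vectors \<open>v\<^sub>1, \<dots>, v\<^sub>k\<close> in affine \<open>(N + 1)\<close>-space,
  where \<open>k\<close> is the number of parts of the partition. The points \<open>x\<close> of the affine cone over \<open>X\<close> at which the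
  differentials of all \<open>f\<^sub>j\<close> kill all \<open>v\<^sub>a\<close> form a cone \<open>T\<close> defined by \<open>(1 + k) c < N\<close> equations. For
  \<open>x\<close> in \<open>T\<close> the \<open>v\<^sub>a\<close> induce tangent vectors of \<open>X\<close> at the line of \<open>x\<close>, homogeneous of degree \<open>-1\<close> in
  \<open>x\<close>; for suitable \<open>v\<^sub>a\<close> they are linearly independent at every point of \<open>T\<close>. Evaluation of a section
  of the Schur power at this frame of tangent vectors is a nonzero linear form on the fibre,
  homogeneous of degree minus the size of the partition. If the Schur power were ample, sections of
  powers of the Serre line bundle, evaluated at this linear form, would give for each point of \<open>T\<close> a
  regular function \<open>H\<close> on \<open>T\<close> of negative degree \<open>-w\<close> that does not vanish there. But multiplication
  by the functions \<open>H x\<^sub>j\<^sup>w\<close> of degree \<open>0\<close> preserves the finite-dimensional space of forms of a large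
  degree on \<open>T\<close>, so they have finitely many values, and \<open>H = 1\<close> has finitely many solutions. Hence
  \<open>T\<close> consists of finitely many lines, although fewer than \<open>N\<close> equations define it.\<close>


section \<open>Polynomial functions\<close>

text \<open>By the Euler sequence a constant vector is a section of the tangent bundle of projective
  space twisted by -1; this is the origin of the degree -1. The delicate point is independence at
  every point of T, since a dependent tuple is not a point of the frame bundle. It fails exactly
  where a nontrivial combination of the \<open>v_a\<close> is a multiple of \<open>x\<close>.
  Smoothness provides a nonzero partial derivative there, so the tangency conditions make the bad
  tuples a set of smaller dimension than all tuples.

  Dimension theory is replaced throughout by counting monomials in boxes: independent monomials in
  \<open>M\<close> variables grow like \<open>D ^ M\<close>, which a space growing with a smaller
  exponent cannot contain. The final contradiction has the same source: a linear form missing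
  finitely many lines still leaves at most N equations in N + 1 unknowns, and these have a nonzero
  common solution. All regularity statements are reduced to local fractions of polynomials on
  subsets of the affine cone.\<close>

lemma sum_fun_apply: "(\<Sum>a\<in>A. f a) x = (\<Sum>a\<in>A. f a x)"
  by (induction A rule: infinite_finite_induct) auto

lemma polyfun_const: "(\<lambda>_. c) \<in> polyfun n"
  unfolding polyfun_def by (rule alg_gen.const)

lemma polyfun_var: "i < n \<Longrightarrow> (\<lambda>x. x i) \<in> polyfun n"
  unfolding polyfun_def by (rule alg_gen.gen) auto

lemma polyfun_add: "p \<in> polyfun n \<Longrightarrow> q \<in> polyfun n \<Longrightarrow> (\<lambda>x. p x + q x) \<in> polyfun n"
  using alg_gen.add[of p _ q] unfolding polyfun_def by (simp add: plus_fun_def)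

lemma polyfun_mult: "p \<in> polyfun n \<Longrightarrow> q \<in> polyfun n \<Longrightarrow> (\<lambda>x. p x * q x) \<in> polyfun n"
  using alg_gen.mult[of p _ q] unfolding polyfun_def by (simp add: times_fun_def)

lemma polyfun_uminus: "p \<in> polyfun n \<Longrightarrow> (\<lambda>x. - p x) \<in> polyfun n"
  using polyfun_mult[OF polyfun_const[of "-1"], of p n] by simp

lemma polyfun_diff: "p \<in> polyfun n \<Longrightarrow> q \<in> polyfun n \<Longrightarrow> (\<lambda>x. p x - q x) \<in> polyfun n"
  using polyfun_add[OF _ polyfun_uminus, of p n q] by simp

lemma polyfun_power: "p \<in> polyfun n \<Longrightarrow> (\<lambda>x. p x ^ m) \<in> polyfun n"
  by (induction m) (auto intro: polyfun_const polyfun_mult)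

lemma polyfun_sum: "(\<And>i. i \<in> A \<Longrightarrow> p i \<in> polyfun n) \<Longrightarrow> (\<lambda>x. \<Sum>i\<in>A. p i x) \<in> polyfun n"
  by (induction A rule: infinite_finite_induct) (auto intro: polyfun_const polyfun_add)

lemma polyfun_prod: "(\<And>i. i \<in> A \<Longrightarrow> p i \<in> polyfun n) \<Longrightarrow> (\<lambda>x. \<Prod>i\<in>A. p i x) \<in> polyfun n"
  by (induction A rule: infinite_finite_induct) (auto intro: polyfun_const polyfun_mult)

lemmas polyfun_intros = polyfun_const polyfun_var polyfun_add polyfun_mult polyfun_uminus
  polyfun_diff polyfun_power polyfun_sum polyfun_prod

lemma polyfun_induct [consumes 1, case_names const var add mult]:
  assumes "p \<in> polyfun n"
    and "\<And>c. P (\<lambda>_. c)" and "\<And>i. i < n \<Longrightarrow> P (\<lambda>x. x i)"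
    and "\<And>p q. p \<in> polyfun n \<Longrightarrow> q \<in> polyfun n \<Longrightarrow> P p \<Longrightarrow> P q \<Longrightarrow> P (\<lambda>x. p x + q x)"
    and "\<And>p q. p \<in> polyfun n \<Longrightarrow> q \<in> polyfun n \<Longrightarrow> P p \<Longrightarrow> P q \<Longrightarrow> P (\<lambda>x. p x * q x)"
  shows "P p"
  using assms(1) unfolding polyfun_def
proof (induction rule: alg_gen.induct)
  case (add g h)
  then show ?case using assms(4)[of g h] by (simp add: plus_fun_def polyfun_def)
next
  case (mult g h)
  then show ?case using assms(5)[of g h] by (simp add: times_fun_def polyfun_def)
qed (use assms(2,3) in auto)

lemma polyfun_cong:
  assumes "p \<in> polyfun n" "\<And>i. i < n \<Longrightarrow> x i = y i"
  shows "p x = p y"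
  using assms(1) by (induction rule: polyfun_induct) (auto simp: assms(2))

lemma polyfun_subst:
  assumes "p \<in> polyfun n" "\<And>i. i < n \<Longrightarrow> s i \<in> polyfun m"
  shows "(\<lambda>x. p (\<lambda>i. s i x)) \<in> polyfun m"
  using assms(1) by (induction rule: polyfun_induct) (auto intro!: polyfun_intros assms(2))

lemma polyfun_mono: "p \<in> polyfun n \<Longrightarrow> n \<le> m \<Longrightarrow> p \<in> polyfun m"
  using polyfun_subst[of p n "\<lambda>i x. x i" m] by (simp add: polyfun_var)

text \<open>Restriction to a parametrised curve reduces questions in several variables to univariate
  polynomials, which are determined by their values in characteristic zero.\<close>

lemma polyfun_on_curve:
  assumes "p \<in> polyfun n"
  shows "\<exists>c. \<forall>t. p (\<lambda>i. poly (s i) t) = poly c (t::'k::field)"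
  using assms
proof (induction rule: polyfun_induct)
  case (const c)
  show ?case by (rule exI[of _ "[:c:]"]) simp
next
  case (var i)
  show ?case by (rule exI[of _ "s i"]) simp
next
  case (add p q)
  then obtain c d where "\<forall>t. p (\<lambda>i. poly (s i) t) = poly c t" "\<forall>t. q (\<lambda>i. poly (s i) t) = poly d t"
    by blast
  then show ?case by (intro exI[of _ "c + d"]) simp
next
  case (mult p q)
  then obtain c d where "\<forall>t. p (\<lambda>i. poly (s i) t) = poly c t" "\<forall>t. q (\<lambda>i. poly (s i) t) = poly d t"
    by blast
  then show ?case by (intro exI[of _ "c * d"]) simp
qed

lemma poly_eq_all:
  fixes c d :: "'k::field_char_0 poly"
  assumes "\<And>t. poly c t = poly d t" shows "c = d"
  using assms poly_eq_poly_eq_iff[of c d] by auto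

text \<open>Polynomial functions form a domain: on the line through \<open>a\<close> and
  \<open>b\<close> both factors restrict to nonzero univariate polynomials, whose product is nonzero
  somewhere.\<close>

lemma polyfun_nonzero_mult:
  fixes p q :: "(nat \<Rightarrow> 'k::field_char_0) \<Rightarrow> 'k"
  assumes p: "p \<in> polyfun n" and q: "q \<in> polyfun n" and a: "p a \<noteq> 0" and b: "q b \<noteq> 0"
  shows "\<exists>x. p x \<noteq> 0 \<and> q x \<noteq> 0"
proof -
  define s where "s = (\<lambda>i. [:a i, b i - a i:])"
  obtain c where c: "\<And>t. p (\<lambda>i. poly (s i) t) = poly c t" using polyfun_on_curve[OF p] by blast
  obtain d where d: "\<And>t. q (\<lambda>i. poly (s i) t) = poly d t" using polyfun_on_curve[OF q] by blast
  have "poly c 0 = p a" using c[of 0] by (simp add: s_def)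
  moreover have "poly d 1 = q b" using d[of 1] by (simp add: s_def)
  ultimately have "c * d \<noteq> 0" using a b by auto
  then obtain t where "poly (c * d) t \<noteq> 0" using poly_eq_all[of "c*d" 0] by auto
  then have "p (\<lambda>i. poly (s i) t) \<noteq> 0 \<and> q (\<lambda>i. poly (s i) t) \<noteq> 0" using c[of t] d[of t] by simp
  then show ?thesis by (rule exI[of _ "\<lambda>i. poly (s i) t"])
qed

text \<open>Finitely many generic conditions can be met at one point.\<close>

lemma polyfun_nonzero_prod:
  fixes p :: "'i \<Rightarrow> (nat \<Rightarrow> 'k::field_char_0) \<Rightarrow> 'k"
  assumes "finite A" "\<And>i. i \<in> A \<Longrightarrow> p i \<in> polyfun n" "\<And>i. i \<in> A \<Longrightarrow> \<exists>x. p i x \<noteq> 0"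
  shows "\<exists>x. \<forall>i\<in>A. p i x \<noteq> 0"
  using assms
proof (induction A rule: finite_induct)
  case (insert i A)
  have "\<exists>x. \<forall>i\<in>A. p i x \<noteq> 0" using insert.prems by (intro insert.IH) auto
  then obtain x where x: "\<forall>i\<in>A. p i x \<noteq> 0" ..
  obtain y where y: "p i y \<noteq> 0" using insert.prems(2)[of i] by auto
  have "(\<lambda>x. \<Prod>i\<in>A. p i x) \<in> polyfun n" using insert by (auto intro: polyfun_prod)
  from polyfun_nonzero_mult[OF this insert.prems(1)[of i], of x y] x y insert.hyps
  show ?case by (auto simp: prod_zero_iff)
qed auto


section \<open>Monomials\<close>

definition mon :: "nat \<Rightarrow> (nat \<Rightarrow> nat) \<Rightarrow> (nat \<Rightarrow> 'k::comm_ring_1) \<Rightarrow> 'k" where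
  "mon n \<alpha> x = (\<Prod>i<n. x i ^ \<alpha> i)"

text \<open>Exponents are bounded one variable at a time, not in total, so that counting gives
  exactly \<open>(D + 1) ^ n\<close>. Extensionality leaves one exponent vector per
  monomial.\<close>

definition ebox :: "nat \<Rightarrow> nat \<Rightarrow> (nat \<Rightarrow> nat) set" where
  "ebox n D = {..<n} \<rightarrow>\<^sub>E {..D}"

definition polybox :: "nat \<Rightarrow> nat \<Rightarrow> ((nat \<Rightarrow> 'k::field) \<Rightarrow> 'k) set" where
  "polybox n D = fvs.span (mon n ` ebox n D)"

lemma finite_ebox [simp]: "finite (ebox n D)"
  unfolding ebox_def by (rule finite_PiE) auto

lemma card_ebox [simp]: "card (ebox n D) = (D + 1) ^ n"
  unfolding ebox_def by (subst card_PiE) auto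

lemma mon_polyfun: "mon n \<alpha> \<in> polyfun n"
  unfolding mon_def[abs_def] by (intro polyfun_intros) auto

lemma mon_mult: "mon n \<alpha> x * mon n \<beta> x = mon n (\<lambda>i. \<alpha> i + \<beta> i) x"
  by (simp add: mon_def prod.distrib power_add)

lemma mon_cong: "(\<And>i. i < n \<Longrightarrow> \<alpha> i = \<beta> i) \<Longrightarrow> mon n \<alpha> = mon n \<beta>"
  by (auto simp: mon_def fun_eq_iff)

lemma mon_in_polybox: "(\<And>i. i < n \<Longrightarrow> \<alpha> i \<le> D) \<Longrightarrow> mon n \<alpha> \<in> polybox n D"
proof -
  assume *: "\<And>i. i < n \<Longrightarrow> \<alpha> i \<le> D"
  have "restrict \<alpha> {..<n} \<in> ebox n D" using * by (auto simp: ebox_def)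
  moreover have "mon n \<alpha> = mon n (restrict \<alpha> {..<n})" by (rule mon_cong) auto
  ultimately show ?thesis unfolding polybox_def by (auto intro: fvs.span_base)
qed

section \<open>Linear relations between finitely many functions\<close>

lemma span_image_finite:
  assumes "finite I" "p \<in> fvs.span (f ` I)"
  shows "\<exists>c. p = (\<Sum>i\<in>I. fscale (c i) (f i))"
proof -
  define S where "S = {p. \<exists>c. p = (\<Sum>i\<in>I. fscale (c i) (f i))}"
  have sub: "fvs.subspace S"
    unfolding fvs.subspace_def
  proof (intro conjI allI ballI)
    show "0 \<in> S" unfolding S_def by (auto intro!: exI[of _ "\<lambda>_. 0"] simp: fscale_def fun_eq_iff sum_fun_apply)
  next
    fix x y assume "x \<in> S" "y \<in> S"
    then obtain c d where "x = (\<Sum>i\<in>I. fscale (c i) (f i))" "y = (\<Sum>i\<in>I. fscale (d i) (f i))"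
      unfolding S_def by auto
    then have "x + y = (\<Sum>i\<in>I. fscale (c i + d i) (f i))"
      by (simp add: fun_eq_iff sum_fun_apply fscale_def sum.distrib algebra_simps)
    then show "x + y \<in> S" unfolding S_def by (auto intro!: exI[of _ "\<lambda>i. c i + d i"])
  next
    fix e x assume "x \<in> S"
    then obtain c where "x = (\<Sum>i\<in>I. fscale (c i) (f i))" unfolding S_def by auto
    then have "fscale e x = (\<Sum>i\<in>I. fscale (e * c i) (f i))"
      by (simp add: fun_eq_iff sum_fun_apply fscale_def sum_distrib_left algebra_simps)
    then show "fscale e x \<in> S" unfolding S_def by (auto intro!: exI[of _ "\<lambda>i. e * c i"])
  qed
  have "f i \<in> S" if "i \<in> I" for i
    unfolding S_def using that assms(1)
    by (auto intro!: exI[of _ "\<lambda>j. if j = i then 1 else 0"]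
        simp: fscale_def fun_eq_iff sum_fun_apply if_distrib[of "\<lambda>x. x * _"] sum.delta cong: if_cong)
  then have "fvs.span (f ` I) \<subseteq> S" by (intro fvs.span_minimal sub) auto
  then show ?thesis using assms(2) unfolding S_def by auto
qed

text \<open>The relation is between members of a family, not of its image, because distinct indices
  may give equal functions; such a coincidence is itself a relation with coefficients 1 and
  -1.\<close>

lemma dependent_family:
  fixes f :: "'i \<Rightarrow> 'v \<Rightarrow> 'k::field"
  assumes "finite I" "finite t" "card t < card I" "\<And>i. i \<in> I \<Longrightarrow> f i \<in> fvs.span t"
  shows "\<exists>c. (\<exists>i\<in>I. c i \<noteq> 0) \<and> (\<forall>x. (\<Sum>i\<in>I. c i * f i x) = 0)"
proof (cases "inj_on f I")
  case False
  then obtain i j where ij: "i \<in> I" "j \<in> I" "i \<noteq> j" "f i = f j" by (auto simp: inj_on_def)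
  let ?c = "\<lambda>l. if l = i then 1 else if l = j then -1 else (0::'k)"
  have "(\<Sum>l\<in>I. ?c l * f l x) = (\<Sum>l\<in>{i,j}. ?c l * f l x)" for x
    using ij assms(1) by (intro sum.mono_neutral_right) auto
  also have "\<dots> x = 0" for x using ij by simp
  finally show ?thesis using ij by (intro exI[of _ ?c]) auto
next
  case True
  have "fvs.dependent (f ` I)"
  proof (rule ccontr)
    assume "\<not> fvs.dependent (f ` I)"
    then have "card (f ` I) \<le> card t"
      using fvs.independent_span_bound[OF assms(2), of "f ` I"] assms(4) by auto
    then show False using assms(3) True by (simp add: card_image)
  qed
  then obtain u v where u: "v \<in> f ` I" "u v \<noteq> 0" "(\<Sum>v\<in>f ` I. fscale (u v) v) = 0"
    using fvs.dependent_finite[of "f ` I"] assms(1) by auto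
  have "(\<Sum>i\<in>I. fscale (u (f i)) (f i)) = 0"
    using u(3) True by (simp add: sum.reindex)
  then have "(\<Sum>i\<in>I. u (f i) * f i x) = 0" for x
    by (simp add: fun_eq_iff sum_fun_apply fscale_def)
  then show ?thesis using u(1,2) by (intro exI[of _ "\<lambda>i. u (f i)"]) auto
qed

lemma polybox_subspace: "fvs.subspace (polybox n D)"
  unfolding polybox_def by (rule fvs.subspace_span)

lemma polybox_polyfun: "p \<in> polybox n D \<Longrightarrow> p \<in> polyfun n"
proof -
  assume "p \<in> polybox n D"
  then obtain c where "p = (\<Sum>i\<in>ebox n D. fscale (c i) (mon n i))"
    unfolding polybox_def using span_image_finite[of "ebox n D" p "mon n"] by auto
  then have "p = (\<lambda>x. \<Sum>i\<in>ebox n D. c i * mon n i x)"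
    by (simp add: fun_eq_iff sum_fun_apply fscale_def)
  then show ?thesis by (auto intro!: polyfun_intros mon_polyfun)
qed

lemma polybox_mono: "D \<le> E \<Longrightarrow> polybox n D \<subseteq> polybox n E"
  unfolding polybox_def by (intro fvs.span_mono image_mono) (auto simp: ebox_def PiE_def Pi_def)

lemma polybox_mult:
  assumes "p \<in> polybox n D" "q \<in> polybox n E" shows "(\<lambda>x. p x * q x) \<in> polybox n (D + E)"
proof -
  obtain c where c: "p = (\<Sum>i\<in>ebox n D. fscale (c i) (mon n i))"
    using assms(1) span_image_finite[of "ebox n D" p "mon n"] unfolding polybox_def by auto
  obtain d where d: "q = (\<Sum>i\<in>ebox n E. fscale (d i) (mon n i))"
    using assms(2) span_image_finite[of "ebox n E" q "mon n"] unfolding polybox_def by auto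
  have "(\<lambda>x. p x * q x) = (\<Sum>i\<in>ebox n D. \<Sum>j\<in>ebox n E. fscale (c i * d j) (mon n (\<lambda>l. i l + j l)))"
    unfolding c d by (simp add: fun_eq_iff sum_fun_apply fscale_def sum_product mon_mult[symmetric] algebra_simps)
  also have "\<dots> \<in> polybox n (D + E)"
    by (intro fvs.subspace_sum fvs.subspace_scale polybox_subspace mon_in_polybox)
       (auto simp: ebox_def PiE_def Pi_def intro!: add_mono)
  finally show ?thesis .
qed

lemma polybox_const: "(\<lambda>_. c) \<in> polybox n D"
proof -
  have "fscale c (mon n (\<lambda>_. 0)) \<in> polybox n D"
    by (intro fvs.subspace_scale polybox_subspace mon_in_polybox) auto
  then show ?thesis by (simp add: fscale_def mon_def)
qed

lemma polybox_power:
  "p \<in> polybox n D \<Longrightarrow> (\<lambda>x. p x ^ m) \<in> polybox n (m * D)"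
  by (induction m) (auto intro: polybox_const dest: polybox_mult)

lemma polybox_prod:
  assumes "finite A" "\<And>i. i \<in> A \<Longrightarrow> p i \<in> polybox n (D i)"
  shows "(\<lambda>x. \<Prod>i\<in>A. p i x) \<in> polybox n (\<Sum>i\<in>A. D i)"
  using assms by (induction A rule: finite_induct) (auto intro: polybox_const polybox_mult)

lemma polyfun_polybox:
  fixes p :: "(nat \<Rightarrow> 'k::field) \<Rightarrow> 'k"
  assumes "p \<in> polyfun n" shows "\<exists>D. p \<in> polybox n D"
  using assms
proof (induction rule: polyfun_induct)
  case (const c)
  then show ?case using polybox_const by blast
next
  case (var i)
  have 1: "mon n (\<lambda>j. if j = i then 1 else 0) \<in> polybox n 1"
    by (rule mon_in_polybox) auto
  have 2: "mon n (\<lambda>j. if j = i then 1 else 0) = (\<lambda>x. x i)"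
    using var by (simp add: mon_def fun_eq_iff if_distrib[of "\<lambda>e. _ ^ e"] prod.delta cong: if_cong)
  show ?case using 1 unfolding 2 by (rule exI)
next
  case (add p q)
  obtain D where D: "p \<in> polybox n D" using add by blast
  obtain E where E: "q \<in> polybox n E" using add by blast
  have "p \<in> polybox n (D + E)" by (rule subsetD[OF polybox_mono D]) simp
  moreover have "q \<in> polybox n (D + E)" by (rule subsetD[OF polybox_mono E]) simp
  ultimately have "p + q \<in> polybox n (D + E)" using fvs.subspace_add[OF polybox_subspace] by blast
  then show ?case by (auto simp: plus_fun_def)
next
  case (mult p q)
  then show ?case using polybox_mult by blast
qed

text \<open>Induction on the number of variables. With the other variables fixed, the sum is a
  univariate polynomial in the last one; its coefficients vanish and are sums of the same
  kind.\<close>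

lemma mon_independent:
  fixes c :: "(nat \<Rightarrow> nat) \<Rightarrow> 'k::field_char_0"
  assumes "\<And>x. (\<Sum>\<alpha>\<in>ebox n D. c \<alpha> * mon n \<alpha> x) = 0" "\<alpha> \<in> ebox n D"
  shows "c \<alpha> = 0"
  using assms
proof (induction n arbitrary: c \<alpha>)
  case 0
  then show ?case by (auto simp: ebox_def mon_def)
next
  case (Suc n)
  have box: "ebox (Suc n) D = (\<lambda>(e, \<beta>). \<beta>(n := e)) ` ({..D} \<times> ebox n D)"
    unfolding ebox_def lessThan_Suc PiE_insert_eq by simp
  have inj: "inj_on (\<lambda>(e, \<beta>). \<beta>(n := e)) ({..D} \<times> ebox n D)"
  proof (rule inj_onI, clarify)
    fix e b e' b' assume h: "b \<in> ebox n D" "b' \<in> ebox n D" "b(n := e) = b'(n := (e'::nat))"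
    have "b i = b' i" for i
    \<comment> \<open>Both functions are \<open>undefined\<close> at \<open>n\<close>, so
      overwriting that value loses nothing.\<close>
    proof (cases "i = n")
      case True
      then show ?thesis using h(1,2) by (auto simp: ebox_def PiE_def extensional_def)
    next
      case False
      then show ?thesis using fun_cong[OF h(3), of i] by auto
    qed
    moreover have "e = e'" using fun_cong[OF h(3), of n] by auto
    ultimately show "e = e' \<and> b = b'" by auto
  qed
  have m: "mon (Suc n) (\<beta>(n := e)) x = mon n \<beta> x * x n ^ e" for \<beta> e and x :: "nat \<Rightarrow> 'k"
    by (simp add: mon_def)
  have eq: "(\<Sum>e\<le>D. (\<Sum>\<beta>\<in>ebox n D. c (\<beta>(n := e)) * mon n \<beta> x) * t ^ e) = 0" for x t
  proof -
    let ?x = "x(n := t)"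
    have mx: "mon n \<beta> ?x = mon n \<beta> x" for \<beta> by (auto simp: mon_def intro!: prod.cong)
    have "0 = (\<Sum>\<alpha>\<in>ebox (Suc n) D. c \<alpha> * mon (Suc n) \<alpha> ?x)" using Suc.prems(1) by simp
    also have "\<dots> = (\<Sum>(e,\<beta>)\<in>{..D} \<times> ebox n D. c (\<beta>(n := e)) * mon (Suc n) (\<beta>(n := e)) ?x)"
      unfolding box by (subst sum.reindex[OF inj]) (auto intro!: sum.cong)
    also have "\<dots> = (\<Sum>(e,\<beta>)\<in>{..D} \<times> ebox n D. c (\<beta>(n := e)) * (mon n \<beta> x * t ^ e))"
      by (intro sum.cong refl) (auto simp: m mx)
    also have "\<dots> = (\<Sum>e\<le>D. (\<Sum>\<beta>\<in>ebox n D. c (\<beta>(n := e)) * mon n \<beta> x) * t ^ e)"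
      by (simp add: sum.cartesian_product[symmetric] sum_distrib_right mult.assoc)
    finally show ?thesis by simp
  qed
  have coef: "(\<Sum>\<beta>\<in>ebox n D. c (\<beta>(n := e)) * mon n \<beta> x) = 0" if "e \<le> D" for e x
  proof -
    define P where "P = (\<Sum>e\<le>D. monom (\<Sum>\<beta>\<in>ebox n D. c (\<beta>(n := e)) * mon n \<beta> x) e)"
    have "poly P t = poly 0 t" for t using eq[of x t] by (simp add: P_def poly_sum poly_monom)
    then have "P = 0" by (rule poly_eq_all)
    then have "coeff P e = 0" by simp
    then show ?thesis using that by (simp add: P_def coeff_sum sum.delta)
  qed
  obtain e \<beta> where e: "\<alpha> = \<beta>(n := e)" "e \<le> D" "\<beta> \<in> ebox n D" using Suc.prems(2) unfolding box by auto
  show ?case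
    unfolding e(1) by (rule Suc.IH[of "\<lambda>\<beta>. c (\<beta>(n := e))", OF coef[OF e(2)] e(3)])
qed

text \<open>The substitute for dimension theory: at most \<open>B * (C * D + 1) ^ m\<close>
  generators cannot span the \<open>(D + 1) ^ M\<close> independent monomials of a suitably large
  box.\<close>

lemma box_count_large:
  fixes B C m M :: nat
  assumes "m < M"
  shows "\<exists>D. B * (C * D + 1) ^ m < (D + 1) ^ M"
proof -
  \<comment> \<open>This value turns \<open>B * ((C + 1) * (D + 1)) ^ m\<close> into
    \<open>D * (D + 1) ^ m\<close>, which stays below \<open>(D + 1) ^ Suc m\<close>.\<close>
  define D where "D = B * (C + 1) ^ m"
  have "C * D + 1 \<le> (C + 1) * (D + 1)" by (simp add: algebra_simps)
  then have "(C * D + 1) ^ m \<le> ((C + 1) * (D + 1)) ^ m" by (rule power_mono) simp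
  then have "B * (C * D + 1) ^ m \<le> B * ((C + 1) * (D + 1)) ^ m" by (rule mult_left_mono) simp
  also have "\<dots> = D * (D + 1) ^ m" unfolding power_mult_distrib by (simp only: D_def mult.assoc)
  also have "\<dots> < (D + 1) * (D + 1) ^ m" by simp
  also have "\<dots> = (D + 1) ^ (Suc m)" by simp
  also have "\<dots> \<le> (D + 1) ^ M" using assms by (intro power_increasing) auto
  finally show ?thesis by blast
qed

section \<open>Homogeneous components\<close>

definition hdeg :: "nat \<Rightarrow> (nat \<Rightarrow> nat) \<Rightarrow> nat" where
  "hdeg n \<alpha> = (\<Sum>i<n. \<alpha> i)"

lemma mon_fscale: "mon n \<alpha> (fscale c x) = c ^ hdeg n \<alpha> * mon n \<alpha> x"
  by (simp add: mon_def fscale_def hdeg_def power_mult_distrib prod.distrib power_sum)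

lemma homogeneous_mon: "homogeneous n (hdeg n \<alpha>) (mon n \<alpha>)"
  by (auto simp: homogeneous_def mon_fscale mon_polyfun)

lemma homogeneous_sum:
  "(\<And>i. i \<in> A \<Longrightarrow> homogeneous n d (p i)) \<Longrightarrow> homogeneous n d (\<lambda>x. \<Sum>i\<in>A. p i x)"
  by (auto simp: homogeneous_def sum_distrib_left intro: polyfun_sum)

lemma homogeneous_cmult: "homogeneous n d p \<Longrightarrow> homogeneous n d (\<lambda>x. c * p x)"
  by (auto simp: homogeneous_def intro: polyfun_intros)

lemma homogeneous_mult: "homogeneous n d p \<Longrightarrow> homogeneous n e q \<Longrightarrow> homogeneous n (d + e) (\<lambda>x. p x * q x)"
  by (auto simp: homogeneous_def power_add intro: polyfun_intros)

lemma homogeneous_zero: "homogeneous n d (\<lambda>_. 0)"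
  by (auto simp: homogeneous_def intro: polyfun_intros)

text \<open>Membership in the span is kept beside homogeneity, since the leading term after a shear
  is computed monomial by monomial.\<close>

lemma homogeneous_components:
  fixes p :: "(nat \<Rightarrow> 'k::field) \<Rightarrow> 'k"
  assumes "p \<in> polybox n E"
  shows "\<exists>P. (\<forall>d. homogeneous n d (P d) \<and> P d \<in> fvs.span (mon n ` {\<alpha> \<in> ebox n E. hdeg n \<alpha> = d})) \<and>
     (\<forall>x. p x = (\<Sum>d\<le>n * E. P d x))"
proof -
  obtain c where c: "p = (\<Sum>i\<in>ebox n E. fscale (c i) (mon n i))"
    using assms span_image_finite[of "ebox n E" p "mon n"] unfolding polybox_def by auto
  define P where "P = (\<lambda>d x. \<Sum>i\<in>{\<alpha> \<in> ebox n E. hdeg n \<alpha> = d}. c i * mon n i x)"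
  have 1: "homogeneous n d (P d)" for d
    unfolding P_def by (intro homogeneous_sum homogeneous_cmult) (use homogeneous_mon in force)
  have 2: "P d \<in> fvs.span (mon n ` {\<alpha> \<in> ebox n E. hdeg n \<alpha> = d})" for d
  proof -
    have "P d = (\<Sum>i\<in>{\<alpha> \<in> ebox n E. hdeg n \<alpha> = d}. fscale (c i) (mon n i))"
      by (simp add: fun_eq_iff P_def sum_fun_apply fscale_def)
    also have "\<dots> \<in> fvs.span (mon n ` {\<alpha> \<in> ebox n E. hdeg n \<alpha> = d})"
      by (intro fvs.span_sum fvs.span_scale fvs.span_base) auto
    finally show ?thesis .
  qed
  have "p x = (\<Sum>d\<le>n * E. P d x)" for x
  proof -
    have "hdeg n \<alpha> \<le> n * E" if "\<alpha> \<in> ebox n E" for \<alpha>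
      using that sum_bounded_above[of "{..<n}" \<alpha> E] by (auto simp: hdeg_def ebox_def)
    then have "(\<Sum>d\<le>n * E. P d x) = (\<Sum>i\<in>ebox n E. c i * mon n i x)"
      unfolding P_def by (intro sum.group) auto
    then show ?thesis by (simp add: c sum_fun_apply fscale_def)
  qed
  then show ?thesis using 1 2 by blast
qed

lemma homogeneous_sum_zero:
  fixes a :: "nat \<Rightarrow> 'k::field_char_0"
  assumes "\<And>t. t \<noteq> 0 \<Longrightarrow> (\<Sum>d\<le>D. t ^ d * a d) = 0" "d \<le> D"
  shows "a d = 0"
proof -
  \<comment> \<open>The factor X makes the polynomial vanish at 0 as well, where nothing is
    assumed.\<close>
  define P where "P = [:0,1:] * (\<Sum>e\<le>D. monom (a e) e)"
  have "poly P t = poly 0 t" for t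
    using assms(1)[of t] by (cases "t = 0") (auto simp: P_def poly_sum poly_monom mult.commute)
  then have "P = 0" by (rule poly_eq_all)
  then have "(\<Sum>e\<le>D. monom (a e) e) = 0" by (simp add: P_def)
  then have "coeff (\<Sum>e\<le>D. monom (a e) e) d = 0" by simp
  then show ?thesis using assms(2) by (simp add: coeff_sum sum.delta)
qed

text \<open>Homogeneity is defined by scaling, so its link with monomials has to be proved:
  comparing powers of \<open>t\<close> in \<open>p (fscale t x)\<close> leaves only the component of
  degree \<open>d\<close>, and each of its exponents is at most their sum \<open>d\<close>.\<close>

lemma homogeneous_span:
  fixes p :: "(nat \<Rightarrow> 'k::field_char_0) \<Rightarrow> 'k"
  assumes "homogeneous n d p"
  shows "p \<in> fvs.span (mon n ` {\<alpha> \<in> ebox n d. hdeg n \<alpha> = d})"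
proof -
  obtain E where "p \<in> polybox n E" using assms polyfun_polybox[of p n] by (auto simp: homogeneous_def)
  from homogeneous_components[OF this] obtain P where
    P: "\<And>d. homogeneous n d (P d)" "\<And>d. P d \<in> fvs.span (mon n ` {\<alpha> \<in> ebox n E. hdeg n \<alpha> = d})"
     "\<And>x. p x = (\<Sum>d\<le>n * E. P d x)" by blast
  \<comment> \<open>\<open>d\<close> may exceed the degrees that occur in the box, so the components
    are continued by zero.\<close>
  define P' where "P' e = (if e \<le> n * E then P e else (\<lambda>_. 0))" for e
  have P'h: "homogeneous n e (P' e)" for e unfolding P'_def using P(1) homogeneous_zero by auto
  have P's: "p x = (\<Sum>e\<le>n * E + d. P' e x)" for x
    unfolding P(3) P'_def by (rule sum.mono_neutral_cong_left) auto
  have "p x = P' d x" for x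
  proof -
    have "(\<Sum>e\<le>n * E + d. t ^ e * (P' e x - (if e = d then p x else 0))) = 0" for t
    proof -
      have "p (fscale t x) = (\<Sum>e\<le>n * E + d. t ^ e * P' e x)"
        unfolding P's using P'h by (simp add: homogeneous_def)
      moreover have "p (fscale t x) = t ^ d * p x" using assms by (simp add: homogeneous_def)
      moreover have "(\<Sum>e\<le>n * E + d. t ^ e * (if e = d then p x else 0)) = t ^ d * p x"
        by (simp add: if_distrib[of "\<lambda>z. _ * z"] sum.delta cong: if_cong)
      ultimately show ?thesis by (simp add: right_diff_distrib sum_subtractf)
    qed
    from homogeneous_sum_zero[where D = "n * E + d" and a = "\<lambda>e. P' e x - (if e = d then p x else 0)" and d = d, OF this]
    show ?thesis by simp
  qed
  then have pP: "p = P' d" by auto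
  show ?thesis
  proof (cases "d \<le> n * E")
    case True
    then have "p \<in> fvs.span (mon n ` {\<alpha> \<in> ebox n E. hdeg n \<alpha> = d})" using pP P(2) by (simp add: P'_def)
    moreover have "{\<alpha> \<in> ebox n E. hdeg n \<alpha> = d} \<subseteq> {\<alpha> \<in> ebox n d. hdeg n \<alpha> = d}"
    proof (clarify)
      fix \<alpha> assume a: "\<alpha> \<in> ebox n E"
      have "\<alpha> i \<le> hdeg n \<alpha>" if "i < n" for i
        unfolding hdeg_def using that by (intro member_le_sum) auto
      then show "\<alpha> \<in> ebox n (hdeg n \<alpha>) \<and> hdeg n \<alpha> = hdeg n \<alpha>" using a by (auto simp: ebox_def PiE_def Pi_def)
    qed
    ultimately show ?thesis using fvs.span_mono[OF image_mono] by blast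
  next
    case False
    then have "p = 0" using pP by (auto simp: P'_def)
    then show ?thesis using fvs.span_zero by simp
  qed
qed


section \<open>Nullstellensatz\<close>

definition poly_ideal :: "nat \<Rightarrow> ((nat \<Rightarrow> 'k::field) \<Rightarrow> 'k) set \<Rightarrow> bool" where
  "poly_ideal n J \<longleftrightarrow> J \<subseteq> polyfun n \<and> (\<lambda>_. 0) \<in> J \<and>
     (\<forall>p\<in>J. \<forall>q\<in>J. (\<lambda>x. p x + q x) \<in> J) \<and> (\<forall>a\<in>polyfun n. \<forall>p\<in>J. (\<lambda>x. a x * p x) \<in> J)"

lemma poly_idealD:
  assumes "poly_ideal n J"
  shows "p \<in> J \<Longrightarrow> p \<in> polyfun n" "(\<lambda>_. 0) \<in> J"
    "p \<in> J \<Longrightarrow> q \<in> J \<Longrightarrow> (\<lambda>x. p x + q x) \<in> J"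
    "a \<in> polyfun n \<Longrightarrow> p \<in> J \<Longrightarrow> (\<lambda>x. a x * p x) \<in> J"
    "p \<in> J \<Longrightarrow> q \<in> J \<Longrightarrow> (\<lambda>x. p x - q x) \<in> J"
proof -
  show 1: "p \<in> J \<Longrightarrow> p \<in> polyfun n" "(\<lambda>_. 0) \<in> J"
    "a \<in> polyfun n \<Longrightarrow> p \<in> J \<Longrightarrow> (\<lambda>x. a x * p x) \<in> J" for p a
    using assms by (auto simp: poly_ideal_def)
  show 2: "p \<in> J \<Longrightarrow> q \<in> J \<Longrightarrow> (\<lambda>x. p x + q x) \<in> J" for p q
    using assms by (auto simp: poly_ideal_def)
  show "p \<in> J \<Longrightarrow> q \<in> J \<Longrightarrow> (\<lambda>x. p x - q x) \<in> J"
    using 2[of p "\<lambda>x. -1 * q x"] 1(3)[of "\<lambda>_. -1" q] polyfun_const[of "-1" n] by auto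
qed

lemma last_variable_expansion:
  fixes p :: "(nat \<Rightarrow> 'k::field) \<Rightarrow> 'k"
  assumes "p \<in> polyfun (Suc n)"
  shows "\<exists>D c. (\<forall>i. c i \<in> polyfun n) \<and> (\<forall>x. p x = (\<Sum>i\<le>D. c i x * x n ^ i))"
proof -
  obtain D where "p \<in> polybox (Suc n) D" using polyfun_polybox[OF assms] by blast
  then obtain a where a: "p = (\<Sum>i\<in>ebox (Suc n) D. fscale (a i) (mon (Suc n) i))"
    using span_image_finite[of "ebox (Suc n) D" p "mon (Suc n)"] unfolding polybox_def by auto
  define c where "c = (\<lambda>i x. \<Sum>\<alpha>\<in>{\<alpha>\<in>ebox (Suc n) D. \<alpha> n = i}. a \<alpha> * mon n \<alpha> x)"
  have "p x = (\<Sum>i\<le>D. c i x * x n ^ i)" for x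
  proof -
    have "(\<Sum>i\<le>D. c i x * x n ^ i) =
        (\<Sum>i\<le>D. \<Sum>\<alpha>\<in>{\<alpha>\<in>ebox (Suc n) D. \<alpha> n = i}. a \<alpha> * mon (Suc n) \<alpha> x)"
      by (auto simp: c_def mon_def sum_distrib_right mult.assoc intro!: sum.cong)
    also have "\<dots> = (\<Sum>\<alpha>\<in>ebox (Suc n) D. a \<alpha> * mon (Suc n) \<alpha> x)"
      by (rule sum.group[OF finite_ebox]) (auto simp: ebox_def)
    finally show ?thesis by (simp add: a sum_fun_apply fscale_def)
  qed
  moreover have "c i \<in> polyfun n" for i
    unfolding c_def by (intro polyfun_intros mon_polyfun)
  ultimately show ?thesis by blast
qed

section \<open>Polynomials of bounded degree in the last variable\<close>

definition lower :: "nat \<Rightarrow> nat \<Rightarrow> ((nat \<Rightarrow> 'k::field) \<Rightarrow> 'k) set" where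
  "lower n d = {(\<lambda>x. \<Sum>i<d. c i x * x n ^ i) |c. \<forall>i. c i \<in> polyfun n}"

lemma lower_add: "p \<in> lower n d \<Longrightarrow> q \<in> lower n d \<Longrightarrow> (\<lambda>x. p x + q x) \<in> lower n d"
proof -
  assume "p \<in> lower n d" "q \<in> lower n d"
  then obtain b c where "p = (\<lambda>x. \<Sum>i<d. b i x * x n ^ i)" "\<forall>i. b i \<in> polyfun n"
    "q = (\<lambda>x. \<Sum>i<d. c i x * x n ^ i)" "\<forall>i. c i \<in> polyfun n" unfolding lower_def by blast
  then show ?thesis unfolding lower_def mem_Collect_eq
    by (intro exI[of _ "\<lambda>i x. b i x + c i x"])
       (auto simp: sum.distrib algebra_simps intro: polyfun_add)
qed

lemma lower_mult: "a \<in> polyfun n \<Longrightarrow> q \<in> lower n d \<Longrightarrow> (\<lambda>x. a x * q x) \<in> lower n d"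
proof -
  assume a: "a \<in> polyfun n" and "q \<in> lower n d"
  then obtain c where 
    "q = (\<lambda>x. \<Sum>i<d. c i x * x n ^ i)" "\<forall>i. c i \<in> polyfun n" unfolding lower_def by blast
  then show ?thesis using a unfolding lower_def mem_Collect_eq
    by (intro exI[of _ "\<lambda>i x. a x * c i x"])
       (auto simp: sum_distrib_left algebra_simps intro: polyfun_mult)
qed

lemma lower_zero: "(\<lambda>_. 0) \<in> lower n d"
  unfolding lower_def by (auto intro!: exI[of _ "\<lambda>_ _. 0"] polyfun_const)

lemma lower_sum:
  "(\<And>i. i \<in> A \<Longrightarrow> p i \<in> lower n d) \<Longrightarrow> (\<lambda>x. \<Sum>i\<in>A. p i x) \<in> lower n d"
  by (induction A rule: infinite_finite_induct) (auto intro: lower_zero lower_add)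

lemma lower_term: "c \<in> polyfun n \<Longrightarrow> i < d \<Longrightarrow> (\<lambda>x. c x * x n ^ i) \<in> lower n d"
  unfolding lower_def
  by (auto intro!: exI[of _ "\<lambda>j. if j = i then c else (\<lambda>_. 0)"] polyfun_const
      simp: fun_eq_iff if_distrib[of "\<lambda>f. f _ * _"] sum.delta cong: if_cong)

lemma lower_mono: "p \<in> lower n d \<Longrightarrow> d \<le> e \<Longrightarrow> p \<in> lower n e"
proof -
  assume "p \<in> lower n d" "d \<le> e"
  then obtain c where p: "p = (\<lambda>x. \<Sum>i<d. c i x * x n ^ i)" "\<forall>i. c i \<in> polyfun n" unfolding lower_def by blast
  show ?thesis unfolding p(1) by (rule lower_sum, rule lower_term) (use p \<open>d \<le> e\<close> in auto)
qed

lemma lower_prod: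
  assumes "p \<in> lower n (Suc d)" "q \<in> lower n e" shows "(\<lambda>x. p x * q x) \<in> lower n (d + e)"
proof -
  obtain b where b: "p = (\<lambda>x. \<Sum>i<Suc d. b i x * x n ^ i)" "\<forall>i. b i \<in> polyfun n"
    using assms(1) unfolding lower_def by blast
  obtain c where c: "q = (\<lambda>x. \<Sum>i<e. c i x * x n ^ i)" "\<forall>i. c i \<in> polyfun n"
    using assms(2) unfolding lower_def by blast
  have "(\<lambda>x. p x * q x) = (\<lambda>x. \<Sum>i<Suc d. \<Sum>j<e. (b i x * c j x) * x n ^ (i + j))"
    unfolding b(1) c(1) by (simp only: sum_product power_add mult.assoc mult.left_commute)
  also have "\<dots> \<in> lower n (d + e)"
    by (rule lower_sum, rule lower_sum, rule lower_term) (use b c in \<open>auto intro: polyfun_mult\<close>)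
  finally show ?thesis .
qed

text \<open>Membership of \<open>1\<close> in \<open>J + m\<^sub>a R[x\<^sub>n]\<close>, where \<open>R[x\<^sub>n]/J\<close> is generated over \<open>R\<close> by the powers
  of \<open>x\<^sub>n\<close> below \<open>d\<close>: Nakayama's lemma, removing one generator at a time.\<close>

lemma nakayama_step:
  fixes J :: "((nat \<Rightarrow> 'k::field_char_0) \<Rightarrow> 'k) set"
  assumes J: "poly_ideal (Suc n) J" and g: "g \<in> J" "\<And>t. g (a(n := t)) = 1"
    and r: "r \<in> polyfun n" "r a \<noteq> 0"
    and red: "\<And>p. p \<in> polyfun (Suc n) \<Longrightarrow> \<exists>j\<in>J. \<exists>l\<in>lower n (Suc i). \<forall>x. r x * p x = j x + l x"
  shows "\<exists>r\<in>polyfun n. r a \<noteq> 0 \<and>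
    (\<forall>p\<in>polyfun (Suc n). \<exists>j\<in>J. \<exists>l\<in>lower n i. \<forall>x. r x * p x = j x + l x)"
proof -
  have up: "b \<in> polyfun n \<Longrightarrow> b \<in> polyfun (Suc n)" for b :: "(nat \<Rightarrow> 'k) \<Rightarrow> 'k"
    by (rule polyfun_mono) auto
  note Jd = poly_idealD[OF J]
  obtain D c where c: "\<And>i. c i \<in> polyfun n" "\<And>x. g x = (\<Sum>i\<le>D. c i x * x n ^ i)"
    using last_variable_expansion[OF Jd(1)[OF g(1)]] by blast
  \<comment> \<open>The coefficients of \<open>1 - g\<close> as a polynomial in \<open>x n\<close>.
    They vanish at \<open>a\<close> because \<open>g\<close> is 1 on the whole line over
    \<open>a\<close>.\<close>
  define m where "m e x = (if e = 0 then 1 else 0) - c e x" for e x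
  have m: "m e \<in> polyfun n" for e
    unfolding m_def[abs_def] by (intro polyfun_diff c polyfun_const)
  have ca: "c e (a(n := t)) = c e a" for e t by (rule polyfun_cong[OF c(1)]) auto
  have m0: "m e a = 0" if "e \<le> D" for e
  proof -
    define P where "P = (\<Sum>e\<le>D. monom (c e a) e)"
    have "poly P t = poly 1 t" for t
      using g(2)[of t] unfolding c(2) by (simp add: P_def poly_sum poly_monom ca)
    then have "P = 1" by (rule poly_eq_all)
    then have "coeff P e = (if e = 0 then 1 else 0)" by simp
    then show ?thesis using that by (simp add: P_def coeff_sum sum.delta m_def)
  qed
  have gm: "1 - g x = (\<Sum>e\<le>D. m e x * x n ^ e)" for x
    unfolding c(2) m_def left_diff_distrib sum_subtractf
    by (simp add: if_distrib[of "\<lambda>z. z * _"] sum.delta cong: if_cong)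
  define q where "q e x = x n ^ e * x n ^ i" for e and x :: "nat \<Rightarrow> 'k"
  have q: "q e \<in> polyfun (Suc n)" for e unfolding q_def[abs_def] by (intro polyfun_intros) auto
  have "\<forall>e. \<exists>j\<in>J. \<exists>l\<in>lower n (Suc i). \<forall>x. r x * q e x = j x + l x" using red[OF q] by blast
  then obtain j l where jl: "\<And>e. j e \<in> J" "\<And>e. l e \<in> lower n (Suc i)" "\<And>e x. r x * q e x = j e x + l e x"
    by metis
  have "\<forall>e. \<exists>b. (\<forall>i. b i \<in> polyfun n) \<and> l e = (\<lambda>x. \<Sum>u<Suc i. b u x * x n ^ u)"
    using jl(2) unfolding lower_def by blast
  then obtain b where b: "\<And>e u. b e u \<in> polyfun n" "\<And>e. l e = (\<lambda>x. \<Sum>u<Suc i. b e u x * x n ^ u)"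
    by metis
  \<comment> \<open>Reducing \<open>(1 - g) * r * x n ^ i\<close> gives back \<open>x n ^ i\<close>
    with coefficient \<open>\<mu>\<close>. As \<open>\<mu>\<close> vanishes at \<open>a\<close>,
    this term can be moved to the other side: \<open>r - \<mu>\<close> is still nonzero at
    \<open>a\<close>.\<close>
  define \<mu> where "\<mu> x = (\<Sum>e\<le>D. m e x * b e i x)" for x
  have \<mu>: "\<mu> \<in> polyfun n" unfolding \<mu>_def[abs_def] by (intro polyfun_intros m b)
  have \<mu>a: "\<mu> a = 0" unfolding \<mu>_def using m0 by simp
  define j' where "j' x = (r x * x n ^ i) * g x + (\<Sum>e\<le>D. m e x * j e x)" for x
  define l' where "l' x = (\<Sum>e\<le>D. m e x * (\<Sum>u<i. b e u x * x n ^ u))" for x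
  have Jsum: "(\<lambda>x. \<Sum>e\<in>A. m e x * j e x) \<in> J" for A
  proof (induction A rule: infinite_finite_induct)
    case (insert e A)
    then show ?case using Jd(3)[OF Jd(4)[OF up[OF m] jl(1)] insert.IH, of e e] by simp
  qed (simp_all add: Jd(2))
  have j': "j' \<in> J" unfolding j'_def[abs_def]
    by (intro Jd(3) Jsum Jd(4) g polyfun_intros up r) auto
  have l': "l' \<in> lower n i" unfolding l'_def[abs_def]
    by (intro lower_sum lower_mult m lower_term b) auto
  have key: "(r x - \<mu> x) * x n ^ i = j' x + l' x" for x
  proof -
    have "r x * x n ^ i = (r x * x n ^ i) * g x + (1 - g x) * (r x * x n ^ i)" by (simp add: algebra_simps)
    also have "(1 - g x) * (r x * x n ^ i) = (\<Sum>e\<le>D. m e x * (r x * q e x))"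
      unfolding gm q_def sum_distrib_right by (simp add: mult_ac)
    also have "\<dots> = (\<Sum>e\<le>D. m e x * j e x) + l' x + \<mu> x * x n ^ i"
      unfolding jl(3) b(2) l'_def \<mu>_def by (simp add: sum.distrib algebra_simps sum_distrib_left)
    finally have e: "r x * x n ^ i = (r x * x n ^ i) * g x + ((\<Sum>e\<le>D. m e x * j e x) + l' x + \<mu> x * x n ^ i)" .
    show ?thesis unfolding left_diff_distrib j'_def by (subst e) simp
  qed
  \<comment> \<open>The factor \<open>r\<close> brings \<open>p\<close> below degree
    \<open>Suc i\<close>; the factor \<open>r - \<mu>\<close> then removes the remaining power
    \<open>x n ^ i\<close>.\<close>
  define r' where "r' x = (r x - \<mu> x) * r x" for x
  have "r' \<in> polyfun n" unfolding r'_def[abs_def] by (rule polyfun_mult[OF polyfun_diff[OF r(1) \<mu>] r(1)])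
  moreover have "r' a \<noteq> 0" unfolding r'_def using r \<mu>a by simp
  moreover have "\<exists>j\<in>J. \<exists>l\<in>lower n i. \<forall>x. r' x * p x = j x + l x" if pp: "p \<in> polyfun (Suc n)" for p
  proof -
    obtain j0 l0 where p: "j0 \<in> J" "l0 \<in> lower n (Suc i)" "\<And>x. r x * p x = j0 x + l0 x"
      using red[OF pp] by blast
    obtain e where e: "\<And>u. e u \<in> polyfun n" "l0 = (\<lambda>x. \<Sum>u<Suc i. e u x * x n ^ u)"
      using p(2) unfolding lower_def by blast
    define J1 where "J1 x = (r x - \<mu> x) * j0 x + e i x * j' x" for x
    define L1 where "L1 x = (r x - \<mu> x) * (\<Sum>u<i. e u x * x n ^ u) + e i x * l' x" for x
    have "J1 \<in> J" unfolding J1_def[abs_def] by (intro Jd(3) Jd(4) up polyfun_diff r \<mu> e p j')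
    moreover have "L1 \<in> lower n i" unfolding L1_def[abs_def]
      by (intro lower_add lower_mult polyfun_diff r \<mu> e l' lower_sum lower_term) auto
    moreover have "r' x * p x = J1 x + L1 x" for x
    proof -
      have "r' x * p x = (r x - \<mu> x) * (j0 x + l0 x)" unfolding r'_def p(3)[symmetric] by (simp add: mult_ac)
      also have "\<dots> = (r x - \<mu> x) * j0 x + (r x - \<mu> x) * (\<Sum>u<i. e u x * x n ^ u)
          + e i x * ((r x - \<mu> x) * x n ^ i)"
        unfolding e(2) by (simp add: algebra_simps)
      finally show ?thesis unfolding key J1_def L1_def by (simp add: algebra_simps)
    qed
    ultimately show ?thesis by blast
  qed
  ultimately show ?thesis by blast
qed

text \<open>A zero \<open>a\<close> of the members of \<open>J\<close> that involve only the first
  \<open>n\<close> variables extends to a zero of \<open>J\<close>: the monic \<open>f\<close> makes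
  the quotient by \<open>J\<close> finite over the polynomials in these variables, so by Nakayama
  the fibre over \<open>a\<close> is not empty.\<close>

lemma nullstellensatz_monic:
  fixes J :: "((nat \<Rightarrow> 'k::{alg_closed_field, field_char_0}) \<Rightarrow> 'k) set"
  assumes J: "poly_ideal (Suc n) J" and one: "(\<lambda>_. 1) \<notin> J"
    and f: "f \<in> J" "l \<in> lower n d" "\<And>x. f x = x n ^ d + l x"
    and IH: "\<And>J. poly_ideal n J \<Longrightarrow> (\<lambda>_. 1) \<notin> J \<Longrightarrow> \<exists>x::nat \<Rightarrow> 'k. \<forall>p\<in>J. p x = 0"
  shows "\<exists>x. \<forall>p\<in>J. p x = 0"
proof -
  have up: "b \<in> polyfun n \<Longrightarrow> b \<in> polyfun (Suc n)" for b :: "(nat \<Rightarrow> 'k) \<Rightarrow> 'k"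
    by (rule polyfun_mono) auto
  note Jd = poly_idealD[OF J]
  have "poly_ideal n (J \<inter> polyfun n)"
    unfolding poly_ideal_def by (auto intro: Jd polyfun_intros up)
  then obtain a where a: "\<And>p. p \<in> J \<Longrightarrow> p \<in> polyfun n \<Longrightarrow> p a = 0"
    using IH[of "J \<inter> polyfun n"] one by auto
  \<comment> \<open>This turns out to be everything (\<open>all\<close>), that is, the powers of
    \<open>x n\<close> below \<open>d\<close> generate the quotient by \<open>J\<close>.\<close>
  define JL where "JL = {p. \<exists>j\<in>J. \<exists>l\<in>lower n d. \<forall>x. p x = j x + l x}"
  have JLadd: "(\<lambda>x. p x + q x) \<in> JL" if pq: "p \<in> JL" "q \<in> JL" for p q
  proof -
    obtain j l where *: "j \<in> J" "l \<in> lower n d" "\<forall>x. p x = j x + l x"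
      using pq(1) unfolding JL_def by blast
    obtain j' l' where **: "j' \<in> J" "l' \<in> lower n d" "\<forall>x. q x = j' x + l' x"
      using pq(2) unfolding JL_def by blast
    show ?thesis unfolding JL_def mem_Collect_eq
      by (rule bexI[OF _ Jd(3)[OF *(1) **(1)]], rule bexI[OF _ lower_add[OF *(2) **(2)]])
         (use * ** in \<open>auto simp: algebra_simps\<close>)
  qed
  have JLmult: "(\<lambda>x. b x * q x) \<in> JL" if bq: "b \<in> polyfun n" "q \<in> JL" for b q
  proof -
    obtain j' l' where *: "j' \<in> J" "l' \<in> lower n d" "\<forall>x. q x = j' x + l' x"
      using bq(2) unfolding JL_def by blast
    show ?thesis unfolding JL_def mem_Collect_eq
      by (rule bexI[OF _ Jd(4)[OF up[OF bq(1)] *(1)]], rule bexI[OF _ lower_mult[OF bq(1) *(2)]])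
         (use * in \<open>auto simp: algebra_simps\<close>)
  qed
  have JLlow: "l \<in> JL" if "l \<in> lower n d" for l
    unfolding JL_def using that Jd(2) by force
  have JLJ: "j \<in> JL" if "j \<in> J" for j
    unfolding JL_def using that lower_zero by force
  have JLsum: "(\<And>i. i \<in> A \<Longrightarrow> p i \<in> JL) \<Longrightarrow> (\<lambda>x. \<Sum>i\<in>A. p i x) \<in> JL" for A :: "nat set" and p
    by (induction A rule: infinite_finite_induct) (auto intro: JLlow lower_zero JLadd)
  have top: "(\<lambda>x. x n ^ d) \<in> JL"
  proof -
    have "(\<lambda>x. -1 * l x) \<in> lower n d" by (intro lower_mult polyfun_const f)
    moreover have "\<forall>x. x n ^ d = f x + -1 * l x" using f(3) by simp
    ultimately show ?thesis unfolding JL_def mem_Collect_eq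
      using f(1) by (intro bexI[of _ f] bexI[of _ "\<lambda>x. -1 * l x"])
  qed
  have pow: "(\<lambda>x. x n ^ e) \<in> JL" for e
  proof (induction e)
    case 0
    show ?case
    proof (cases "d = 0")
      case True
      then show ?thesis using top by simp
    next
      case False
      then show ?thesis using JLlow[OF lower_term[of "\<lambda>_. 1" n 0 d]] polyfun_const[of 1 n] by simp
    qed
  next
    case (Suc e)
    then obtain j m where *: "j \<in> J" "m \<in> lower n d" "\<And>x. x n ^ e = j x + m x" unfolding JL_def by blast
    obtain c where c: "\<And>i. c i \<in> polyfun n" "m = (\<lambda>x. \<Sum>i<d. c i x * x n ^ i)"
      using *(2) unfolding lower_def by blast
    have "(\<lambda>x. c i x * x n ^ Suc i) \<in> JL" if "i < d" for i
    proof (cases "Suc i = d")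
      case True
      then show ?thesis using JLmult[OF c(1) top, of i] by simp
    next
      case False
      then show ?thesis using that by (intro JLlow lower_term c) auto
    qed
    then have 1: "(\<lambda>x. \<Sum>i<d. c i x * x n ^ Suc i) \<in> JL" by (intro JLsum) auto
    have 2: "(\<lambda>x. x n * j x) \<in> JL" by (intro JLJ Jd(4) * polyfun_var) auto
    have "(\<lambda>x. x n ^ Suc e) = (\<lambda>x. x n * j x + (\<Sum>i<d. c i x * x n ^ Suc i))"
      using *(3) unfolding c(2) by (simp add: algebra_simps sum_distrib_left)
    then show ?case using JLadd[OF 2 1] by simp
  qed
  have all: "p \<in> JL" if pp: "p \<in> polyfun (Suc n)" for p
  proof -
    obtain D c where c: "\<And>i. c i \<in> polyfun n" "\<And>x. p x = (\<Sum>i\<le>D. c i x * x n ^ i)"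
      using last_variable_expansion[OF pp] by blast
    have "(\<lambda>x. \<Sum>i\<le>D. c i x * x n ^ i) \<in> JL" by (intro JLsum JLmult c pow)
    moreover have "p = (\<lambda>x. \<Sum>i\<le>D. c i x * x n ^ i)" using c(2) by (rule ext)
    ultimately show ?thesis by simp
  qed
  \<comment> \<open>All \<open>d\<close> generators are removed in turn. Then \<open>r\<close>
    itself lies in \<open>J\<close>, although \<open>r a\<close> is not 0.\<close>
  have nog: False if g: "g \<in> J" "\<And>t. g (a(n := t)) = 1" for g
  proof -
    have Q: "\<exists>r\<in>polyfun n. r a \<noteq> 0 \<and>
      (\<forall>p\<in>polyfun (Suc n). \<exists>j\<in>J. \<exists>l\<in>lower n (d - i). \<forall>x. r x * p x = j x + l x)" if "i \<le> d" for i
      using that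
    proof (induction i)
      case 0
      show ?case using all by (intro bexI[of _ "\<lambda>_. 1"]) (auto simp: JL_def intro: polyfun_const)
    next
      case (Suc i)
      have di: "d - i = Suc (d - Suc i)" using Suc.prems by simp
      from Suc obtain r where "r\<in>polyfun n" "r a \<noteq> 0"
        "\<And>p. p\<in>polyfun (Suc n) \<Longrightarrow> \<exists>j\<in>J. \<exists>l\<in>lower n (Suc (d - Suc i)). \<forall>x. r x * p x = j x + l x"
        unfolding di by auto
      from nakayama_step[OF J g this] show ?case by blast
    qed
    obtain r where r: "r\<in>polyfun n" "r a \<noteq> 0"
        "\<And>p. p\<in>polyfun (Suc n) \<Longrightarrow> \<exists>j\<in>J. \<exists>l\<in>lower n 0. \<forall>x. r x * p x = j x + l x"
      using Q[of d] by auto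
    obtain j where "j \<in> J" "\<forall>x. r x = j x"
      using r(3)[OF polyfun_const[of 1]] by (auto simp: lower_def)
    then have "r = j" by auto
    then have "r \<in> J" using \<open>j \<in> J\<close> by simp
    then show False using a[of r] r by auto
  qed
  \<comment> \<open>The ideal of restrictions of \<open>J\<close> to the line over \<open>a\<close>.
    Unless it is zero, an element of least degree generates it, which by \<open>nog\<close> is not
    constant and hence has a root.\<close>
  define K where "K = {c. \<exists>g\<in>J. \<forall>t. g (a(n := t)) = poly c t}"
  have Kadd: "c + e \<in> K" if "c \<in> K" "e \<in> K" for c e
  proof -
    obtain g h where gh: "g \<in> J" "\<And>t. g (a(n := t)) = poly c t" "h \<in> J" "\<And>t. h (a(n := t)) = poly e t"
      using \<open>c \<in> K\<close> \<open>e \<in> K\<close> unfolding K_def by blast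
    show ?thesis unfolding K_def mem_Collect_eq
      by (rule bexI[OF _ Jd(3)[OF gh(1,3)]]) (simp add: gh)
  qed
  have Kmult: "c * e \<in> K" if eK: "e \<in> K" for c e
  proof -
    obtain g where g: "g \<in> J" "\<And>t. g (a(n := t)) = poly e t" using eK unfolding K_def by blast
    \<comment> \<open>A univariate polynomial acts on \<open>J\<close> through its value at
      \<open>x n\<close>, which makes \<open>K\<close> an ideal.\<close>
    have "(\<lambda>x. \<Sum>i\<le>degree c. coeff c i * x n ^ i) \<in> polyfun (Suc n)" by (intro polyfun_intros) auto
    note * = Jd(4)[OF this g(1)]
    show ?thesis unfolding K_def mem_Collect_eq
      by (rule bexI[OF _ *]) (simp add: g(2) poly_altdef[of c])
  qed
  have root: "\<exists>t. \<forall>c\<in>K. poly c t = 0"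
  proof (cases "K \<subseteq> {0}")
    case True
    then show ?thesis by (intro exI[of _ 0]) auto
  next
    case False
    define q where "q = arg_min degree (\<lambda>c. c \<in> K \<and> c \<noteq> 0)"
    have q: "q \<in> K" "q \<noteq> 0" and qmin: "\<And>c. c \<in> K \<Longrightarrow> c \<noteq> 0 \<Longrightarrow> degree q \<le> degree c"
      using False arg_min_nat_lemma[of "\<lambda>c. c \<in> K \<and> c \<noteq> 0" _ degree] unfolding q_def by auto
    have "degree q > 0"
    proof (rule ccontr)
      assume "\<not> degree q > 0"
      then obtain u where u: "q = [:u:]" using degree_eq_zeroE by blast
      have "[:1/u:] * q \<in> K" by (rule Kmult[OF q(1)])
      moreover have "[:1/u:] * q = 1" using q(2) u by (simp add: one_pCons)
      ultimately have "1 \<in> K" by simp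
      then obtain g where "g \<in> J" "\<forall>t. g (a(n := t)) = poly 1 t" unfolding K_def by blast
      then show False using nog[of g] by simp
    qed
    then obtain t where t: "poly q t = 0" using alg_closed_imp_poly_has_root by blast
    have "poly c t = 0" if "c \<in> K" for c
    proof -
      have "c mod q = c + (- (c div q)) * q" by (simp add: minus_div_mult_eq_mod[symmetric])
      then have "c mod q \<in> K" using that q Kadd Kmult by metis
      then have "c mod q = 0" using qmin[of "c mod q"] degree_mod_less[OF q(2), of c] by linarith
      then have "q dvd c" by (simp add: dvd_eq_mod_eq_0)
      then show ?thesis using t by (auto elim!: dvdE)
    qed
    then show ?thesis by blast
  qed
  then obtain t where t: "\<And>c. c \<in> K \<Longrightarrow> poly c t = 0" by blast
  have "p (a(n := t)) = 0" if pJ: "p \<in> J" for p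
  proof -
    define s where "s i = (if i = n then [:0,1:] else [:a i:])" for i
    obtain c where c: "\<And>t. p (\<lambda>i. poly (s i) t) = poly c t" using polyfun_on_curve[OF Jd(1)[OF pJ]] by blast
    have s: "(\<lambda>i. poly (s i) t) = a(n := t)" for t by (auto simp: s_def)
    have "c \<in> K" unfolding K_def using pJ c[unfolded s] by auto
    then show ?thesis using t c[of t, unfolded s] by auto
  qed
  then show ?thesis by blast
qed


text \<open>Shearing along a direction \<open>e\<close> with \<open>e\<^sub>n = 1\<close> where the top homogeneous component does not
  vanish makes a polynomial monic in \<open>x\<^sub>n\<close>.\<close>

definition shear :: "nat \<Rightarrow> (nat \<Rightarrow> 'k) \<Rightarrow> (nat \<Rightarrow> 'k::field) \<Rightarrow> nat \<Rightarrow> 'k" where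
  "shear n e x = (\<lambda>i. if i = n then x n else x i + e i * x n)"

lemma shear_inverse: "shear n e (shear n (\<lambda>i. - e i) x) = x" "shear n (\<lambda>i. - e i) (shear n e x) = x"
  by (auto simp: shear_def)

lemma polyfun_shear:
  assumes "p \<in> polyfun (Suc n)" shows "(\<lambda>x. p (shear n e x)) \<in> polyfun (Suc n)"
proof -
  have "(\<lambda>x. p (\<lambda>i. (if i = n then (\<lambda>x. x n) else (\<lambda>x. x i + e i * x n)) x)) \<in> polyfun (Suc n)"
    by (rule polyfun_subst[OF assms]) (auto intro!: polyfun_intros)
  then show ?thesis by (simp add: shear_def if_distrib[of "\<lambda>f. f _"] cong: if_cong)
qed

text \<open>\<open>L\<close> is a constant and may be 0, so sums and products need no case
  distinction.\<close>

definition lead :: "nat \<Rightarrow> nat \<Rightarrow> 'k \<Rightarrow> ((nat \<Rightarrow> 'k::field) \<Rightarrow> 'k) \<Rightarrow> bool" where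
  "lead n d L p \<longleftrightarrow> (\<exists>l\<in>lower n d. \<forall>x. p x = L * x n ^ d + l x)"

lemma lead_lower: assumes "lead n d L p" shows "p \<in> lower n (Suc d)"
proof -
  obtain l where l: "l \<in> lower n d" "\<And>x. p x = L * x n ^ d + l x" using assms unfolding lead_def by blast
  have "(\<lambda>x. L * x n ^ d + l x) \<in> lower n (Suc d)"
    by (rule lower_add[OF lower_term lower_mono[OF l(1)]]) (auto intro: polyfun_const)
  moreover have "p = (\<lambda>x. L * x n ^ d + l x)" using l(2) by (rule ext)
  ultimately show ?thesis by simp
qed

lemma lead_mult:
  assumes "lead n d L p" "lead n e M q" shows "lead n (d + e) (L * M) (\<lambda>x. p x * q x)"
proof -
  obtain l where l: "l \<in> lower n d" "\<And>x. p x = L * x n ^ d + l x" using assms(1) unfolding lead_def by blast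
  obtain m where m: "m \<in> lower n e" "\<And>x. q x = M * x n ^ e + m x" using assms(2) unfolding lead_def by blast
  have "(\<lambda>x. p x * m x) \<in> lower n (d + e)" by (rule lower_prod[OF lead_lower[OF assms(1)] m(1)])
  moreover have "(\<lambda>x. (M * x n ^ e) * l x) \<in> lower n (e + d)"
    by (rule lower_prod[OF lower_term l(1)]) (auto intro: polyfun_const)
  ultimately have "(\<lambda>x. p x * m x + (M * x n ^ e) * l x) \<in> lower n (d + e)"
    using lower_add by (simp add: add.commute)
  then show ?thesis unfolding lead_def
    by (rule bexI[rotated]) (simp add: l m power_add algebra_simps)
qed

lemma lead_power: "lead n d L p \<Longrightarrow> lead n (m * d) (L ^ m) (\<lambda>x. p x ^ m)"
proof (induction m)
  case 0
  show ?case unfolding lead_def by (rule bexI[OF _ lower_zero]) simp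
next
  case (Suc m)
  then show ?case using lead_mult[of n d L p "m * d"] by simp
qed

lemma lead_prod:
  assumes "finite A" "\<And>i. i \<in> A \<Longrightarrow> lead n (d i) (L i) (p i)"
  shows "lead n (\<Sum>i\<in>A. d i) (\<Prod>i\<in>A. L i) (\<lambda>x. \<Prod>i\<in>A. p i x)"
  using assms
proof (induction A rule: finite_induct)
  case empty
  show ?case unfolding lead_def by (rule bexI[OF _ lower_zero]) simp
next
  case (insert i A)
  then show ?case using lead_mult[of n "d i" "L i" "p i"] by simp
qed

lemma lead_sum:
  assumes "\<And>i. i \<in> A \<Longrightarrow> lead n d (L i) (p i)"
  shows "lead n d (\<Sum>i\<in>A. L i) (\<lambda>x. \<Sum>i\<in>A. p i x)"
proof -
  have "\<forall>i\<in>A. \<exists>l. l \<in> lower n d \<and> (\<forall>x. p i x = L i * x n ^ d + l x)"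
    using assms unfolding lead_def by blast
  then obtain l where l: "\<And>i. i \<in> A \<Longrightarrow> l i \<in> lower n d"
    "\<And>i x. i \<in> A \<Longrightarrow> p i x = L i * x n ^ d + l i x" by metis
  have "(\<lambda>x. \<Sum>i\<in>A. l i x) \<in> lower n d" by (rule lower_sum) (rule l)
  then show ?thesis unfolding lead_def
    by (rule bexI[rotated]) (simp add: l(2) sum.distrib sum_distrib_right)
qed

lemma lead_cmult: assumes "lead n d L p" shows "lead n d (c * L) (\<lambda>x. c * p x)"
proof -
  have "lead n 0 c (\<lambda>_. c)" unfolding lead_def by (rule bexI[OF _ lower_zero]) simp
  from lead_mult[OF this assms] show ?thesis by simp
qed

text \<open>Since \<open>e n = 1\<close>, the \<open>i\<close>-th coordinate of the shear has
  leading coefficient \<open>e i\<close> in \<open>x n\<close>; a form of degree \<open>d\<close> in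
  these coordinates therefore has leading coefficient \<open>p e\<close>.\<close>

lemma lead_shear_homogeneous:
  assumes "p \<in> fvs.span (mon (Suc n) ` {\<alpha> \<in> ebox (Suc n) E. hdeg (Suc n) \<alpha> = d})" "e n = 1"
  shows "lead n d (p e) (\<lambda>x. p (shear n e x))"
proof -
  have v: "lead n 1 (e i) (\<lambda>x. shear n e x i)" if "i < Suc n" for i
  proof (cases "i = n")
    case True
    then show ?thesis using assms(2) unfolding lead_def shear_def by (intro bexI[OF _ lower_zero]) simp
  next
    case False
    then have "(\<lambda>x. x i * x n ^ 0) \<in> lower n 1" using that by (intro lower_term polyfun_var) auto
    moreover have "\<forall>x. shear n e x i = e i * x n ^ 1 + x i * x n ^ 0" using False by (simp add: shear_def)
    ultimately show ?thesis unfolding lead_def by (intro bexI[of _ "\<lambda>x. x i * x n ^ 0"])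
  qed
  have m: "lead n (hdeg (Suc n) \<alpha>) (mon (Suc n) \<alpha> e) (\<lambda>x. mon (Suc n) \<alpha> (shear n e x))" for \<alpha>
  proof -
    have "lead n (\<Sum>i<Suc n. \<alpha> i * 1) (\<Prod>i<Suc n. e i ^ \<alpha> i) (\<lambda>x. \<Prod>i<Suc n. shear n e x i ^ \<alpha> i)"
      by (rule lead_prod[OF finite_lessThan], rule lead_power, rule v) simp
    then show ?thesis by (simp only: mon_def hdeg_def mult_1_right)
  qed
  define B where "B = {\<alpha> \<in> ebox (Suc n) E. hdeg (Suc n) \<alpha> = d}"
  have "finite B" unfolding B_def by simp
  then obtain c where c: "p = (\<Sum>\<alpha>\<in>B. fscale (c \<alpha>) (mon (Suc n) \<alpha>))"
    using span_image_finite[of B p "mon (Suc n)"] assms(1) unfolding B_def by blast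
  have px: "p x = (\<Sum>\<alpha>\<in>B. c \<alpha> * mon (Suc n) \<alpha> x)" for x by (simp add: c sum_fun_apply fscale_def)
  show ?thesis unfolding px
    by (rule lead_sum, rule lead_cmult) (use m in \<open>auto simp: B_def\<close>)
qed

text \<open>Induction on \<open>n\<close> by Noether normalisation: a shear makes some element of
  \<open>J\<close> monic in the last variable up to a constant, and zeros are carried back by the
  shear.\<close>

lemma nullstellensatz:
  fixes J :: "((nat \<Rightarrow> 'k::{alg_closed_field, field_char_0}) \<Rightarrow> 'k) set"
  assumes "poly_ideal n J" "(\<lambda>_. 1) \<notin> J"
  shows "\<exists>x. \<forall>p\<in>J. p x = 0"
  using assms
proof (induction n arbitrary: J)
  case 0
  note Jd = poly_idealD[OF 0(1)]
  have "p x = 0" if p: "p \<in> J" for p x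
  proof (rule ccontr)
    assume "p x \<noteq> 0"
    have "p y = p x" for y by (rule polyfun_cong[OF Jd(1)[OF p]]) auto
    then have "(\<lambda>y. (1 / p x) * p y) = (\<lambda>_. 1)" using \<open>p x \<noteq> 0\<close> by auto
    moreover have "(\<lambda>y. (1 / p x) * p y) \<in> J" by (rule Jd(4)[OF polyfun_const p])
    ultimately show False using 0(2) by simp
  qed
  then show ?case by blast
next
  case (Suc n)
  note Jd = poly_idealD[OF Suc.prems(1)]
  show ?case
  proof (cases "\<forall>p\<in>J. \<forall>x. p x = 0")
    case True
    then show ?thesis by blast
  next
    case False
    then obtain g y where g: "g \<in> J" "g y \<noteq> 0" by blast
    obtain E where E: "g \<in> polybox (Suc n) E" using polyfun_polybox[OF Jd(1)[OF g(1)]] by blast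
    obtain P where P: "\<And>d. homogeneous (Suc n) d (P d)"
      "\<And>d. P d \<in> fvs.span (mon (Suc n) ` {\<alpha> \<in> ebox (Suc n) E. hdeg (Suc n) \<alpha> = d})"
      "\<And>x. g x = (\<Sum>d\<le>Suc n * E. P d x)"
      using homogeneous_components[OF E] by blast
    define D where "D = Suc n * E"
    have ex: "\<exists>d\<le>D. \<exists>x. P d x \<noteq> 0"
    proof (rule ccontr)
      assume "\<not> ?thesis"
      then have "g y = 0" unfolding P(3) D_def[symmetric] by (intro sum.neutral) auto
      then show False using g(2) by simp
    qed
    \<comment> \<open>Components above \<open>d\<close> vanish identically, and those below have
      degree less than \<open>d\<close> in \<open>x n\<close> after the shear, so the component of
      degree \<open>d\<close> alone decides the leading term.\<close>
    define d where "d = (GREATEST d. d \<le> D \<and> (\<exists>x. P d x \<noteq> 0))"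
    have d: "d \<le> D \<and> (\<exists>x. P d x \<noteq> 0)"
      unfolding d_def by (rule GreatestI_ex_nat[of _ D]) (use ex in auto)
    have dmax: "P d' x = 0" if "d < d'" "d' \<le> D" for d' x
    proof (rule ccontr)
      assume "P d' x \<noteq> 0"
      then have "d' \<le> d" unfolding d_def using that(2) by (intro Greatest_le_nat[of _ d' D]) auto
      then show False using that(1) by simp
    qed
    obtain z where z: "P d z \<noteq> 0" using d by blast
    have "P d \<in> polyfun (Suc n)" using P(1)[of d] by (simp add: homogeneous_def)
    \<comment> \<open>The direction must avoid the zeros of the top component and also have a
      nonzero last coordinate, which is then scaled to 1.\<close>
    from polyfun_nonzero_mult[OF this polyfun_var[of n "Suc n"] z, of "\<lambda>_. 1"]
    obtain e0 where e0: "P d e0 \<noteq> 0" "e0 n \<noteq> 0" by auto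
    define e where "e = fscale (1 / e0 n) e0"
    have e: "P d e \<noteq> 0" "e n = 1"
    proof -
      have "P d e = (1 / e0 n) ^ d * P d e0" using P(1)[of d] unfolding e_def homogeneous_def by blast
      then show "P d e \<noteq> 0" using e0 by simp
      show "e n = 1" using e0 by (simp add: e_def fscale_def)
    qed
    have gl: "lead n d (P d e) (\<lambda>x. g (shear n e x))"
    proof -
      have "\<exists>l\<in>lower n d. \<forall>x. P d (shear n e x) = P d e * x n ^ d + l x"
        using lead_shear_homogeneous[OF P(2), of e d] e by (simp add: lead_def)
      then obtain l where l: "l\<in>lower n d" "\<And>x. P d (shear n e x) = P d e * x n ^ d + l x" by blast
      have low: "(\<lambda>x. P d' (shear n e x)) \<in> lower n d" if "d' < d" for d'
        using lower_mono[OF lead_lower[OF lead_shear_homogeneous[OF P(2), of e d']]] e that by simp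
      have "(\<lambda>x. l x + (\<Sum>d'<d. P d' (shear n e x))) \<in> lower n d"
        by (intro lower_add lower_sum l low) auto
      moreover have "g (shear n e x) = P d e * x n ^ d + (l x + (\<Sum>d'<d. P d' (shear n e x)))" for x
      proof -
        have "g (shear n e x) = (\<Sum>d'\<le>d. P d' (shear n e x))"
          unfolding P(3) D_def[symmetric] using d dmax by (intro sum.mono_neutral_right) auto
        then show ?thesis by (simp add: l(2) lessThan_Suc_atMost[symmetric] algebra_simps)
      qed
      ultimately show ?thesis unfolding lead_def
        by (intro bexI[of _ "\<lambda>x. l x + (\<Sum>d'<d. P d' (shear n e x))"]) auto
    qed
    define J' where "J' = {(\<lambda>x. p (shear n e x)) |p. p \<in> J}"
    have J'I: "q \<in> J'" if "(\<lambda>x. q (shear n (\<lambda>i. - e i) x)) \<in> J" for q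
      unfolding J'_def mem_Collect_eq
      by (rule exI[of _ "\<lambda>x. q (shear n (\<lambda>i. - e i) x)"]) (simp add: shear_inverse that)
    have J'D: "(\<lambda>x. q (shear n (\<lambda>i. - e i) x)) \<in> J" if "q \<in> J'" for q
      using that unfolding J'_def by (auto simp: shear_inverse)
    have 1: "poly_ideal (Suc n) J'"
      unfolding poly_ideal_def
    proof (intro conjI ballI subsetI)
      fix q assume "q \<in> J'"
      then show "q \<in> polyfun (Suc n)" unfolding J'_def using polyfun_shear Jd(1) by blast
    qed (auto intro!: J'I Jd polyfun_shear dest!: J'D)
    have 2: "(\<lambda>_. 1) \<notin> J'" using J'D[of "\<lambda>_. 1"] Suc.prems(2) by auto
    obtain l where l: "l\<in>lower n d" "\<And>x. g (shear n e x) = P d e * x n ^ d + l x"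
      using gl unfolding lead_def by blast
    have 3: "(\<lambda>x. (1 / P d e) * g (shear n e x)) \<in> J'"
      by (rule J'I, simp only: shear_inverse, rule Jd(4)[OF polyfun_const g(1)])
    have 4: "(\<lambda>x. (1 / P d e) * l x) \<in> lower n d" by (intro lower_mult polyfun_const l)
    have 5: "(1 / P d e) * g (shear n e x) = x n ^ d + (1 / P d e) * l x" for x
      unfolding l(2) using e(1) by (simp add: field_simps)
    obtain x where x: "\<forall>p\<in>J'. p x = 0"
      using nullstellensatz_monic[OF 1 2 3 4 5 Suc.IH] by blast
    have "p (shear n e x) = 0" if "p \<in> J" for p
      using bspec[OF x, of "\<lambda>x. p (shear n e x)"] that unfolding J'_def by blast
    then show ?thesis by blast
  qed
qed


section \<open>Generated ideals; strong and projective Nullstellensatz\<close>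

definition gen_ideal :: "nat \<Rightarrow> ((nat \<Rightarrow> 'k::field) \<Rightarrow> 'k) set \<Rightarrow> ((nat \<Rightarrow> 'k) \<Rightarrow> 'k) set" where
  "gen_ideal n Q = {p. \<exists>S A. finite S \<and> S \<subseteq> Q \<and> (\<forall>q\<in>S. A q \<in> polyfun n) \<and> (\<forall>x. p x = (\<Sum>q\<in>S. A q x * q x))}"

lemma gen_idealI:
  assumes "finite S" "S \<subseteq> Q" "\<And>q. q \<in> S \<Longrightarrow> A q \<in> polyfun n" "\<And>x. p x = (\<Sum>q\<in>S. A q x * q x)"
  shows "p \<in> gen_ideal n Q"
  unfolding gen_ideal_def mem_Collect_eq using assms by (intro exI[of _ S] exI[of _ A]) simp

lemma gen_ideal_add:
  fixes p r :: "(nat \<Rightarrow> 'k::field) \<Rightarrow> 'k"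
  assumes "p \<in> gen_ideal n Q" "r \<in> gen_ideal n Q"
  shows "(\<lambda>x. p x + r x) \<in> gen_ideal n Q"
proof -
  obtain S A where *: "finite S" "S \<subseteq> Q" "\<And>q. q \<in> S \<Longrightarrow> A q \<in> polyfun n" "\<And>x. p x = (\<Sum>q\<in>S. A q x * q x)"
    using assms(1) unfolding gen_ideal_def mem_Collect_eq by blast
  obtain S' A' where **: "finite S'" "S' \<subseteq> Q" "\<And>q. q \<in> S' \<Longrightarrow> A' q \<in> polyfun n" "\<And>x. r x = (\<Sum>q\<in>S'. A' q x * q x)"
    using assms(2) unfolding gen_ideal_def mem_Collect_eq by blast
  define B where "B q = (if q \<in> S then A q else (\<lambda>_. 0))" for q
  define B' where "B' q = (if q \<in> S' then A' q else (\<lambda>_. 0))" for q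
  have p: "p x = (\<Sum>q\<in>S \<union> S'. B q x * q x)" for x
    unfolding *(4) B_def using *(1) **(1) by (intro sum.mono_neutral_cong_left) auto
  have r: "r x = (\<Sum>q\<in>S \<union> S'. B' q x * q x)" for x
    unfolding **(4) B'_def using *(1) **(1) by (intro sum.mono_neutral_cong_left) auto
  show ?thesis
  proof (rule gen_idealI[of "S \<union> S'" _ "\<lambda>q x. B q x + B' q x"])
    show "(\<lambda>x. B q x + B' q x) \<in> polyfun n" for q
      unfolding B_def B'_def using *(3) **(3) by (auto intro!: polyfun_intros)
  qed (use * ** in \<open>auto simp: p r sum.distrib algebra_simps\<close>)
qed

lemma gen_ideal_mult:
  fixes a p :: "(nat \<Rightarrow> 'k::field) \<Rightarrow> 'k"
  assumes a: "a \<in> polyfun n" and "p \<in> gen_ideal n Q"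
  shows "(\<lambda>x. a x * p x) \<in> gen_ideal n Q"
proof -
  obtain S A where *: "finite S" "S \<subseteq> Q" "\<And>q. q \<in> S \<Longrightarrow> A q \<in> polyfun n" "\<And>x. p x = (\<Sum>q\<in>S. A q x * q x)"
    using assms(2) unfolding gen_ideal_def mem_Collect_eq by blast
  show ?thesis
    by (rule gen_idealI[of S _ "\<lambda>q x. a x * A q x"])
       (use * a in \<open>auto simp: sum_distrib_left mult.assoc intro: polyfun_mult\<close>)
qed

lemma gen_ideal_polyfun:
  fixes p :: "(nat \<Rightarrow> 'k::field) \<Rightarrow> 'k"
  assumes Q: "Q \<subseteq> polyfun n" and "p \<in> gen_ideal n Q"
  shows "p \<in> polyfun n"
proof -
  obtain S A where *: "finite S" "S \<subseteq> Q" "\<And>q. q \<in> S \<Longrightarrow> A q \<in> polyfun n" "\<And>x. p x = (\<Sum>q\<in>S. A q x * q x)"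
    using assms(2) unfolding gen_ideal_def mem_Collect_eq by blast
  have "(\<lambda>x. \<Sum>q\<in>S. A q x * q x) \<in> polyfun n"
    by (rule polyfun_sum, rule polyfun_mult) (use * Q in auto)
  moreover have "p = (\<lambda>x. \<Sum>q\<in>S. A q x * q x)" using *(4) by (rule ext)
  ultimately show ?thesis by simp
qed

lemma poly_ideal_gen_ideal: "Q \<subseteq> polyfun n \<Longrightarrow> poly_ideal n (gen_ideal n Q)"
  unfolding poly_ideal_def
  by (auto intro: gen_ideal_add gen_ideal_mult gen_ideal_polyfun gen_idealI[of "{}"])

lemma gen_ideal_base: "q \<in> Q \<Longrightarrow> q \<in> gen_ideal n Q"
  by (rule gen_idealI[of "{q}" _ "\<lambda>_ _. 1"]) (auto intro: polyfun_const)

text \<open>Every exponent from \<open>D\<close> on works, so that finitely many polynomials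
  \<open>A\<close> can share one exponent.\<close>

lemma clear_denominator:
  fixes f :: "(nat \<Rightarrow> 'k::field) \<Rightarrow> 'k"
  assumes "A \<in> polyfun (Suc n)" and f: "f \<in> polyfun n"
  shows "\<exists>D. \<forall>D'\<ge>D. \<exists>B\<in>polyfun n. \<forall>x. f x \<noteq> 0 \<longrightarrow> B x = f x ^ D' * A (x(n := 1 / f x))"
  using assms(1)
proof (induction rule: polyfun_induct)
  case (const c)
  have "(\<lambda>x. f x ^ D' * c) \<in> polyfun n" for D' by (intro polyfun_mult polyfun_power f polyfun_const)
  then show ?case by (intro exI[of _ 0] allI impI, intro bexI[of _ "\<lambda>x. f x ^ _ * c"]) auto
next
  case (var i)
  show ?case
  proof (cases "i = n")
    case False
    have "(\<lambda>x. f x ^ D' * x i) \<in> polyfun n" for D'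
      by (intro polyfun_mult polyfun_power f polyfun_var) (use False var in auto)
    then show ?thesis using False by (intro exI[of _ 0] allI impI, intro bexI[of _ "\<lambda>x. f x ^ _ * x i"]) auto
  next
    case True
    have "\<exists>B\<in>polyfun n. \<forall>x. f x \<noteq> 0 \<longrightarrow> B x = f x ^ D' * (x(n := 1 / f x)) i" if "D' \<ge> 1" for D'
    proof (rule bexI[of _ "\<lambda>x. f x ^ (D' - 1)"])
      show "\<forall>x. f x \<noteq> 0 \<longrightarrow> f x ^ (D' - 1) = f x ^ D' * (x(n := 1 / f x)) i"
        using that True by (cases D') auto
    qed (intro polyfun_power f)
    then show ?thesis by blast
  qed
next
  case (add p q)
  then obtain D E where D: "\<And>D'. D' \<ge> D \<Longrightarrow> \<exists>B\<in>polyfun n. \<forall>x. f x \<noteq> 0 \<longrightarrow> B x = f x ^ D' * p (x(n := 1 / f x))"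
    and E: "\<And>D'. D' \<ge> E \<Longrightarrow> \<exists>B\<in>polyfun n. \<forall>x. f x \<noteq> 0 \<longrightarrow> B x = f x ^ D' * q (x(n := 1 / f x))" by blast
  have "\<exists>B\<in>polyfun n. \<forall>x. f x \<noteq> 0 \<longrightarrow> B x = f x ^ D' * (p (x(n := 1 / f x)) + q (x(n := 1 / f x)))"
    if D': "D' \<ge> D + E" for D'
  proof -
    obtain B where B: "B\<in>polyfun n" "\<And>x. f x \<noteq> 0 \<Longrightarrow> B x = f x ^ D' * p (x(n := 1 / f x))" using D[of D'] D' by auto
    obtain C where C: "C\<in>polyfun n" "\<And>x. f x \<noteq> 0 \<Longrightarrow> C x = f x ^ D' * q (x(n := 1 / f x))" using E[of D'] D' by auto
    show ?thesis by (rule bexI[OF _ polyfun_add[OF B(1) C(1)]]) (simp add: B C algebra_simps)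
  qed
  then show ?case by blast
next
  case (mult p q)
  then obtain D E where D: "\<And>D'. D' \<ge> D \<Longrightarrow> \<exists>B\<in>polyfun n. \<forall>x. f x \<noteq> 0 \<longrightarrow> B x = f x ^ D' * p (x(n := 1 / f x))"
    and E: "\<And>D'. D' \<ge> E \<Longrightarrow> \<exists>B\<in>polyfun n. \<forall>x. f x \<noteq> 0 \<longrightarrow> B x = f x ^ D' * q (x(n := 1 / f x))" by blast
  have "\<exists>B\<in>polyfun n. \<forall>x. f x \<noteq> 0 \<longrightarrow> B x = f x ^ D' * (p (x(n := 1 / f x)) * q (x(n := 1 / f x)))"
    if D': "D' \<ge> D + E" for D'
  proof -
    obtain B where B: "B\<in>polyfun n" "\<And>x. f x \<noteq> 0 \<Longrightarrow> B x = f x ^ D * p (x(n := 1 / f x))" using D[of D] by auto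
    obtain C where C: "C\<in>polyfun n" "\<And>x. f x \<noteq> 0 \<Longrightarrow> C x = f x ^ (D' - D) * q (x(n := 1 / f x))" using E[of "D' - D"] D' by (metis add_le_imp_le_diff add.commute)
    have "f x ^ D' = f x ^ D * f x ^ (D' - D)" for x using D' by (simp add: power_add[symmetric])
    then show ?thesis by (intro bexI[OF _ polyfun_mult[OF B(1) C(1)]]) (simp add: B C algebra_simps)
  qed
  then show ?case by blast
qed

text \<open>Rabinowitsch's trick: with one more variable, \<open>Q\<close> and
  \<open>1 - x n * f\<close> have no common zero, and substituting \<open>1 / f\<close> for
  \<open>x n\<close> in the resulting identity gives the power of \<open>f\<close>.\<close>

lemma strong_nullstellensatz:
  fixes f :: "(nat \<Rightarrow> 'k::{alg_closed_field, field_char_0}) \<Rightarrow> 'k"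
  assumes Q: "Q \<subseteq> polyfun n" and f: "f \<in> polyfun n"
    and van: "\<And>x. \<forall>q\<in>Q. q x = 0 \<Longrightarrow> f x = 0"
  shows "\<exists>D. (\<lambda>x. f x ^ D) \<in> gen_ideal n Q"
proof -
  define r where "r x = 1 - x n * f x" for x
  have fS: "f \<in> polyfun (Suc n)" by (rule polyfun_mono[OF f]) simp
  have r: "r \<in> polyfun (Suc n)" unfolding r_def[abs_def] by (intro polyfun_diff polyfun_const polyfun_mult polyfun_var fS) simp
  have fc: "f (x(n := c)) = f x" for x c by (rule polyfun_cong[OF f]) auto
  have qc: "q (x(n := c)) = q x" if "q \<in> Q" for q x c by (rule polyfun_cong[of q n]) (use that Q in auto)
  have Q': "insert r Q \<subseteq> polyfun (Suc n)"
    using r Q polyfun_mono[of _ n "Suc n"] by auto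
  have "(\<lambda>_. 1) \<in> gen_ideal (Suc n) (insert r Q)"
  proof (rule ccontr)
    assume "(\<lambda>_. 1) \<notin> gen_ideal (Suc n) (insert r Q)"
    from nullstellensatz[OF poly_ideal_gen_ideal[OF Q'] this]
    obtain x where x: "\<And>p. p \<in> insert r Q \<Longrightarrow> p x = 0" using gen_ideal_base by blast
    have "f x = 0" by (rule van) (use x in auto)
    moreover have "r x = 0" by (rule x) simp
    ultimately show False by (simp add: r_def)
  qed
  then obtain S A where S: "finite S" "S \<subseteq> insert r Q" "\<And>q. q \<in> S \<Longrightarrow> A q \<in> polyfun (Suc n)"
    "\<And>x. 1 = (\<Sum>q\<in>S. A q x * q x)"
    unfolding gen_ideal_def mem_Collect_eq by blast
  have "\<forall>q\<in>S. \<exists>D. \<forall>D'\<ge>D. \<exists>B\<in>polyfun n. \<forall>x. f x \<noteq> 0 \<longrightarrow> B x = f x ^ D' * A q (x(n := 1 / f x))"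
    using clear_denominator[OF S(3) f] by blast
  then obtain D where D: "\<And>q D'. q \<in> S \<Longrightarrow> D' \<ge> D q \<Longrightarrow>
      \<exists>B\<in>polyfun n. \<forall>x. f x \<noteq> 0 \<longrightarrow> B x = f x ^ D' * A q (x(n := 1 / f x))" by metis
  define M where "M = (\<Sum>q\<in>S. D q)"
  have "M \<ge> D q" if "q \<in> S" for q unfolding M_def using that S(1) by (intro member_le_sum) auto
  then have "\<forall>q\<in>S. \<exists>B. B \<in> polyfun n \<and> (\<forall>x. f x \<noteq> 0 \<longrightarrow> B x = f x ^ M * A q (x(n := 1 / f x)))"
    using D by blast
  then obtain B where B: "\<And>q. q \<in> S \<Longrightarrow> B q \<in> polyfun n"
    "\<And>q x. q \<in> S \<Longrightarrow> f x \<noteq> 0 \<Longrightarrow> B q x = f x ^ M * A q (x(n := 1 / f x))" by metis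
  \<comment> \<open>The \<open>B q\<close> are controlled only where \<open>f\<close> is nonzero.
    The additional factor \<open>f\<close> makes the identity trivial at its zeros, even for
    \<open>M = 0\<close>.\<close>
  have "(\<lambda>x. f x ^ Suc M) \<in> gen_ideal n Q"
  proof (rule gen_idealI[of "S \<inter> Q" _ "\<lambda>q x. f x * B q x"])
    fix x
    show "f x ^ Suc M = (\<Sum>q\<in>S \<inter> Q. f x * B q x * q x)"
    proof (cases "f x = 0")
      case False
      let ?y = "x(n := 1 / f x)"
      have ry: "r ?y = 0" using False by (simp add: r_def fc)
      have "(\<Sum>q\<in>S. A q ?y * q ?y) = (\<Sum>q\<in>S \<inter> Q. A q ?y * q ?y)"
        using S(1,2) ry by (intro sum.mono_neutral_right) auto
      with S(4)[of ?y] have "1 = (\<Sum>q\<in>S \<inter> Q. A q ?y * q ?y)" by (rule trans)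
      then have "f x ^ M * 1 = f x ^ M * (\<Sum>q\<in>S \<inter> Q. A q ?y * q ?y)" by (rule arg_cong)
      also have "\<dots> = (\<Sum>q\<in>S \<inter> Q. B q x * q x)"
        unfolding sum_distrib_left using False by (intro sum.cong) (auto simp: B qc)
      finally have "f x ^ M = (\<Sum>q\<in>S \<inter> Q. B q x * q x)" by simp
      then show ?thesis by (simp add: sum_distrib_left mult.assoc)
    qed simp
  qed (use S B in \<open>auto intro: polyfun_mult f\<close>)
  then show ?thesis by blast
qed

text \<open>Every coordinate vanishes on the common zeros, so a power of each coordinate lies in the
  ideal; one exponent \<open>E\<close> beyond all these powers is good for every monomial.\<close>

lemma projective_nullstellensatz:
  fixes Q :: "((nat \<Rightarrow> 'k::{alg_closed_field, field_char_0}) \<Rightarrow> 'k) set"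
  assumes Q: "Q \<subseteq> polyfun n"
    and van: "\<And>x i. \<forall>q\<in>Q. q x = 0 \<Longrightarrow> i < n \<Longrightarrow> x i = 0"
  shows "\<exists>E\<ge>1. \<forall>\<alpha>. (\<exists>i<n. \<alpha> i \<ge> E) \<longrightarrow> mon n \<alpha> \<in> gen_ideal n Q"
proof -
  note I = poly_idealD[OF poly_ideal_gen_ideal[OF Q]]
  have "\<exists>D. (\<lambda>x. x i ^ D) \<in> gen_ideal n Q" if i: "i < n" for i
    by (rule strong_nullstellensatz[OF Q polyfun_var[OF i]], rule van) (use i in auto)
  then obtain D where D: "\<And>i. i < n \<Longrightarrow> (\<lambda>x. x i ^ D i) \<in> gen_ideal n Q" by metis
  define E where "E = 1 + (\<Sum>i<n. D i)"
  have "mon n \<alpha> \<in> gen_ideal n Q" if "i < n" "\<alpha> i \<ge> E" for \<alpha> i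
  proof -
    have "D i \<le> (\<Sum>i<n. D i)" using that(1) by (intro member_le_sum) auto
    then have le: "D i \<le> \<alpha> i" using that(2) unfolding E_def by simp
    have "(mon n \<alpha> :: (nat \<Rightarrow> 'k) \<Rightarrow> 'k) = (\<lambda>x. mon n (\<alpha>(i := \<alpha> i - D i)) x * x i ^ D i)"
    proof
      fix x :: "nat \<Rightarrow> 'k"
      have i: "i \<in> {..<n}" using that by simp
      have "(\<Prod>j\<in>{..<n} - {i}. x j ^ (\<alpha>(i := \<alpha> i - D i)) j) = (\<Prod>j\<in>{..<n} - {i}. x j ^ \<alpha> j)"
        by (intro prod.cong) auto
      then show "mon n \<alpha> x = mon n (\<alpha>(i := \<alpha> i - D i)) x * x i ^ D i"
        unfolding mon_def using le by (simp add: prod.remove[OF _ i] power_add[symmetric] mult_ac)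
    qed
    then show ?thesis using I(4)[OF mon_polyfun D[OF that(1)]] by simp
  qed
  then show ?thesis by (intro exI[of _ E]) (auto simp: E_def)
qed

lemma big_degree_exponent:
  assumes "n * E < hdeg n \<alpha>" shows "\<exists>i<n. \<alpha> i \<ge> E"
proof (rule ccontr)
  assume "\<not> ?thesis"
  then have "hdeg n \<alpha> \<le> (\<Sum>i<n. E)" unfolding hdeg_def by (intro sum_mono) auto
  then show False using assms by simp
qed

text \<open>The homogeneous components appear as coefficients of a polynomial in the scaling factor,
  so that identities between them follow from identities of univariate polynomials.\<close>

lemma homogeneous_coefficients:
  fixes A :: "(nat \<Rightarrow> 'k::field) \<Rightarrow> 'k"
  assumes "A \<in> polyfun n"
  shows "\<exists>Q. (\<forall>x t. poly (Q x) t = A (fscale t x)) \<and> (\<forall>e. homogeneous n e (\<lambda>x. coeff (Q x) e))"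
proof -
  obtain E where "A \<in> polybox n E" using polyfun_polybox[OF assms] by blast
  from homogeneous_components[OF this] obtain P where P: "\<And>d. homogeneous n d (P d)"
     "\<And>x. A x = (\<Sum>d\<le>n * E. P d x)" by blast
  define Q where "Q x = (\<Sum>d\<le>n * E. monom (P d x) d)" for x
  have "poly (Q x) t = A (fscale t x)" for x t
    unfolding P(2) Q_def using P(1) by (simp add: poly_sum poly_monom homogeneous_def mult.commute)
  moreover have "homogeneous n e (\<lambda>x. coeff (Q x) e)" for e
  proof (cases "e \<le> n * E")
    case True
    then have "coeff (Q x) e = P e x" for x by (simp add: Q_def coeff_sum sum.delta)
    then show ?thesis using P(1)[of e] by (simp add: homogeneous_def)
  next
    case False
    then have "coeff (Q x) e = 0" for x by (simp add: Q_def coeff_sum sum.delta)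
    then show ?thesis using homogeneous_zero by simp
  qed
  ultimately show ?thesis by blast
qed

lemma poly_eq_nonzero:
  fixes c d :: "'k::field_char_0 poly"
  assumes "\<And>t. t \<noteq> 0 \<Longrightarrow> poly c t = poly d t" shows "c = d"
proof -
  have "poly ([:0,1:] * c) t = poly ([:0,1:] * d) t" for t using assms[of t] by (cases "t = 0") auto
  then have "[:0,1:] * c = [:0,1:] * d" by (rule poly_eq_all)
  then show ?thesis by simp
qed

text \<open>Comparison of the coefficients of \<open>t ^ D\<close> under scaling, which is available
  on any set \<open>T\<close> stable under nonzero scalars, in particular on cones. Natural
  subtraction in \<open>D - d q\<close> is harmless because the coefficient is 0 when
  \<open>D < d q\<close>.\<close>

lemma homogeneous_combination:
  fixes p :: "(nat \<Rightarrow> 'k::field_char_0) \<Rightarrow> 'k"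
  assumes p: "homogeneous n D p" and S: "finite S"
    and A: "\<And>q. q \<in> S \<Longrightarrow> A q \<in> polyfun n" and q: "\<And>q. q \<in> S \<Longrightarrow> homogeneous n (d q) q"
    and T: "\<And>x t. x \<in> T \<Longrightarrow> t \<noteq> 0 \<Longrightarrow> fscale t x \<in> T"
    and eq: "\<And>x. x \<in> T \<Longrightarrow> p x = (\<Sum>q\<in>S. A q x * q x)"
  shows "\<exists>C. (\<forall>q\<in>S. homogeneous n (D - d q) (C q) \<and> (D < d q \<longrightarrow> C q = (\<lambda>_. 0))) \<and>
    (\<forall>x\<in>T. p x = (\<Sum>q\<in>S. C q x * q x))"
proof -
  have "\<forall>q\<in>S. \<exists>Q. (\<forall>x t. poly (Q x) t = A q (fscale t x)) \<and> (\<forall>e. homogeneous n e (\<lambda>x. coeff (Q x) e))"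
    using homogeneous_coefficients[OF A] by blast
  then obtain Q where Q: "\<And>q x t. q \<in> S \<Longrightarrow> poly (Q q x) t = A q (fscale t x)"
    "\<And>q e. q \<in> S \<Longrightarrow> homogeneous n e (\<lambda>x. coeff (Q q x) e)" by metis
  define C where "C q = (if D < d q then (\<lambda>_. 0) else (\<lambda>x. coeff (Q q x) (D - d q)))" for q
  have "p x = (\<Sum>q\<in>S. C q x * q x)" if x: "x \<in> T" for x
  proof -
    define R where "R = (\<Sum>q\<in>S. smult (q x) (monom 1 (d q) * Q q x))"
    have "R = monom (p x) D"
    proof (rule poly_eq_nonzero)
      fix t :: 'k assume t: "t \<noteq> 0"
      have "poly R t = (\<Sum>q\<in>S. A q (fscale t x) * q (fscale t x))"
        unfolding R_def poly_sum by (intro sum.cong refl) (use q in \<open>simp add: poly_monom Q homogeneous_def mult_ac\<close>)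
      also have "\<dots> = p (fscale t x)" using eq[OF T[OF x t]] by simp
      also have "\<dots> = poly (monom (p x) D) t" using p by (simp add: homogeneous_def poly_monom mult.commute)
      finally show "poly R t = poly (monom (p x) D) t" .
    qed
    then have "p x = coeff R D" by simp
    also have "\<dots> = (\<Sum>q\<in>S. C q x * q x)"
      unfolding R_def coeff_sum by (intro sum.cong refl) (auto simp: C_def coeff_monom_mult)
    finally show ?thesis .
  qed
  moreover have "homogeneous n (D - d q) (C q)" if "q \<in> S" for q
    unfolding C_def using Q(2)[OF that] homogeneous_zero by auto
  ultimately show ?thesis unfolding C_def by (intro exI[of _ C]) (auto simp: C_def)
qed


section \<open>Common zeros of homogeneous polynomials\<close>

text \<open>Polynomials in \<open>n\<close> variables ignore the other coordinates, so a zero can be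
  moved into \<open>coord_space n\<close>.\<close>

definition trunc :: "nat \<Rightarrow> (nat \<Rightarrow> 'k::zero) \<Rightarrow> nat \<Rightarrow> 'k" where
  "trunc n x = (\<lambda>i. if i < n then x i else 0)"

lemma trunc_coord_space: "trunc n x \<in> coord_space n"
  by (auto simp: trunc_def coord_space_def)

lemma polyfun_trunc: "p \<in> polyfun n \<Longrightarrow> p (trunc n x) = p x"
  by (rule polyfun_cong) (auto simp: trunc_def)

lemma fscale_coord_space: "x \<in> coord_space n \<Longrightarrow> fscale t x \<in> coord_space n"
  by (auto simp: coord_space_def fscale_def)

lemma fscale_nonzero: "x \<noteq> 0 \<Longrightarrow> t \<noteq> 0 \<Longrightarrow> fscale t x \<noteq> 0"
  by (auto simp: fscale_def fun_eq_iff)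

text \<open>If the origin were the only zero, all polynomials would be combinations of finitely many
  monomials over the polynomials in the members of \<open>G\<close>. Then about
  \<open>D ^ card G\<close> functions would span the polynomials of a box \<open>D\<close>, against
  \<open>(D + 1) ^ n\<close> independent monomials.\<close>

theorem few_forms_common_zero:
  fixes G :: "((nat \<Rightarrow> 'k::{alg_closed_field, field_char_0}) \<Rightarrow> 'k) set"
  assumes fin: "finite G" and card: "card G < n"
    and G: "\<And>g. g \<in> G \<Longrightarrow> homogeneous n (d g) g \<and> 0 < d g"
  shows "\<exists>x\<in>coord_space n. x \<noteq> 0 \<and> (\<forall>g\<in>G. g x = 0)"
proof (rule ccontr)
  assume no: "\<not> ?thesis"
  have Gp: "G \<subseteq> polyfun n" using G by (auto simp: homogeneous_def)
  have "x i = 0" if "\<forall>q\<in>G. q x = 0" "i < n" for x i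
  proof (rule ccontr)
    assume "x i \<noteq> 0"
    then have "trunc n x \<noteq> 0" using that(2) by (auto simp: trunc_def fun_eq_iff)
    moreover have "\<forall>g\<in>G. g (trunc n x) = 0" using that(1) Gp polyfun_trunc by (metis subsetD)
    ultimately show False using no trunc_coord_space by blast
  qed
  then have "\<exists>E\<ge>1. \<forall>\<alpha>. (\<exists>i<n. \<alpha> i \<ge> E) \<longrightarrow> mon n \<alpha> \<in> gen_ideal n G"
    by (intro projective_nullstellensatz[OF Gp])
  then obtain E where
    E: "E \<ge> 1" "\<And>\<alpha> i. i < n \<Longrightarrow> \<alpha> i \<ge> E \<Longrightarrow> mon n \<alpha> \<in> gen_ideal n G" by blast
  \<comment> \<open>The spanning functions: a monomial with small exponents times a monomial in the
    members of \<open>G\<close>.\<close>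
  define F where "F = (\<lambda>(b, \<beta>) x. mon n b x * (\<Prod>g\<in>G. g x ^ (\<beta> g :: nat)))"
  define I where "I D = ebox n E \<times> (G \<rightarrow>\<^sub>E {..D})" for D :: nat
  have finI: "finite (I D)" for D unfolding I_def using fin by (auto intro: finite_PiE)
  have cardI: "card (I D) = (E + 1) ^ n * (D + 1) ^ card G" for D
    unfolding I_def card_cartesian_product by (subst card_PiE[OF fin]) simp_all
  have main: "p \<in> fvs.span (F ` I D)" if "homogeneous n D p" for p D
    using that
  proof (induction D arbitrary: p rule: less_induct)
    case (less D)
    have "mon n \<alpha> \<in> fvs.span (F ` I D)" if a: "\<alpha> \<in> ebox n D" "hdeg n \<alpha> = D" for \<alpha>
    proof (cases "\<exists>i<n. \<alpha> i \<ge> E")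
      case False
      then have "\<alpha> \<in> ebox n E" using a(1) by (auto simp: ebox_def PiE_def Pi_def not_le less_imp_le)
      then have "(\<alpha>, restrict (\<lambda>_. 0) G) \<in> I D" unfolding I_def by auto
      moreover have "F (\<alpha>, restrict (\<lambda>_. 0) G) = mon n \<alpha>" unfolding F_def by simp
      ultimately show ?thesis by (metis fvs.span_base imageI)
    next
      case True
      then have "mon n \<alpha> \<in> gen_ideal n G" using E(2) by blast
      then obtain S A where S: "finite S" "S \<subseteq> G" "\<And>q. q \<in> S \<Longrightarrow> A q \<in> polyfun n"
        "\<And>x. mon n \<alpha> x = (\<Sum>q\<in>S. A q x * q x)"
    unfolding gen_ideal_def mem_Collect_eq by blast
      have hm: "homogeneous n D (mon n \<alpha>)" using homogeneous_mon[of n \<alpha>] a(2) by simp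
      have "\<exists>C. (\<forall>q\<in>S. homogeneous n (D - d q) (C q) \<and> (D < d q \<longrightarrow> C q = (\<lambda>_. 0))) \<and>
          (\<forall>x\<in>UNIV. mon n \<alpha> x = (\<Sum>q\<in>S. C q x * q x))"
        by (rule homogeneous_combination[OF hm S(1) S(3)]) (use G S in auto)
      then obtain C where C: "\<And>q. q \<in> S \<Longrightarrow> homogeneous n (D - d q) (C q)"
         "\<And>q. q \<in> S \<Longrightarrow> D < d q \<Longrightarrow> C q = (\<lambda>_. 0)" "\<And>x. mon n \<alpha> x = (\<Sum>q\<in>S. C q x * q x)"
        by blast
      have "(\<lambda>x. C q x * q x) \<in> fvs.span (F ` I D)" if q: "q \<in> S" for q
      proof (cases "D < d q")
        case True
        then have "(\<lambda>x. C q x * q x) = 0" using C(2)[OF q] by auto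
        then show ?thesis using fvs.span_zero by simp
      next
        case False
        have qG: "q \<in> G" "0 < d q" using q S(2) G by auto
        then have "C q \<in> fvs.span (F ` I (D - d q))" using False by (intro less.IH C(1) q) auto
        then obtain c where c: "C q = (\<Sum>i\<in>I (D - d q). fscale (c i) (F i))"
          using span_image_finite[OF finI] by blast
        \<comment> \<open>Multiplication by \<open>q\<close> raises one exponent of the second
          monomial; \<open>0 < d q\<close> keeps it within the bound \<open>D\<close>.\<close>
        define up where "up = (\<lambda>(b::nat\<Rightarrow>nat, \<beta>). (b, \<beta>(q := Suc (\<beta> q))))"
        have Fup: "F (up i) x = F i x * q x" for i x
        proof -
          obtain b \<beta> where i: "i = (b, \<beta>)" by fastforce
          have "(\<Prod>g\<in>G - {q}. g x ^ (\<beta>(q := Suc (\<beta> q))) g) = (\<Prod>g\<in>G - {q}. g x ^ \<beta> g)"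
            by (intro prod.cong) auto
          then show ?thesis unfolding i F_def up_def using qG fin by (simp add: prod.remove[of G q] mult_ac)
        qed
        have upI: "up i \<in> I D" if i: "i \<in> I (D - d q)" for i
        proof -
          obtain b \<beta> where b: "i = (b, \<beta>)" "b \<in> ebox n E" "\<beta> \<in> G \<rightarrow>\<^sub>E {..D - d q}"
            using i unfolding I_def by auto
          have "\<beta> g \<le> D - d q" if "g \<in> G" for g using b(3) that by auto
          then have "(\<beta>(q := Suc (\<beta> q))) g \<le> D" if "g \<in> G" for g
            using that qG False by (cases "g = q") (force simp: not_less intro: le_trans)+
          moreover have "(\<beta>(q := Suc (\<beta> q))) g = undefined" if "g \<notin> G" for g
            using b(3) that qG by (auto simp: PiE_def extensional_def)
          ultimately have "\<beta>(q := Suc (\<beta> q)) \<in> G \<rightarrow>\<^sub>E {..D}"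
            by (intro PiE_I) auto
          then show ?thesis using b by (auto simp: I_def up_def)
        qed
        have "(\<lambda>x. C q x * q x) = (\<Sum>i\<in>I (D - d q). fscale (c i) (F (up i)))"
          unfolding c by (simp add: fun_eq_iff sum_fun_apply fscale_def Fup sum_distrib_right mult.assoc)
        also have "\<dots> \<in> fvs.span (F ` I D)"
          by (intro fvs.span_sum fvs.span_scale fvs.span_base) (use upI in auto)
        finally show ?thesis .
      qed
      then have "(\<Sum>q\<in>S. (\<lambda>x. C q x * q x)) \<in> fvs.span (F ` I D)" by (intro fvs.span_sum)
      moreover have "(\<Sum>q\<in>S. (\<lambda>x. C q x * q x)) = mon n \<alpha>"
        by (rule ext) (simp add: C(3) sum_fun_apply)
      ultimately show ?thesis by simp
    qed
    then have "mon n ` {\<alpha> \<in> ebox n D. hdeg n \<alpha> = D} \<subseteq> fvs.span (F ` I D)" by blast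
    then have "fvs.span (mon n ` {\<alpha> \<in> ebox n D. hdeg n \<alpha> = D}) \<subseteq> fvs.span (F ` I D)"
      by (intro fvs.span_minimal fvs.subspace_span)
    then show ?case using homogeneous_span[OF less.prems] by blast
  qed
  \<comment> \<open>Monomials of the box \<open>D\<close> have degree up to \<open>n * D\<close>,
    hence this bound for the exponents in the spanning functions.\<close>
  obtain D where D: "(E + 1) ^ n * (n * D + 1) ^ card G < (D + 1) ^ n"
    using box_count_large[OF card] by blast
  have "\<exists>c. (\<exists>i\<in>ebox n D. c i \<noteq> 0) \<and> (\<forall>x. (\<Sum>i\<in>ebox n D. c i * mon n i x) = (0::'k))"
  proof (rule dependent_family[of _ "F ` I (n * D)"])
    show "card (F ` I (n * D)) < card (ebox n D)"
      using le_less_trans[OF card_image_le[OF finI, of F "n * D"]] D by (simp add: cardI)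
  next
    fix \<alpha> assume a: "\<alpha> \<in> ebox n D"
    have le: "hdeg n \<alpha> \<le> n * D"
      using a sum_bounded_above[of "{..<n}" \<alpha> D] by (auto simp: hdeg_def ebox_def)
    have "F ` I (hdeg n \<alpha>) \<subseteq> F ` I (n * D)"
      unfolding I_def using le by (intro image_mono) (auto simp: PiE_def Pi_def intro: le_trans)
    then show "mon n \<alpha> \<in> fvs.span (F ` I (n * D))"
      using main[OF homogeneous_mon] fvs.span_mono by blast
  qed (use finI in auto)
  then obtain c \<alpha> where c: "\<alpha> \<in> ebox n D" "c \<alpha> \<noteq> (0::'k)" "\<And>x. (\<Sum>i\<in>ebox n D. c i * mon n i x) = 0" by blast
  have "c \<alpha> = 0" by (rule mon_independent[OF c(3) c(1)])
  then show False using c(2) by simp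
qed


section \<open>Regular functions of negative degree\<close>

text \<open>Local fractions on an arbitrary set of vectors, not necessarily open; regularity on the
  spaces of the theorem is translated into this form.\<close>

definition zreg :: "nat \<Rightarrow> (nat \<Rightarrow> 'k::field) set \<Rightarrow> ((nat \<Rightarrow> 'k) \<Rightarrow> 'k) \<Rightarrow> bool" where
  "zreg n U h \<longleftrightarrow> (\<forall>p\<in>U. \<exists>P\<in>polyfun n. \<exists>Q\<in>polyfun n. Q p \<noteq> 0 \<and> (\<forall>x\<in>U. Q x \<noteq> 0 \<longrightarrow> h x = P x / Q x))"

lemma zregE:
  assumes "zreg n U h" "p \<in> U"
  obtains P Q where "P \<in> polyfun n" "Q \<in> polyfun n" "Q p \<noteq> 0" "\<And>x. x \<in> U \<Longrightarrow> Q x \<noteq> 0 \<Longrightarrow> h x = P x / Q x"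
proof -
  have "\<exists>P\<in>polyfun n. \<exists>Q\<in>polyfun n. Q p \<noteq> 0 \<and> (\<forall>x\<in>U. Q x \<noteq> 0 \<longrightarrow> h x = P x / Q x)"
    by (rule bspec[OF assms(1)[unfolded zreg_def] assms(2)])
  then show ?thesis
  proof (elim bexE conjE)
    fix P Q assume "P \<in> polyfun n" "Q \<in> polyfun n" "Q p \<noteq> 0" "\<forall>x\<in>U. Q x \<noteq> 0 \<longrightarrow> h x = P x / Q x"
    then show ?thesis by (intro that[of P Q]) simp_all
  qed
qed

definition cone_zeros :: "nat \<Rightarrow> ((nat \<Rightarrow> 'k::field) \<Rightarrow> 'k) set \<Rightarrow> (nat \<Rightarrow> 'k) set" where
  "cone_zeros n G = {x \<in> coord_space n. x \<noteq> 0 \<and> (\<forall>g\<in>G. g x = 0)}"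

lemma cone_zeros_fscale:
  assumes "\<And>g. g \<in> G \<Longrightarrow> homogeneous n (d g) g" "x \<in> cone_zeros n G" "t \<noteq> 0"
  shows "fscale t x \<in> cone_zeros n G"
proof -
  have "g (fscale t x) = 0" if "g \<in> G" for g
    using assms(1)[OF that] assms(2) that by (simp add: cone_zeros_def homogeneous_def)
  then show ?thesis
    using assms(2,3) fscale_coord_space[of x n t] fscale_nonzero[of x t] by (simp add: cone_zeros_def)
qed

text \<open>\<open>H\<close> behaves like a section of O(-w) over the projective zero set. The forms
  that clear its denominators have no common zero there, so together with \<open>G\<close> they
  generate all monomials of large degree.\<close>

lemma polynomial_multiples_of_twisted_function:
  fixes H :: "(nat \<Rightarrow> 'k::{alg_closed_field, field_char_0}) \<Rightarrow> 'k"
  assumes G: "\<And>g. g \<in> G \<Longrightarrow> homogeneous n (d g) g \<and> 0 < d g"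
    and H: "zreg n (cone_zeros n G) H"
    and tw: "\<And>x t. x \<in> cone_zeros n G \<Longrightarrow> t \<noteq> 0 \<Longrightarrow> H (fscale t x) * t ^ w = H x"
  shows "\<exists>E. \<forall>\<alpha>. E \<le> hdeg n \<alpha> \<longrightarrow>
    (\<exists>h. homogeneous n (hdeg n \<alpha> - w) h \<and> (\<forall>x\<in>cone_zeros n G. H x * mon n \<alpha> x = h x))"
proof -
  let ?T = "cone_zeros n G"
  have Tt: "fscale t x \<in> ?T" if "x \<in> ?T" "t \<noteq> 0" for x t
    by (rule cone_zeros_fscale[OF _ that]) (use G in auto)
  \<comment> \<open>The degrees \<open>e + w\<close> and \<open>e\<close> keep the degree of
    \<open>H * q\<close> a natural number.\<close>
  define Q where "Q = {q. \<exists>e h. homogeneous n (e + w) q \<and> homogeneous n e h \<and> (\<forall>x\<in>?T. H x * q x = h x)}"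
  have sub: "Q \<union> G \<subseteq> polyfun n" unfolding Q_def using G by (auto simp: homogeneous_def)
  have local: "\<exists>q\<in>Q. q p \<noteq> 0" if p: "p \<in> ?T" for p
  proof -
    obtain P0 Q0 where PQ0: "P0 \<in> polyfun n" "Q0 \<in> polyfun n" "Q0 p \<noteq> 0"
      "\<And>x. x \<in> ?T \<Longrightarrow> Q0 x \<noteq> 0 \<Longrightarrow> H x = P0 x / Q0 x" by (rule zregE[OF H p], rule that)
    \<comment> \<open>Multiplying the fraction by \<open>Q0\<close> once more gives the identity
      \<open>H * Q1 = P1\<close> on all of the cone, also at the zeros of \<open>Q0\<close>.\<close>
    define P1 where "P1 x = P0 x * Q0 x" for x
    define Q1 where "Q1 x = Q0 x * Q0 x" for x
    have P1: "P1 \<in> polyfun n" unfolding P1_def[abs_def] by (rule polyfun_mult[OF PQ0(1,2)])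
    have Q1: "Q1 \<in> polyfun n" unfolding Q1_def[abs_def] by (rule polyfun_mult[OF PQ0(2,2)])
    have HQ: "H x * Q1 x = P1 x" if "x \<in> ?T" for x
      using PQ0(4)[OF that] by (cases "Q0 x = 0") (auto simp: P1_def Q1_def)
    obtain RP where RP: "\<And>x t. poly (RP x) t = P1 (fscale t x)" "\<And>e. homogeneous n e (\<lambda>x. coeff (RP x) e)"
      using homogeneous_coefficients[OF P1] by blast
    obtain RQ where RQ: "\<And>x t. poly (RQ x) t = Q1 (fscale t x)" "\<And>e. homogeneous n e (\<lambda>x. coeff (RQ x) e)"
      using homogeneous_coefficients[OF Q1] by blast
    have co: "H x * coeff (RQ x) e = (if w \<le> e then coeff (RP x) (e - w) else 0)" if x: "x \<in> ?T" for x e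
    proof -
      have "smult (H x) (RQ x) = monom 1 w * RP x"
      proof (rule poly_eq_nonzero)
        fix t :: 'k assume t: "t \<noteq> 0"
        have "poly (monom 1 w * RP x) t = t ^ w * (H (fscale t x) * Q1 (fscale t x))"
          using HQ[OF Tt[OF x t]] by (simp add: poly_monom RP)
        also have "\<dots> = (H (fscale t x) * t ^ w) * Q1 (fscale t x)" by (simp add: mult_ac)
        also have "\<dots> = H x * Q1 (fscale t x)" using tw[OF x t] by simp
        finally show "poly (smult (H x) (RQ x)) t = poly (monom 1 w * RP x) t" by (simp add: RQ)
      qed
      then have "coeff (smult (H x) (RQ x)) e = coeff (monom 1 w * RP x) e" by simp
      then show ?thesis by (simp add: coeff_monom_mult)
    qed
    have "poly (RQ p) 1 \<noteq> 0" using PQ0(3) by (simp add: RQ Q1_def fscale_def)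
    then have "RQ p \<noteq> 0" by auto
    then obtain e where e: "coeff (RQ p) e \<noteq> 0" using leading_coeff_neq_0 by blast
    have "p \<noteq> 0" using p by (simp add: cone_zeros_def)
    then obtain i where "p i \<noteq> 0" by (auto simp: fun_eq_iff)
    then have i: "i < n" "p i \<noteq> 0" using p by (auto simp: cone_zeros_def coord_space_def not_less[symmetric])
    \<comment> \<open>A component of \<open>Q1\<close> that is nonzero at \<open>p\<close> can have
      degree less than \<open>w\<close>; the factor \<open>x i ^ w\<close> makes room for the twist.
      In that case \<open>H\<close> times the component is 0 by \<open>co\<close>.\<close>
    define q where "q x = coeff (RQ x) e * x i ^ w" for x
    define h where "h x = (if w \<le> e then coeff (RP x) (e - w) * x i ^ w else 0)" for x
    have xi: "homogeneous n w (\<lambda>x::nat\<Rightarrow>'k. x i ^ w)"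
      unfolding homogeneous_def using i by (auto intro: polyfun_intros simp: fscale_def power_mult_distrib)
    have "homogeneous n (e + w) q" unfolding q_def[abs_def] by (rule homogeneous_mult[OF RQ(2) xi])
    moreover have "homogeneous n e h"
    proof (cases "w \<le> e")
      case True
      then show ?thesis using homogeneous_mult[OF RP(2)[of "e - w"] xi] by (simp add: h_def[abs_def])
    qed (simp add: h_def[abs_def] homogeneous_zero)
    moreover have "H x * q x = h x" if "x \<in> ?T" for x
      using co[OF that, of e] by (simp add: q_def h_def mult.assoc[symmetric])
    ultimately have "q \<in> Q" unfolding Q_def by blast
    moreover have "q p \<noteq> 0" using e i by (simp add: q_def)
    ultimately show ?thesis by blast
  qed
  have van: "x i = 0" if x: "\<forall>q\<in>Q \<union> G. q x = 0" "i < n" for x i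
  proof (rule ccontr)
    assume "x i \<noteq> 0"
    then have "trunc n x \<noteq> 0" using x(2) by (auto simp: trunc_def fun_eq_iff)
    moreover have 0: "q (trunc n x) = 0" if "q \<in> Q \<union> G" for q
      using x(1) polyfun_trunc[of q n x] sub that by auto
    ultimately have "trunc n x \<in> ?T" using trunc_coord_space[of n x] by (auto simp: cone_zeros_def)
    from local[OF this] 0 show False by blast
  qed
  have "\<exists>E\<ge>1. \<forall>\<alpha>. (\<exists>i<n. \<alpha> i \<ge> E) \<longrightarrow> mon n \<alpha> \<in> gen_ideal n (Q \<union> G)"
    using van by (intro projective_nullstellensatz[OF sub])
  then obtain E where E: "\<And>\<alpha> i. i < n \<Longrightarrow> \<alpha> i \<ge> E \<Longrightarrow> mon n \<alpha> \<in> gen_ideal n (Q \<union> G)" by blast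
  have "\<exists>h. homogeneous n (hdeg n \<alpha> - w) h \<and> (\<forall>x\<in>?T. H x * mon n \<alpha> x = h x)"
    if big: "n * E + 1 \<le> hdeg n \<alpha>" for \<alpha>
  proof -
    obtain i where "i < n" "\<alpha> i \<ge> E" using big_degree_exponent[of n E \<alpha>] big by auto
    then have "mon n \<alpha> \<in> gen_ideal n (Q \<union> G)" by (rule E)
    then obtain S A where S: "finite S" "S \<subseteq> Q \<union> G" "\<And>q. q \<in> S \<Longrightarrow> A q \<in> polyfun n"
      "\<And>x. mon n \<alpha> x = (\<Sum>q\<in>S. A q x * q x)" unfolding gen_ideal_def mem_Collect_eq by blast
    have "\<forall>q\<in>Q. \<exists>e h. homogeneous n (e + w) q \<and> homogeneous n e h \<and> (\<forall>x\<in>?T. H x * q x = h x)"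
      unfolding Q_def by blast
    then obtain e h where eh: "\<And>q. q \<in> Q \<Longrightarrow> homogeneous n (e q + w) q"
      "\<And>q. q \<in> Q \<Longrightarrow> homogeneous n (e q) (h q)" "\<And>q x. q \<in> Q \<Longrightarrow> x \<in> ?T \<Longrightarrow> H x * q x = h q x"
      by metis
    have eq: "mon n \<alpha> x = (\<Sum>q\<in>S \<inter> Q. A q x * q x)" if "x \<in> ?T" for x
      unfolding S(4) using S(1,2) that by (intro sum.mono_neutral_right) (auto simp: cone_zeros_def)
    have "\<exists>C. (\<forall>q\<in>S \<inter> Q. homogeneous n (hdeg n \<alpha> - (e q + w)) (C q) \<and> (hdeg n \<alpha> < e q + w \<longrightarrow> C q = (\<lambda>_. 0))) \<and>
      (\<forall>x\<in>?T. mon n \<alpha> x = (\<Sum>q\<in>S \<inter> Q. C q x * q x))"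
      by (rule homogeneous_combination[OF homogeneous_mon]) (use S eh Tt eq in auto)
    then obtain C where C: "\<And>q. q \<in> S \<Longrightarrow> q \<in> Q \<Longrightarrow> homogeneous n (hdeg n \<alpha> - (e q + w)) (C q)"
      "\<And>q. q \<in> S \<Longrightarrow> q \<in> Q \<Longrightarrow> hdeg n \<alpha> < e q + w \<Longrightarrow> C q = (\<lambda>_. 0)"
      "\<And>x. x \<in> ?T \<Longrightarrow> mon n \<alpha> x = (\<Sum>q\<in>S \<inter> Q. C q x * q x)" by blast
    have "homogeneous n (hdeg n \<alpha> - w) (\<lambda>x. \<Sum>q\<in>S \<inter> Q. C q x * h q x)"
    proof (rule homogeneous_sum)
      fix q assume q: "q \<in> S \<inter> Q"
      show "homogeneous n (hdeg n \<alpha> - w) (\<lambda>x. C q x * h q x)"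
      proof (cases "hdeg n \<alpha> < e q + w")
        case True
        then show ?thesis using C(2)[of q] q by (simp add: homogeneous_zero)
      next
        case False
        then have "hdeg n \<alpha> - w = (hdeg n \<alpha> - (e q + w)) + e q" by simp
        then show ?thesis using homogeneous_mult[OF C(1) eh(2), of q q] q by simp
      qed
    qed
    moreover have "H x * mon n \<alpha> x = (\<Sum>q\<in>S \<inter> Q. C q x * h q x)" if x: "x \<in> ?T" for x
      unfolding C(3)[OF x] sum_distrib_left
      by (intro sum.cong refl) (use eh(3)[OF _ x] in \<open>simp add: mult.left_commute\<close>)
    ultimately show ?thesis by blast
  qed
  then show ?thesis by blast
qed

lemma finite_nth_roots_in:
  fixes F :: "'k::field_char_0 set"
  assumes "finite F" "0 < w" shows "finite {z. z ^ w \<in> F}"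
proof -
  have "finite {z. z ^ w = y}" for y :: 'k
  proof -
    have "monom 1 w - [:y:] \<noteq> 0"
    proof
      assume "monom 1 w - [:y:] = 0"
      then have "coeff (monom 1 w - [:y:]) w = 0" by simp
      then show False using assms(2) by (simp add: coeff_pCons split: nat.splits)
    qed
    then have "finite {z. poly (monom 1 w - [:y:]) z = 0}" by (rule poly_roots_finite)
    then show ?thesis by (simp add: poly_monom)
  qed
  then have "finite (\<Union>y\<in>F. {z. z ^ w = y})" using assms(1) by simp
  moreover have "{z. z ^ w \<in> F} = (\<Union>y\<in>F. {z. z ^ w = y})" by blast
  ultimately show ?thesis by simp
qed

lemma twisted_function_finite_level:
  fixes H :: "(nat \<Rightarrow> 'k::{alg_closed_field, field_char_0}) \<Rightarrow> 'k"
  assumes G: "\<And>g. g \<in> G \<Longrightarrow> homogeneous n (d g) g \<and> 0 < d g"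
    and H: "zreg n (cone_zeros n G) H" and w: "0 < w"
    and tw: "\<And>x t. x \<in> cone_zeros n G \<Longrightarrow> t \<noteq> 0 \<Longrightarrow> H (fscale t x) * t ^ w = H x"
  shows "finite {x \<in> cone_zeros n G. H x = 1}"
proof -
  let ?T = "cone_zeros n G"
  obtain E where E: "\<And>\<alpha>. E \<le> hdeg n \<alpha> \<Longrightarrow>
    \<exists>h. homogeneous n (hdeg n \<alpha> - w) h \<and> (\<forall>x\<in>?T. H x * mon n \<alpha> x = h x)"
    using polynomial_multiples_of_twisted_function[OF G H tw] by blast
  define B where "B = {\<alpha> \<in> ebox n E. hdeg n \<alpha> = E}"
  have finB: "finite B" unfolding B_def by simp
  \<comment> \<open>Relations are sought on the cone only, so its forms are continued by 0 to all
    vectors.\<close>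
  define f where "f \<alpha> x = (if x \<in> ?T then mon n \<alpha> x else 0)" for \<alpha> and x :: "nat \<Rightarrow> 'k"
  define V where "V = fvs.span (f ` B)"
  have VI: "(\<lambda>x. if x \<in> ?T then q x else 0) \<in> V" if hq: "homogeneous n E q" for q
  proof -
    obtain c where c: "q = (\<Sum>\<alpha>\<in>B. fscale (c \<alpha>) (mon n \<alpha>))"
      using span_image_finite[OF finB] homogeneous_span[OF hq] unfolding B_def by blast
    have "(\<lambda>x. if x \<in> ?T then q x else 0) = (\<Sum>\<alpha>\<in>B. fscale (c \<alpha>) (f \<alpha>))"
      unfolding c by (auto simp: fun_eq_iff sum_fun_apply fscale_def f_def)
    also have "\<dots> \<in> V" unfolding V_def by (intro fvs.span_sum fvs.span_scale fvs.span_base) auto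
    finally show ?thesis .
  qed
  have stab: "(\<lambda>x. (H x * x j ^ w) * v x) \<in> V" if v: "v \<in> V" and j: "j < n" for v j
  proof -
    have fa: "(\<lambda>x. (H x * x j ^ w) * f \<alpha> x) \<in> V" if a: "\<alpha> \<in> B" for \<alpha>
    proof -
      let ?\<beta> = "\<alpha>(j := \<alpha> j + w)"
      have jn: "j \<in> {..<n}" using j by simp
      have "hdeg n ?\<beta> = hdeg n \<alpha> + w"
      proof -
        have "(\<Sum>i\<in>{..<n} - {j}. ?\<beta> i) = (\<Sum>i\<in>{..<n} - {j}. \<alpha> i)" by (intro sum.cong) auto
        then show ?thesis unfolding hdeg_def by (simp add: sum.remove[OF _ jn])
      qed
      then have deg: "hdeg n ?\<beta> = E + w" using a by (simp add: B_def)
      have m: "mon n ?\<beta> x = x j ^ w * mon n \<alpha> x" for x :: "nat \<Rightarrow> 'k"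
      proof -
        have "(\<Prod>i\<in>{..<n} - {j}. x i ^ ?\<beta> i) = (\<Prod>i\<in>{..<n} - {j}. x i ^ \<alpha> i)" by (intro prod.cong) auto
        then show ?thesis unfolding mon_def by (simp add: prod.remove[OF _ jn] power_add mult_ac)
      qed
      obtain h where h: "homogeneous n E h" "\<And>x. x \<in> ?T \<Longrightarrow> H x * mon n ?\<beta> x = h x"
        using E[of ?\<beta>] deg by auto
      have "(\<lambda>x. (H x * x j ^ w) * f \<alpha> x) = (\<lambda>x. if x \<in> ?T then h x else 0)"
        using h(2) by (auto simp: f_def m fun_eq_iff mult.assoc)
      then show ?thesis using VI[OF h(1)] by simp
    qed
    obtain c where c: "v = (\<Sum>\<alpha>\<in>B. fscale (c \<alpha>) (f \<alpha>))"
      using span_image_finite[OF finB] v unfolding V_def by blast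
    have "(\<lambda>x. (H x * x j ^ w) * v x) = (\<Sum>\<alpha>\<in>B. fscale (c \<alpha>) (\<lambda>x. (H x * x j ^ w) * f \<alpha> x))"
      unfolding c by (auto simp: fun_eq_iff sum_fun_apply fscale_def sum_distrib_left algebra_simps)
    also have "\<dots> \<in> V" using fa unfolding V_def by (intro fvs.span_sum fvs.span_scale) auto
    finally show ?thesis .
  qed
  \<comment> \<open>The \<open>card B + 1\<close> iterates of one monomial lie in a space spanned by
    at most \<open>card B\<close> functions. Their dependence is a polynomial equation for the
    values of \<open>H x * x j ^ w\<close> wherever that monomial is nonzero.\<close>
  have "\<exists>\<psi>. \<psi> \<noteq> 0 \<and> (\<forall>x\<in>?T. poly \<psi> (H x * x j ^ w) * mon n \<alpha> x = 0)"
    if j: "j < n" and a: "\<alpha> \<in> B" for j \<alpha>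
  proof -
    define p where "p i x = (H x * x j ^ w) ^ i * f \<alpha> x" for i x
    have pV: "p i \<in> V" for i
    proof (induction i)
      case 0
      show ?case unfolding p_def V_def using a by (auto intro: fvs.span_base)
    next
      case (Suc i)
      from stab[OF this j] show ?case by (simp add: p_def[abs_def] mult.assoc)
    qed
    have "\<exists>c. (\<exists>i\<in>{..card B}. c i \<noteq> 0) \<and> (\<forall>x. (\<Sum>i\<in>{..card B}. c i * p i x) = 0)"
    proof (rule dependent_family[of _ "f ` B"])
      show "card (f ` B) < card {..card B}" using card_image_le[OF finB, of f] by simp
    qed (use pV finB V_def in auto)
    then obtain c i where c: "i \<le> card B" "c i \<noteq> 0" "\<And>x. (\<Sum>i\<le>card B. c i * p i x) = 0" by auto
    define \<psi> where "\<psi> = (\<Sum>i\<le>card B. monom (c i) i)"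
    have "coeff \<psi> i = c i" using c(1) by (simp add: \<psi>_def coeff_sum sum.delta)
    then have "\<psi> \<noteq> 0" using c(2) by auto
    moreover have "poly \<psi> (H x * x j ^ w) * mon n \<alpha> x = 0" if "x \<in> ?T" for x
      using c(3)[of x] that by (simp add: \<psi>_def poly_sum poly_monom p_def f_def sum_distrib_right mult.assoc)
    ultimately show ?thesis by blast
  qed
  then obtain \<psi> where \<psi>: "\<And>j \<alpha>. j < n \<Longrightarrow> \<alpha> \<in> B \<Longrightarrow> \<psi> j \<alpha> \<noteq> 0"
    "\<And>j \<alpha> x. j < n \<Longrightarrow> \<alpha> \<in> B \<Longrightarrow> x \<in> ?T \<Longrightarrow> poly (\<psi> j \<alpha>) (H x * x j ^ w) * mon n \<alpha> x = 0"
    by metis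
  define F where "F j = (\<Union>\<alpha>\<in>B. {z. poly (\<psi> j \<alpha>) z = 0})" for j
  have finF: "finite (F j)" if "j < n" for j
    unfolding F_def using finB \<psi>(1)[OF that] by (auto intro: poly_roots_finite)
  have HF: "H x * x j ^ w \<in> F j" if x: "x \<in> ?T" and j: "j < n" for x j
  proof -
    obtain i where i: "i < n" "x i \<noteq> 0"
      using x by (auto simp: cone_zeros_def coord_space_def fun_eq_iff) (metis not_less)
    \<comment> \<open>The pure power of a coordinate that does not vanish at
      \<open>x\<close>.\<close>
    define \<alpha> where "\<alpha> = (\<lambda>l\<in>{..<n}. if l = i then E else 0)"
    have "\<alpha> \<in> B" using i by (auto simp: B_def ebox_def \<alpha>_def hdeg_def sum.delta)
    moreover have "mon n \<alpha> x \<noteq> 0" using i by (auto simp: mon_def \<alpha>_def split: if_splits)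
    ultimately show ?thesis using \<psi>(2)[OF j _ x, of \<alpha>] unfolding F_def by auto
  qed
  \<comment> \<open>Where \<open>H x = 1\<close>, the finitely many values of
    \<open>H x * x j ^ w\<close> are those of \<open>x j ^ w\<close>, so every coordinate has
    finitely many values.\<close>
  have "{x \<in> ?T. H x = 1} \<subseteq> trunc n ` (PiE {..<n} (\<lambda>j. {z. z ^ w \<in> F j}))"
  proof
    fix x assume x: "x \<in> {x \<in> ?T. H x = 1}"
    have "x = trunc n (restrict x {..<n})"
      using x by (auto simp: trunc_def cone_zeros_def coord_space_def fun_eq_iff)
    moreover have "restrict x {..<n} \<in> PiE {..<n} (\<lambda>j. {z. z ^ w \<in> F j})" using HF[of x] x by auto
    ultimately show "x \<in> trunc n ` (PiE {..<n} (\<lambda>j. {z. z ^ w \<in> F j}))" by (rule image_eqI)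
  qed
  moreover have "finite (PiE {..<n} (\<lambda>j. {z. z ^ w \<in> F j}))"
    by (intro finite_PiE finite_nth_roots_in finF w) auto
  ultimately show ?thesis using finite_subset by blast
qed

text \<open>\<open>H\<close> may change with the point. Where a single \<open>H\<close> is nonzero,
  each line contains a point of the finite set \<open>H x = 1\<close>. Finitely many such loci cover
  the cone, which therefore consists of finitely many lines, and a linear form can miss them
  all.\<close>

theorem no_negative_degree_functions:
  fixes G :: "((nat \<Rightarrow> 'k::{alg_closed_field, field_char_0}) \<Rightarrow> 'k) set"
  assumes fin: "finite G" and card: "card G + 1 < n"
    and G: "\<And>g. g \<in> G \<Longrightarrow> homogeneous n (d g) g \<and> 0 < d g"
    and ex: "\<And>p. p \<in> cone_zeros n G \<Longrightarrow> \<exists>w H. 0 < w \<and> zreg n (cone_zeros n G) H \<and>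
      (\<forall>x\<in>cone_zeros n G. \<forall>t. t \<noteq> 0 \<longrightarrow> H (fscale t x) * t ^ w = H x) \<and> H p \<noteq> 0"
  shows False
proof -
  let ?T = "cone_zeros n G"
  have Gp: "G \<subseteq> polyfun n" using G by (auto simp: homogeneous_def)
  have Tt: "fscale t x \<in> ?T" if "x \<in> ?T" "t \<noteq> 0" for x t
    by (rule cone_zeros_fscale[OF _ that]) (use G in auto)
  \<comment> \<open>The open set where the function \<open>H\<close> belonging to \<open>p\<close>
    is nonzero is replaced by the nonvanishing locus of a polynomial \<open>q\<close>, to which the
    Nullstellensatz applies; \<open>F\<close> meets every line of this locus.\<close>
  define W where "W p q F \<longleftrightarrow> q \<in> polyfun n \<and> q p \<noteq> 0 \<and> finite F \<and>
      (\<forall>x\<in>?T. q x \<noteq> 0 \<longrightarrow> (\<exists>t. t \<noteq> 0 \<and> fscale t x \<in> F))" for p q F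
  have "\<exists>q F. W p q F" if p: "p \<in> ?T" for p
  proof -
    obtain w H where H: "0 < w" "zreg n ?T H" "\<And>x t. x \<in> ?T \<Longrightarrow> t \<noteq> 0 \<Longrightarrow> H (fscale t x) * t ^ w = H x" "H p \<noteq> 0"
      using ex[OF p] by blast
    obtain E where E: "\<And>\<alpha>. E \<le> hdeg n \<alpha> \<Longrightarrow>
      \<exists>h. homogeneous n (hdeg n \<alpha> - w) h \<and> (\<forall>x\<in>?T. H x * mon n \<alpha> x = h x)"
      using polynomial_multiples_of_twisted_function[OF G H(2,3)] by blast
    obtain i where i: "i < n" "p i \<noteq> 0"
      using p by (auto simp: cone_zeros_def coord_space_def fun_eq_iff) (metis not_less)
    define \<alpha> where "\<alpha> = (\<lambda>l. if l = i then E else 0)"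
    have "hdeg n \<alpha> = E" using i by (simp add: \<alpha>_def hdeg_def sum.delta)
    then obtain h where h: "homogeneous n (E - w) h" "\<And>x. x \<in> ?T \<Longrightarrow> H x * mon n \<alpha> x = h x" using E[of \<alpha>] by auto
    have hp: "h p \<noteq> 0" using h(2)[OF p] H(4) i by (auto simp: mon_def \<alpha>_def split: if_splits)
    have "\<exists>t. t \<noteq> 0 \<and> fscale t x \<in> {x \<in> ?T. H x = 1}" if x: "x \<in> ?T" "h x \<noteq> 0" for x
    proof -
      have Hx: "H x \<noteq> 0" using h(2)[OF x(1)] x(2) by auto
      \<comment> \<open>Scaling by a \<open>w\<close>-th root of \<open>H x\<close> normalises the
        value of \<open>H\<close> to 1.\<close>
      obtain t where t: "t ^ w = H x" using nth_root_exists[of w "H x"] H(1) by blast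
      have "t \<noteq> 0" using t Hx H(1) by (auto simp: power_0_left)
      moreover have "H (fscale t x) = 1" using H(3)[OF x(1) \<open>t \<noteq> 0\<close>] t Hx by simp
      ultimately show ?thesis using Tt[OF x(1)] by blast
    qed
    moreover have "finite {x \<in> ?T. H x = 1}" by (rule twisted_function_finite_level[OF G H(2,1,3)])
    moreover have "h \<in> polyfun n" using h(1) by (simp add: homogeneous_def)
    ultimately have "W p h {x \<in> ?T. H x = 1}" unfolding W_def using hp by blast
    then show ?thesis by blast
  qed
  then obtain q F where W: "\<And>p. p \<in> ?T \<Longrightarrow> W p (q p) (F p)" by metis
  have qF: "\<And>p. p \<in> ?T \<Longrightarrow> q p \<in> polyfun n" "\<And>p. p \<in> ?T \<Longrightarrow> q p p \<noteq> 0"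
    "\<And>p. p \<in> ?T \<Longrightarrow> finite (F p)"
    "\<And>p x. p \<in> ?T \<Longrightarrow> x \<in> ?T \<Longrightarrow> q p x \<noteq> 0 \<Longrightarrow> \<exists>t. t \<noteq> 0 \<and> fscale t x \<in> F p"
    using W unfolding W_def by simp_all
  have sub: "q ` ?T \<union> G \<subseteq> polyfun n" using qF(1) Gp by auto
  have van: "x i = 0" if x: "\<forall>r\<in>q ` ?T \<union> G. r x = 0" "i < n" for x i
  proof (rule ccontr)
    assume "x i \<noteq> 0"
    then have "trunc n x \<noteq> 0" using x(2) by (auto simp: trunc_def fun_eq_iff)
    moreover have 0: "r (trunc n x) = 0" if "r \<in> q ` ?T \<union> G" for r
      using x(1) polyfun_trunc[of r n x] sub that by auto
    ultimately have "trunc n x \<in> ?T" using trunc_coord_space[of n x] by (auto simp: cone_zeros_def)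
    then show False using qF(2) 0[of "q (trunc n x)"] by auto
  qed
  have "\<exists>E\<ge>1. \<forall>\<alpha>. (\<exists>i<n. \<alpha> i \<ge> E) \<longrightarrow> mon n \<alpha> \<in> gen_ideal n (q ` ?T \<union> G)"
    using van by (intro projective_nullstellensatz[OF sub])
  then obtain E where E: "E \<ge> 1" "\<And>\<alpha> i. i < n \<Longrightarrow> \<alpha> i \<ge> E \<Longrightarrow> mon n \<alpha> \<in> gen_ideal n (q ` ?T \<union> G)" by blast
  \<comment> \<open>Quasi-compactness: a power of the coordinate \<open>i\<close> is a combination
    of finitely many members, one of which is nonzero wherever that coordinate is.\<close>
  have "\<exists>S. finite S \<and> S \<subseteq> q ` ?T \<union> G \<and> (\<forall>x. x i \<noteq> 0 \<longrightarrow> (\<exists>r\<in>S. r x \<noteq> 0))" if i: "i < n" for i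
  proof -
    have "mon n (\<lambda>l. if l = i then E else 0) \<in> gen_ideal n (q ` ?T \<union> G)" by (rule E(2)[OF i]) simp
    then obtain S A where S: "finite S" "S \<subseteq> q ` ?T \<union> G"
      "\<And>x. mon n (\<lambda>l. if l = i then E else 0) x = (\<Sum>r\<in>S. A r x * r x)" unfolding gen_ideal_def mem_Collect_eq by blast
    have "\<exists>r\<in>S. r x \<noteq> 0" if "x i \<noteq> 0" for x
    proof (rule ccontr)
      assume "\<not> ?thesis"
      then have "mon n (\<lambda>l. if l = i then E else 0) x = 0" unfolding S(3) by (intro sum.neutral) auto
      then show False using that by (auto simp: mon_def split: if_splits)
    qed
    then show ?thesis using S by blast
  qed
  then obtain S where S: "\<And>i. i < n \<Longrightarrow> finite (S i)" "\<And>i. i < n \<Longrightarrow> S i \<subseteq> q ` ?T \<union> G"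
    "\<And>i x. i < n \<Longrightarrow> x i \<noteq> 0 \<Longrightarrow> \<exists>r\<in>S i. r x \<noteq> 0" by metis
  \<comment> \<open>Members of \<open>G\<close> vanish on the cone and cannot contribute to a
    covering of it.\<close>
  define R where "R = (\<Union>i<n. S i) - G"
  have "finite R" unfolding R_def using S(1) by auto
  moreover have "R \<subseteq> q ` ?T" unfolding R_def using S(2) by blast
  ultimately obtain P where P: "finite P" "P \<subseteq> ?T" "R = q ` P" using finite_subset_image by metis
  define L where "L = (\<Union>p\<in>P. F p)"
  have finL: "finite L" unfolding L_def using P qF(3) by auto
  have cover: "\<exists>t. t \<noteq> 0 \<and> fscale t x \<in> L" if x: "x \<in> ?T" for x
  proof -
    obtain i where i: "i < n" "x i \<noteq> 0"
      using x by (auto simp: cone_zeros_def coord_space_def fun_eq_iff) (metis not_less)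
    then obtain r where r: "r \<in> S i" "r x \<noteq> 0" using S(3) by blast
    have "r \<notin> G" using r(2) x by (auto simp: cone_zeros_def)
    then have "r \<in> R" unfolding R_def using r(1) i(1) by blast
    then obtain p where "p \<in> P" "r = q p" using P(3) by blast
    then show ?thesis using qF(4)[of p x] x r(2) P(2) unfolding L_def by blast
  qed
  define l where "l f c = (\<Sum>i<n. c i * f i)" for f c :: "nat \<Rightarrow> 'k"
  \<comment> \<open>\<open>l f c\<close> is polynomial in the coefficients \<open>c\<close> of the
    linear form, so some form is nonzero at all of the finitely many representatives.\<close>
  have "\<exists>c. \<forall>f\<in>L \<inter> ?T. l f c \<noteq> 0"
  proof (rule polyfun_nonzero_prod)
    fix f assume f: "f \<in> L \<inter> ?T"
    show "l f \<in> polyfun n" unfolding l_def[abs_def] by (intro polyfun_intros) auto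
    obtain i where i: "i < n" "f i \<noteq> 0"
      using f by (auto simp: cone_zeros_def coord_space_def fun_eq_iff) (metis not_less)
    show "\<exists>x. l f x \<noteq> 0"
      by (rule exI[of _ "\<lambda>j. if j = i then 1 else 0"])
         (use i in \<open>simp add: l_def if_distrib[of "\<lambda>z. z * _"] sum.delta cong: if_cong\<close>)
  qed (use finL in auto)
  then obtain c where c: "\<And>f. f \<in> L \<Longrightarrow> f \<in> ?T \<Longrightarrow> l f c \<noteq> 0" by blast
  define lc where "lc x = l x c" for x
  have lc: "homogeneous n 1 lc" unfolding homogeneous_def lc_def[abs_def] l_def
    by (auto intro!: polyfun_intros simp: fscale_def sum_distrib_left mult.left_commute)
  define d' where "d' g = (if g \<in> G then d g else 1)" for g
  have "\<exists>x\<in>coord_space n. x \<noteq> 0 \<and> (\<forall>g\<in>insert lc G. g x = 0)"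
  proof (rule few_forms_common_zero[of _ _ d'])
    show "card (insert lc G) < n" using card_insert_le_m1[of "Suc (card G)" G lc] card fin by (simp add: card_insert_if)
    show "homogeneous n (d' g) g \<and> 0 < d' g" if "g \<in> insert lc G" for g
      using that G lc unfolding d'_def by auto
  qed (use fin in auto)
  then obtain x where x: "x \<in> ?T" "lc x = 0" unfolding cone_zeros_def by blast
  obtain t where t: "t \<noteq> 0" "fscale t x \<in> L" using cover[OF x(1)] by blast
  have "lc (fscale t x) = 0" using lc x(2) by (simp add: homogeneous_def)
  then show False using c[OF t(2) Tt[OF x(1) t(1)]] by (simp add: lc_def)
qed


section \<open>Determinants\<close>

text \<open>The Leibniz formula with the size as an ordinary argument, since minors of several
  sizes, among them 0, occur side by side.\<close>

definition ldet :: "nat \<Rightarrow> (nat \<Rightarrow> nat \<Rightarrow> 'k::field_char_0) \<Rightarrow> 'k" where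
  "ldet d m = (\<Sum>p | p permutes {..<d}. of_int (sign p) * (\<Prod>i<d. m i (p i)))"

lemma ldet_cong:
  assumes "\<And>i j. i < d \<Longrightarrow> j < d \<Longrightarrow> m i j = m' i j" shows "ldet d m = ldet d m'"
  unfolding ldet_def
proof (intro sum.cong refl, clarify)
  fix p :: "nat \<Rightarrow> nat" assume p: "p permutes {..<d}"
  have "m i (p i) = m' i (p i)" if "i < d" for i
    using assms[OF that] permutes_in_image[OF p, of i] that by auto
  then show "of_int (sign p) * (\<Prod>i<d. m i (p i)) = of_int (sign p) * (\<Prod>i<d. m' i (p i))" by simp
qed

lemma ldet_row_linear:
  assumes "i < d"
  shows "ldet d (m(i := \<lambda>b. c * r b + s b)) = c * ldet d (m(i := r)) + ldet d (m(i := s))"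
proof -
  have i: "i \<in> {..<d}" using assms by simp
  have *: "(\<Prod>l<d. (m(i := t)) l (p l)) = t (p i) * (\<Prod>l\<in>{..<d} - {i}. m l (p l))" for t p
  proof -
    have "(\<Prod>l\<in>{..<d} - {i}. (m(i := t)) l (p l)) = (\<Prod>l\<in>{..<d} - {i}. m l (p l))" by (intro prod.cong) auto
    then show ?thesis by (simp add: prod.remove[OF _ i])
  qed
  show ?thesis unfolding ldet_def * by (simp add: sum_distrib_left sum.distrib algebra_simps)
qed

lemma ldet_row_zero:
  assumes "i < d" shows "ldet d (m(i := \<lambda>_. 0)) = 0"
  using ldet_row_linear[OF assms, of m 1 "\<lambda>_. 0" "\<lambda>_. 0"] by simp

lemma ldet_row_sum:
  assumes "i < d" "finite S"
  shows "ldet d (m(i := \<lambda>b. \<Sum>s\<in>S. c s * r s b)) = (\<Sum>s\<in>S. c s * ldet d (m(i := r s)))"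
  using assms(2)
proof (induction S rule: finite_induct)
  case empty
  show ?case by (simp only: sum.empty ldet_row_zero[OF assms(1)])
next
  case (insert s S)
  show ?case
    using ldet_row_linear[OF assms(1), of m "c s" "r s" "\<lambda>b. \<Sum>s\<in>S. c s * r s b"]
    by (simp only: sum.insert[OF insert.hyps] insert.IH)
qed

text \<open>Composing with the transposition shows that the determinant equals its negative, which
  suffices in characteristic zero.\<close>

lemma ldet_equal_rows:
  assumes ij: "i < d" "j < d" "i \<noteq> j" "\<And>b. b < d \<Longrightarrow> m i b = m j b"
  shows "ldet d m = 0"
proof -
  let ?t = "Transposition.transpose i j"
  let ?P = "{p. p permutes {..<d}}"
  have t: "?t permutes {..<d}" using ij by (intro permutes_swap_id) auto
  have "ldet d m = (\<Sum>p\<in>?P. of_int (sign (p \<circ> ?t)) * (\<Prod>l<d. m l ((p \<circ> ?t) l)))"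
    unfolding ldet_def
    by (rule sum.reindex_bij_witness[of _ "\<lambda>p. p \<circ> ?t" "\<lambda>p. p \<circ> ?t"])
       (auto simp: o_assoc[symmetric] intro: permutes_compose t)
  also have "\<dots> = (\<Sum>p\<in>?P. - (of_int (sign p) * (\<Prod>l<d. m l (p l))))"
  proof (intro sum.cong refl, clarify)
    fix p assume p: "p permutes {..<d}"
    have fin: "permutation p" using p by (auto intro: permutation_permutes[THEN iffD2])
    have s: "sign (p \<circ> ?t) = - sign p"
      using ij by (simp add: sign_compose[OF fin permutation_swap_id] sign_swap_id)
    have "(\<Prod>l<d. m l ((p \<circ> ?t) l)) = (\<Prod>l<d. m (?t l) ((p \<circ> ?t) (?t l)))"
      using prod.permute[OF t, of "\<lambda>l. m l ((p \<circ> ?t) l)"] by (simp add: o_def)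
    also have "\<dots> = (\<Prod>l<d. m l (p l))"
    proof (rule prod.cong[OF refl])
      fix l assume l: "l \<in> {..<d}"
      have "p l < d" using permutes_in_image[OF p, of l] l by simp
      then have "m (?t l) (p l) = m l (p l)" using ij(4)[of "p l"] by (auto simp: Transposition.transpose_def)
      then show "m (?t l) ((p \<circ> ?t) (?t l)) = m l (p l)" by simp
    qed
    finally show "of_int (sign (p \<circ> ?t)) * (\<Prod>l<d. m l ((p \<circ> ?t) l)) = - (of_int (sign p) * (\<Prod>l<d. m l (p l)))"
      by (simp add: s)
  qed
  also have "\<dots> = - ldet d m" unfolding ldet_def by (rule sum_negf)
  finally show ?thesis by (metis add.inverse_neutral eq_neg_iff_add_eq_0 mult_2 mult_eq_0_iff zero_neq_numeral)
qed

lemma ldet_dependent_row: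
  assumes "i < d" "\<And>b. b < d \<Longrightarrow> m i b = (\<Sum>s\<in>{..<d} - {i}. c s * m s b)"
  shows "ldet d m = 0"
proof -
  have "ldet d m = ldet d (m(i := \<lambda>b. \<Sum>s\<in>{..<d} - {i}. c s * m s b))"
    by (rule ldet_cong) (use assms in auto)
  also have "\<dots> = (\<Sum>s\<in>{..<d} - {i}. c s * ldet d (m(i := m s)))" by (rule ldet_row_sum[OF assms(1)]) simp
  also have "\<dots> = 0"
  proof (intro sum.neutral ballI)
    fix s assume "s \<in> {..<d} - {i}"
    then have "ldet d (m(i := m s)) = 0" using assms(1) by (intro ldet_equal_rows[of i d s]) auto
    then show "c s * ldet d (m(i := m s)) = 0" by simp
  qed
  finally show ?thesis .
qed

lemma ldet_identity: "ldet d (\<lambda>i j. if i = j then 1 else 0) = 1"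
proof -
  have "ldet d (\<lambda>i j. if i = j then 1 else 0) =
      (\<Sum>p\<in>{id}. of_int (sign p) * (\<Prod>i<d. (if i = p i then 1 else (0::'a))))"
    unfolding ldet_def
  proof (rule sum.mono_neutral_right)
    show "\<forall>p\<in>{p. p permutes {..<d}} - {id}. of_int (sign p) * (\<Prod>i<d. if i = p i then 1 else (0::'a)) = 0"
    proof
      fix p assume p: "p \<in> {p. p permutes {..<d}} - {id}"
      have "\<exists>i<d. p i \<noteq> i"
      proof (rule ccontr)
        assume "\<not> ?thesis"
        then have "p i = i" for i using p permutes_not_in[of p "{..<d}" i] by (cases "i < d") auto
        then show False using p by auto
      qed
      then obtain i where "i < d" "i \<noteq> p i" by metis
      then have "(\<Prod>i<d. if i = p i then 1 else (0::'a)) = 0" by (intro prod_zero) auto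
      then show "of_int (sign p) * (\<Prod>i<d. if i = p i then 1 else (0::'a)) = 0" by simp
    qed
  qed (auto simp: finite_permutations permutes_id)
  then show ?thesis by (simp add: sign_id)
qed


section \<open>Directional derivatives of polynomials\<close>

text \<open>The directional derivative. Polynomials are given as functions, so it is read off as the
  linear coefficient along a line; it is meaningful for polynomial \<open>p\<close> only.\<close>

definition dird :: "((nat \<Rightarrow> 'k) \<Rightarrow> 'k) \<Rightarrow> (nat \<Rightarrow> 'k) \<Rightarrow> (nat \<Rightarrow> 'k::field_char_0) \<Rightarrow> 'k" where
  "dird p x v = coeff (THE c. \<forall>t. p (\<lambda>i. x i + t * v i) = poly c t) 1"

lemma dird_eq:
  assumes "\<And>t. p (\<lambda>i. x i + t * v i) = poly c t" shows "dird p x v = coeff c 1"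
proof -
  have "(THE c. \<forall>t. p (\<lambda>i. x i + t * v i) = poly c t) = c"
    by (rule the_equality) (use assms poly_eq_all in auto)
  then show ?thesis by (simp add: dird_def)
qed

lemma polyfun_on_line:
  assumes "p \<in> polyfun n" obtains c where "\<And>t. p (\<lambda>i. x i + t * v i) = poly c (t::'k::field_char_0)"
  using polyfun_on_curve[OF assms, of "\<lambda>i. [:x i, v i:]"] by (auto simp: mult.commute)

lemma dird_const: "dird (\<lambda>_. a) x v = 0"
  using dird_eq[of "\<lambda>_. a" x v "[:a:]"] by simp

lemma dird_var: "dird (\<lambda>x. x i) x v = v i"
  using dird_eq[of "\<lambda>x. x i" x v "[:x i, v i:]"] by (simp add: mult.commute)

lemma dird_add:
  assumes "p \<in> polyfun n" "q \<in> polyfun n"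
  shows "dird (\<lambda>x. p x + q x) x v = dird p x v + dird q x v"
proof -
  obtain c where c: "\<And>t. p (\<lambda>i. x i + t * v i) = poly c t" using polyfun_on_line[OF assms(1)] by blast
  obtain d where d: "\<And>t. q (\<lambda>i. x i + t * v i) = poly d t" using polyfun_on_line[OF assms(2)] by blast
  have "dird (\<lambda>x. p x + q x) x v = coeff (c + d) 1" by (rule dird_eq) (simp add: c d)
  then show ?thesis using dird_eq[OF c] dird_eq[OF d] by simp
qed

lemma dird_mult:
  assumes "p \<in> polyfun n" "q \<in> polyfun n"
  shows "dird (\<lambda>x. p x * q x) x v = p x * dird q x v + q x * dird p x v"
proof -
  obtain c where c: "\<And>t. p (\<lambda>i. x i + t * v i) = poly c t" using polyfun_on_line[OF assms(1)] by blast
  obtain d where d: "\<And>t. q (\<lambda>i. x i + t * v i) = poly d t" using polyfun_on_line[OF assms(2)] by blast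
  have "dird (\<lambda>x. p x * q x) x v = coeff (c * d) 1" by (rule dird_eq) (simp add: c d)
  moreover have "coeff c 0 = p x" "coeff d 0 = q x" using c[of 0] d[of 0] by (simp_all add: poly_0_coeff_0)
  ultimately show ?thesis using dird_eq[OF c] dird_eq[OF d] by (simp add: coeff_mult algebra_simps)
qed

definition unit_vec :: "nat \<Rightarrow> nat \<Rightarrow> 'k::zero_neq_one" where
  "unit_vec b = (\<lambda>i. if i = b then 1 else 0)"

definition partial :: "((nat \<Rightarrow> 'k) \<Rightarrow> 'k) \<Rightarrow> nat \<Rightarrow> (nat \<Rightarrow> 'k::field_char_0) \<Rightarrow> 'k" where
  "partial p b x = dird p x (unit_vec b)"

lemma dird_partial:
  assumes "p \<in> polyfun n" shows "dird p x v = (\<Sum>b<n. v b * partial p b x)"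
  using assms
proof (induction rule: polyfun_induct)
  case (const c)
  show ?case by (simp add: partial_def dird_const)
next
  case (var i)
  then show ?case
    by (simp add: partial_def dird_var unit_vec_def if_distrib[of "\<lambda>z. _ * z"] sum.delta cong: if_cong)
next
  case (add p q)
  then show ?case by (simp add: partial_def dird_add sum.distrib distrib_left)
next
  case (mult p q)
  then show ?case by (simp add: partial_def dird_mult sum.distrib sum_distrib_left distrib_left mult_ac)
qed

lemma polyfun_dird: assumes "p \<in> polyfun n" shows "(\<lambda>x. dird p x v) \<in> polyfun n"
  using assms
proof (induction rule: polyfun_induct)
  case (mult p q)
  then show ?case by (simp add: dird_mult[OF mult(1,2)] polyfun_add polyfun_mult)
next
  case (add p q)
  then show ?case by (simp add: dird_add[OF add(1,2)] polyfun_add)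
qed (simp_all add: dird_const dird_var polyfun_const)

lemma polyfun_partial: "p \<in> polyfun n \<Longrightarrow> partial p b \<in> polyfun n"
  unfolding partial_def[abs_def] by (rule polyfun_dird)

lemma dird_sum:
  assumes "p \<in> polyfun n"
  shows "dird p x (\<lambda>i. \<Sum>s\<in>S. c s * v s i) = (\<Sum>s\<in>S. c s * dird p x (v s))"
  unfolding dird_partial[OF assms] sum_distrib_left sum_distrib_right
  by (subst sum.swap) (simp add: mult.assoc)

text \<open>For nonzero scalars this is the chain rule; the scalar 0 follows because both sides are
  polynomial in the scalar.\<close>

lemma homogeneous_dird:
  assumes p: "homogeneous n (Suc d) p" shows "homogeneous n d (\<lambda>x. dird p x v)"
proof -
  have pp: "p \<in> polyfun n" using p by (simp add: homogeneous_def)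
  have nz: "dird p (fscale a x) v = a ^ d * dird p x v" if a: "a \<noteq> 0" for a x
  proof -
    obtain c where c: "\<And>t. p (\<lambda>i. x i + t * v i) = poly c t" using polyfun_on_line[OF pp] by blast
    have "p (\<lambda>i. fscale a x i + t * v i) = poly (smult (a ^ Suc d) (pcompose c [:0, 1 / a:])) t" for t
    proof -
      have "(\<lambda>i. fscale a x i + t * v i) = fscale a (\<lambda>i. x i + (t / a) * v i)"
        using a by (simp add: fscale_def fun_eq_iff field_simps)
      then have "p (\<lambda>i. fscale a x i + t * v i) = a ^ Suc d * p (\<lambda>i. x i + (t / a) * v i)"
        using p unfolding homogeneous_def by metis
      then show ?thesis unfolding c by (simp add: poly_pcompose)
    qed
    then have "dird p (fscale a x) v = coeff (smult (a ^ Suc d) (pcompose c [:0, 1 / a:])) 1" by (rule dird_eq)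
    also have "\<dots> = a ^ Suc d * (coeff c 1 / a)" by (simp add: coeff_pcompose_linear)
    finally show ?thesis using a dird_eq[OF c] by simp
  qed
  have "dird p (fscale a x) v = a ^ d * dird p x v" for a x
  proof -
    obtain c where c: "\<And>t. dird p (\<lambda>i. poly [:0, x i:] t) v = poly c t"
      using polyfun_on_curve[OF polyfun_dird[OF pp], of "\<lambda>i. [:0, x i:]"] by blast
    have fs: "(\<lambda>i. poly [:0, x i:] t) = fscale t x" for t by (simp add: fscale_def)
    note c' = c[unfolded fs]
    have "c = monom (dird p x v) d"
      by (rule poly_eq_nonzero) (simp add: c'[symmetric] nz poly_monom mult.commute)
    then show ?thesis using c'[of a] by (simp add: poly_monom mult.commute)
  qed
  then show ?thesis unfolding homogeneous_def using polyfun_dird[OF pp] by blast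
qed

text \<open>On the line through \<open>x\<close> in direction \<open>x\<close> the form equals
  \<open>(1 + t) ^ d * p x\<close>.\<close>

lemma euler:
  assumes p: "homogeneous n d p" shows "dird p x x = of_nat d * p x"
proof -
  have co: "coeff ([:1,1:] ^ d) 0 = (1::'a)" "coeff ([:1,1:] ^ d) 1 = (of_nat d :: 'a)" for d
    by (induction d) (auto simp: coeff_mult)
  have "dird p x x = coeff (smult (p x) ([:1,1:] ^ d)) 1"
  proof (rule dird_eq)
    fix t
    have "(\<lambda>i. x i + t * x i) = fscale (1 + t) x" by (simp add: fscale_def fun_eq_iff algebra_simps)
    then show "p (\<lambda>i. x i + t * x i) = poly (smult (p x) ([:1,1:] ^ d)) t"
      using p by (simp add: homogeneous_def poly_power mult.commute)
  qed
  then show ?thesis by (simp only: coeff_smult co) (simp add: mult.commute)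
qed

text \<open>The derivative has degree 0, hence does not depend on \<open>x\<close>, and Euler's
  formula evaluates it at \<open>x = v\<close>.\<close>

lemma dird_linear_form:
  assumes p: "homogeneous n 1 p" shows "dird p x v = p v"
proof -
  have 1: "homogeneous n 0 (\<lambda>x. dird p x v)" by (rule homogeneous_dird) (use p in simp)
  then have "dird p (fscale 0 x) v = dird p x v" unfolding homogeneous_def by (metis power_0 mult_1)
  moreover have "dird p (fscale 0 v) v = dird p v v" using 1 unfolding homogeneous_def by (metis power_0 mult_1)
  moreover have "fscale 0 x = fscale 0 v" by (simp add: fscale_def)
  moreover have "dird p v v = p v" using euler[OF p, of v] by simp
  ultimately show ?thesis by simp
qed

lemma linear_form_sum:
  fixes p :: "(nat \<Rightarrow> 'k::field_char_0) \<Rightarrow> 'k"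
  assumes p: "homogeneous n 1 p"
  shows "p (\<lambda>i. \<Sum>s\<in>S. c s * v s i) = (\<Sum>s\<in>S. c s * p (v s))"
proof -
  have pp: "p \<in> polyfun n" using p by (simp add: homogeneous_def)
  show ?thesis using dird_sum[OF pp, where x = "\<lambda>_. 0" and S = S and c = c and v = v] unfolding dird_linear_form[OF p] .
qed


section \<open>A dimension count\<close>

text \<open>A discrete mean value estimate: the difference of two nested boxes in \<open>M\<close>
  variables, with side lengths differing by a constant, grows with exponent \<open>M - 1\<close>
  only.\<close>

lemma power_diff_bound:
  fixes a b :: nat assumes "b \<le> a" shows "a ^ M \<le> b ^ M + M * (a - b) * a ^ (M - 1)"
proof (induction M)
  case (Suc M)
  have 1: "a * b ^ M \<le> b ^ Suc M + (a - b) * a ^ M"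
  proof -
    have "a * b ^ M = b ^ Suc M + (a - b) * b ^ M"
      using assms by (simp add: distrib_right[symmetric])
    also have "(a - b) * b ^ M \<le> (a - b) * a ^ M" using assms by (intro mult_left_mono power_mono) auto
    finally show ?thesis by simp
  qed
  have "a ^ Suc M \<le> a * (b ^ M + M * (a - b) * a ^ (M - 1))" using Suc.IH by simp
  also have "\<dots> = a * b ^ M + M * (a - b) * a ^ M" by (cases M) (auto simp: algebra_simps)
  also have "\<dots> \<le> b ^ Suc M + (a - b) * a ^ M + M * (a - b) * a ^ M" using 1 by simp
  also have "\<dots> = b ^ Suc M + Suc M * (a - b) * a ^ (Suc M - 1)" by (simp add: add_mult_distrib)
  finally show ?case .
qed simp

text \<open>The products of \<open>f\<close> with the monomials of the smaller box are independent
  and vanish where \<open>f\<close> does. When they are extended to a basis of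
  \<open>polybox n E\<close>, only the added vectors survive on the hypersurface. Functions on it
  are continued by 0.\<close>

lemma hypersurface_span:
  fixes f :: "(nat \<Rightarrow> 'k::field_char_0) \<Rightarrow> 'k"
  assumes f: "f \<in> polybox n d" "f x0 \<noteq> 0" and dE: "d \<le> E"
  shows "\<exists>t. finite t \<and> card t \<le> (E + 1) ^ n - (E - d + 1) ^ n \<and>
    (\<forall>p\<in>polybox n E. (\<lambda>z. if f z = 0 then p z else 0) \<in> fvs.span t)"
proof -
  define g where "g \<beta> = (\<lambda>z. f z * mon n \<beta> z)" for \<beta>
  let ?B = "ebox n (E - d)"
  define K where "K = g ` ?B"
  have fp: "f \<in> polyfun n" by (rule polybox_polyfun[OF f(1)])
  \<comment> \<open>Polynomial functions form a domain, so a relation between the products gives one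
    between the monomials.\<close>
  have indep: "\<forall>\<beta>\<in>?B. c \<beta> = 0" if c: "\<And>x. (\<Sum>\<beta>\<in>?B. c \<beta> * g \<beta> x) = 0" for c
  proof -
    have "(\<Sum>\<beta>\<in>?B. c \<beta> * mon n \<beta> x) = 0" for x
    proof (rule ccontr)
      assume nz: "(\<Sum>\<beta>\<in>?B. c \<beta> * mon n \<beta> x) \<noteq> 0"
      have "(\<lambda>x. \<Sum>\<beta>\<in>?B. c \<beta> * mon n \<beta> x) \<in> polyfun n"
        by (rule polyfun_sum, rule polyfun_mult[OF polyfun_const mon_polyfun])
      from polyfun_nonzero_mult[OF fp this f(2) nz] obtain y where
        y: "f y \<noteq> 0" "(\<Sum>\<beta>\<in>?B. c \<beta> * mon n \<beta> y) \<noteq> 0" by blast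
      have "f y * (\<Sum>\<beta>\<in>?B. c \<beta> * mon n \<beta> y) = (\<Sum>\<beta>\<in>?B. c \<beta> * g \<beta> y)"
        by (simp add: g_def sum_distrib_left mult.left_commute)
      then show False using c[of y] y by simp
    qed
    then show ?thesis using mon_independent by blast
  qed
  have inj: "inj_on g ?B"
  proof (rule inj_onI, rule ccontr)
    fix \<beta> \<gamma> assume h: "\<beta> \<in> ?B" "\<gamma> \<in> ?B" "g \<beta> = g \<gamma>" "\<beta> \<noteq> \<gamma>"
    let ?c = "\<lambda>l. if l = \<beta> then 1 else if l = \<gamma> then -1 else (0::'k)"
    have "(\<Sum>l\<in>?B. ?c l * g l x) = (\<Sum>l\<in>{\<beta>,\<gamma>}. ?c l * g l x)" for x
      using h by (intro sum.mono_neutral_right) auto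
    then have "(\<Sum>l\<in>?B. ?c l * g l x) = 0" for x using h by simp
    from indep[OF this] h(1) show False by auto
  qed
  have indepK: "fvs.independent K"
  proof
    assume "fvs.dependent K"
    then obtain u v where u: "v \<in> K" "u v \<noteq> 0" "(\<Sum>v\<in>K. fscale (u v) v) = 0"
      using fvs.dependent_finite[of K] unfolding K_def by auto
    have "(\<Sum>\<beta>\<in>?B. fscale (u (g \<beta>)) (g \<beta>)) = 0" using u(3) inj unfolding K_def by (simp add: sum.reindex)
    then have "(\<Sum>\<beta>\<in>?B. u (g \<beta>) * g \<beta> x) = 0" for x by (simp add: fun_eq_iff sum_fun_apply fscale_def)
    from indep[OF this] u(1,2) show False unfolding K_def by auto
  qed
  have KV: "K \<subseteq> polybox n E"
    unfolding K_def g_def using polybox_mult[OF f(1) mon_in_polybox, of _ "E - d"] dE by (auto simp: ebox_def)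
  obtain B where B: "K \<subseteq> B" "B \<subseteq> polybox n E" "fvs.independent B" "polybox n E \<subseteq> fvs.span B"
    using fvs.maximal_independent_subset_extend[OF KV indepK] by blast
  have finB: "finite B \<and> card B \<le> card (mon n ` ebox n E :: ((nat \<Rightarrow> 'k) \<Rightarrow> 'k) set)"
    by (rule fvs.independent_span_bound) (use B in \<open>auto simp: polybox_def\<close>)
  have "card (mon n ` ebox n E :: ((nat \<Rightarrow> 'k) \<Rightarrow> 'k) set) \<le> (E + 1) ^ n"
    using card_image_le[of "ebox n E" "mon n"] by simp
  then have cardB: "card B \<le> (E + 1) ^ n" using finB by linarith
  have cardK: "card K = (E - d + 1) ^ n" unfolding K_def by (simp add: card_image[OF inj])
  define r where "r p = (\<lambda>z. if f z = 0 then p z else 0)" for p :: "(nat \<Rightarrow> 'k) \<Rightarrow> 'k"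
  define t where "t = r ` (B - K)"
  have "finite t" unfolding t_def using finB by auto
  moreover have "card t \<le> (E + 1) ^ n - (E - d + 1) ^ n"
  proof -
    have "card t \<le> card (B - K)" unfolding t_def using finB by (intro card_image_le) auto
    also have "\<dots> = card B - card K" using B(1) finB by (intro card_Diff_subset) (auto intro: finite_subset)
    finally show ?thesis using cardB cardK by linarith
  qed
  moreover have "r p \<in> fvs.span t" if p: "p \<in> polybox n E" for p
  proof -
    have "p \<in> fvs.span (id ` B)" using B(4) p by auto
    then obtain c where c: "p = (\<Sum>b\<in>B. fscale (c b) (id b))" using span_image_finite[of B p id] finB by blast
    have "r p = (\<Sum>b\<in>B. fscale (c b) (r b))"
      unfolding c r_def by (auto simp: fun_eq_iff sum_fun_apply fscale_def)
    also have "\<dots> = (\<Sum>b\<in>B - K. fscale (c b) (r b))"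
    proof (rule sum.mono_neutral_right)
      show "\<forall>b\<in>B - (B - K). fscale (c b) (r b) = 0"
        by (auto simp: K_def g_def r_def fscale_def fun_eq_iff)
    qed (use finB in auto)
    also have "\<dots> \<in> fvs.span t" unfolding t_def by (intro fvs.span_sum fvs.span_scale fvs.span_base) auto
    finally show ?thesis .
  qed
  ultimately show ?thesis unfolding r_def by blast
qed

text \<open>The map \<open>A / q\<close> goes from a hypersurface in \<open>M\<close>-space to
  \<open>M\<close>-space. Pulled back and with denominators cleared, the monomials of a box lie in a
  space that grows with exponent \<open>M - 1\<close>, so some nontrivial combination of them
  vanishes on the image.\<close>

lemma hypersurface_image_not_dense:
  fixes f q :: "(nat \<Rightarrow> 'k::field_char_0) \<Rightarrow> 'k"
  assumes f: "f \<in> polyfun M" "f x0 \<noteq> 0" and q: "q \<in> polyfun M"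
    and A: "\<And>l. l < M \<Longrightarrow> A l \<in> polyfun M"
  shows "\<exists>\<Phi>\<in>polyfun M. (\<exists>x. \<Phi> x \<noteq> 0) \<and>
    (\<forall>u z. f z = 0 \<longrightarrow> q z \<noteq> 0 \<longrightarrow> (\<forall>l<M. q z * u l = A l z) \<longrightarrow> \<Phi> u = 0)"
proof (cases "M = 0")
  case True
  \<comment> \<open>Without variables \<open>f\<close> is a nonzero constant and the hypersurface is
    empty.\<close>
  have "f z \<noteq> 0" for z using polyfun_cong[OF f(1), of z x0] True f(2) by simp
  then show ?thesis using f(2) by (intro bexI[of _ "\<lambda>_. 1"]) (auto intro: polyfun_const)
next
  case False
  obtain d where d: "f \<in> polybox M d" using polyfun_polybox[OF f(1)] by blast
  obtain c0 where c0: "q \<in> polybox M c0" using polyfun_polybox[OF q] by blast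
  have "\<forall>l\<in>{..<M}. \<exists>c. A l \<in> polybox M c" using polyfun_polybox[OF A] by blast
  then obtain c1 where c1: "\<And>l. l < M \<Longrightarrow> A l \<in> polybox M (c1 l)" by (metis lessThan_iff)
  \<comment> \<open>One degree bound for \<open>q\<close> and all \<open>A l\<close>; the summand
    \<open>d\<close> will give \<open>d \<le> E\<close>.\<close>
  define c where "c = d + c0 + (\<Sum>l<M. c1 l)"
  have qc: "q \<in> polybox M c" using polybox_mono[of c0 c M] c0 by (auto simp: c_def)
  have Ac: "A l \<in> polybox M c" if "l < M" for l
  proof -
    have "c1 l \<le> (\<Sum>l<M. c1 l)" using that by (intro member_le_sum) auto
    then show ?thesis using polybox_mono[of "c1 l" c M] c1[OF that] by (auto simp: c_def)
  qed
  have "M - 1 < M" using False by simp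
  from box_count_large[OF this] obtain D where D: "(M * d) * ((c * M) * D + 1) ^ (M - 1) < (D + 1) ^ M" by blast
  define E where "E = c * (M * D)"
  have dE: "d \<le> E"
  \<comment> \<open>For \<open>D = 0\<close> the counting inequality reads \<open>M * d < 1\<close>,
    which forces \<open>d = 0\<close>.\<close>
  proof (cases "D = 0")
    case True
    then have "d = 0" using D False by simp
    then show ?thesis by simp
  next
    case False
    then have "1 \<le> M * D" using \<open>M \<noteq> 0\<close> by simp
    then have "d * 1 \<le> c * (M * D)" by (intro mult_mono) (auto simp: c_def)
    then show ?thesis by (simp add: E_def)
  qed
  obtain t where t: "finite t" "card t \<le> (E + 1) ^ M - (E - d + 1) ^ M"
    "\<And>p. p\<in>polybox M E \<Longrightarrow> (\<lambda>z. if f z = 0 then p z else 0) \<in> fvs.span t"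
    using hypersurface_span[OF d f(2) dE] by blast
  have "(E + 1) ^ M \<le> (E - d + 1) ^ M + M * ((E + 1) - (E - d + 1)) * (E + 1) ^ (M - 1)"
    by (rule power_diff_bound) simp
  moreover have "(E + 1) - (E - d + 1) = d" using dE by simp
  ultimately have "card t \<le> M * d * (E + 1) ^ (M - 1)" using t(2) by simp
  then have ct: "card t < (D + 1) ^ M" using D by (simp add: E_def mult.assoc)
  \<comment> \<open>The monomial \<open>\<gamma>\<close> in the \<open>A l / q\<close>, multiplied
    by \<open>q ^ (M * D)\<close>.\<close>
  define a where "a \<gamma> z = q z ^ (M * D - hdeg M \<gamma>) * (\<Prod>l<M. A l z ^ \<gamma> l)" for \<gamma> z
  have hd: "hdeg M \<gamma> \<le> M * D" if "\<gamma> \<in> ebox M D" for \<gamma>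
    using that sum_bounded_above[of "{..<M}" \<gamma> D] by (auto simp: hdeg_def ebox_def)
  have aE: "a \<gamma> \<in> polybox M E" if g: "\<gamma> \<in> ebox M D" for \<gamma>
  proof -
    have "(\<lambda>z. \<Prod>l<M. A l z ^ \<gamma> l) \<in> polybox M (\<Sum>l<M. \<gamma> l * c)"
      by (rule polybox_prod) (use polybox_power[OF Ac] in auto)
    from polybox_mult[OF polybox_power[OF qc, of "M * D - hdeg M \<gamma>"] this]
    have "a \<gamma> \<in> polybox M ((M * D - hdeg M \<gamma>) * c + hdeg M \<gamma> * c)"
      by (simp add: a_def[abs_def] hdeg_def sum_distrib_right)
    moreover have "(M * D - hdeg M \<gamma>) * c + hdeg M \<gamma> * c = E"
      using hd[OF g] unfolding add_mult_distrib[symmetric] by (simp add: E_def mult.commute)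
    ultimately show ?thesis by simp
  qed
  have "\<exists>b. (\<exists>\<gamma>\<in>ebox M D. b \<gamma> \<noteq> 0) \<and> (\<forall>z. (\<Sum>\<gamma>\<in>ebox M D. b \<gamma> * (if f z = 0 then a \<gamma> z else 0)) = 0)"
    by (rule dependent_family[of _ t]) (use t aE ct in auto)
  then obtain b \<gamma>0 where b: "\<gamma>0 \<in> ebox M D" "b \<gamma>0 \<noteq> 0"
    "\<And>z. (\<Sum>\<gamma>\<in>ebox M D. b \<gamma> * (if f z = 0 then a \<gamma> z else 0)) = 0" by blast
  define \<Phi> where "\<Phi> u = (\<Sum>\<gamma>\<in>ebox M D. b \<gamma> * mon M \<gamma> u)" for u
  have "\<Phi> \<in> polyfun M" unfolding \<Phi>_def[abs_def]
    by (rule polyfun_sum, rule polyfun_mult[OF polyfun_const mon_polyfun])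
  moreover have "\<exists>x. \<Phi> x \<noteq> 0"
  proof (rule ccontr)
    assume "\<not> ?thesis"
    then have "(\<Sum>\<gamma>\<in>ebox M D. b \<gamma> * mon M \<gamma> u) = 0" for u unfolding \<Phi>_def by simp
    from mon_independent[OF this b(1)] b(2) show False by simp
  qed
  moreover have "\<Phi> u = 0" if z: "f z = 0" "q z \<noteq> 0" "\<forall>l<M. q z * u l = A l z" for u z
  proof -
    have "a \<gamma> z = q z ^ (M * D) * mon M \<gamma> u" if g: "\<gamma> \<in> ebox M D" for \<gamma>
    proof -
      have "(\<Prod>l<M. A l z ^ \<gamma> l) = (\<Prod>l<M. (q z * u l) ^ \<gamma> l)" using z(3) by (intro prod.cong) auto
      also have "\<dots> = q z ^ hdeg M \<gamma> * mon M \<gamma> u"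
        by (simp add: power_mult_distrib prod.distrib mon_def hdeg_def power_sum)
      finally show ?thesis unfolding a_def using hd[OF g] by (simp add: mult.assoc[symmetric] power_add[symmetric])
    qed
    then have "q z ^ (M * D) * \<Phi> u = (\<Sum>\<gamma>\<in>ebox M D. b \<gamma> * a \<gamma> z)"
      unfolding \<Phi>_def sum_distrib_left by (intro sum.cong) (auto simp: mult_ac)
    also have "\<dots> = 0" using b(3)[of z] z(1) by simp
    finally show ?thesis using z(2) by simp
  qed
  ultimately show ?thesis by blast
qed


section \<open>Choice of the constant vectors\<close>

text \<open>Each new vector is a common zero of \<open>H\<close> and the forms already found. The
  forms \<open>l a\<close> are produced together with the vectors, because requiring them to vanish
  at \<open>x\<close> will keep \<open>x\<close> away from the span of the
  \<open>v a\<close>.\<close>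

lemma dual_vectors_in_kernel:
  fixes H :: "((nat \<Rightarrow> 'k::{alg_closed_field, field_char_0}) \<Rightarrow> 'k) set"
  assumes "finite H" "\<And>h. h \<in> H \<Longrightarrow> homogeneous n 1 h" "card H + k \<le> n"
  shows "\<exists>v l. \<forall>a<k. v a \<in> coord_space n \<and> homogeneous n 1 (l a) \<and> (\<forall>h\<in>H. h (v a) = 0) \<and>
    (\<forall>b<k. l a (v b) = (if a = b then 1 else 0))"
  using assms(3)
proof (induction k)
  case (Suc k)
  have "card H + k \<le> n" using Suc.prems by simp
  from Suc.IH[OF this] obtain v l where "\<forall>a<k. v a \<in> coord_space n \<and> homogeneous n 1 (l a) \<and> (\<forall>h\<in>H. h (v a) = 0) \<and>
    (\<forall>b<k. l a (v b) = (if a = b then 1 else 0))" by blast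
  then have vl: "\<And>a. a < k \<Longrightarrow> v a \<in> coord_space n" "\<And>a. a < k \<Longrightarrow> homogeneous n 1 (l a)"
    "\<And>a h. a < k \<Longrightarrow> h \<in> H \<Longrightarrow> h (v a) = 0" "\<And>a b. a < k \<Longrightarrow> b < k \<Longrightarrow> l a (v b) = (if a = b then 1 else 0)"
    by simp_all
  have "card (H \<union> l ` {..<k}) \<le> card H + card (l ` {..<k})" by (rule card_Un_le)
  also have "card (l ` {..<k}) \<le> k" using card_image_le[of "{..<k}" l] by simp
  finally have "card (H \<union> l ` {..<k}) < n" using Suc.prems by simp
  then have "\<exists>x\<in>coord_space n. x \<noteq> 0 \<and> (\<forall>g\<in>H \<union> l ` {..<k}. g x = 0)"
    by (rule few_forms_common_zero[where d = "\<lambda>_. 1", rotated]) (use assms(1,2) vl(2) in auto)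
  then obtain w where w: "w \<in> coord_space n" "w \<noteq> 0" "\<And>h. h \<in> H \<Longrightarrow> h w = 0" "\<And>a. a < k \<Longrightarrow> l a w = 0" by blast
  then obtain i where i: "i < n" "w i \<noteq> 0"
    by (auto simp: coord_space_def fun_eq_iff) (metis not_less)
  \<comment> \<open>The coordinate \<open>i\<close>, scaled to 1 at \<open>w\<close> and corrected
    so as to vanish at the earlier vectors.\<close>
  define m where "m x = x i / w i - (\<Sum>b<k. (v b i / w i) * l b x)" for x
  have m1: "homogeneous n 1 m"
  proof -
    have "l b \<in> polyfun n" if "b < k" for b using vl(2)[OF that] by (simp add: homogeneous_def)
    then have "(\<lambda>x. (1 / w i) * x i - (\<Sum>b<k. (v b i / w i) * l b x)) \<in> polyfun n"
      using i(1) by (intro polyfun_diff polyfun_sum polyfun_mult polyfun_const polyfun_var) auto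
    moreover have "m (fscale c x) = c * m x" for c x
    proof -
      have "l b (fscale c x) = c * l b x" if "b < k" for b
        using vl(2)[OF that] by (simp add: homogeneous_def)
      moreover have "fscale c x i = c * x i" by (simp add: fscale_def)
      ultimately show ?thesis by (simp add: m_def sum_distrib_left right_diff_distrib mult.left_commute)
    qed
    ultimately show ?thesis by (simp add: homogeneous_def m_def[abs_def])
  qed
  have mw: "m w = 1" using i w(4) by (simp add: m_def)
  have mv: "m (v a) = 0" if "a < k" for a
  proof -
    have "(\<Sum>b<k. (v b i / w i) * l b (v a)) = (\<Sum>b<k. if b = a then v a i / w i else 0)"
      by (intro sum.cong refl) (use vl(4) that in auto)
    then show ?thesis using that by (simp add: m_def sum.delta)
  qed
  show ?case
    by (rule exI[of _ "v(k := w)"], rule exI[of _ "l(k := m)"])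
       (use vl w m1 mw mv in \<open>auto simp: less_Suc_eq\<close>)
qed simp

lemma index_bound: "i < k \<Longrightarrow> b < n \<Longrightarrow> i * n + b < k * (n::nat)"
proof -
  assume "i < k" "b < n"
  then have "i * n + b < Suc i * n" by simp
  also have "\<dots> \<le> k * n" using \<open>i < k\<close> by (intro mult_right_mono) auto
  finally show ?thesis .
qed

lemma index_decomp: "l < k * n \<Longrightarrow> l div n < k \<and> l mod n < n \<and> l = (l div n) * n + l mod (n::nat)"
  by (cases "n = 0") (auto simp: less_mult_imp_div_less)

text \<open>The tuples \<open>v\<close> for which some combination \<open>y = v\<^sub>i + \<dots>\<close> is a zero of \<open>f\<close> at which the differential
  of \<open>f\<close> kills all \<open>v\<^sub>a\<close>, while \<open>\<partial>f/\<partial>x\<^sub>b(y) \<noteq> 0\<close>. They are parametrised by \<open>y\<close> on the hypersurface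
  \<open>f = 0\<close> (stored in row \<open>i\<close>) and, for the other rows, by the coefficients (stored in column \<open>b\<close>)
  and the coordinates of \<open>v\<^sub>a\<close> other than the \<open>b\<close>-th one.\<close>

lemma bad_tuples_not_dense:
  fixes f :: "(nat \<Rightarrow> 'k::field_char_0) \<Rightarrow> 'k"
  assumes f: "f \<in> polyfun n" and i: "i < k" and b: "b < n"
  shows "\<exists>\<Phi>\<in>polyfun (k * n). (\<exists>x. \<Phi> x \<noteq> 0) \<and>
    (\<forall>u \<alpha> y. f y = 0 \<longrightarrow> partial f b y \<noteq> 0 \<longrightarrow>
      (\<forall>a<k. (\<Sum>c<n. u (a * n + c) * partial f c y) = 0) \<longrightarrow>
      (\<forall>c<n. y c = u (i * n + c) + (\<Sum>a\<in>{..<k} - {i}. \<alpha> a * u (a * n + c))) \<longrightarrow> \<Phi> u = 0)"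
proof (cases "\<forall>x. f x = 0")
  case True
  \<comment> \<open>A polynomial that vanishes identically has no nonzero partial derivative, so
    there are no bad tuples.\<close>
  have "partial f b y = 0" for y
    unfolding partial_def using dird_eq[of f y "unit_vec b" 0] True by simp
  then show ?thesis by (intro bexI[of _ "\<lambda>_. 1"]) (auto intro: polyfun_const)
next
  case False
  then obtain x0 where x0: "f x0 \<noteq> 0" by blast
  let ?M = "k * n"
  define row where "row z = (\<lambda>c. if c < n then z (i * n + c) else (0::'k))" for z :: "nat \<Rightarrow> 'k"
  have sub: "(\<lambda>z. p (row z)) \<in> polyfun ?M" if p: "p \<in> polyfun n" for p
  proof -
    have "(\<lambda>z. p (\<lambda>c. (\<lambda>z. z (i * n + c)) z)) \<in> polyfun ?M"
      by (rule polyfun_subst[OF p]) (auto intro!: polyfun_var index_bound i)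
    moreover have "p (\<lambda>c. z (i * n + c)) = p (row z)" for z
      by (rule polyfun_cong[OF p]) (simp add: row_def)
    ultimately show ?thesis by simp
  qed
  define q where "q z = partial f b (row z)" for z
  \<comment> \<open>Up to the factor \<open>q\<close>, a row \<open>a\<close> other than
    \<open>i\<close>: tangency determines its \<open>b\<close>-th coordinate, since \<open>q\<close>
    is the coefficient of that coordinate.\<close>
  define A0 where "A0 a c z = (if c = b then - (\<Sum>e\<in>{..<n} - {b}. partial f e (row z) * z (a * n + e))
      else q z * z (a * n + c))" for a c z
  \<comment> \<open>Row \<open>i\<close> is recovered from \<open>y\<close> by subtracting the other
    rows with their coefficients.\<close>
  define A where "A l z = (let a = l div n; c = l mod n in if a = i then q z * z (i * n + c) - (\<Sum>a\<in>{..<k} - {i}. z (a * n + b) * A0 a c z)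
      else A0 a c z)" for l z
  have fM: "(\<lambda>z. f (row z)) \<in> polyfun ?M" by (rule sub[OF f])
  have qM: "q \<in> polyfun ?M" unfolding q_def[abs_def] by (rule sub[OF polyfun_partial[OF f]])
  have A0M: "A0 a c \<in> polyfun ?M" if "a < k" "c < n" for a c
    unfolding A0_def[abs_def] using that
    by (cases "c = b") (auto intro!: polyfun_uminus polyfun_sum polyfun_mult sub polyfun_partial f polyfun_var index_bound qM)
  have AM: "A l \<in> polyfun ?M" if "l < ?M" for l
    unfolding A_def[abs_def] Let_def using index_decomp[OF that] i b that
    by (cases "l div n = i") (auto intro!: polyfun_diff polyfun_mult polyfun_sum polyfun_var index_bound qM A0M)
  have nz: "f (row (\<lambda>l. x0 (l mod n))) \<noteq> 0"
  proof -
    have "f (row (\<lambda>l. x0 (l mod n))) = f x0" by (rule polyfun_cong[OF f]) (simp add: row_def)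
    then show ?thesis using x0 by simp
  qed
  \<comment> \<open>There are as many parameters as entries of a tuple, but they satisfy one
    equation.\<close>
  have "\<exists>\<Phi>\<in>polyfun ?M. (\<exists>x. \<Phi> x \<noteq> 0) \<and>
    (\<forall>u z. f (row z) = 0 \<longrightarrow> q z \<noteq> 0 \<longrightarrow> (\<forall>l<?M. q z * u l = A l z) \<longrightarrow> \<Phi> u = 0)"
    by (rule hypersurface_image_not_dense[OF fM nz qM]) (rule AM)
  then obtain \<Phi> where \<Phi>: "\<Phi> \<in> polyfun ?M" "\<exists>x. \<Phi> x \<noteq> 0"
    "\<And>u z. f (row z) = 0 \<Longrightarrow> q z \<noteq> 0 \<Longrightarrow> \<forall>l<?M. q z * u l = A l z \<Longrightarrow> \<Phi> u = 0"
    by blast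
  have "\<Phi> u = 0" if y: "f y = 0" "partial f b y \<noteq> 0"
      "\<And>a. a < k \<Longrightarrow> (\<Sum>c<n. u (a * n + c) * partial f c y) = 0"
      "\<And>c. c < n \<Longrightarrow> y c = u (i * n + c) + (\<Sum>a\<in>{..<k} - {i}. \<alpha> a * u (a * n + c))" for u \<alpha> y
  proof -
    define z where "z l = (if l div n = i then y (l mod n) else if l mod n = b then \<alpha> (l div n) else u l)" for l
    have zi: "z (a * n + c) = (if a = i then y c else if c = b then \<alpha> a else u (a * n + c))" if "c < n" for a c
      using that by (simp add: z_def)
    have pr: "p (row z) = p y" if p: "p \<in> polyfun n" for p
      by (rule polyfun_cong[OF p]) (simp add: row_def zi)
    have qz: "q z = partial f b y" unfolding q_def by (rule pr[OF polyfun_partial[OF f]])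
    have A0z: "q z * u (a * n + c) = A0 a c z" if ac: "a < k" "a \<noteq> i" "c < n" for a c
    proof (cases "c = b")
      case True
      have bn: "b \<in> {..<n}" using b by simp
      have "u (a * n + b) * partial f b y = - (\<Sum>e\<in>{..<n} - {b}. u (a * n + e) * partial f e y)"
        using y(3)[OF ac(1)] by (simp add: sum.remove[OF _ bn] eq_neg_iff_add_eq_0)
      also have "(\<Sum>e\<in>{..<n} - {b}. u (a * n + e) * partial f e y) = (\<Sum>e\<in>{..<n} - {b}. partial f e (row z) * z (a * n + e))"
        by (intro sum.cong refl) (use ac in \<open>auto simp: zi pr[OF polyfun_partial[OF f]]\<close>)
      finally show ?thesis using True by (simp add: A0_def qz mult.commute)
    next
      case False
      then show ?thesis using ac by (simp add: A0_def zi)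
    qed
    have "q z * u l = A l z" if l: "l < ?M" for l
    proof -
      obtain a c where ac: "a < k" "c < n" "l = a * n + c" using index_decomp[OF l] by blast
      show ?thesis
      proof (cases "a = i")
        case False
        then show ?thesis using A0z[OF ac(1) False ac(2)] ac by (simp add: A_def Let_def)
      next
        case True
        have "q z * u (i * n + c) = q z * y c - (\<Sum>a\<in>{..<k} - {i}. \<alpha> a * (q z * u (a * n + c)))"
          unfolding y(4)[OF ac(2)] by (simp add: distrib_left sum_distrib_left mult.left_commute)
        also have "(\<Sum>a\<in>{..<k} - {i}. \<alpha> a * (q z * u (a * n + c))) = (\<Sum>a\<in>{..<k} - {i}. z (a * n + b) * A0 a c z)"
          by (intro sum.cong refl) (use A0z ac b in \<open>auto simp: zi\<close>)
        finally show ?thesis using True ac by (simp add: A_def Let_def zi)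
      qed
    qed
    then show ?thesis using \<Phi>(3)[of z u] y(1,2) by (simp add: pr[OF f] qz)
  qed
  then show ?thesis using \<Phi>(1,2) by (intro bexI[of _ \<Phi>] conjI allI impI) blast+
qed

lemma ldet_polyfun:
  assumes "\<And>i j. i < d \<Longrightarrow> j < d \<Longrightarrow> e i j < M"
  shows "(\<lambda>V. ldet d (\<lambda>i j. V (e i j))) \<in> polyfun M"
  unfolding ldet_def
proof (intro polyfun_sum polyfun_mult polyfun_const polyfun_prod polyfun_var assms)
  fix p i assume "p \<in> {p. p permutes {..<d}}" "i \<in> {..<d}"
  then show "p i < d" using permutes_in_image[of p "{..<d}" i] by simp
qed auto


text \<open>Tangency to \<open>v\<^sub>1, \<dots>, v\<^sub>k\<close> of the zeros \<open>x\<close> of the \<open>f\<^sub>j\<close> costs \<open>ck\<close> equations. If some \<open>f\<^sub>j\<close> is linear,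
  the \<open>v\<^sub>a\<close> are taken in the common kernel of the linear \<open>f\<^sub>j\<close>, and the equations thus saved are spent on
  linear forms keeping \<open>x\<close> away from the span of the \<open>v\<^sub>a\<close>. Otherwise generic \<open>v\<^sub>a\<close> do.\<close>

theorem tangent_vectors_exist:
  fixes f :: "nat \<Rightarrow> (nat \<Rightarrow> 'k::{alg_closed_field, field_char_0}) \<Rightarrow> 'k"
  assumes f: "\<And>j. j < c \<Longrightarrow> homogeneous n (d j) (f j) \<and> 0 < d j"
    and ck: "1 \<le> c" "(1 + k) * c + 1 < n"
    and smooth: "\<And>y. y \<in> coord_space n \<Longrightarrow> y \<noteq> 0 \<Longrightarrow> \<forall>j<c. f j y = 0 \<Longrightarrow> \<exists>j<c. \<exists>b<n. partial (f j) b y \<noteq> 0"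
  shows "\<exists>v G. finite G \<and> card G + 1 < n \<and> (\<forall>g\<in>G. \<exists>e>0. homogeneous n e g) \<and>
    (\<forall>x\<in>cone_zeros n G. (\<forall>j<c. f j x = 0) \<and> (\<forall>j<c. \<forall>a<k. dird (f j) x (v a) = 0) \<and>
      (\<forall>\<alpha> \<beta>. (\<forall>i<n. (\<Sum>a<k. \<alpha> a * v a i) = \<beta> * x i) \<longrightarrow> (\<forall>a<k. \<alpha> a = 0)))"
proof -
  have fp: "f j \<in> polyfun n" if "j < c" for j using f[OF that] by (simp add: homogeneous_def)
  define L where "L = {j. j < c \<and> d j = 1}"
  define M where "M = {j. j < c \<and> d j \<noteq> 1}"
  have fin: "finite L" "finite M" unfolding L_def M_def by auto
  \<comment> \<open>Only for degree at least 2 is the derivative a form of positive degree; for a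
    linear form it is a constant.\<close>
  have Mhom: "\<exists>e>0. homogeneous n e (\<lambda>x. dird (f j) x w)" if "j \<in> M" for j w
  proof -
    obtain e where e: "d j = Suc e" "e > 0" using \<open>j \<in> M\<close> f[of j] unfolding M_def by (cases "d j") auto
    then have "homogeneous n e (\<lambda>x. dird (f j) x w)" using f[of j] that unfolding M_def by (intro homogeneous_dird) auto
    then show ?thesis using e by blast
  qed
  define D where "D v = (\<lambda>(j, a) x. dird (f j) x (v a)) ` (M \<times> {..<k})" for v :: "nat \<Rightarrow> nat \<Rightarrow> 'k"
  have cardD: "card (D v) \<le> card M * k" for v
    unfolding D_def using card_image_le[of "M \<times> {..<k}"] fin by (simp add: card_cartesian_product)
  have cardF: "card (f ` {..<c}) \<le> c" using card_image_le[of "{..<c}" f] by simp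
  have finD: "finite (D v)" for v unfolding D_def using fin by simp
  have hom: "\<forall>g\<in>f ` {..<c} \<union> D v. \<exists>e>0. homogeneous n e g" for v
    unfolding D_def using f Mhom by auto
  show ?thesis
  proof (cases "L = {}")
    case False
    then obtain j0 where "j0 \<in> L" by blast
    then have j0: "j0 < c" "j0 \<notin> M" unfolding L_def M_def by auto
    then have "card M \<le> card ({..<c} - {j0})" by (intro card_mono) (auto simp: M_def)
    then have cM: "card M \<le> c - 1" using j0(1) by simp
    have "card (f ` L) \<le> card L" by (rule card_image_le[OF fin(1)])
    also have "\<dots> \<le> c" using card_mono[of "{..<c}" L] unfolding L_def by auto
    finally have "card (f ` L) + k \<le> c + k" by simp
    also have "\<dots> \<le> (1 + k) * c" using ck(1) by (simp add: algebra_simps)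
    finally have cn: "card (f ` L) + k \<le> n" using ck(2) by simp
    have Lhom: "homogeneous n 1 h" if "h \<in> f ` L" for h
    proof -
      obtain j where "j < c" "d j = 1" "h = f j" using \<open>h \<in> f ` L\<close> unfolding L_def by blast
      then show ?thesis using f[of j] by simp
    qed
    obtain v l where vl: "\<forall>a<k. v a \<in> coord_space n \<and> homogeneous n 1 (l a) \<and> (\<forall>h\<in>f ` L. h (v a) = 0) \<and>
      (\<forall>b<k. l a (v b) = (if a = b then 1 else (0::'k)))"
      using dual_vectors_in_kernel[of "f ` L" n k] fin(1) Lhom cn by blast
    define G where "G = (f ` {..<c} \<union> D v) \<union> l ` {..<k}"
    have "card G \<le> card (f ` {..<c} \<union> D v) + card (l ` {..<k})" unfolding G_def by (rule card_Un_le)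
    also have "card (f ` {..<c} \<union> D v) \<le> card (f ` {..<c}) + card (D v)" by (rule card_Un_le)
    also have "card (l ` {..<k}) \<le> k" using card_image_le[of "{..<k}" l] by simp
    \<comment> \<open>The \<open>k\<close> forms \<open>l a\<close> take the place of the
      \<open>k\<close> tangency equations of the linear form \<open>f j0\<close>, so the total is
      still at most \<open>(1 + k) * c\<close>.\<close>
    finally have "card G \<le> c + (c - 1) * k + k"
      using cardF cardD[of v] mult_le_mono1[OF cM, of k] by linarith
    also have "\<dots> = (1 + k) * c" using ck(1) by (cases c) (auto simp: algebra_simps)
    finally have g2: "card G + 1 < n" using ck(2) by simp
    have g1: "finite G" unfolding G_def using finD by simp
    have g3: "\<forall>g\<in>G. \<exists>e>0. homogeneous n e g"
      unfolding G_def using hom[of v] vl by (auto intro: exI[of _ 1])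
    have g4: "(\<forall>j<c. f j x = 0) \<and> (\<forall>j<c. \<forall>a<k. dird (f j) x (v a) = 0) \<and>
      (\<forall>\<alpha> \<beta>. (\<forall>i<n. (\<Sum>a<k. \<alpha> a * v a i) = \<beta> * x i) \<longrightarrow> (\<forall>a<k. \<alpha> a = 0))"
      if x: "x \<in> cone_zeros n G" for x
    proof (intro conjI allI impI)
      fix j assume "j < c"
      then show "f j x = 0" using x by (auto simp: cone_zeros_def G_def)
    next
      fix j a assume ja: "j < c" "a < k"
      show "dird (f j) x (v a) = 0"
      proof (cases "j \<in> L")
        case True
        then show ?thesis using dird_linear_form[of n "f j" x "v a"] Lhom vl ja by auto
      next
        case False
        then have "(\<lambda>x. dird (f j) x (v a)) \<in> G" using ja unfolding G_def D_def L_def M_def by force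
        then show ?thesis using x by (auto simp: cone_zeros_def)
      qed
    next
      fix \<alpha> \<beta> b assume e: "\<forall>i<n. (\<Sum>a<k. \<alpha> a * v a i) = \<beta> * x i" and b: "b < k"
      have lb: "homogeneous n 1 (l b)" using vl b by blast
      then have lbp: "l b \<in> polyfun n" by (simp add: homogeneous_def)
      have "\<alpha> b = (\<Sum>a<k. \<alpha> a * l b (v a))"
      proof -
        have "(\<Sum>a<k. \<alpha> a * l b (v a)) = (\<Sum>a<k. if a = b then \<alpha> b else 0)"
          by (intro sum.cong refl) (use vl b in auto)
        then show ?thesis using b by simp
      qed
      also have "\<dots> = l b (\<lambda>i. \<Sum>a<k. \<alpha> a * v a i)" by (rule linear_form_sum[OF lb, symmetric])
      also have "\<dots> = l b (fscale \<beta> x)" by (rule polyfun_cong[OF lbp]) (use e in \<open>simp add: fscale_def\<close>)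
      also have "\<dots> = \<beta> * l b x" using lb by (simp add: homogeneous_def)
      also have "l b x = 0" using x b by (auto simp: cone_zeros_def G_def)
      finally show "\<alpha> b = 0" by simp
    qed
    show ?thesis
      by (rule exI[of _ v], rule exI[of _ G], rule conjI[OF g1], rule conjI[OF g2], rule conjI[OF g3], rule ballI) (rule g4)
  next
    case True
    then have Mc: "M = {..<c}" using f unfolding L_def M_def by auto
    define W where "W j b i \<Phi> \<longleftrightarrow> \<Phi> \<in> polyfun (k * n) \<and> (\<exists>x. \<Phi> x \<noteq> 0) \<and>
      (\<forall>u \<alpha> y. f j y = 0 \<longrightarrow> partial (f j) b y \<noteq> 0 \<longrightarrow>
      (\<forall>a<k. (\<Sum>c<n. u (a * n + c) * partial (f j) c y) = 0) \<longrightarrow>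
      (\<forall>c<n. y c = u (i * n + c) + (\<Sum>a\<in>{..<k} - {i}. \<alpha> a * u (a * n + c))) \<longrightarrow> \<Phi> u = 0)" for j b i \<Phi>
    have "\<exists>\<Phi>. W j b i \<Phi>" if "j < c" "b < n" "i < k" for j b i
      unfolding W_def using bad_tuples_not_dense[OF fp[OF that(1)] that(3,2)] unfolding Bex_def .
    then obtain \<Phi> where W: "\<And>j b i. j < c \<Longrightarrow> b < n \<Longrightarrow> i < k \<Longrightarrow> W j b i (\<Phi> j b i)" by metis
    note \<Phi> = W[unfolded W_def]
    \<comment> \<open>Needed for the minor formed from the first \<open>k\<close>
      coordinates.\<close>
    have kn: "k \<le> n"
    proof -
      have "k * 1 \<le> k * c" using ck(1) by (intro mult_left_mono) auto
      moreover have "(1 + k) * c = c + k * c" by simp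
      ultimately show ?thesis using ck(2) by linarith
    qed
    define \<Delta> where "\<Delta> V = ldet k (\<lambda>i j. V (i * n + j))" for V :: "nat \<Rightarrow> 'k"
    have \<Delta>p: "\<Delta> \<in> polyfun (k * n)" unfolding \<Delta>_def[abs_def]
      by (rule ldet_polyfun, rule index_bound) (use kn in auto)
    have \<Delta>1: "\<exists>V. \<Delta> V \<noteq> 0"
    proof -
      have "\<Delta> (\<lambda>l. if l div n = l mod n then 1 else 0) = ldet k (\<lambda>i j. if i = j then 1 else 0)"
        unfolding \<Delta>_def by (rule ldet_cong) (use kn in auto)
      then have "\<Delta> (\<lambda>l. if l div n = l mod n then 1 else 0) \<noteq> 0" unfolding ldet_identity by simp
      then show ?thesis by blast
    qed
    \<comment> \<open>\<open>None\<close> stands for the independence of the \<open>v a\<close>, the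
      other indices for the equations satisfied by bad tuples.\<close>
    define I where "I = insert None (Some ` ({..<c} \<times> {..<n} \<times> {..<k}))"
    define P where "P r = (case r of None \<Rightarrow> \<Delta> | Some (j, b, i) \<Rightarrow> \<Phi> j b i)" for r
    have "\<exists>V. \<forall>r\<in>I. P r V \<noteq> 0"
    proof (rule polyfun_nonzero_prod[of _ _ "k * n"])
      fix r assume r: "r \<in> I"
      have "P r \<in> polyfun (k * n) \<and> (\<exists>x. P r x \<noteq> 0)"
      proof (cases r)
        case None
        then show ?thesis using \<Delta>p \<Delta>1 by (simp add: P_def)
      next
        case (Some t)
        then obtain j b i where "t = (j, b, i)" "j < c" "b < n" "i < k" using r unfolding I_def by auto
        then show ?thesis using Some \<Phi>[of j b i, THEN conjunct1] \<Phi>[of j b i, THEN conjunct2, THEN conjunct1]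
          by (simp add: P_def)
      qed
      then show "P r \<in> polyfun (k * n)" "\<exists>x. P r x \<noteq> 0" by blast+
    qed (simp add: I_def)
    then obtain V where V0: "\<And>r. r \<in> I \<Longrightarrow> P r V \<noteq> 0" by blast
    have V: "\<Delta> V \<noteq> 0" "\<And>j b i. j < c \<Longrightarrow> b < n \<Longrightarrow> i < k \<Longrightarrow> \<Phi> j b i V \<noteq> 0"
      using V0[of None] V0[of "Some (_, _, _)"] by (simp_all add: I_def P_def)
    define v where "v a = (\<lambda>i. V (a * n + i))" for a
    define G where "G = f ` {..<c} \<union> D v"
    have "card G \<le> card (f ` {..<c}) + card (D v)" unfolding G_def by (rule card_Un_le)
    also have "\<dots> \<le> c + c * k" using cardF cardD[of v] Mc by simp
    finally have g2: "card G + 1 < n" using ck(2) by (simp add: algebra_simps)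
    have g1: "finite G" unfolding G_def using finD by simp
    have g3: "\<forall>g\<in>G. \<exists>e>0. homogeneous n e g" unfolding G_def by (rule hom)
    have g4: "(\<forall>j<c. f j x = 0) \<and> (\<forall>j<c. \<forall>a<k. dird (f j) x (v a) = 0) \<and>
      (\<forall>\<alpha> \<beta>. (\<forall>i<n. (\<Sum>a<k. \<alpha> a * v a i) = \<beta> * x i) \<longrightarrow> (\<forall>a<k. \<alpha> a = 0))"
      if x: "x \<in> cone_zeros n G" for x
    proof -
      have z: "f j y = 0 \<and> (\<forall>a<k. dird (f j) y (v a) = 0)" if "y \<in> cone_zeros n G" "j < c" for y j
      proof -
        have "(\<lambda>x. dird (f j) x (v a)) \<in> G" if "a < k" for a
          using \<open>j < c\<close> that unfolding G_def D_def Mc by force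
        moreover have "g y = 0" if "g \<in> G" for g using \<open>y \<in> cone_zeros n G\<close> that by (simp add: cone_zeros_def)
        moreover have "f j \<in> G" using \<open>j < c\<close> by (simp add: G_def)
        ultimately show ?thesis by blast
      qed
      have "\<alpha> i = 0" if e: "\<And>l. l < n \<Longrightarrow> (\<Sum>a<k. \<alpha> a * v a l) = \<beta> * x l" and i: "i < k" for \<alpha> \<beta> i
      proof (rule ccontr)
        assume ai: "\<alpha> i \<noteq> 0"
        define \<alpha>' where "\<alpha>' a = \<alpha> a / \<alpha> i" for a
        have ii: "i \<in> {..<k}" using i by simp
        have e': "\<beta> / \<alpha> i * x l = v i l + (\<Sum>a\<in>{..<k} - {i}. \<alpha>' a * v a l)" if "l < n" for l
        proof -
          have "\<beta> / \<alpha> i * x l = (\<Sum>a<k. \<alpha>' a * v a l)"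
            using e[OF that] ai by (simp add: \<alpha>'_def sum_divide_distrib[symmetric] field_simps)
          also have "\<dots> = v i l + (\<Sum>a\<in>{..<k} - {i}. \<alpha>' a * v a l)"
            using ai by (simp add: sum.remove[OF _ ii] \<alpha>'_def)
          finally show ?thesis .
        qed
        show False
        \<comment> \<open>A relation with \<open>\<beta> = 0\<close> is a dependence among the
          \<open>v a\<close>. Otherwise a nonzero multiple of \<open>x\<close> is a combination of
          the \<open>v a\<close>, and the tuple is bad for a form and a coordinate supplied by
          smoothness.\<close>
        proof (cases "\<beta> = 0")
          case True
          have "\<Delta> V = 0" unfolding \<Delta>_def
          proof (rule ldet_dependent_row[OF i])
            fix b assume "b < k"
            then have "v i b = - (\<Sum>a\<in>{..<k} - {i}. \<alpha>' a * v a b)"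
              using e'[of b] kn True by (simp add: eq_neg_iff_add_eq_0)
            then show "V (i * n + b) = (\<Sum>a\<in>{..<k} - {i}. - \<alpha>' a * V (a * n + b))"
              by (simp add: v_def sum_negf)
          qed
          then show False using V(1) by simp
        next
          case False
          define y where "y = fscale (\<beta> / \<alpha> i) x"
          have "\<forall>g\<in>G. \<exists>e. homogeneous n e g" using hom[of v] unfolding G_def by blast
          then obtain dg where dg: "\<And>g. g \<in> G \<Longrightarrow> homogeneous n (dg g) g" by metis
          have yG: "y \<in> cone_zeros n G" unfolding y_def
            by (rule cone_zeros_fscale[OF dg x]) (use False ai in auto)
          obtain j b where jb: "j < c" "b < n" "partial (f j) b y \<noteq> 0"
            using smooth[of y] z[OF yG] yG unfolding cone_zeros_def by auto
          have "\<Phi> j b i V = 0"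
          proof (rule \<Phi>[OF jb(1,2) i, THEN conjunct2, THEN conjunct2, rule_format])
            show "f j y = 0" using z[OF yG jb(1)] by simp
            show "partial (f j) b y \<noteq> 0" by (rule jb(3))
            show "(\<Sum>c<n. V (a * n + c) * partial (f j) c y) = 0" if "a < k" for a
              using z[OF yG jb(1)] that unfolding dird_partial[OF fp[OF jb(1)]] v_def by simp
            show "y l = V (i * n + l) + (\<Sum>a\<in>{..<k} - {i}. \<alpha>' a * V (a * n + l))" if "l < n" for l
              using e'[OF that] by (simp add: y_def fscale_def v_def)
          qed
          then show False using V(2)[OF jb(1,2) i] by simp
        qed
      qed
      then show ?thesis using z[OF x] by blast
    qed
    show ?thesis
      by (rule exI[of _ v], rule exI[of _ G], rule conjI[OF g1], rule conjI[OF g2], rule conjI[OF g3], rule ballI) (rule g4)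
  qed
qed


section \<open>Zariski-regular maps from subsets of affine space\<close>

definition zopen :: "nat \<Rightarrow> (nat \<Rightarrow> 'k::field) set \<Rightarrow> (nat \<Rightarrow> 'k) set \<Rightarrow> bool" where
  "zopen n T W \<longleftrightarrow> W \<subseteq> T \<and> (\<forall>p\<in>W. \<exists>Q\<in>polyfun n. Q p \<noteq> 0 \<and> (\<forall>x\<in>T. Q x \<noteq> 0 \<longrightarrow> x \<in> W))"

lemma zopenE:
  assumes "zopen n T W" "p \<in> W"
  obtains Q where "Q \<in> polyfun n" "Q p \<noteq> 0" "\<And>x. x \<in> T \<Longrightarrow> Q x \<noteq> 0 \<Longrightarrow> x \<in> W"
proof -
  from assms have "\<exists>Q\<in>polyfun n. Q p \<noteq> 0 \<and> (\<forall>x\<in>T. Q x \<noteq> 0 \<longrightarrow> x \<in> W)"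
    unfolding zopen_def by simp
  then show ?thesis
  proof (elim bexE conjE)
    fix Q assume "Q \<in> polyfun n" "Q p \<noteq> 0" "\<forall>x\<in>T. Q x \<noteq> 0 \<longrightarrow> x \<in> W"
    then show ?thesis by (intro that[of Q]) simp_all
  qed
qed

lemma zopen_self: "zopen n T T"
  unfolding zopen_def by (auto intro!: bexI[of _ "\<lambda>_. 1"] polyfun_const)

lemma zopen_empty: "zopen n T {}"
  unfolding zopen_def by auto

lemma zopen_Int: assumes "zopen n T U" "zopen n T V" shows "zopen n T (U \<inter> V)"
  unfolding zopen_def
proof (intro conjI ballI)
  show "U \<inter> V \<subseteq> T" using assms unfolding zopen_def by auto
  fix p assume "p \<in> U \<inter> V"
  then have p: "p \<in> U" "p \<in> V" by auto
  obtain Q where Q: "Q \<in> polyfun n" "Q p \<noteq> 0" "\<And>x. x \<in> T \<Longrightarrow> Q x \<noteq> 0 \<Longrightarrow> x \<in> U"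
    by (rule zopenE[OF assms(1) p(1)], rule that)
  obtain R where R: "R \<in> polyfun n" "R p \<noteq> 0" "\<And>x. x \<in> T \<Longrightarrow> R x \<noteq> 0 \<Longrightarrow> x \<in> V"
    by (rule zopenE[OF assms(2) p(2)], rule that)
  show "\<exists>Q\<in>polyfun n. Q p \<noteq> 0 \<and> (\<forall>x\<in>T. Q x \<noteq> 0 \<longrightarrow> x \<in> U \<inter> V)"
    by (rule bexI[of _ "\<lambda>x. Q x * R x"]) (use Q R in \<open>auto intro: polyfun_mult\<close>)
qed

lemma zopen_Union: assumes "\<And>U. U \<in> K \<Longrightarrow> zopen n T U" shows "zopen n T (\<Union>K)"
  unfolding zopen_def
proof (intro conjI ballI)
  show "\<Union>K \<subseteq> T" using assms unfolding zopen_def by blast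
  fix p assume "p \<in> \<Union>K"
  then obtain U where U: "U \<in> K" "p \<in> U" by blast
  obtain Q where Q: "Q \<in> polyfun n" "Q p \<noteq> 0" "\<And>x. x \<in> T \<Longrightarrow> Q x \<noteq> 0 \<Longrightarrow> x \<in> U"
    by (rule zopenE[OF assms[OF U(1)] U(2)], rule that)
  show "\<exists>Q\<in>polyfun n. Q p \<noteq> 0 \<and> (\<forall>x\<in>T. Q x \<noteq> 0 \<longrightarrow> x \<in> \<Union>K)"
    by (rule bexI[OF _ Q(1)]) (use Q U in auto)
qed

lemma zreg_cong: "zreg n U h \<Longrightarrow> (\<And>x. x \<in> U \<Longrightarrow> h x = g x) \<Longrightarrow> zreg n U g"
  unfolding zreg_def by simp

lemma zregI:
  assumes "\<And>p. p \<in> U \<Longrightarrow> \<exists>P Q. P \<in> polyfun n \<and> Q \<in> polyfun n \<and> Q p \<noteq> 0 \<and> (\<forall>x\<in>U. Q x \<noteq> 0 \<longrightarrow> h x = P x / Q x)"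
  shows "zreg n U h"
  unfolding zreg_def
proof
  fix p assume "p \<in> U"
  from assms[OF this] obtain P Q where "P \<in> polyfun n" "Q \<in> polyfun n" "Q p \<noteq> 0 \<and> (\<forall>x\<in>U. Q x \<noteq> 0 \<longrightarrow> h x = P x / Q x)"
    by (elim exE conjE) (rule that, assumption, assumption, rule conjI)
  then show "\<exists>P\<in>polyfun n. \<exists>Q\<in>polyfun n. Q p \<noteq> 0 \<and> (\<forall>x\<in>U. Q x \<noteq> 0 \<longrightarrow> h x = P x / Q x)"
    by (intro bexI)
qed

lemma zreg_subset: assumes "zreg n U h" "V \<subseteq> U" shows "zreg n V h"
proof (rule zregI)
  fix p assume "p \<in> V"
  then have "p \<in> U" using assms(2) by auto
  show "\<exists>P Q. P \<in> polyfun n \<and> Q \<in> polyfun n \<and> Q p \<noteq> 0 \<and> (\<forall>x\<in>V. Q x \<noteq> 0 \<longrightarrow> h x = P x / Q x)"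
  proof (rule zregE[OF assms(1) \<open>p \<in> U\<close>])
    fix P Q assume "P \<in> polyfun n" "Q \<in> polyfun n" "Q p \<noteq> 0" "\<And>x. x \<in> U \<Longrightarrow> Q x \<noteq> 0 \<Longrightarrow> h x = P x / Q x"
    then show ?thesis using assms(2) by (intro exI[of _ P] exI[of _ Q]) auto
  qed
qed

lemma zreg_polyfun: "p \<in> polyfun n \<Longrightarrow> zreg n U p"
  by (rule zregI, rule exI[of _ p], rule exI[of _ "\<lambda>_. 1"]) (auto intro: polyfun_const)

lemma zreg_const: "zreg n U (\<lambda>_. c)"
  by (rule zreg_polyfun[OF polyfun_const])

lemma zreg_add: assumes "zreg n U g" "zreg n U h" shows "zreg n U (\<lambda>x. g x + h x)"
proof (rule zregI)
  fix p assume p: "p \<in> U"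
  obtain P Q where PQ: "P \<in> polyfun n" "Q \<in> polyfun n" "Q p \<noteq> 0" "\<And>x. x \<in> U \<Longrightarrow> Q x \<noteq> 0 \<Longrightarrow> g x = P x / Q x"
    by (rule zregE[OF assms(1) p], rule that)
  obtain R S where RS: "R \<in> polyfun n" "S \<in> polyfun n" "S p \<noteq> 0" "\<And>x. x \<in> U \<Longrightarrow> S x \<noteq> 0 \<Longrightarrow> h x = R x / S x"
    by (rule zregE[OF assms(2) p], rule that)
  show "\<exists>P Q. P \<in> polyfun n \<and> Q \<in> polyfun n \<and> Q p \<noteq> 0 \<and> (\<forall>x\<in>U. Q x \<noteq> 0 \<longrightarrow> g x + h x = P x / Q x)"
    by (rule exI[of _ "\<lambda>x. P x * S x + R x * Q x"], rule exI[of _ "\<lambda>x. Q x * S x"])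
       (use PQ RS in \<open>auto intro!: polyfun_intros simp: field_simps\<close>)
qed

lemma zreg_mult: assumes "zreg n U g" "zreg n U h" shows "zreg n U (\<lambda>x. g x * h x)"
proof (rule zregI)
  fix p assume p: "p \<in> U"
  obtain P Q where PQ: "P \<in> polyfun n" "Q \<in> polyfun n" "Q p \<noteq> 0" "\<And>x. x \<in> U \<Longrightarrow> Q x \<noteq> 0 \<Longrightarrow> g x = P x / Q x"
    by (rule zregE[OF assms(1) p], rule that)
  obtain R S where RS: "R \<in> polyfun n" "S \<in> polyfun n" "S p \<noteq> 0" "\<And>x. x \<in> U \<Longrightarrow> S x \<noteq> 0 \<Longrightarrow> h x = R x / S x"
    by (rule zregE[OF assms(2) p], rule that)
  show "\<exists>P Q. P \<in> polyfun n \<and> Q \<in> polyfun n \<and> Q p \<noteq> 0 \<and> (\<forall>x\<in>U. Q x \<noteq> 0 \<longrightarrow> g x * h x = P x / Q x)"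
    by (rule exI[of _ "\<lambda>x. P x * R x"], rule exI[of _ "\<lambda>x. Q x * S x"])
       (use PQ RS in \<open>auto intro!: polyfun_intros simp: field_simps\<close>)
qed

lemma zreg_sum: "(\<And>i. i \<in> A \<Longrightarrow> zreg n U (h i)) \<Longrightarrow> zreg n U (\<lambda>x. \<Sum>i\<in>A. h i x)"
  by (induction A rule: infinite_finite_induct) (auto intro: zreg_const zreg_add)

lemma zreg_prod: "(\<And>i. i \<in> A \<Longrightarrow> zreg n U (h i)) \<Longrightarrow> zreg n U (\<lambda>x. \<Prod>i\<in>A. h i x)"
  by (induction A rule: infinite_finite_induct) (auto intro: zreg_const zreg_mult)

lemma zreg_divide:
  assumes "zreg n U g" "zreg n U h" shows "zreg n {x\<in>U. h x \<noteq> 0} (\<lambda>x. g x / h x)"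
proof (rule zregI)
  fix p assume p: "p \<in> {x\<in>U. h x \<noteq> 0}"
  then have pU: "p \<in> U" by simp
  obtain P Q where PQ: "P \<in> polyfun n" "Q \<in> polyfun n" "Q p \<noteq> 0" "\<And>x. x \<in> U \<Longrightarrow> Q x \<noteq> 0 \<Longrightarrow> g x = P x / Q x"
    by (rule zregE[OF assms(1) pU], rule that)
  obtain R S where RS: "R \<in> polyfun n" "S \<in> polyfun n" "S p \<noteq> 0" "\<And>x. x \<in> U \<Longrightarrow> S x \<noteq> 0 \<Longrightarrow> h x = R x / S x"
    by (rule zregE[OF assms(2) pU], rule that)
  have "R p \<noteq> 0" using RS p by auto
  \<comment> \<open>The additional factor \<open>S\<close> in numerator and denominator confines the
    identity to points where both given fractions are valid.\<close>
  then show "\<exists>P Q. P \<in> polyfun n \<and> Q \<in> polyfun n \<and> Q p \<noteq> 0 \<and> (\<forall>x\<in>{x\<in>U. h x \<noteq> 0}. Q x \<noteq> 0 \<longrightarrow> g x / h x = P x / Q x)"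
    by (intro exI[of _ "\<lambda>x. P x * (S x * S x)"] exI[of _ "\<lambda>x. Q x * (R x * S x)"])
       (use PQ RS in \<open>auto intro!: polyfun_intros simp: field_simps\<close>)
qed

lemma zreg_nonzero_open:
  assumes "zopen n T U" "zreg n U h" shows "zopen n T {x\<in>U. h x \<noteq> 0}"
  unfolding zopen_def
proof (intro conjI ballI)
  show "{x\<in>U. h x \<noteq> 0} \<subseteq> T" using assms(1) unfolding zopen_def by auto
  fix p assume p: "p \<in> {x\<in>U. h x \<noteq> 0}"
  then have pU: "p \<in> U" by simp
  obtain Q where Q: "Q \<in> polyfun n" "Q p \<noteq> 0" "\<And>x. x \<in> T \<Longrightarrow> Q x \<noteq> 0 \<Longrightarrow> x \<in> U"
    by (rule zopenE[OF assms(1) pU], rule that)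
  obtain R S where RS: "R \<in> polyfun n" "S \<in> polyfun n" "S p \<noteq> 0" "\<And>x. x \<in> U \<Longrightarrow> S x \<noteq> 0 \<Longrightarrow> h x = R x / S x"
    by (rule zregE[OF assms(2) pU], rule that)
  have "R p \<noteq> 0" using RS p by auto
  then show "\<exists>Q\<in>polyfun n. Q p \<noteq> 0 \<and> (\<forall>x\<in>T. Q x \<noteq> 0 \<longrightarrow> x \<in> {x\<in>U. h x \<noteq> 0})"
    by (intro bexI[of _ "\<lambda>x. Q x * (R x * S x)"]) (use Q RS in \<open>auto intro!: polyfun_intros\<close>)
qed

lemma zreg_local:
  assumes "U \<subseteq> T" "\<And>p. p \<in> U \<Longrightarrow> \<exists>V. zopen n T V \<and> p \<in> V \<and> zreg n (V \<inter> U) h"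
  shows "zreg n U h"
proof (rule zregI)
  fix p assume p: "p \<in> U"
  obtain V where V: "zopen n T V" "p \<in> V" "zreg n (V \<inter> U) h" using assms(2)[OF p] by blast
  obtain Q where Q: "Q \<in> polyfun n" "Q p \<noteq> 0" "\<And>x. x \<in> T \<Longrightarrow> Q x \<noteq> 0 \<Longrightarrow> x \<in> V"
    by (rule zopenE[OF V(1,2)], rule that)
  have pVU: "p \<in> V \<inter> U" using p V by simp
  obtain R S where RS: "R \<in> polyfun n" "S \<in> polyfun n" "S p \<noteq> 0" "\<And>x. x \<in> V \<inter> U \<Longrightarrow> S x \<noteq> 0 \<Longrightarrow> h x = R x / S x"
    by (rule zregE[OF V(3) pVU], rule that)
  show "\<exists>P Q. P \<in> polyfun n \<and> Q \<in> polyfun n \<and> Q p \<noteq> 0 \<and> (\<forall>x\<in>U. Q x \<noteq> 0 \<longrightarrow> h x = P x / Q x)"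
    by (rule exI[of _ "\<lambda>x. R x * Q x"], rule exI[of _ "\<lambda>x. S x * Q x"])
       (use Q RS assms(1) in \<open>auto intro!: polyfun_intros\<close>)
qed

lemma zreg_alg_gen:
  assumes "h \<in> alg_gen S" "\<And>s. s \<in> S \<Longrightarrow> zreg n U (\<lambda>x. s (\<Theta> x))"
  shows "zreg n U (\<lambda>x. h (\<Theta> x))"
  using assms(1)
proof (induction rule: alg_gen.induct)
  case (add g h)
  then show ?case using zreg_add[of n U "\<lambda>x. g (\<Theta> x)"] by simp
next
  case (mult g h)
  then show ?case using zreg_mult[of n U "\<lambda>x. g (\<Theta> x)"] by simp
qed (auto intro: zreg_const assms(2))

text \<open>The morphism condition for maps out of a set \<open>T\<close> of vectors, phrased with
  \<open>zopen\<close> and \<open>zreg\<close>, so that maps to frame and flag bundles can be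
  checked along the construction of these spaces.\<close>

definition zmor :: "nat \<Rightarrow> (nat \<Rightarrow> 'k::field) set \<Rightarrow> ('p, 'k) fspace \<Rightarrow> ((nat \<Rightarrow> 'k) \<Rightarrow> 'p) \<Rightarrow> bool" where
  "zmor n T M \<Theta> \<longleftrightarrow> (\<forall>x\<in>T. \<Theta> x \<in> points M) \<and>
    (\<forall>U. openin (opens M) U \<longrightarrow> zopen n T {x\<in>T. \<Theta> x \<in> U}) \<and>
    (\<forall>U g. openin (opens M) U \<longrightarrow> g \<in> regs M U \<longrightarrow> zreg n {x\<in>T. \<Theta> x \<in> U} (\<lambda>x. g (\<Theta> x)))"

lemma zmorD:
  assumes "zmor n T M \<Theta>"
  shows "x \<in> T \<Longrightarrow> \<Theta> x \<in> points M" "openin (opens M) U \<Longrightarrow> zopen n T {x\<in>T. \<Theta> x \<in> U}"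
    "openin (opens M) U \<Longrightarrow> g \<in> regs M U \<Longrightarrow> zreg n {x\<in>T. \<Theta> x \<in> U} (\<lambda>x. g (\<Theta> x))"
  using assms unfolding zmor_def by blast+

section \<open>Maps into generated spaces, subspaces and quotients\<close>

lemma points_generated_space: "points (generated_space A) = (\<Union>(D, h)\<in>A. {z\<in>D. h z \<noteq> 0})"
  unfolding points_def generated_space_def by (auto simp: topology_generated_by_topspace)

lemma opens_generated_space: "opens (generated_space A) = topology_generated_by {{z \<in> D. h z \<noteq> 0} |D h. (D, h) \<in> A}"
  unfolding generated_space_def by simp

lemma regs_generated_spaceI:
  assumes "\<And>z. z \<in> W \<Longrightarrow> \<exists>D g h. (D, g) \<in> A \<and> (D, h) \<in> A \<and> z \<in> D \<and> h z \<noteq> 0 \<and>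
    (\<forall>w \<in> W \<inter> D. h w \<noteq> 0 \<longrightarrow> f w = g w / h w)"
  shows "f \<in> regs (generated_space A) W"
  using assms unfolding generated_space_def by simp

lemma regs_generated_spaceE:
  assumes "f \<in> regs (generated_space A) W" "z \<in> W"
  obtains D g h where "(D, g) \<in> A" "(D, h) \<in> A" "z \<in> D" "h z \<noteq> 0"
    "\<And>w. w \<in> W \<Longrightarrow> w \<in> D \<Longrightarrow> h w \<noteq> 0 \<Longrightarrow> f w = g w / h w"
proof -
  from assms have "\<exists>D g h. (D, g) \<in> A \<and> (D, h) \<in> A \<and> z \<in> D \<and> h z \<noteq> 0 \<and>
    (\<forall>w \<in> W \<inter> D. h w \<noteq> 0 \<longrightarrow> f w = g w / h w)" unfolding generated_space_def by simp
  then show ?thesis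
  proof (elim exE conjE)
    fix D g h assume "(D, g) \<in> A" "(D, h) \<in> A" "z \<in> D" "h z \<noteq> 0" "\<forall>w \<in> W \<inter> D. h w \<noteq> 0 \<longrightarrow> f w = g w / h w"
    then show ?thesis by (intro that[of D g h]) simp_all
  qed
qed

lemma zmor_generated_space:
  assumes o: "\<And>D h. (D, h) \<in> A \<Longrightarrow> zopen n T {x\<in>T. \<Theta> x \<in> D}"
    and r: "\<And>D h. (D, h) \<in> A \<Longrightarrow> zreg n {x\<in>T. \<Theta> x \<in> D} (\<lambda>x. h (\<Theta> x))"
    and p: "\<And>x. x \<in> T \<Longrightarrow> \<Theta> x \<in> points (generated_space A)"
  shows "zmor n T (generated_space A) \<Theta>"
proof -
  have basic: "zopen n T {x\<in>T. \<Theta> x \<in> D \<and> h (\<Theta> x) \<noteq> 0}" if "(D, h) \<in> A" for D h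
    using zreg_nonzero_open[OF o[OF that] r[OF that]] by (simp add: conj_assoc)
  have 1: "zopen n T {x\<in>T. \<Theta> x \<in> U}" if "openin (opens (generated_space A)) U" for U
    using that unfolding opens_generated_space openin_topology_generated_by_iff
  proof (induction rule: generate_topology_on.induct)
    case Empty
    show ?case by (simp add: zopen_empty)
  next
    case (Int a b)
    have "{x\<in>T. \<Theta> x \<in> a \<inter> b} = {x\<in>T. \<Theta> x \<in> a} \<inter> {x\<in>T. \<Theta> x \<in> b}" by auto
    then show ?case using zopen_Int[OF Int.IH] by simp
  next
    case (UN K)
    have "{x\<in>T. \<Theta> x \<in> \<Union>K} = \<Union>((\<lambda>k. {x\<in>T. \<Theta> x \<in> k}) ` K)" by auto
    then show ?case using UN by (auto intro!: zopen_Union)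
  next
    case (Basis s)
    then show ?case using basic by auto
  qed
  have 2: "zreg n {x\<in>T. \<Theta> x \<in> U} (\<lambda>x. f (\<Theta> x))" if U: "openin (opens (generated_space A)) U" and f: "f \<in> regs (generated_space A) U" for U f
  proof (rule zreg_local[of _ T])
    fix x assume x: "x \<in> {x\<in>T. \<Theta> x \<in> U}"
    then have "\<Theta> x \<in> U" by simp
    obtain D g h where D: "(D, g) \<in> A" "(D, h) \<in> A" "\<Theta> x \<in> D" "h (\<Theta> x) \<noteq> 0"
      "\<And>w. w \<in> U \<Longrightarrow> w \<in> D \<Longrightarrow> h w \<noteq> 0 \<Longrightarrow> f w = g w / h w"
      by (rule regs_generated_spaceE[OF f \<open>\<Theta> x \<in> U\<close>], rule that)
    let ?V = "{x\<in>T. \<Theta> x \<in> D \<and> h (\<Theta> x) \<noteq> 0}"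
    have "zreg n {x \<in> {x\<in>T. \<Theta> x \<in> D}. h (\<Theta> x) \<noteq> 0} (\<lambda>x. g (\<Theta> x) / h (\<Theta> x))"
      by (rule zreg_divide[OF r[OF D(1)] r[OF D(2)]])
    then have "zreg n (?V \<inter> {x\<in>T. \<Theta> x \<in> U}) (\<lambda>x. g (\<Theta> x) / h (\<Theta> x))" by (rule zreg_subset) auto
    then have "zreg n (?V \<inter> {x\<in>T. \<Theta> x \<in> U}) (\<lambda>x. f (\<Theta> x))" by (rule zreg_cong) (use D in auto)
    then show "\<exists>V. zopen n T V \<and> x \<in> V \<and> zreg n (V \<inter> {x\<in>T. \<Theta> x \<in> U}) (\<lambda>x. f (\<Theta> x))"
      using basic[OF D(2)] x D by (intro exI[of _ ?V]) auto
  qed auto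
  show ?thesis unfolding zmor_def using 1 2 p by blast
qed

lemma points_sub_fspace: "points (sub_fspace M S) = points M \<inter> S"
  unfolding points_def sub_fspace_def by simp

lemma openin_sub_fspace: "openin (opens (sub_fspace M S)) U \<longleftrightarrow> (\<exists>V. openin (opens M) V \<and> U = V \<inter> S)"
  unfolding sub_fspace_def by (simp add: openin_subtopology)

lemma regs_sub_fspace:
  "f \<in> regs (sub_fspace M S) W \<longleftrightarrow> (\<forall>x\<in>W. \<exists>U g. openin (opens M) U \<and> x \<in> U \<and> g \<in> regs M U \<and> (\<forall>y \<in> U \<inter> W. f y = g y))"
  unfolding sub_fspace_def by simp

lemma zmor_sub_fspace:
  assumes "zmor n T M \<Theta>" "\<And>x. x \<in> T \<Longrightarrow> \<Theta> x \<in> S"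
  shows "zmor n T (sub_fspace M S) \<Theta>"
proof -
  have pre: "{x\<in>T. \<Theta> x \<in> V \<inter> S} = {x\<in>T. \<Theta> x \<in> V}" for V using assms(2) by auto
  have 2: "zreg n {x\<in>T. \<Theta> x \<in> U} (\<lambda>x. f (\<Theta> x))" if f: "f \<in> regs (sub_fspace M S) U" for U f
  proof (rule zreg_local[of _ T])
    fix x assume x: "x \<in> {x\<in>T. \<Theta> x \<in> U}"
    then have "\<exists>V g. openin (opens M) V \<and> \<Theta> x \<in> V \<and> g \<in> regs M V \<and> (\<forall>y \<in> V \<inter> U. f y = g y)"
      using f unfolding regs_sub_fspace by simp
    then obtain V g where V: "openin (opens M) V" "\<Theta> x \<in> V" "g \<in> regs M V" "\<And>y. y \<in> V \<inter> U \<Longrightarrow> f y = g y"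
      by metis
    have "zreg n ({x\<in>T. \<Theta> x \<in> V} \<inter> {x\<in>T. \<Theta> x \<in> U}) (\<lambda>x. g (\<Theta> x))"
      by (rule zreg_subset[OF zmorD(3)[OF assms(1) V(1,3)]]) auto
    then have "zreg n ({x\<in>T. \<Theta> x \<in> V} \<inter> {x\<in>T. \<Theta> x \<in> U}) (\<lambda>x. f (\<Theta> x))" by (rule zreg_cong) (use V in auto)
    then show "\<exists>V. zopen n T V \<and> x \<in> V \<and> zreg n (V \<inter> {x\<in>T. \<Theta> x \<in> U}) (\<lambda>x. f (\<Theta> x))"
      using zmorD(2)[OF assms(1) V(1)] x V(2) by (intro exI[of _ "{x\<in>T. \<Theta> x \<in> V}"]) auto
  qed auto
  have 1: "zopen n T {x\<in>T. \<Theta> x \<in> U}" if U: "openin (opens (sub_fspace M S)) U" for U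
  proof -
    obtain V where V: "openin (opens M) V" "U = V \<inter> S" using U unfolding openin_sub_fspace by blast
    show ?thesis unfolding V(2) pre by (rule zmorD(2)[OF assms(1) V(1)])
  qed
  have 3: "\<Theta> x \<in> points (sub_fspace M S)" if "x \<in> T" for x
    using zmorD(1)[OF assms(1)] assms(2) that by (simp add: points_sub_fspace)
  show ?thesis unfolding zmor_def by (intro conjI ballI allI impI 1 2 3)
qed

lemma openin_quotient_fspace:
  "openin (opens (quotient_fspace q M Q)) U \<longleftrightarrow> U \<subseteq> Q \<and> openin (opens M) {z \<in> points M. q z \<in> U}"
proof -
  have "istopology (\<lambda>U. U \<subseteq> Q \<and> openin (opens M) {z \<in> points M. q z \<in> U})"
    unfolding istopology_def
  proof (intro conjI allI impI)
    fix S T assume "S \<subseteq> Q \<and> openin (opens M) {z \<in> points M. q z \<in> S}" "T \<subseteq> Q \<and> openin (opens M) {z \<in> points M. q z \<in> T}"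
    moreover have "{z \<in> points M. q z \<in> S \<inter> T} = {z \<in> points M. q z \<in> S} \<inter> {z \<in> points M. q z \<in> T}" by auto
    ultimately show "S \<inter> T \<subseteq> Q" "openin (opens M) {z \<in> points M. q z \<in> S \<inter> T}" by auto
  next
    fix K assume "\<forall>S\<in>K. S \<subseteq> Q \<and> openin (opens M) {z \<in> points M. q z \<in> S}"
    moreover have "{z \<in> points M. q z \<in> \<Union>K} = \<Union>((\<lambda>S. {z \<in> points M. q z \<in> S}) ` K)" by auto
    ultimately show "\<Union>K \<subseteq> Q" "openin (opens M) {z \<in> points M. q z \<in> \<Union>K}" by (auto intro!: openin_Union)
  qed
  then show ?thesis unfolding quotient_fspace_def by (simp add: topology_inverse')
qed

lemma regs_quotient_fspace:
  "f \<in> regs (quotient_fspace q M Q) U \<longleftrightarrow> (\<lambda>z. f (q z)) \<in> regs M {z \<in> points M. q z \<in> U}"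
  unfolding quotient_fspace_def by (simp add: o_def)

lemma points_quotient_fspace:
  assumes "\<And>z. z \<in> points M \<Longrightarrow> q z \<in> Q" shows "points (quotient_fspace q M Q) = Q"
proof -
  have "{z \<in> points M. q z \<in> Q} = topspace (opens M)" using assms by (auto simp: points_def)
  then have "openin (opens (quotient_fspace q M Q)) Q" unfolding openin_quotient_fspace by simp
  moreover have "U \<subseteq> Q" if "openin (opens (quotient_fspace q M Q)) U" for U
    using that unfolding openin_quotient_fspace by simp
  ultimately show ?thesis unfolding points_def by (meson openin_subset openin_topspace subset_antisym)
qed

lemma zmor_quotient_fspace:
  assumes "zmor n T M \<Theta>" "\<And>z. z \<in> points M \<Longrightarrow> q z \<in> Q"
  shows "zmor n T (quotient_fspace q M Q) (\<lambda>x. q (\<Theta> x))"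
proof -
  have pre: "{x\<in>T. q (\<Theta> x) \<in> U} = {x\<in>T. \<Theta> x \<in> {z \<in> points M. q z \<in> U}}" for U
    using zmorD(1)[OF assms(1)] by auto
  let ?N = "quotient_fspace q M Q"
  have 1: "q (\<Theta> x) \<in> points ?N" if "x \<in> T" for x
    using zmorD(1)[OF assms(1) that] assms(2) points_quotient_fspace[of M q Q, OF assms(2)] by simp
  have 2: "zopen n T {x \<in> T. q (\<Theta> x) \<in> U}" if "openin (opens ?N) U" for U
    unfolding pre using that by (intro zmorD(2)[OF assms(1)]) (simp add: openin_quotient_fspace)
  have 3: "zreg n {x \<in> T. q (\<Theta> x) \<in> U} (\<lambda>x. g (q (\<Theta> x)))" if "openin (opens ?N) U" "g \<in> regs ?N U" for U g
    unfolding pre using that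
    by (intro zmorD(3)[OF assms(1), of _ "\<lambda>z. g (q z)"]) (simp_all add: openin_quotient_fspace regs_quotient_fspace)
  show ?thesis unfolding zmor_def by (intro conjI ballI allI impI 1 2 3)
qed

text \<open>An \<open>fspace\<close> is arbitrary data; these closure properties are what allows
  sections of bundles to be restricted and scaled.\<close>

definition fspace_ok :: "('p, 'k::field) fspace \<Rightarrow> bool" where
  "fspace_ok M \<longleftrightarrow> (\<forall>U V f. f \<in> regs M U \<longrightarrow> V \<subseteq> U \<longrightarrow> f \<in> regs M V) \<and>
    (\<forall>U f c. f \<in> regs M U \<longrightarrow> (\<lambda>x. c * f x) \<in> regs M U)"

lemma fspace_okD:
  assumes "fspace_ok M"
  shows "f \<in> regs M U \<Longrightarrow> V \<subseteq> U \<Longrightarrow> f \<in> regs M V" "f \<in> regs M U \<Longrightarrow> (\<lambda>x. c * f x) \<in> regs M U"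
  using assms unfolding fspace_ok_def by blast+

lemma fspace_ok_generated_space:
  assumes "\<And>D g c. (D, g) \<in> A \<Longrightarrow> (D, \<lambda>x. c * g x) \<in> A"
  shows "fspace_ok (generated_space A)"
  unfolding fspace_ok_def
proof (intro conjI allI impI)
  fix U V f assume f: "f \<in> regs (generated_space A) U" and "V \<subseteq> U"
  show "f \<in> regs (generated_space A) V"
  proof (rule regs_generated_spaceI)
    fix z assume "z \<in> V"
    then have "z \<in> U" using \<open>V \<subseteq> U\<close> by blast
    show "\<exists>D g h. (D, g) \<in> A \<and> (D, h) \<in> A \<and> z \<in> D \<and> h z \<noteq> 0 \<and>
      (\<forall>w \<in> V \<inter> D. h w \<noteq> 0 \<longrightarrow> f w = g w / h w)"
    proof (rule regs_generated_spaceE[OF f \<open>z \<in> U\<close>])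
      fix D g h assume "(D, g) \<in> A" "(D, h) \<in> A" "z \<in> D" "h z \<noteq> 0"
        "\<And>w. w \<in> U \<Longrightarrow> w \<in> D \<Longrightarrow> h w \<noteq> 0 \<Longrightarrow> f w = g w / h w"
      then show ?thesis using \<open>V \<subseteq> U\<close> by (intro exI[of _ D] exI[of _ g] exI[of _ h]) auto
    qed
  qed
next
  fix U f c assume f: "f \<in> regs (generated_space A) U"
  show "(\<lambda>x. c * f x) \<in> regs (generated_space A) U"
  proof (rule regs_generated_spaceI)
    fix z assume "z \<in> U"
    show "\<exists>D g h. (D, g) \<in> A \<and> (D, h) \<in> A \<and> z \<in> D \<and> h z \<noteq> 0 \<and>
      (\<forall>w \<in> U \<inter> D. h w \<noteq> 0 \<longrightarrow> c * f w = g w / h w)"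
    proof (rule regs_generated_spaceE[OF f \<open>z \<in> U\<close>])
      fix D g h assume "(D, g) \<in> A" "(D, h) \<in> A" "z \<in> D" "h z \<noteq> 0"
        "\<And>w. w \<in> U \<Longrightarrow> w \<in> D \<Longrightarrow> h w \<noteq> 0 \<Longrightarrow> f w = g w / h w"
      then show ?thesis using assms[of D g c] by (intro exI[of _ D] exI[of _ "\<lambda>x. c * g x"] exI[of _ h]) auto
    qed
  qed
qed

lemma fspace_ok_sub_fspace:
  assumes "fspace_ok M" shows "fspace_ok (sub_fspace M S)"
  unfolding fspace_ok_def regs_sub_fspace
proof (intro conjI allI impI)
  fix U V :: "'a set" and f
  assume f: "\<forall>x\<in>U. \<exists>Ua g. openin (opens M) Ua \<and> x \<in> Ua \<and> g \<in> regs M Ua \<and> (\<forall>y\<in>Ua \<inter> U. f y = g y)" and VU: "V \<subseteq> U"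
  show "\<forall>x\<in>V. \<exists>Ua g. openin (opens M) Ua \<and> x \<in> Ua \<and> g \<in> regs M Ua \<and> (\<forall>y\<in>Ua \<inter> V. f y = g y)"
  proof
    fix x assume "x \<in> V"
    then obtain W g where "openin (opens M) W" "x \<in> W" "g \<in> regs M W" "\<forall>y\<in>W \<inter> U. f y = g y" using f VU by blast
    then show "\<exists>Ua g. openin (opens M) Ua \<and> x \<in> Ua \<and> g \<in> regs M Ua \<and> (\<forall>y\<in>Ua \<inter> V. f y = g y)"
      using VU by (intro exI[of _ W] exI[of _ g]) auto
  qed
next
  fix U :: "'a set" and f c
  assume f: "\<forall>x\<in>U. \<exists>Ua g. openin (opens M) Ua \<and> x \<in> Ua \<and> g \<in> regs M Ua \<and> (\<forall>y\<in>Ua \<inter> U. f y = g y)"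
  show "\<forall>x\<in>U. \<exists>Ua g. openin (opens M) Ua \<and> x \<in> Ua \<and> g \<in> regs M Ua \<and> (\<forall>y\<in>Ua \<inter> U. c * f y = g y)"
  proof
    fix x assume "x \<in> U"
    then obtain V g where "openin (opens M) V" "x \<in> V" "g \<in> regs M V" "\<forall>y\<in>V \<inter> U. f y = g y" using f by blast
    then show "\<exists>Ua g. openin (opens M) Ua \<and> x \<in> Ua \<and> g \<in> regs M Ua \<and> (\<forall>y\<in>Ua \<inter> U. c * f y = g y)"
      using fspace_okD(2)[OF assms, of g V c] by (intro exI[of _ V] exI[of _ "\<lambda>x. c * g x"]) auto
  qed
qed

lemma fspace_ok_quotient_fspace:
  assumes "fspace_ok M" shows "fspace_ok (quotient_fspace q M Q)"
  unfolding fspace_ok_def regs_quotient_fspace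
proof (intro conjI allI impI)
  fix U V f assume f: "(\<lambda>z. f (q z)) \<in> regs M {z \<in> points M. q z \<in> U}" and "V \<subseteq> U"
  then show "(\<lambda>z. f (q z)) \<in> regs M {z \<in> points M. q z \<in> V}"
    by (intro fspace_okD(1)[OF assms f]) auto
next
  fix U f c assume f: "(\<lambda>z. f (q z)) \<in> regs M {z \<in> points M. q z \<in> U}"
  show "(\<lambda>z. c * f (q z)) \<in> regs M {z \<in> points M. q z \<in> U}" by (rule fspace_okD(2)[OF assms f])
qed


section \<open>Frames and flags in the dual of a bundle\<close>

lemma alg_gen_add: "g \<in> alg_gen S \<Longrightarrow> h \<in> alg_gen S \<Longrightarrow> (\<lambda>z. g z + h z) \<in> alg_gen S"
  using alg_gen.add[of g S h] by (simp add: plus_fun_def)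

lemma alg_gen_mult: "g \<in> alg_gen S \<Longrightarrow> h \<in> alg_gen S \<Longrightarrow> (\<lambda>z. g z * h z) \<in> alg_gen S"
  using alg_gen.mult[of g S h] by (simp add: times_fun_def)

lemma alg_gen_sum: "(\<And>i. i \<in> A \<Longrightarrow> h i \<in> alg_gen S) \<Longrightarrow> (\<lambda>z. \<Sum>i\<in>A. h i z) \<in> alg_gen S"
  by (induction A rule: infinite_finite_induct) (auto intro: alg_gen.const alg_gen_add)

lemma alg_gen_prod: "(\<And>i. i \<in> A \<Longrightarrow> h i \<in> alg_gen S) \<Longrightarrow> (\<lambda>z. \<Prod>i\<in>A. h i z) \<in> alg_gen S"
  by (induction A rule: infinite_finite_induct) (auto intro: alg_gen.const alg_gen_mult)

lemma alg_gen_power: "h \<in> alg_gen S \<Longrightarrow> (\<lambda>z. h z ^ m) \<in> alg_gen S"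
  by (induction m) (auto intro: alg_gen.const alg_gen_mult)

definition tuple_gens :: "('p, 'k::field) fspace \<Rightarrow> ('p, 'v, 'k) fbundle \<Rightarrow> nat \<Rightarrow> 'p set \<Rightarrow>
    ('p \<times> (('v \<Rightarrow> 'k) \<Rightarrow> 'k) list \<Rightarrow> 'k) set" where
  "tuple_gens M E k U = {(\<lambda>(y, \<phi>s). a y) |a. a \<in> regs M U} \<union>
     {(\<lambda>(y, \<phi>s). (\<phi>s ! j) (s y)) |j s. j < k \<and> s \<in> E U}"

lemma dual_tuples_alt: "dual_tuples M E k = generated_space {(dual_tuples_over M E k U, h) |U h.
     openin (opens M) U \<and> h \<in> alg_gen (tuple_gens M E k U)}"
  unfolding dual_tuples_def tuple_gens_def ..

lemma points_dual_tuples: "points (dual_tuples M E k) = dual_tuples_over M E k (points M)"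
proof
  show "points (dual_tuples M E k) \<subseteq> dual_tuples_over M E k (points M)"
  proof
    fix z assume "z \<in> points (dual_tuples M E k)"
    then obtain U where "openin (opens M) U" "z \<in> dual_tuples_over M E k U"
      unfolding dual_tuples_alt points_generated_space by auto
    then show "z \<in> dual_tuples_over M E k (points M)"
      using openin_subset[of "opens M" U] unfolding dual_tuples_over_def points_def by auto
  qed
next
  have "(dual_tuples_over M E k (points M), \<lambda>_. 1) \<in> {(dual_tuples_over M E k U, h) |U h.
     openin (opens M) U \<and> h \<in> alg_gen (tuple_gens M E k U)}"
    by (auto simp: points_def intro!: alg_gen.const)
  then show "dual_tuples_over M E k (points M) \<subseteq> points (dual_tuples M E k)"
    unfolding dual_tuples_alt points_generated_space by force
qed

lemma points_frame_bundle:
  "(y, \<phi>s) \<in> points (frame_bundle M E k) \<longleftrightarrow> y \<in> points M \<and> length \<phi>s = k \<and> set \<phi>s \<subseteq> dual_fibre M E y \<and>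
     distinct \<phi>s \<and> fvs.independent (set \<phi>s)"
  unfolding frame_bundle_def points_sub_fspace points_dual_tuples dual_tuples_over_def by auto

lemma openin_dual_tuples:
  assumes "openin (opens M) U" "h \<in> alg_gen (tuple_gens M E k U)"
  shows "openin (opens (dual_tuples M E k)) {z \<in> dual_tuples_over M E k U. h z \<noteq> 0}"
  unfolding dual_tuples_alt opens_generated_space
  by (rule topology_generated_by_Basis) (use assms in blast)

lemma openin_frame_bundle:
  assumes "openin (opens M) U" "h \<in> alg_gen (tuple_gens M E k U)"
  shows "openin (opens (frame_bundle M E k)) {z \<in> points (frame_bundle M E k). fst z \<in> U \<and> h z \<noteq> 0}"
proof -
  have "openin (opens (frame_bundle M E k)) ({z \<in> dual_tuples_over M E k U. h z \<noteq> 0} \<inter>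
    {(y, \<phi>s) \<in> points (dual_tuples M E k). distinct \<phi>s \<and> fvs.independent (set \<phi>s)})"
    unfolding frame_bundle_def openin_sub_fspace using openin_dual_tuples[OF assms] by blast
  also have "{z \<in> dual_tuples_over M E k U. h z \<noteq> 0} \<inter>
    {(y, \<phi>s) \<in> points (dual_tuples M E k). distinct \<phi>s \<and> fvs.independent (set \<phi>s)} =
    {z \<in> points (frame_bundle M E k). fst z \<in> U \<and> h z \<noteq> 0}"
    by (auto simp: points_frame_bundle points_dual_tuples dual_tuples_over_def)
  finally show ?thesis .
qed

lemma regs_frame_bundle:
  assumes U: "openin (opens M) U" and g: "g \<in> alg_gen (tuple_gens M E k U)" and h: "h \<in> alg_gen (tuple_gens M E k U)"
    and W: "W \<subseteq> points (frame_bundle M E k)"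
    and f: "\<And>w. w \<in> W \<Longrightarrow> fst w \<in> U \<and> h w \<noteq> 0 \<and> f w = g w / h w"
  shows "f \<in> regs (frame_bundle M E k) W"
  unfolding frame_bundle_def regs_sub_fspace
proof
  let ?V = "{z \<in> dual_tuples_over M E k U. h z \<noteq> 0}"
  fix x assume x: "x \<in> W"
  have "(\<lambda>z. g z / h z) \<in> regs (dual_tuples M E k) ?V"
    unfolding dual_tuples_alt
  proof (rule regs_generated_spaceI)
    fix z assume "z \<in> ?V"
    then show "\<exists>D g' h'. (D, g') \<in> {(dual_tuples_over M E k U, h) |U h. openin (opens M) U \<and> h \<in> alg_gen (tuple_gens M E k U)} \<and>
      (D, h') \<in> {(dual_tuples_over M E k U, h) |U h. openin (opens M) U \<and> h \<in> alg_gen (tuple_gens M E k U)} \<and>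
      z \<in> D \<and> h' z \<noteq> 0 \<and> (\<forall>w\<in>?V \<inter> D. h' w \<noteq> 0 \<longrightarrow> g w / h w = g' w / h' w)"
      using U g h by (intro exI[of _ "dual_tuples_over M E k U"] exI[of _ g] exI[of _ h]) auto
  qed
  moreover have "x \<in> ?V"
  proof -
    have "x \<in> points (frame_bundle M E k)" using x W by blast
    then show ?thesis using f[OF x] by (cases x) (auto simp: points_frame_bundle dual_tuples_over_def)
  qed
  ultimately show "\<exists>V g. openin (opens (dual_tuples M E k)) V \<and> x \<in> V \<and> g \<in> regs (dual_tuples M E k) V \<and> (\<forall>y \<in> V \<inter> W. f y = g y)"
    using openin_dual_tuples[OF U h] f by (intro exI[of _ ?V] exI[of _ "\<lambda>z. g z / h z"]) auto
qed

lemma fspace_ok_frame_bundle: "fspace_ok (frame_bundle M E k)"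
  unfolding frame_bundle_def dual_tuples_alt
proof (intro fspace_ok_sub_fspace fspace_ok_generated_space)
  fix D :: "('a \<times> (('b \<Rightarrow> 'c) \<Rightarrow> 'c) list) set" and g c
  assume "(D, g) \<in> {(dual_tuples_over M E k U, h) |U h. openin (opens M) U \<and> h \<in> alg_gen (tuple_gens M E k U)}"
  then show "(D, \<lambda>x. c * g x) \<in> {(dual_tuples_over M E k U, h) |U h. openin (opens M) U \<and> h \<in> alg_gen (tuple_gens M E k U)}"
    using alg_gen_mult[OF alg_gen.const[of c]] by auto
qed

text \<open>Regularity is tested on generators, that is, on functions of the base and on the
  pairings of the functionals with sections.\<close>

lemma zmor_frame_bundle:
  assumes y: "zmor n T M y" and p: "\<And>x. x \<in> T \<Longrightarrow> (y x, \<phi> x) \<in> points (frame_bundle M E k)"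
    and r: "\<And>U s j. openin (opens M) U \<Longrightarrow> s \<in> E U \<Longrightarrow> j < k \<Longrightarrow> zreg n {x\<in>T. y x \<in> U} (\<lambda>x. (\<phi> x ! j) (s (y x)))"
  shows "zmor n T (frame_bundle M E k) (\<lambda>x. (y x, \<phi> x))"
proof -
  have over: "{x\<in>T. (y x, \<phi> x) \<in> dual_tuples_over M E k U} = {x\<in>T. y x \<in> U}" for U
    using p unfolding points_frame_bundle dual_tuples_over_def by auto
  have "zmor n T (dual_tuples M E k) (\<lambda>x. (y x, \<phi> x))"
    unfolding dual_tuples_alt
  proof (rule zmor_generated_space)
    fix D h assume "(D, h) \<in> {(dual_tuples_over M E k U, h) |U h. openin (opens M) U \<and> h \<in> alg_gen (tuple_gens M E k U)}"
    then obtain U where U: "D = dual_tuples_over M E k U" "openin (opens M) U" "h \<in> alg_gen (tuple_gens M E k U)" by blast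
    show "zopen n T {x\<in>T. (y x, \<phi> x) \<in> D}" unfolding U(1) over by (rule zmorD(2)[OF y U(2)])
    show "zreg n {x\<in>T. (y x, \<phi> x) \<in> D} (\<lambda>x. h (y x, \<phi> x))"
      unfolding U(1) over
    proof (rule zreg_alg_gen[OF U(3)])
      fix s assume "s \<in> tuple_gens M E k U"
      then show "zreg n {x\<in>T. y x \<in> U} (\<lambda>x. s (y x, \<phi> x))"
        unfolding tuple_gens_def using zmorD(3)[OF y U(2)] r[OF U(2)] by auto
    qed
  next
    fix x assume "x \<in> T"
    then show "(y x, \<phi> x) \<in> points (generated_space {(dual_tuples_over M E k U, h) |U h. openin (opens M) U \<and> h \<in> alg_gen (tuple_gens M E k U)})"
      using p[of x] unfolding dual_tuples_alt[symmetric] by (simp add: frame_bundle_def points_sub_fspace)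
  qed
  then show ?thesis unfolding frame_bundle_def
    using p by (intro zmor_sub_fspace) (auto simp: frame_bundle_def points_sub_fspace)
qed

lemma subspace_dual_fibre: "fvs.subspace (dual_fibre M E y)"
  unfolding fvs.subspace_def dual_fibre_def by (auto simp: fscale_def algebra_simps)

text \<open>Covers the jump sequence of a partition as well as \<open>[1]\<close>, the type of the
  projective bundle.\<close>

definition valid_type :: "nat list \<Rightarrow> bool" where
  "valid_type s \<longleftrightarrow> s \<noteq> [] \<and> sorted_wrt (>) s \<and> (\<forall>d\<in>set s. 0 < d)"

lemma valid_type_nth: "valid_type s \<Longrightarrow> i < j \<Longrightarrow> j < length s \<Longrightarrow> s ! j < s ! i"
  unfolding valid_type_def by (simp add: sorted_wrt_iff_nth_less)

lemma valid_type_pos: "valid_type s \<Longrightarrow> i < length s \<Longrightarrow> 0 < s ! i"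
  unfolding valid_type_def by simp

lemma nth_rank_antimono: "valid_type s \<Longrightarrow> i \<le> j \<Longrightarrow> nth_rank s j \<le> nth_rank s i"
  using valid_type_nth[of s i j] unfolding nth_rank_def by (cases "i = j") auto

lemma nth_rank_le_hd: "valid_type s \<Longrightarrow> nth_rank s i \<le> hd s"
  using nth_rank_antimono[of s 0 i] by (auto simp: nth_rank_def valid_type_def hd_conv_nth)

lemma hd_nth_rank: "valid_type s \<Longrightarrow> hd s = nth_rank s 0"
  by (auto simp: nth_rank_def valid_type_def hd_conv_nth)

lemma nth_rank_less: "valid_type s \<Longrightarrow> i < length s \<Longrightarrow> nth_rank s (Suc i) < nth_rank s i"
  using valid_type_nth[of s i "Suc i"] valid_type_pos[of s i] by (auto simp: nth_rank_def)

lemma fst_flag_of [simp]: "fst (flag_of s z) = fst z"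
  by (cases z) (simp add: flag_of_def)

lemma nth_sub_flag_of:
  "nth_sub (snd (flag_of s (y, \<phi>s))) i = fvs.span (set (take (nth_rank s i) \<phi>s))"
  unfolding nth_sub_def flag_of_def nth_rank_def by auto

lemma flag_of_in_flags:
  assumes s: "valid_type s" and p: "(y, \<phi>s) \<in> points (frame_bundle M E (hd s))"
  shows "flag_of s (y, \<phi>s) \<in> flags M E s"
proof -
  note P = p[unfolded points_frame_bundle]
  let ?F = "\<lambda>d. fvs.span (set (take d \<phi>s))"
  have ind: "fvs.independent (set (take d \<phi>s))" for d
    using P fvs.independent_mono[OF _ set_take_subset[of d \<phi>s]] by simp
  have dim: "fvs.dim (?F d) = d" if "d \<le> hd s" for d
    using fvs.dim_span_eq_card_independent[OF ind, of d] P that by (simp add: distinct_card)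
  have le: "s ! i \<le> hd s" if "i < length s" for i
    using nth_rank_le_hd[OF s, of i] that by (simp add: nth_rank_def)
  have sub: "?F d \<subseteq> dual_fibre M E y" for d
  proof (rule fvs.span_minimal[OF _ subspace_dual_fibre])
    show "set (take d \<phi>s) \<subseteq> dual_fibre M E y" using P set_take_subset[of d \<phi>s] by auto
  qed
  have strict: "?F (s ! j) \<subset> ?F (s ! i)" if "i < j" "j < length s" for i j
  proof
    have "set (take (s ! j) \<phi>s) \<subseteq> set (take (s ! i) \<phi>s)"
      using valid_type_nth[OF s that] by (simp add: set_take_subset_set_take)
    then show "?F (s ! j) \<subseteq> ?F (s ! i)" by (rule fvs.span_mono)
    show "?F (s ! j) \<noteq> ?F (s ! i)"
    proof
      assume "?F (s ! j) = ?F (s ! i)"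
      then have "s ! j = s ! i" using dim[OF le[of j]] dim[OF le[of i]] that by (metis less_trans)
      then show False using valid_type_nth[OF s that] by simp
    qed
  qed
  show ?thesis unfolding flags_def flag_of_def using P sub dim le strict by (auto simp: fvs.subspace_span)
qed

lemma points_flag_bundle: "valid_type s \<Longrightarrow> points (flag_bundle M E s) = flags M E s"
  unfolding flag_bundle_def by (rule points_quotient_fspace) (metis flag_of_in_flags prod.collapse)

text \<open>Flags are listed from the largest member down, so a basis is extended starting from the
  end of the list. New vectors are appended, whence each member is spanned by an initial
  segment.\<close>

lemma adapted_frame_exists:
  assumes s: "valid_type s" and z: "(y, F) \<in> flags M E s"
  shows "\<exists>\<phi>s. (y, \<phi>s) \<in> points (frame_bundle M E (hd s)) \<and> flag_of s (y, \<phi>s) = (y, F)"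
proof -
  from z have F: "y \<in> points M" "length F = length s"
    "\<And>i. i < length s \<Longrightarrow> fvs.subspace (F ! i)" "\<And>i. i < length s \<Longrightarrow> F ! i \<subseteq> dual_fibre M E y"
    "\<And>i. i < length s \<Longrightarrow> fvs.dim (F ! i) = s ! i" "\<And>i j. i < length s \<Longrightarrow> j < length s \<Longrightarrow> i < j \<Longrightarrow> F ! j \<subset> F ! i"
    unfolding flags_def by auto
  have "\<exists>bs. distinct bs \<and> fvs.independent (set bs) \<and> set bs \<subseteq> dual_fibre M E y \<and> length bs = nth_rank s (length s - m) \<and>
    (\<forall>i<length s. length s - m \<le> i \<longrightarrow> fvs.span (set (take (s ! i) bs)) = F ! i)" if "m \<le> length s" for m
    using that
  proof (induction m)
    case 0
    show ?case by (rule exI[of _ "[]"]) (auto simp: nth_rank_def fvs.independent_empty)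
  next
    case (Suc m)
    define i where "i = length s - Suc m"
    have i: "i < length s" "length s - m = Suc i" using Suc.prems unfolding i_def by auto
    from Suc i(2) obtain bs where bs: "distinct bs" "fvs.independent (set bs)" "set bs \<subseteq> dual_fibre M E y"
      "length bs = nth_rank s (Suc i)" "\<And>j. j < length s \<Longrightarrow> Suc i \<le> j \<Longrightarrow> fvs.span (set (take (s ! j) bs)) = F ! j" by auto
    have sub: "set bs \<subseteq> F ! i"
    proof (cases "Suc i < length s")
      case True
      then have "set bs \<subseteq> F ! Suc i" using bs(4) bs(5)[of "Suc i"] fvs.span_superset[of "set bs"] by (simp add: nth_rank_def)
      then show ?thesis using F(6)[of i "Suc i"] True by auto
    qed (use bs(4) in \<open>auto simp: nth_rank_def\<close>)
    obtain B where B: "set bs \<subseteq> B" "B \<subseteq> F ! i" "fvs.independent B" "F ! i \<subseteq> fvs.span B"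
      using fvs.maximal_independent_subset_extend[OF sub bs(2)] by blast
    have cB: "card B = s ! i" using fvs.basis_card_eq_dim[OF B(2,4,3)] F(5)[OF i(1)] by simp
    \<comment> \<open>An infinite set has \<open>card\<close> 0, but the rank is positive.\<close>
    then have fB: "finite B" using valid_type_pos[OF s i(1)] card_ge_0_finite[of B] by simp
    obtain cs where cs: "set cs = B - set bs" "distinct cs" using finite_distinct_list[of "B - set bs"] fB by auto
    have setB: "set (bs @ cs) = B" using cs B(1) by auto
    have len: "length (bs @ cs) = s ! i" using cB setB distinct_card[of "bs @ cs"] bs(1) cs by auto
    show ?case
    proof (rule exI[of _ "bs @ cs"], intro conjI allI impI)
      show "distinct (bs @ cs)" using bs(1) cs by auto
      show "fvs.independent (set (bs @ cs))" unfolding setB by (rule B(3))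
      show "set (bs @ cs) \<subseteq> dual_fibre M E y" unfolding setB using B(2) F(4)[OF i(1)] by auto
      show "length (bs @ cs) = nth_rank s (length s - Suc m)" using len i(1) unfolding i_def nth_rank_def by simp
      fix j assume j: "j < length s" "length s - Suc m \<le> j"
      show "fvs.span (set (take (s ! j) (bs @ cs))) = F ! j"
      proof (cases "j = i")
        case True
        have "take (s ! j) (bs @ cs) = bs @ cs" using True len by simp
        then show ?thesis using True setB B(2,4) fvs.span_minimal[OF B(2) F(3)[OF i(1)]] by auto
      next
        case False
        then have ji: "Suc i \<le> j" using j unfolding i_def by simp
        then have "Suc i < length s" using j by simp
        moreover have "s ! j \<le> s ! Suc i"
          using nth_rank_antimono[OF s ji] j(1) \<open>Suc i < length s\<close> by (simp add: nth_rank_def)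
        ultimately have "s ! j \<le> length bs" using bs(4) by (simp add: nth_rank_def)
        then show ?thesis using bs(5)[OF j(1) ji] by simp
      qed
    qed
  qed
  from this[of "length s"] obtain bs where bs: "distinct bs" "fvs.independent (set bs)" "set bs \<subseteq> dual_fibre M E y"
    "length bs = nth_rank s 0" "\<And>i. i < length s \<Longrightarrow> fvs.span (set (take (s ! i) bs)) = F ! i" by auto
  have "map (\<lambda>d. fvs.span (set (take d bs))) s = F" by (rule nth_equalityI) (use F(2) bs(5) in auto)
  then have "flag_of s (y, bs) = (y, F)" by (simp add: flag_of_def)
  moreover have "(y, bs) \<in> points (frame_bundle M E (hd s))"
    unfolding points_frame_bundle hd_nth_rank[OF s] using bs F(1) by blast
  ultimately show ?thesis by blast
qed

lemma openin_flag_bundle_over: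
  fixes M :: "('p, 'k::field) fspace" and E :: "('p, 'v, 'k) fbundle"
  assumes s: "valid_type s" and V: "openin (opens M) V"
  shows "openin (opens (flag_bundle M E s)) {z \<in> points (flag_bundle M E s). fst z \<in> V}"
proof -
  have "{w \<in> points (frame_bundle M E (hd s)). flag_of s w \<in> {z \<in> points (flag_bundle M E s). fst z \<in> V}} =
    {w \<in> points (frame_bundle M E (hd s)). fst w \<in> V \<and> (\<lambda>_. 1::'k) w \<noteq> 0}"
    using flag_of_in_flags[OF s, of _ _ M E] unfolding points_flag_bundle[OF s] by auto
  moreover have "openin (opens (frame_bundle M E (hd s))) \<dots>"
    by (rule openin_frame_bundle[OF V alg_gen.const])
  moreover have "{z \<in> points (flag_bundle M E s). fst z \<in> V} \<subseteq> flags M E s"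
    unfolding points_flag_bundle[OF s] by blast
  ultimately show ?thesis
    using openin_quotient_fspace[of "flag_of s" "frame_bundle M E (hd s)" "flags M E s"] unfolding flag_bundle_def by simp
qed

lemma fspace_ok_flag_bundle: "fspace_ok (flag_bundle M E s)"
  unfolding flag_bundle_def by (intro fspace_ok_quotient_fspace fspace_ok_frame_bundle)


section \<open>Tensor products of determinant line bundles\<close>

text \<open>The vectors of an adapted frame that represent a basis of one graded piece of the flag.
  Frames begin with the smallest member.\<close>

definition block :: "nat list \<Rightarrow> 'u list \<Rightarrow> nat \<Rightarrow> 'u list" where
  "block s \<phi>s i = drop (nth_rank s (Suc i)) (take (nth_rank s i) \<phi>s)"

definition block_rank :: "nat list \<Rightarrow> nat \<Rightarrow> nat" where
  "block_rank s i = nth_rank s i - nth_rank s (Suc i)"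

lemma length_block: "valid_type s \<Longrightarrow> length \<phi>s = hd s \<Longrightarrow> length (block s \<phi>s i) = block_rank s i"
  using nth_rank_le_hd[of s i] by (simp add: block_def block_rank_def)

lemma set_block: "set (block s \<phi>s i) \<subseteq> nth_sub (snd (flag_of s (y, \<phi>s))) i"
  unfolding nth_sub_flag_of block_def using fvs.span_superset set_drop_subset by fastforce

lemma map_block: "map f (block s \<phi>s i) = block s (map f \<phi>s) i"
  by (simp add: block_def drop_map take_map)

lemma det_dual_quotient_iff:
  "\<sigma> \<in> det_dual_quotient M E s i W \<longleftrightarrow>
    (\<forall>z\<in>W. \<sigma> z \<in> alternating_forms (block_rank s i) (nth_sub (snd z) i) (nth_sub (snd z) (Suc i))) \<and>
    (\<lambda>z. \<sigma> (flag_of s z) (block s (snd z) i)) \<in> regs (frame_bundle M E (hd s))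
           {z \<in> points (frame_bundle M E (hd s)). flag_of s z \<in> W}"
  unfolding det_dual_quotient_def block_def block_rank_def by (auto simp: case_prod_unfold)

lemma det_dual_quotient_mono:
  assumes "\<sigma> \<in> det_dual_quotient M E s i W" "V \<subseteq> W" shows "\<sigma> \<in> det_dual_quotient M E s i V"
  using assms unfolding det_dual_quotient_iff
  by (auto intro: fspace_okD(1)[OF fspace_ok_frame_bundle])

lemma tensor_bundleE:
  assumes "\<tau> \<in> tensor_bundle Z Es U" "x \<in> U"
  obtains V m a \<sigma> where "openin (opens Z) V" "x \<in> V" "V \<subseteq> U"
     "\<And>j. j < m \<Longrightarrow> a j \<in> regs Z V" "\<And>j i. j < m \<Longrightarrow> i < length Es \<Longrightarrow> \<sigma> j i \<in> (Es ! i) V"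
     "\<And>y. y \<in> V \<Longrightarrow> \<tau> y = (\<Sum>j<(m::nat). fscale (a j y) (pure_tensor (map (\<lambda>i. \<sigma> j i y) [0..<length Es])))"
proof -
  from assms have "\<exists>V (m::nat) a \<sigma>. openin (opens Z) V \<and> x \<in> V \<and> V \<subseteq> U \<and>
     (\<forall>j<m. a j \<in> regs Z V \<and> (\<forall>i<length Es. \<sigma> j i \<in> (Es ! i) V)) \<and>
     (\<forall>y\<in>V. \<tau> y = (\<Sum>j<m. fscale (a j y) (pure_tensor (map (\<lambda>i. \<sigma> j i y) [0..<length Es]))))"
    unfolding tensor_bundle_def by simp
  then show ?thesis
  proof (elim exE conjE)
    fix V and m :: nat and a \<sigma> assume *: "openin (opens Z) V" "x \<in> V" "V \<subseteq> U"
     "\<forall>j<m. a j \<in> regs Z V \<and> (\<forall>i<length Es. \<sigma> j i \<in> (Es ! i) V)"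
     "\<forall>y\<in>V. \<tau> y = (\<Sum>j<m. fscale (a j y) (pure_tensor (map (\<lambda>i. \<sigma> j i y) [0..<length Es])))"
    show ?thesis by (rule that[of V m a \<sigma>]) (use * in auto)
  qed
qed

lemma tensor_bundleI:
  assumes "\<And>x. x \<in> U \<Longrightarrow> \<exists>V (m::nat) a \<sigma>. openin (opens Z) V \<and> x \<in> V \<and> V \<subseteq> U \<and>
     (\<forall>j<m. a j \<in> regs Z V \<and> (\<forall>i<length Es. \<sigma> j i \<in> (Es ! i) V)) \<and>
     (\<forall>y\<in>V. \<tau> y = (\<Sum>j<m. fscale (a j y) (pure_tensor (map (\<lambda>i. \<sigma> j i y) [0..<length Es]))))"
  shows "\<tau> \<in> tensor_bundle Z Es U"
  using assms unfolding tensor_bundle_def by simp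

definition mono_bundle :: "('p, 'v, 'k) fbundle \<Rightarrow> bool" where
  "mono_bundle L \<longleftrightarrow> (\<forall>U V s. s \<in> L U \<longrightarrow> V \<subseteq> U \<longrightarrow> s \<in> L V)"

lemma tensor_bundle_mono:
  assumes Z: "fspace_ok Z" and L: "\<And>L. L \<in> set Es \<Longrightarrow> mono_bundle L"
    and \<tau>: "\<tau> \<in> tensor_bundle Z Es U" and V: "V \<subseteq> U" "openin (opens Z) V"
  shows "\<tau> \<in> tensor_bundle Z Es V"
proof (rule tensor_bundleI)
  fix x assume "x \<in> V"
  then have "x \<in> U" using V by auto
  obtain W m a \<sigma> where *: "openin (opens Z) W" "x \<in> W" "W \<subseteq> U"
     "\<And>j. j < m \<Longrightarrow> a j \<in> regs Z W" "\<And>j i. j < m \<Longrightarrow> i < length Es \<Longrightarrow> \<sigma> j i \<in> (Es ! i) W"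
     "\<And>y. y \<in> W \<Longrightarrow> \<tau> y = (\<Sum>j<(m::nat). fscale (a j y) (pure_tensor (map (\<lambda>i. \<sigma> j i y) [0..<length Es])))"
    by (rule tensor_bundleE[OF \<tau> \<open>x \<in> U\<close>], rule that)
  have L': "\<sigma> j i \<in> (Es ! i) (W \<inter> V)" if "j < m" "i < length Es" for i j
    using L[of "Es ! i"] *(5)[OF that] that unfolding mono_bundle_def by (meson Int_lower1 nth_mem)
  have r: "a j \<in> regs Z (W \<inter> V)" if "j < m" for j by (rule fspace_okD(1)[OF Z *(4)[OF that]]) simp
  show "\<exists>V' (m::nat) a \<sigma>. openin (opens Z) V' \<and> x \<in> V' \<and> V' \<subseteq> V \<and>
     (\<forall>j<m. a j \<in> regs Z V' \<and> (\<forall>i<length Es. \<sigma> j i \<in> (Es ! i) V')) \<and>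
     (\<forall>y\<in>V'. \<tau> y = (\<Sum>j<m. fscale (a j y) (pure_tensor (map (\<lambda>i. \<sigma> j i y) [0..<length Es]))))"
    by (rule exI[of _ "W \<inter> V"], rule exI[of _ m], rule exI[of _ a], rule exI[of _ \<sigma>])
       (use * L' \<open>x \<in> V\<close> V r in auto)
qed

lemma tensor_bundle_scale:
  assumes Z: "fspace_ok Z" and \<tau>: "\<tau> \<in> tensor_bundle Z Es U"
  shows "(\<lambda>z. fscale c (\<tau> z)) \<in> tensor_bundle Z Es U"
proof (rule tensor_bundleI)
  fix x assume x: "x \<in> U"
  obtain W m a \<sigma> where *: "openin (opens Z) W" "x \<in> W" "W \<subseteq> U"
     "\<And>j. j < m \<Longrightarrow> a j \<in> regs Z W" "\<And>j i. j < m \<Longrightarrow> i < length Es \<Longrightarrow> \<sigma> j i \<in> (Es ! i) W"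
     "\<And>y. y \<in> W \<Longrightarrow> \<tau> y = (\<Sum>j<(m::nat). fscale (a j y) (pure_tensor (map (\<lambda>i. \<sigma> j i y) [0..<length Es])))"
    by (rule tensor_bundleE[OF \<tau> x], rule that)
  show "\<exists>V' (m::nat) a \<sigma>. openin (opens Z) V' \<and> x \<in> V' \<and> V' \<subseteq> U \<and>
     (\<forall>j<m. a j \<in> regs Z V' \<and> (\<forall>i<length Es. \<sigma> j i \<in> (Es ! i) V')) \<and>
     (\<forall>y\<in>V'. fscale c (\<tau> y) = (\<Sum>j<m. fscale (a j y) (pure_tensor (map (\<lambda>i. \<sigma> j i y) [0..<length Es]))))"
    by (rule exI[of _ W], rule exI[of _ m], rule exI[of _ "\<lambda>j y. c * a j y"], rule exI[of _ \<sigma>])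
       (use * fspace_okD(2)[OF Z] in \<open>auto simp: fun_eq_iff sum_fun_apply fscale_def sum_distrib_left mult.assoc\<close>)
qed

lemma tensor_bundle_add:
  fixes Z :: "('z, 'k::field) fspace" and Es :: "('z, 'v, 'k) fbundle list"
  assumes Z: "fspace_ok Z" and L: "\<And>L. L \<in> set Es \<Longrightarrow> mono_bundle L"
    and \<tau>: "\<tau> \<in> tensor_bundle Z Es U" and \<tau>': "\<tau>' \<in> tensor_bundle Z Es U"
  shows "(\<lambda>z. \<tau> z + \<tau>' z) \<in> tensor_bundle Z Es U"
proof (rule tensor_bundleI)
  fix x assume x: "x \<in> U"
  obtain W m a \<sigma> where *: "openin (opens Z) W" "x \<in> W" "W \<subseteq> U"
     "\<And>j. j < m \<Longrightarrow> a j \<in> regs Z W" "\<And>j i. j < m \<Longrightarrow> i < length Es \<Longrightarrow> \<sigma> j i \<in> (Es ! i) W"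
     "\<And>y. y \<in> W \<Longrightarrow> \<tau> y = (\<Sum>j<(m::nat). fscale (a j y) (pure_tensor (map (\<lambda>i. \<sigma> j i y) [0..<length Es])))"
    by (rule tensor_bundleE[OF \<tau> x], rule that)
  obtain W' m' a' \<sigma>' where **: "openin (opens Z) W'" "x \<in> W'" "W' \<subseteq> U"
     "\<And>j. j < m' \<Longrightarrow> a' j \<in> regs Z W'" "\<And>j i. j < m' \<Longrightarrow> i < length Es \<Longrightarrow> \<sigma>' j i \<in> (Es ! i) W'"
     "\<And>y. y \<in> W' \<Longrightarrow> \<tau>' y = (\<Sum>j<(m'::nat). fscale (a' j y) (pure_tensor (map (\<lambda>i. \<sigma>' j i y) [0..<length Es])))"
    by (rule tensor_bundleE[OF \<tau>' x], rule that)
  define b where "b j = (if j < m then a j else a' (j - m))" for j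
  define \<rho> where "\<rho> j = (if j < m then \<sigma> j else \<sigma>' (j - m))" for j
  have L1: "\<sigma> j i \<in> (Es ! i) (W \<inter> W')" if "j < m" "i < length Es" for i j
    using L[of "Es ! i"] *(5)[OF that] that unfolding mono_bundle_def by (meson Int_lower1 nth_mem)
  have L2: "\<sigma>' j i \<in> (Es ! i) (W \<inter> W')" if "j < m'" "i < length Es" for i j
    using L[of "Es ! i"] **(5)[OF that] that unfolding mono_bundle_def by (meson Int_lower2 nth_mem)
  have r: "b j \<in> regs Z (W \<inter> W')" if "j < m + m'" for j
  proof (cases "j < m")
    case True
    then show ?thesis unfolding b_def using fspace_okD(1)[OF Z *(4)[OF True], of "W \<inter> W'"] by simp
  next
    case False
    then have "j - m < m'" using that by simp
    then show ?thesis unfolding b_def using False fspace_okD(1)[OF Z **(4)[of "j - m"], of "W \<inter> W'"] by simp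
  qed
  have L3: "\<rho> j i \<in> (Es ! i) (W \<inter> W')" if "j < m + m'" "i < length Es" for i j
    unfolding \<rho>_def using that L1 L2 by auto
  have eq: "\<tau> y + \<tau>' y = (\<Sum>j<m + m'. fscale (b j y) (pure_tensor (map (\<lambda>i. \<rho> j i y) [0..<length Es])))"
    if "y \<in> W \<inter> W'" for y
  proof -
    have split: "(\<Sum>j<m + m'. f j) = (\<Sum>j<m. f j) + (\<Sum>j<m'. f (m + j))" for f :: "nat \<Rightarrow> 'v list \<Rightarrow> 'k"
      by (induction m') (auto simp: add.assoc)
    show ?thesis unfolding split using that by (simp add: * ** b_def \<rho>_def)
  qed
  show "\<exists>V' (m::nat) a \<sigma>. openin (opens Z) V' \<and> x \<in> V' \<and> V' \<subseteq> U \<and>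
     (\<forall>j<m. a j \<in> regs Z V' \<and> (\<forall>i<length Es. \<sigma> j i \<in> (Es ! i) V')) \<and>
     (\<forall>y\<in>V'. \<tau> y + \<tau>' y = (\<Sum>j<m. fscale (a j y) (pure_tensor (map (\<lambda>i. \<sigma> j i y) [0..<length Es]))))"
    by (rule exI[of _ "W \<inter> W'"], rule exI[of _ "m + m'"], rule exI[of _ b], rule exI[of _ \<rho>])
       (use * ** r L3 eq in \<open>intro conjI allI impI ballI; (auto; fail)\<close>)
qed

lemma pure_tensor_upt:
  assumes "length vs = m"
  shows "pure_tensor (map f [0..<m]) vs = (\<Prod>i<m. f i (vs ! i))"
  unfolding pure_tensor_def using assms by (auto intro!: prod.cong)

lemma mono_det_dual_quotient: "mono_bundle (det_dual_quotient M E s i)"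
  unfolding mono_bundle_def using det_dual_quotient_mono by blast

text \<open>Here sections become functions: regularity of a section of a determinant bundle is
  defined through its values on adapted frames, and tensors inherit this factor by factor.\<close>

lemma zreg_tensor_on_frames:
  assumes s: "valid_type s" and \<Psi>: "zmor n T (frame_bundle M E (hd s)) \<Psi>"
    and \<tau>: "\<tau> \<in> tensor_bundle (flag_bundle M E s) (map (det_dual_quotient M E s) is) W"
  shows "zreg n {x\<in>T. flag_of s (\<Psi> x) \<in> W} (\<lambda>x. \<tau> (flag_of s (\<Psi> x)) (map (block s (snd (\<Psi> x))) is))"
proof (rule zreg_local[of _ T])
  let ?Es = "map (det_dual_quotient M E s) is"
  fix x assume "x \<in> {x\<in>T. flag_of s (\<Psi> x) \<in> W}"
  then have x: "x \<in> T" "flag_of s (\<Psi> x) \<in> W" by auto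
  have q: "zmor n T (flag_bundle M E s) (\<lambda>x. flag_of s (\<Psi> x))"
    unfolding flag_bundle_def by (rule zmor_quotient_fspace[OF \<Psi>]) (metis flag_of_in_flags[OF s] prod.collapse)
  obtain V m a \<sigma> where *: "openin (opens (flag_bundle M E s)) V" "flag_of s (\<Psi> x) \<in> V" "V \<subseteq> W"
     "\<And>j. j < m \<Longrightarrow> a j \<in> regs (flag_bundle M E s) V" "\<And>j i. j < m \<Longrightarrow> i < length ?Es \<Longrightarrow> \<sigma> j i \<in> (?Es ! i) V"
     "\<And>y. y \<in> V \<Longrightarrow> \<tau> y = (\<Sum>j<(m::nat). fscale (a j y) (pure_tensor (map (\<lambda>i. \<sigma> j i y) [0..<length ?Es])))"
    by (rule tensor_bundleE[OF \<tau> x(2)], rule that)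
  let ?V = "{x\<in>T. flag_of s (\<Psi> x) \<in> V}"
  have za: "zreg n ?V (\<lambda>x. a j (flag_of s (\<Psi> x)))" if "j < m" for j
    by (rule zmorD(3)[OF q *(1) *(4)[OF that]])
  have zs: "zreg n ?V (\<lambda>x. \<sigma> j i (flag_of s (\<Psi> x)) (block s (snd (\<Psi> x)) (is ! i)))" if "j < m" "i < length is" for i j
  proof -
    have "\<sigma> j i \<in> det_dual_quotient M E s (is ! i) V" using *(5)[of j i] that by simp
    then have "(\<lambda>z. \<sigma> j i (flag_of s z) (block s (snd z) (is ! i))) \<in> regs (frame_bundle M E (hd s))
           {z \<in> points (frame_bundle M E (hd s)). flag_of s z \<in> V}" unfolding det_dual_quotient_iff by blast
    moreover have "openin (opens (frame_bundle M E (hd s))) {z \<in> points (frame_bundle M E (hd s)). flag_of s z \<in> V}"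
      using *(1) unfolding flag_bundle_def openin_quotient_fspace by blast
    ultimately have "zreg n {x\<in>T. \<Psi> x \<in> {z \<in> points (frame_bundle M E (hd s)). flag_of s z \<in> V}}
      (\<lambda>x. \<sigma> j i (flag_of s (\<Psi> x)) (block s (snd (\<Psi> x)) (is ! i)))"
      by (intro zmorD(3)[OF \<Psi>, of _ "\<lambda>z. \<sigma> j i (flag_of s z) (block s (snd z) (is ! i))"])
    then show ?thesis by (rule zreg_subset) (use zmorD(1)[OF \<Psi>] in auto)
  qed
  have "zreg n ?V (\<lambda>x. \<Sum>j<m. a j (flag_of s (\<Psi> x)) *
      (\<Prod>i<length is. \<sigma> j i (flag_of s (\<Psi> x)) (block s (snd (\<Psi> x)) (is ! i))))"
    by (intro zreg_sum zreg_mult zreg_prod za zs) auto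
  then have "zreg n ?V (\<lambda>x. \<tau> (flag_of s (\<Psi> x)) (map (block s (snd (\<Psi> x))) is))"
    by (rule zreg_cong) (simp add: *(6) sum_fun_apply fscale_def pure_tensor_upt)
  then have "zreg n (?V \<inter> {x\<in>T. flag_of s (\<Psi> x) \<in> W}) (\<lambda>x. \<tau> (flag_of s (\<Psi> x)) (map (block s (snd (\<Psi> x))) is))"
    by (rule zreg_subset) auto
  then show "\<exists>V. zopen n T V \<and> x \<in> V \<and> zreg n (V \<inter> {x\<in>T. flag_of s (\<Psi> x) \<in> W})
      (\<lambda>x. \<tau> (flag_of s (\<Psi> x)) (map (block s (snd (\<Psi> x))) is))"
    using zmorD(2)[OF q *(1)] x *(2) by (intro exI[of _ ?V]) auto
qed auto

text \<open>Regularity is discarded: at a single point only the multilinear algebra of the factors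
  matters.\<close>

lemma tensor_value:
  assumes \<tau>: "\<tau> \<in> tensor_bundle (flag_bundle M E s) (map (det_dual_quotient M E s) is) W" and z: "z \<in> W"
  shows "\<exists>(m::nat) a \<omega>. (\<forall>j<m. \<forall>i<length is. \<omega> j i \<in> alternating_forms (block_rank s (is ! i)) (nth_sub (snd z) (is ! i)) (nth_sub (snd z) (Suc (is ! i)))) \<and>
    (\<forall>vs. length vs = length is \<longrightarrow> \<tau> z vs = (\<Sum>j<m. a j * (\<Prod>i<length is. \<omega> j i (vs ! i)))) \<and>
    (\<forall>vs. length vs \<noteq> length is \<longrightarrow> \<tau> z vs = 0)"
proof -
  let ?Es = "map (det_dual_quotient M E s) is"
  obtain V m a \<sigma> where *: "openin (opens (flag_bundle M E s)) V" "z \<in> V" "V \<subseteq> W"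
     "\<And>j. j < m \<Longrightarrow> a j \<in> regs (flag_bundle M E s) V" "\<And>j i. j < m \<Longrightarrow> i < length ?Es \<Longrightarrow> \<sigma> j i \<in> (?Es ! i) V"
     "\<And>y. y \<in> V \<Longrightarrow> \<tau> y = (\<Sum>j<(m::nat). fscale (a j y) (pure_tensor (map (\<lambda>i. \<sigma> j i y) [0..<length ?Es])))"
    by (rule tensor_bundleE[OF \<tau> z], rule that)
  have "\<sigma> j i z \<in> alternating_forms (block_rank s (is ! i)) (nth_sub (snd z) (is ! i)) (nth_sub (snd z) (Suc (is ! i)))"
    if "j < m" "i < length is" for i j
  proof -
    have "\<sigma> j i \<in> det_dual_quotient M E s (is ! i) V" using *(5)[of j i] that by simp
    then show ?thesis using *(2) unfolding det_dual_quotient_iff by blast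
  qed
  moreover have "\<tau> z vs = (\<Sum>j<m. a j z * (\<Prod>i<length is. \<sigma> j i z (vs ! i)))" if "length vs = length is" for vs
    using that by (simp add: *(6)[OF *(2)] sum_fun_apply fscale_def pure_tensor_upt)
  moreover have "\<tau> z vs = 0" if "length vs \<noteq> length is" for vs
    using that by (simp add: *(6)[OF *(2)] sum_fun_apply fscale_def pure_tensor_def)
  ultimately show ?thesis
    by (intro exI[of _ m] exI[of _ "\<lambda>j. a j z"] exI[of _ "\<lambda>j i. \<sigma> j i z"]) auto
qed

lemma alternating_forms_linear:
  assumes "\<omega> \<in> alternating_forms d V V'" "length us = d" "set us \<subseteq> V" "j < d" "u \<in> V" "v \<in> V"
  shows "\<omega> (us[j := fscale c u + v]) = c * \<omega> (us[j := u]) + \<omega> (us[j := v])"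
  using assms unfolding alternating_forms_def mem_Collect_eq by blast

lemma alternating_forms_equal:
  assumes "\<omega> \<in> alternating_forms d V V'" "length us = d" "set us \<subseteq> V" "i < j" "j < d" "us ! i = us ! j"
  shows "\<omega> us = 0"
  using assms unfolding alternating_forms_def mem_Collect_eq by blast

lemma alternating_forms_meets:
  assumes "\<omega> \<in> alternating_forms d V V'" "length us = d" "set us \<subseteq> V" "set us \<inter> V' \<noteq> {}"
  shows "\<omega> us = 0"
  using assms unfolding alternating_forms_def mem_Collect_eq by blast

lemma alternating_forms_outside:
  assumes "\<omega> \<in> alternating_forms d V V'" "\<not> (length us = d \<and> set us \<subseteq> V)"
  shows "\<omega> us = 0"
  using assms unfolding alternating_forms_def mem_Collect_eq by blast

lemma alternating_forms_scale_nth: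
  assumes w: "\<omega> \<in> alternating_forms d V V'" and us: "length us = d" "set us \<subseteq> V" and j: "j < d"
    and V: "fvs.subspace V"
  shows "\<omega> (us[j := fscale c (us ! j)]) = c * \<omega> us"
proof -
  have 0: "0 \<in> V" by (rule fvs.subspace_0[OF V])
  have "\<omega> (us[j := fscale 1 0 + 0]) = 1 * \<omega> (us[j := 0]) + \<omega> (us[j := 0])"
    by (rule alternating_forms_linear[OF w us j 0 0])
  moreover have "fscale 1 0 + 0 = (0 :: 'a \<Rightarrow> 'b)" by (simp add: fscale_def fun_eq_iff)
  ultimately have "\<omega> (us[j := 0]) = \<omega> (us[j := 0]) + \<omega> (us[j := 0])" by (simp only: mult_1)
  then have z: "\<omega> (us[j := 0]) = 0" by (metis add_0_right add_left_cancel)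
  have uj: "us ! j \<in> V" using us j by auto
  have "\<omega> (us[j := fscale c (us ! j) + 0]) = c * \<omega> (us[j := us ! j]) + \<omega> (us[j := 0])"
    by (rule alternating_forms_linear[OF w us j uj 0])
  then show ?thesis using z by simp
qed

lemma alternating_forms_scale:
  assumes w: "\<omega> \<in> alternating_forms d V V'" and us: "length us = d" "set us \<subseteq> V" and V: "fvs.subspace V"
  shows "\<omega> (map (fscale c) us) = c ^ d * \<omega> us"
proof -
  have "\<omega> (map (fscale c) (take m us) @ drop m us) = c ^ m * \<omega> us" if "m \<le> d" for m
    using that
  proof (induction m)
    case (Suc m)
    let ?u = "map (fscale c) (take m us) @ drop m us"
    have len: "length ?u = d" using us(1) Suc.prems by simp
    have sub: "set ?u \<subseteq> V"
      using us(2) set_take_subset[of m us] set_drop_subset[of m us] fvs.subspace_scale[OF V] by auto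
    have "?u ! m = us ! m" using Suc.prems us(1) by (simp add: nth_append)
    have "map (fscale c) (take (Suc m) us) @ drop (Suc m) us = ?u[m := fscale c (?u ! m)]"
      using Suc.prems us(1)
      by (intro nth_equalityI) (auto simp: nth_append nth_list_update less_Suc_eq min_def)
    then have "\<omega> (map (fscale c) (take (Suc m) us) @ drop (Suc m) us) = c * \<omega> ?u"
      using alternating_forms_scale_nth[OF w len sub _ V, of m c] Suc.prems by simp
    then show ?case using Suc by simp
  qed simp
  from this[of d] show ?thesis using us(1) by simp
qed

text \<open>Each factor contributes its rank to the exponent. For the factors of the Schur line
  bundle the total is the size of the partition.\<close>

lemma tensor_scale_frame:
  assumes s: "valid_type s" and p: "(y, \<phi>s) \<in> points (frame_bundle M E (hd s))"
    and \<tau>: "\<tau> \<in> tensor_bundle (flag_bundle M E s) (map (det_dual_quotient M E s) is) W"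
    and z: "flag_of s (y, \<phi>s) \<in> W"
  shows "\<tau> (flag_of s (y, \<phi>s)) (map (block s (map (fscale c) \<phi>s)) is) =
    c ^ (\<Sum>i\<leftarrow>is. block_rank s i) * \<tau> (flag_of s (y, \<phi>s)) (map (block s \<phi>s) is)"
proof -
  let ?z = "flag_of s (y, \<phi>s)"
  from tensor_value[OF \<tau> z] obtain m :: nat and a \<omega> where
    \<omega>: "\<And>j i. j < m \<Longrightarrow> i < length is \<Longrightarrow> \<omega> j i \<in> alternating_forms (block_rank s (is ! i)) (nth_sub (snd ?z) (is ! i)) (nth_sub (snd ?z) (Suc (is ! i)))"
    and v: "\<And>vs. length vs = length is \<Longrightarrow> \<tau> ?z vs = (\<Sum>j<m. a j * (\<Prod>i<length is. \<omega> j i (vs ! i)))" by blast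
  have len: "length \<phi>s = hd s" using p by (simp add: points_frame_bundle)
  have sc: "\<omega> j i (block s (map (fscale c) \<phi>s) (is ! i)) = c ^ block_rank s (is ! i) * \<omega> j i (block s \<phi>s (is ! i))"
    if "j < m" "i < length is" for i j
    unfolding map_block[symmetric]
    by (rule alternating_forms_scale[OF \<omega>[OF that] length_block[OF s len] set_block])
       (simp add: nth_sub_flag_of fvs.subspace_span)
  have sl: "(\<Sum>i\<leftarrow>is. block_rank s i) = (\<Sum>i<length is. block_rank s (is ! i))"
    by (simp add: sum_list_sum_nth atLeast0LessThan)
  show ?thesis unfolding sl
    by (simp add: v sc prod.distrib power_sum sum_distrib_left mult.left_commute)
qed


section \<open>Alternating forms\<close>

lemma alternating_forms_combination:
  assumes "\<omega> \<in> alternating_forms d V V'" "\<rho> \<in> alternating_forms d V V'"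
  shows "(\<lambda>us. a * \<omega> us + b * \<rho> us) \<in> alternating_forms d V V'"
  unfolding alternating_forms_def mem_Collect_eq
proof (intro conjI allI impI)
  fix us :: "('a \<Rightarrow> 'b) list" and j c u v
  assume *: "length us = d \<and> set us \<subseteq> V \<and> j < d \<and> u \<in> V \<and> v \<in> V"
  show "a * \<omega> (us[j := fscale c u + v]) + b * \<rho> (us[j := fscale c u + v]) =
    c * (a * \<omega> (us[j := u]) + b * \<rho> (us[j := u])) + (a * \<omega> (us[j := v]) + b * \<rho> (us[j := v]))"
    using alternating_forms_linear[OF assms(1), of us j u v c] alternating_forms_linear[OF assms(2), of us j u v c] *
    by (simp add: algebra_simps)
next
  fix us :: "('a \<Rightarrow> 'b) list"
  assume "\<not> (length us = d \<and> set us \<subseteq> V)"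
  then show "a * \<omega> us + b * \<rho> us = 0"
    using alternating_forms_outside[OF assms(1)] alternating_forms_outside[OF assms(2)] by simp
next
  fix us :: "('a \<Rightarrow> 'b) list" and i j
  assume *: "length us = d \<and> set us \<subseteq> V \<and> i < j \<and> j < d \<and> us ! i = us ! j"
  then show "a * \<omega> us + b * \<rho> us = 0"
    using alternating_forms_equal[OF assms(1), of us i j] alternating_forms_equal[OF assms(2), of us i j] by simp
next
  fix us :: "('a \<Rightarrow> 'b) list"
  assume "length us = d \<and> set us \<subseteq> V \<and> set us \<inter> V' \<noteq> {}"
  then show "a * \<omega> us + b * \<rho> us = 0"
    using alternating_forms_meets[OF assms(1), of us] alternating_forms_meets[OF assms(2), of us] by simp
qed

lemma alternating_forms_zero_entry:
  assumes w: "\<omega> \<in> alternating_forms d V V'" and us: "length us = d" "set us \<subseteq> V" "j < d" and V: "fvs.subspace V"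
  shows "\<omega> (us[j := 0]) = 0"
proof -
  have len: "length (us[j := 0]) = d" using us by simp
  have sub: "set (us[j := 0]) \<subseteq> V" using us fvs.subspace_0[OF V] set_update_subset_insert[of us j 0] by auto
  have "\<omega> ((us[j := 0])[j := fscale 0 ((us[j := 0]) ! j)]) = 0 * \<omega> (us[j := 0])"
    by (rule alternating_forms_scale_nth[OF w len sub us(3) V])
  moreover have "fscale 0 ((us[j := 0]) ! j) = 0" by (simp add: fscale_def fun_eq_iff)
  ultimately show ?thesis by simp
qed

text \<open>The value with the sum of the two entries in both places is 0; expanding it leaves the
  two orders.\<close>

lemma alternating_forms_swap:
  assumes w: "\<omega> \<in> alternating_forms d V V'" and us: "length us = d" "set us \<subseteq> V" and ij: "i < d" "j < d" "i \<noteq> j"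
    and V: "fvs.subspace V"
  shows "\<omega> (us[i := us ! j, j := us ! i]) = - \<omega> us"
proof -
  let ?a = "us ! i" and ?b = "us ! j"
  have a: "?a \<in> V" "?b \<in> V" using us ij by auto
  have ab: "?a + ?b \<in> V" by (rule fvs.subspace_add[OF V a])
  have in_V: "set (us[i := u, j := v]) \<subseteq> V" "length (us[i := u, j := v]) = d" "set (us[i := u]) \<subseteq> V" "length (us[i := u]) = d"
    if "u \<in> V" "v \<in> V" for u v
    using us that set_update_subset_insert[of us i u] set_update_subset_insert[of "us[i := u]" j v] by auto
  have one: "fscale 1 u + v = u + v" for u v :: "'a \<Rightarrow> 'b" by (simp add: fscale_def fun_eq_iff)
  have lin_j: "\<omega> (us[i := u, j := v + v']) = \<omega> (us[i := u, j := v]) + \<omega> (us[i := u, j := v'])"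
    if "u \<in> V" "v \<in> V" "v' \<in> V" for u v v'
    using alternating_forms_linear[OF w in_V(4,3)[OF that(1,1)] ij(2) that(2,3), of 1] unfolding one by simp
  have lin_i: "\<omega> (us[i := v + v', j := u]) = \<omega> (us[i := v, j := u]) + \<omega> (us[i := v', j := u])"
    if "u \<in> V" "v \<in> V" "v' \<in> V" for u v v'
  proof -
    have sw: "us[i := t, j := u] = us[j := u, i := t]" for t using ij(3) by (rule list_update_swap)
    have s: "set (us[j := u]) \<subseteq> V" "length (us[j := u]) = d" using us that set_update_subset_insert[of us j u] by auto
    show ?thesis unfolding sw
      using alternating_forms_linear[OF w s(2,1) ij(1) that(2,3), of 1] unfolding one by simp
  qed
  have eq0: "\<omega> (us[i := u, j := u]) = 0" if "u \<in> V" for u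
  proof (cases "i < j")
    case True
    show ?thesis by (rule alternating_forms_equal[OF w in_V(2,1)[OF that that] True ij(2)]) (use us ij in simp)
  next
    case False
    then have "j < i" using ij(3) by simp
    show ?thesis by (rule alternating_forms_equal[OF w in_V(2,1)[OF that that] \<open>j < i\<close> ij(1)]) (use us ij in simp)
  qed
  have "0 = \<omega> (us[i := ?a + ?b, j := ?a + ?b])" using eq0[OF ab] by simp
  also have "\<dots> = \<omega> (us[i := ?a, j := ?b]) + \<omega> (us[i := ?b, j := ?a])"
    using lin_j[OF ab a] lin_i[OF a(1) a] lin_i[OF a(2) a] eq0[OF a(1)] eq0[OF a(2)] by simp
  also have "us[i := ?a, j := ?b] = us" by simp
  finally show ?thesis by (simp add: eq_neg_iff_add_eq_0 add.commute)
qed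

text \<open>Multilinearity replaces arbitrary entries by members of \<open>us\<close>, up to entries
  in \<open>V'\<close>, and transpositions put these into the order of \<open>us\<close>. The
  determinant line is thus at most one-dimensional.\<close>

lemma alternating_forms_unique:
  assumes w: "\<omega> \<in> alternating_forms d V V'" and us: "length us = d" "set us \<subseteq> V"
    and V: "fvs.subspace V" "V \<subseteq> fvs.span (set us \<union> V')" "V' \<subseteq> V" and 0: "\<omega> us = 0"
  shows "\<omega> ws = 0"
proof -
  \<comment> \<open>\<open>m\<close> is the number of leading positions that need not yet agree with
    \<open>us\<close>.\<close>
  have perm: "\<omega> ws = 0" if "distinct ws" "set ws = set us" "length ws = d" "\<forall>j<d. m \<le> j \<longrightarrow> ws ! j = us ! j" "m \<le> d" for ws m
    using that
  proof (induction m arbitrary: ws)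
    case 0
    then have "ws = us" using us(1) by (intro nth_equalityI) auto
    then show ?case using \<open>\<omega> us = 0\<close> by simp
  next
    case (Suc m)
    have m: "m < d" using Suc.prems by simp
    then have "us ! m \<in> set ws" using us(1) Suc.prems(2) by auto
    then obtain i where i: "i < d" "ws ! i = us ! m" using Suc.prems(3) by (auto simp: in_set_conv_nth)
    have du: "distinct us" using Suc.prems(1,2,3) us(1) by (metis card_distinct distinct_card)
    have "i \<le> m"
    proof (rule ccontr)
      assume "\<not> i \<le> m"
      then have "us ! i = us ! m" using Suc.prems(4) i by auto
      then show False using du i(1) m us(1) \<open>\<not> i \<le> m\<close> by (simp add: nth_eq_iff_index_eq)
    qed
    show ?case
    proof (cases "i = m")
      case True
      then have "\<forall>j<d. m \<le> j \<longrightarrow> ws ! j = us ! j" using Suc.prems(4) i(2) by (metis Suc_leI le_neq_implies_less)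
      then show ?thesis using Suc.IH[of ws] Suc.prems by simp
    next
      case False
      let ?w = "ws[i := ws ! m, m := ws ! i]"
      have "?w ! j = us ! j" if "j < d" "m \<le> j" for j
        using that \<open>i \<le> m\<close> False i Suc.prems(3,4) m by (cases "j = m") auto
      moreover have "distinct ?w" "set ?w = set us" "length ?w = d"
        using Suc.prems i(1) m by (simp_all add: distinct_swap set_swap)
      ultimately have "\<omega> ?w = 0" using Suc.IH[of ?w] Suc.prems(5) by simp
      moreover have "\<omega> ?w = - \<omega> ws"
        by (rule alternating_forms_swap[OF w]) (use Suc.prems us i m False V in auto)
      ultimately show ?thesis by simp
    qed
  qed
  \<comment> \<open>\<open>m\<close> is the number of leading positions whose entries may lie
    outside \<open>set us\<close>.\<close>
  have main: "\<omega> ws = 0" if "length ws = d" "set ws \<subseteq> V" "\<forall>j<d. m \<le> j \<longrightarrow> ws ! j \<in> set us" "m \<le> d" for ws m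
    using that
  proof (induction m arbitrary: ws)
    case 0
    then have sub: "set ws \<subseteq> set us" by (auto simp: in_set_conv_nth)
    show ?case
    proof (cases "distinct ws")
      case True
      have "card (set us) \<le> card (set ws)" using True 0(1) us(1) card_length[of us] distinct_card[of ws] by simp
      then have "set ws = set us" using sub by (intro card_seteq) auto
      then show ?thesis using perm[of ws d] True 0(1) by simp
    next
      case False
      then obtain i j where "i < d" "j < d" "i \<noteq> j" "ws ! i = ws ! j" using 0(1) by (auto simp: distinct_conv_nth)
      then show ?thesis using alternating_forms_equal[OF w 0(1,2), of i j] alternating_forms_equal[OF w 0(1,2), of j i]
        by (cases "i < j") auto
    qed
  next
    case (Suc m)
    have m: "m < d" using Suc.prems by simp
    let ?S = "{u \<in> V. \<omega> (ws[m := u]) = 0}"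
    have sub: "fvs.subspace ?S"
      unfolding fvs.subspace_def
    proof (intro conjI allI ballI)
      show "0 \<in> ?S" using fvs.subspace_0[OF V(1)] alternating_forms_zero_entry[OF w Suc.prems(1,2) m V(1)] by simp
    next
      fix x y assume "x \<in> ?S" "y \<in> ?S"
      moreover have "fscale 1 x + y = x + y" by (simp add: fscale_def fun_eq_iff)
      ultimately show "x + y \<in> ?S"
        using alternating_forms_linear[OF w Suc.prems(1,2) m, of x y 1] fvs.subspace_add[OF V(1), of x y] by simp
    next
      fix c x assume x: "x \<in> ?S"
      moreover have "fscale c x + 0 = fscale c x" by (simp add: fun_eq_iff)
      ultimately show "fscale c x \<in> ?S"
        using alternating_forms_linear[OF w Suc.prems(1,2) m, of x 0 c] fvs.subspace_scale[OF V(1), of x c]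
          fvs.subspace_0[OF V(1)] alternating_forms_zero_entry[OF w Suc.prems(1,2) m V(1)] by simp
    qed
    have inV: "length (ws[m := u]) = d" "set (ws[m := u]) \<subseteq> V" if "u \<in> V" for u
      using Suc.prems that set_update_subset_insert[of ws m u] by auto
    have "set us \<union> V' \<subseteq> ?S"
    proof
      fix u assume u: "u \<in> set us \<union> V'"
      then have uV: "u \<in> V" using us(2) V(3) by auto
      have "\<omega> (ws[m := u]) = 0"
      proof (cases "u \<in> set us")
        case True
        have "\<forall>j<d. m \<le> j \<longrightarrow> (ws[m := u]) ! j \<in> set us"
          using Suc.prems True by (auto simp: nth_list_update)
        then show ?thesis using Suc.IH[OF inV[OF uV]] m by simp
      next
        case False
        then have "u \<in> set (ws[m := u]) \<inter> V'" using u m Suc.prems(1) by (simp add: set_update_memI)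
        then show ?thesis using alternating_forms_meets[OF w inV[OF uV]] by blast
      qed
      then show "u \<in> ?S" using uV by simp
    qed
    then have "fvs.span (set us \<union> V') \<subseteq> ?S" by (rule fvs.span_minimal[OF _ sub])
    moreover have "ws ! m \<in> V" using Suc.prems m by auto
    ultimately have "ws ! m \<in> ?S" using V(2) by blast
    then show ?case by simp
  qed
  show ?thesis
  proof (cases "length ws = d \<and> set ws \<subseteq> V")
    case True
    then show ?thesis using main[of ws d] by simp
  next
    case False
    then show ?thesis by (rule alternating_forms_outside[OF w])
  qed
qed

text \<open>Cross-multiplied, so that no value has to be nonzero; the difference of the two sides is
  an alternating form in \<open>ws\<close> that vanishes on \<open>us\<close>.\<close>

lemma alternating_forms_ratio:
  assumes "\<omega> \<in> alternating_forms d V V'" "\<rho> \<in> alternating_forms d V V'" "length us = d" "set us \<subseteq> V"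
    "fvs.subspace V" "V \<subseteq> fvs.span (set us \<union> V')" "V' \<subseteq> V"
  shows "\<rho> us * \<omega> ws = \<omega> us * \<rho> ws"
  using alternating_forms_unique[OF alternating_forms_combination[OF assms(1,2), of "\<rho> us" "- \<omega> us"] assms(3-7), of ws]
  by simp

text \<open>For independent \<open>us\<close> and fixed vectors \<open>H a\<close>, a Pluecker
  coordinate of their span.\<close>

definition ev_det :: "(nat \<Rightarrow> 'w \<Rightarrow> 'k::field_char_0) \<Rightarrow> nat \<Rightarrow> (('w \<Rightarrow> 'k) \<Rightarrow> 'k) list \<Rightarrow> 'k" where
  "ev_det H d us = ldet d (\<lambda>b a. (us ! b) (H a))"

lemma ev_det_0 [simp]: "ev_det H 0 us = 1"
proof -
  have "ev_det H 0 us = ldet 0 (\<lambda>i j. if i = j then 1 else 0)" unfolding ev_det_def by (rule ldet_cong) auto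
  then show ?thesis by (simp only: ldet_identity)
qed

lemma ev_det_dual:
  assumes "\<And>a b. a < d \<Longrightarrow> b < d \<Longrightarrow> (us ! b) (H a) = (if a = b then 1 else 0)"
  shows "ev_det H d us = 1"
proof -
  have "ev_det H d us = ldet d (\<lambda>i j. if i = j then 1 else 0)" unfolding ev_det_def by (rule ldet_cong) (use assms in auto)
  then show ?thesis by (simp only: ldet_identity)
qed

lemma ev_det_span_zero:
  assumes i: "length us0 \<le> i" "i < d" and u: "us ! i \<in> fvs.span (set us0)"
    and us: "\<And>j. j < length us0 \<Longrightarrow> us ! j = us0 ! j"
  shows "ev_det H d us = 0"
proof -
  have "us ! i \<in> fvs.span ((\<lambda>j. us0 ! j) ` {..<length us0})"
    using u by (simp add: set_conv_nth image_Collect lessThan_def conj_commute Collect_conj_eq[symmetric] setcompr_eq_image)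
  then obtain c where c: "us ! i = (\<Sum>j<length us0. fscale (c j) (us0 ! j))"
    using span_image_finite[of "{..<length us0}" "us ! i" "\<lambda>j. us0 ! j"] by auto
  show ?thesis unfolding ev_det_def
  proof (rule ldet_dependent_row[OF i(2)])
    fix b
    have "(us ! i) (H b) = (\<Sum>j<length us0. c j * (us ! j) (H b))"
      unfolding c using us by (simp add: sum_fun_apply fscale_def)
    also have "\<dots> = (\<Sum>j\<in>{..<d} - {i}. (if j < length us0 then c j else 0) * (us ! j) (H b))"
      using i by (intro sum.mono_neutral_cong_left) auto
    finally show "(us ! i) (H b) = (\<Sum>j\<in>{..<d} - {i}. (if j < length us0 then c j else 0) * (us ! j) (H b))" .
  qed
qed

text \<open>The fixed rows \<open>us0\<close> make the determinant vanish on \<open>V'\<close>, so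
  that it descends to the quotient. Fixed rows \<open>us1\<close> behind allow the varying block to
  stand in front.\<close>

lemma ev_det_alternating:
  assumes D: "length us0 + d + length us1 = D" and V': "V' \<subseteq> fvs.span (set us0)" and V: "fvs.subspace V"
  shows "(\<lambda>ws. if length ws = d \<and> set ws \<subseteq> V then ev_det H D (us0 @ ws @ us1) else 0) \<in> alternating_forms d V V'"
  unfolding alternating_forms_def mem_Collect_eq
proof (intro conjI allI impI)
  fix ws :: "(('a \<Rightarrow> 'b) \<Rightarrow> 'b) list" and j c u v
  assume *: "length ws = d \<and> set ws \<subseteq> V \<and> j < d \<and> u \<in> V \<and> v \<in> V"
  let ?i = "length us0 + j"
  have iD: "?i < D" using D * by simp
  have upd: "ev_det H D (us0 @ ws[j := t] @ us1) = ldet D ((\<lambda>b a. ((us0 @ ws @ us1) ! b) (H a))(?i := \<lambda>a. t (H a)))" for t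
  proof -
    have "us0 @ ws[j := t] @ us1 = (us0 @ ws @ us1)[?i := t]" using * by (simp add: list_update_append)
    then have "ev_det H D (us0 @ ws[j := t] @ us1) = ldet D (\<lambda>b a. (((us0 @ ws @ us1)[?i := t]) ! b) (H a))"
      unfolding ev_det_def by simp
    also have "\<dots> = ldet D ((\<lambda>b a. ((us0 @ ws @ us1) ! b) (H a))(?i := \<lambda>a. t (H a)))"
      by (rule ldet_cong) (use D * in \<open>auto simp: nth_list_update\<close>)
    finally show ?thesis .
  qed
  have e: "ev_det H D (us0 @ ws[j := fscale c u + v] @ us1) =
    c * ev_det H D (us0 @ ws[j := u] @ us1) + ev_det H D (us0 @ ws[j := v] @ us1)"
    unfolding upd using ldet_row_linear[OF iD, of _ c "\<lambda>a. u (H a)" "\<lambda>a. v (H a)"] by (simp add: fscale_def)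
  have uv: "fscale c u + v \<in> V" using * V by (intro fvs.subspace_add fvs.subspace_scale) auto
  have inV: "set (ws[j := t]) \<subseteq> V" if "t \<in> V" for t
    using * that set_update_subset_insert[of ws j t] by auto
  show "(if length (ws[j := fscale c u + v]) = d \<and> set (ws[j := fscale c u + v]) \<subseteq> V
         then ev_det H D (us0 @ ws[j := fscale c u + v] @ us1) else 0) =
        c * (if length (ws[j := u]) = d \<and> set (ws[j := u]) \<subseteq> V then ev_det H D (us0 @ ws[j := u] @ us1) else 0) +
        (if length (ws[j := v]) = d \<and> set (ws[j := v]) \<subseteq> V then ev_det H D (us0 @ ws[j := v] @ us1) else 0)"
    using e * inV[OF uv] inV[of u] inV[of v] by simp
next
  fix ws :: "(('a \<Rightarrow> 'b) \<Rightarrow> 'b) list" and i j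
  assume *: "length ws = d \<and> set ws \<subseteq> V \<and> i < j \<and> j < d \<and> ws ! i = ws ! j"
  have "ev_det H D (us0 @ ws @ us1) = 0" unfolding ev_det_def
    by (rule ldet_equal_rows[of "length us0 + i" _ "length us0 + j"]) (use * D in \<open>auto simp: nth_append\<close>)
  then show "(if length ws = d \<and> set ws \<subseteq> V then ev_det H D (us0 @ ws @ us1) else 0) = 0" by simp
next
  fix ws :: "(('a \<Rightarrow> 'b) \<Rightarrow> 'b) list"
  assume *: "length ws = d \<and> set ws \<subseteq> V \<and> set ws \<inter> V' \<noteq> {}"
  then obtain j where j: "j < d" "ws ! j \<in> V'" by (auto simp: in_set_conv_nth)
  have "ev_det H D (us0 @ ws @ us1) = 0"
    by (rule ev_det_span_zero[of us0 "length us0 + j"]) (use * j D V' in \<open>auto simp: nth_append\<close>)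
  then show "(if length ws = d \<and> set ws \<subseteq> V then ev_det H D (us0 @ ws @ us1) else 0) = 0" by simp
qed auto


section \<open>Bundles and their Schur powers\<close>

text \<open>Not local freeness, only what makes fibres closed under addition and scaling and lets
  sections be restricted.\<close>

definition is_bundle :: "('p, 'k::field) fspace \<Rightarrow> ('p, 'v, 'k) fbundle \<Rightarrow> bool" where
  "is_bundle M E \<longleftrightarrow> fspace_ok M \<and>
    (\<forall>U V s. s \<in> E U \<longrightarrow> V \<subseteq> U \<longrightarrow> openin (opens M) V \<longrightarrow> s \<in> E V) \<and>
    (\<forall>U s t. s \<in> E U \<longrightarrow> t \<in> E U \<longrightarrow> (\<lambda>y. s y + t y) \<in> E U) \<and>
    (\<forall>U s c. s \<in> E U \<longrightarrow> (\<lambda>y. fscale c (s y)) \<in> E U)"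

lemma is_bundleD:
  assumes "is_bundle M E"
  shows "fspace_ok M" "s \<in> E U \<Longrightarrow> V \<subseteq> U \<Longrightarrow> openin (opens M) V \<Longrightarrow> s \<in> E V"
    "s \<in> E U \<Longrightarrow> t \<in> E U \<Longrightarrow> (\<lambda>y. s y + t y) \<in> E U" "s \<in> E U \<Longrightarrow> (\<lambda>y. fscale c (s y)) \<in> E U"
  using assms unfolding is_bundle_def by blast+

lemma fibre_add:
  assumes B: "is_bundle M E" and "e \<in> fibre M E y" "e' \<in> fibre M E y" shows "e + e' \<in> fibre M E y"
proof -
  obtain s U where s: "e = s y" "openin (opens M) U" "y \<in> U" "s \<in> E U" using assms(2) unfolding fibre_def by blast
  obtain t V where t: "e' = t y" "openin (opens M) V" "y \<in> V" "t \<in> E V" using assms(3) unfolding fibre_def by blast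
  have o: "openin (opens M) (U \<inter> V)" using s t by blast
  have "(\<lambda>y. s y + t y) \<in> E (U \<inter> V)"
    by (intro is_bundleD(3)[OF B] is_bundleD(2)[OF B s(4) _ o] is_bundleD(2)[OF B t(4) _ o]) auto
  then show ?thesis unfolding fibre_def mem_Collect_eq using s t o
    by (intro exI[of _ "\<lambda>y. s y + t y"] exI[of _ "U \<inter> V"]) auto
qed

lemma fibre_scale:
  assumes B: "is_bundle M E" and "e \<in> fibre M E y" shows "fscale c e \<in> fibre M E y"
proof -
  obtain s U where s: "e = s y" "openin (opens M) U" "y \<in> U" "s \<in> E U" using assms(2) unfolding fibre_def by blast
  then show ?thesis unfolding fibre_def mem_Collect_eq using is_bundleD(4)[OF B s(4), of c]
    by (intro exI[of _ "\<lambda>y. fscale c (s y)"] exI[of _ U]) auto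
qed

lemma fibre_mem: "s \<in> E U \<Longrightarrow> openin (opens M) U \<Longrightarrow> y \<in> U \<Longrightarrow> s y \<in> fibre M E y"
  unfolding fibre_def by blast

lemma dual_fibreI:
  assumes B: "is_bundle M E"
    and "\<And>e e'. e \<in> fibre M E y \<Longrightarrow> e' \<in> fibre M E y \<Longrightarrow> L (e + e') = L e + L e'"
    and "\<And>c e. e \<in> fibre M E y \<Longrightarrow> L (fscale c e) = c * L e"
  shows "(\<lambda>e. if e \<in> fibre M E y then L e else 0) \<in> dual_fibre M E y"
  unfolding dual_fibre_def using assms fibre_add[OF B] fibre_scale[OF B] by auto

lemma dual_fibreD:
  assumes "\<phi> \<in> dual_fibre M E y"
  shows "e \<notin> fibre M E y \<Longrightarrow> \<phi> e = 0" "e \<in> fibre M E y \<Longrightarrow> e' \<in> fibre M E y \<Longrightarrow> \<phi> (e + e') = \<phi> e + \<phi> e'"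
    "e \<in> fibre M E y \<Longrightarrow> \<phi> (fscale c e) = c * \<phi> e"
  using assms unfolding dual_fibre_def by auto

text \<open>A fibre without sections is empty, so 0 cannot be taken for granted; the summand
  \<open>x\<close> gives the induction a starting point.\<close>

lemma dual_fibre_combination:
  assumes B: "is_bundle M E" and x: "x \<in> fibre M E y" and "finite S" "\<And>b. b \<in> S \<Longrightarrow> e b \<in> fibre M E y"
  shows "x + (\<Sum>b\<in>S. fscale (c b) (e b)) \<in> fibre M E y \<and>
    (\<forall>\<phi>\<in>dual_fibre M E y. \<phi> (x + (\<Sum>b\<in>S. fscale (c b) (e b))) = \<phi> x + (\<Sum>b\<in>S. c b * \<phi> (e b)))"
  using assms(3,4)
proof (induction S rule: finite_induct)
  case empty
  then show ?case using x by simp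
next
  case (insert b S)
  let ?z = "x + (\<Sum>b\<in>S. fscale (c b) (e b))"
  have "?z \<in> fibre M E y \<and> (\<forall>\<phi>\<in>dual_fibre M E y. \<phi> ?z = \<phi> x + (\<Sum>b\<in>S. c b * \<phi> (e b)))"
    by (rule insert.IH) (use insert.prems in simp)
  then have z: "?z \<in> fibre M E y" "\<And>\<phi>. \<phi> \<in> dual_fibre M E y \<Longrightarrow> \<phi> ?z = \<phi> x + (\<Sum>b\<in>S. c b * \<phi> (e b))" by blast+
  have s: "fscale (c b) (e b) \<in> fibre M E y" by (rule fibre_scale[OF B]) (use insert in simp)
  have eq: "x + (\<Sum>b\<in>insert b S. fscale (c b) (e b)) = ?z + fscale (c b) (e b)"
    using insert.hyps by (simp only: sum.insert add.assoc add.commute[of "fscale (c b) (e b)"] not_False_eq_True)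
  have eb: "e b \<in> fibre M E y" using insert.prems by simp
  have "\<phi> (?z + fscale (c b) (e b)) = \<phi> x + (\<Sum>b\<in>insert b S. c b * \<phi> (e b))" if "\<phi> \<in> dual_fibre M E y" for \<phi>
    using dual_fibreD(2)[OF that z(1) s] dual_fibreD(3)[OF that eb] z(2)[OF that] insert.hyps by (simp add: add_ac)
  then show ?case unfolding eq using fibre_add[OF B z(1) s] by blast
qed

text \<open>Gram-Schmidt for functionals: nothing is known about the dimension of the fibre, so the
  dual vectors are built one at a time.\<close>

lemma dual_basis_exists:
  assumes B: "is_bundle M E" and d: "distinct \<phi>s" and ind: "fvs.independent (set \<phi>s)" and sub: "set \<phi>s \<subseteq> dual_fibre M E y"
    and ne: "x0 \<in> fibre M E y" and m: "m \<le> length \<phi>s"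
  shows "\<exists>e. \<forall>a<m. e a \<in> fibre M E y \<and> (\<forall>b<m. (\<phi>s ! b) (e a) = (if a = b then 1 else 0))"
  using m
proof (induction m)
  case (Suc m)
  then obtain e where e: "\<And>a. a < m \<Longrightarrow> e a \<in> fibre M E y" "\<And>a b. a < m \<Longrightarrow> b < m \<Longrightarrow> (\<phi>s ! b) (e a) = (if a = b then 1 else 0)"
    by (metis Suc_leD)
  let ?\<phi> = "\<phi>s ! m"
  have mem: "\<phi>s ! b \<in> dual_fibre M E y" if "b < Suc m" for b using sub Suc.prems that by auto
  \<comment> \<open>The part of the new functional that vanishes on the earlier \<open>e b\<close>;
    independence makes it nonzero.\<close>
  define \<psi> where "\<psi> = ?\<phi> - (\<Sum>b<m. fscale (?\<phi> (e b)) (\<phi>s ! b))"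
  have "\<exists>x. \<psi> x \<noteq> 0"
  proof (rule ccontr)
    assume "\<not> ?thesis"
    then have "\<psi> = 0" by (auto simp: fun_eq_iff)
    then have "?\<phi> = (\<Sum>b<m. fscale (?\<phi> (e b)) (\<phi>s ! b))" unfolding \<psi>_def by simp
    also have "\<dots> \<in> fvs.span (set \<phi>s - {?\<phi>})"
    proof (intro fvs.span_sum fvs.span_scale fvs.span_base)
      fix b assume "b \<in> {..<m}"
      then show "\<phi>s ! b \<in> set \<phi>s - {?\<phi>}" using d Suc.prems by (auto simp: nth_eq_iff_index_eq)
    qed
    finally have "fvs.dependent (set \<phi>s)" unfolding fvs.dependent_def using Suc.prems by (intro bexI[of _ ?\<phi>]) auto
    then show False using ind by simp
  qed
  then obtain x where x: "\<psi> x \<noteq> 0" by blast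
  have px: "\<psi> x = ?\<phi> x - (\<Sum>b<m. ?\<phi> (e b) * (\<phi>s ! b) x)" unfolding \<psi>_def by (simp add: sum_fun_apply fscale_def)
  \<comment> \<open>Members of \<open>dual_fibre\<close> are 0 outside the fibre by convention, so a
    vector detected by \<open>\<psi>\<close> belongs to the fibre.\<close>
  have xf: "x \<in> fibre M E y"
  proof (rule ccontr)
    assume "x \<notin> fibre M E y"
    then have "(\<phi>s ! b) x = 0" if "b < Suc m" for b using dual_fibreD(1)[OF mem[OF that]] by blast
    then have "\<psi> x = 0" unfolding px by simp
    then show False using x by simp
  qed
  \<comment> \<open>The correction makes the earlier functionals vanish and gives the new one the
    value \<open>\<psi> x\<close>.\<close>
  define x' where "x' = x + (\<Sum>b<m. fscale (- (\<phi>s ! b) x) (e b))"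
  have x'f: "x' \<in> fibre M E y" and x'v: "\<And>\<phi>. \<phi> \<in> dual_fibre M E y \<Longrightarrow> \<phi> x' = \<phi> x + (\<Sum>b<m. - (\<phi>s ! b) x * \<phi> (e b))"
    using dual_fibre_combination[OF B xf, of "{..<m}" e "\<lambda>b. - (\<phi>s ! b) x"] e(1) unfolding x'_def by auto
  have v1: "(\<phi>s ! b) x' = 0" if "b < m" for b
  proof -
    have "(\<Sum>c<m. - (\<phi>s ! c) x * (\<phi>s ! b) (e c)) = (\<Sum>c<m. if c = b then - (\<phi>s ! b) x else 0)"
      by (intro sum.cong) (use e(2) that in auto)
    then show ?thesis using x'v[OF mem, of b] that by simp
  qed
  have v2: "?\<phi> x' = \<psi> x" using x'v[OF mem, of m] unfolding px by (simp add: sum_negf mult.commute)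
  define em where "em = fscale (1 / \<psi> x) x'"
  have emf: "em \<in> fibre M E y" unfolding em_def by (rule fibre_scale[OF B x'f])
  have em: "(\<phi>s ! b) em = (if b = m then 1 else 0)" if "b < Suc m" for b
    unfolding em_def using dual_fibreD(3)[OF mem[OF that] x'f] v1[of b] v2 x that by (auto simp: less_Suc_eq)
  define e' where "e' a = (if a = m then em else e a + fscale (- ?\<phi> (e a)) em)" for a
  have e'f: "e' a \<in> fibre M E y" if "a < Suc m" for a
  proof (cases "a = m")
    case False
    then have "a < m" using that by simp
    show ?thesis unfolding e'_def using False fibre_add[OF B e(1)[OF \<open>a < m\<close>] fibre_scale[OF B emf]] by (simp only: if_False)
  qed (simp add: e'_def emf)
  have e'v: "(\<phi>s ! b) (e' a) = (if a = b then 1 else 0)" if ab: "a < Suc m" "b < Suc m" for a b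
  proof (cases "a = m")
    case True
    then show ?thesis using em[OF ab(2)] by (auto simp: e'_def)
  next
    case False
    then have am: "a < m" using ab by simp
    have "(\<phi>s ! b) (e' a) = (\<phi>s ! b) (e a) + - ?\<phi> (e a) * (\<phi>s ! b) em"
      unfolding e'_def using False
      by (simp only: if_False dual_fibreD(2)[OF mem[OF ab(2)] e(1)[OF am] fibre_scale[OF B emf]]
        dual_fibreD(3)[OF mem[OF ab(2)] emf])
    then show ?thesis using em[OF ab(2)] e(2)[OF am, of b] ab am by (cases "b = m") auto
  qed
  show ?case by (rule exI[of _ e']) (use e'f e'v in auto)
qed simp

text \<open>The dual vectors at \<open>y\<close> are values of sections, and these restrict to a
  common neighbourhood.\<close>

lemma dual_sections_exist:
  assumes B: "is_bundle M E" and p: "(y, \<phi>s) \<in> points (frame_bundle M E k)" and k: "0 < k"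
  shows "\<exists>U h. openin (opens M) U \<and> y \<in> U \<and> (\<forall>a<k. h a \<in> E U) \<and>
    (\<forall>a<k. \<forall>b<k. (\<phi>s ! b) (h a y) = (if a = b then 1 else 0))"
proof -
  note P = p[unfolded points_frame_bundle]
  \<comment> \<open>A nonzero functional exists because \<open>0 < k\<close>. It can be nonzero only
    on the fibre, which is therefore not empty.\<close>
  have "hd \<phi>s \<noteq> 0" using P k fvs.dependent_zero[of "set \<phi>s"] by (metis hd_in_set length_greater_0_conv)
  then obtain x0 where "hd \<phi>s x0 \<noteq> 0" by (auto simp: fun_eq_iff)
  moreover have "hd \<phi>s \<in> dual_fibre M E y" using P k by (metis hd_in_set length_greater_0_conv subsetD)
  ultimately have x0: "x0 \<in> fibre M E y" using dual_fibreD(1) by metis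
  obtain e where e: "\<And>a. a < k \<Longrightarrow> e a \<in> fibre M E y" "\<And>a b. a < k \<Longrightarrow> b < k \<Longrightarrow> (\<phi>s ! b) (e a) = (if a = b then 1 else 0)"
    using dual_basis_exists[OF B _ _ _ x0, of \<phi>s k] P by auto
  have "\<forall>a\<in>{..<k}. \<exists>s U. e a = s y \<and> openin (opens M) U \<and> y \<in> U \<and> s \<in> E U"
    using e(1) unfolding fibre_def by blast
  then obtain s U where sU: "\<And>a. a < k \<Longrightarrow> e a = s a y \<and> openin (opens M) (U a) \<and> y \<in> U a \<and> s a \<in> E (U a)"
    by (metis lessThan_iff)
  have o: "openin (opens M) (\<Inter>a\<in>{..<k}. U a)" using sU k by (intro openin_INT2) auto
  have "s a \<in> E (\<Inter>a\<in>{..<k}. U a)" if "a < k" for a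
    by (rule is_bundleD(2)[OF B _ _ o, of _ "U a"]) (use sU that in auto)
  then show ?thesis using o sU e by (intro exI[of _ "\<Inter>a\<in>{..<k}. U a"] exI[of _ s]) auto
qed

lemma jump_sequence_valid:
  assumes "is_partition lam" "length lam \<ge> 1"
  shows "valid_type (jump_sequence lam)" "hd (jump_sequence lam) = length lam"
proof -
  let ?P = "\<lambda>i. part lam i > part lam (Suc i)"
  have last: "?P (length lam)" using assms unfolding part_def is_partition_def by (auto simp: nth_mem)
  have "[1..<Suc (length lam)] = [1..<length lam] @ [length lam]" using assms(2) by simp
  then have js: "jump_sequence lam = length lam # rev (filter ?P [1..<length lam])"
    unfolding jump_sequence_def using last by simp
  show "hd (jump_sequence lam) = length lam" unfolding js by simp
  have "sorted_wrt (<) (filter ?P [1..<Suc (length lam)])" by (rule sorted_wrt_filter) (rule sorted_wrt_upt)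
  then have "sorted_wrt (>) (jump_sequence lam)" unfolding jump_sequence_def sorted_wrt_rev .
  moreover have "\<forall>d\<in>set (jump_sequence lam). 0 < d" unfolding jump_sequence_def by auto
  ultimately show "valid_type (jump_sequence lam)" unfolding valid_type_def using js by auto
qed

text \<open>One entry for each tensor factor, exponents being turned into repetitions.\<close>

definition schur_index :: "nat list \<Rightarrow> nat list" where
  "schur_index lam = (let s = jump_sequence lam in concat (map (\<lambda>i. replicate (part lam (s ! i)) i) [0..<length s]))"

lemma schur_line_bundle_alt:
  "schur_line_bundle M E lam = tensor_bundle (flag_bundle M E (jump_sequence lam))
     (map (det_dual_quotient M E (jump_sequence lam)) (schur_index lam))"
  unfolding schur_line_bundle_def schur_index_def Let_def by (simp add: map_concat o_def)

lemma schur_index_bound: "i \<in> set (schur_index lam) \<Longrightarrow> i < length (jump_sequence lam)"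
  unfolding schur_index_def Let_def by auto

text \<open>The largest member of the flag already contributes, its exponent being the last part.
  This positivity makes the degree of the final functions negative.\<close>

lemma schur_weight_pos:
  assumes "is_partition lam" "length lam \<ge> 1"
  shows "0 < (\<Sum>i\<leftarrow>schur_index lam. block_rank (jump_sequence lam) i)"
proof -
  let ?s = "jump_sequence lam"
  note v = jump_sequence_valid[OF assms]
  have ne: "0 < length ?s" using v(1) by (simp add: valid_type_def)
  have "?s ! 0 = length lam" using v ne by (metis hd_conv_nth length_greater_0_conv)
  then have "0 < part lam (?s ! 0)" using assms unfolding part_def is_partition_def by (auto simp: nth_mem)
  then have "0 \<in> set (schur_index lam)" unfolding schur_index_def Let_def using ne by force
  moreover have "0 < block_rank ?s 0" using nth_rank_less[OF v(1) ne] by (simp add: block_rank_def)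
  ultimately show ?thesis by (auto simp: sum_list_eq_0_iff simp flip: neq0_conv)
qed

lemma is_bundle_schur_power:
  fixes M :: "('p, 'k::field) fspace" and E :: "('p, 'v, 'k) fbundle"
  assumes B: "is_bundle M E" and s: "valid_type (jump_sequence lam)"
  shows "is_bundle M (schur_power M E lam)"
proof -
  let ?Z = "flag_bundle M E (jump_sequence lam)"
  let ?L = "schur_line_bundle M E lam"
  have ok: "fspace_ok ?Z" by (rule fspace_ok_flag_bundle)
  have mb: "mono_bundle L" if "L \<in> set (map (det_dual_quotient M E (jump_sequence lam)) (schur_index lam))" for L
    using that mono_det_dual_quotient by auto
  define R where "R \<sigma> = (\<lambda>y (z, v). if z \<in> points ?Z \<and> fst z = y then \<sigma> z v else 0)" 
    for \<sigma> :: "'p \<times> (('v \<Rightarrow> 'k) \<Rightarrow> 'k) set list \<Rightarrow> (('v \<Rightarrow> 'k) \<Rightarrow> 'k) list list \<Rightarrow> 'k"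
  have S: "s \<in> schur_power M E lam U \<longleftrightarrow> (\<exists>\<sigma>\<in>?L {z \<in> points ?Z. fst z \<in> U}. s = R \<sigma>)" for s U
    unfolding schur_power_def direct_image_def R_def by auto
  show ?thesis
    unfolding is_bundle_def S
  proof (intro conjI allI impI)
    show "fspace_ok M" by (rule is_bundleD(1)[OF B])
  next
    fix U V s assume "\<exists>\<sigma>\<in>?L {z \<in> points ?Z. fst z \<in> U}. s = R \<sigma>" and V: "V \<subseteq> U" "openin (opens M) V"
    then obtain \<sigma> where \<sigma>: "\<sigma> \<in> ?L {z \<in> points ?Z. fst z \<in> U}" "s = R \<sigma>" by blast
    have "\<sigma> \<in> ?L {z \<in> points ?Z. fst z \<in> V}"
      unfolding schur_line_bundle_alt
      by (rule tensor_bundle_mono[OF ok mb \<sigma>(1)[unfolded schur_line_bundle_alt] _ openin_flag_bundle_over[OF s V(2)]])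
         (use V in auto)
    then show "\<exists>\<sigma>\<in>?L {z \<in> points ?Z. fst z \<in> V}. s = R \<sigma>" using \<sigma>(2) by blast
  next
    fix U s t assume "\<exists>\<sigma>\<in>?L {z \<in> points ?Z. fst z \<in> U}. s = R \<sigma>" "\<exists>\<sigma>\<in>?L {z \<in> points ?Z. fst z \<in> U}. t = R \<sigma>"
    then obtain \<sigma> \<rho> where \<sigma>: "\<sigma> \<in> ?L {z \<in> points ?Z. fst z \<in> U}" "s = R \<sigma>" "\<rho> \<in> ?L {z \<in> points ?Z. fst z \<in> U}" "t = R \<rho>" by blast
    have "(\<lambda>z. \<sigma> z + \<rho> z) \<in> ?L {z \<in> points ?Z. fst z \<in> U}"
      using \<sigma>(1,3) unfolding schur_line_bundle_alt by (intro tensor_bundle_add[OF ok mb])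
    moreover have "(\<lambda>y. s y + t y) = R (\<lambda>z. \<sigma> z + \<rho> z)" unfolding \<sigma> R_def by (auto simp: fun_eq_iff)
    ultimately show "\<exists>\<sigma>\<in>?L {z \<in> points ?Z. fst z \<in> U}. (\<lambda>y. s y + t y) = R \<sigma>" by blast
  next
    fix U s c assume "\<exists>\<sigma>\<in>?L {z \<in> points ?Z. fst z \<in> U}. s = R \<sigma>"
    then obtain \<sigma> where \<sigma>: "\<sigma> \<in> ?L {z \<in> points ?Z. fst z \<in> U}" "s = R \<sigma>" by blast
    have "(\<lambda>z. fscale c (\<sigma> z)) \<in> ?L {z \<in> points ?Z. fst z \<in> U}"
      using \<sigma>(1) unfolding schur_line_bundle_alt by (intro tensor_bundle_scale[OF ok])
    moreover have "(\<lambda>y. fscale c (s y)) = R (\<lambda>z. fscale c (\<sigma> z))" unfolding \<sigma> R_def by (auto simp: fun_eq_iff fscale_def)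
    ultimately show "\<exists>\<sigma>\<in>?L {z \<in> points ?Z. fst z \<in> U}. (\<lambda>y. fscale c (s y)) = R \<sigma>" by blast
  qed
qed


section \<open>Local sections of the Schur line bundle\<close>

abbreviation (input) "frames M E s \<equiv> points (frame_bundle M E (hd s))"

lemma adapted_frame:
  assumes s: "valid_type s" and z: "(y, us) \<in> frames M E s"
  shows "set (take (nth_rank s i) us) \<subseteq> nth_sub (snd (flag_of s (y, us))) i"
    "nth_sub (snd (flag_of s (y, us))) i \<subseteq> fvs.span (set (take (nth_rank s i) us))"
    "fvs.subspace (nth_sub (snd (flag_of s (y, us))) i)"
    "length (take (nth_rank s i) us) = nth_rank s i"
    "take (nth_rank s (Suc i)) us @ block s us i = take (nth_rank s i) us"
    "nth_sub (snd (flag_of s (y, us))) (Suc i) \<subseteq> nth_sub (snd (flag_of s (y, us))) i"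
proof -
  have len: "length us = hd s" using z by (simp add: points_frame_bundle)
  have le: "nth_rank s (Suc i) \<le> nth_rank s i" by (rule nth_rank_antimono[OF s]) simp
  show "set (take (nth_rank s i) us) \<subseteq> nth_sub (snd (flag_of s (y, us))) i"
    "nth_sub (snd (flag_of s (y, us))) i \<subseteq> fvs.span (set (take (nth_rank s i) us))"
    "fvs.subspace (nth_sub (snd (flag_of s (y, us))) i)"
    unfolding nth_sub_flag_of by (auto simp: fvs.subspace_span intro: fvs.span_superset[THEN subsetD])
  show "length (take (nth_rank s i) us) = nth_rank s i" using nth_rank_le_hd[OF s, of i] len by simp
  show "take (nth_rank s (Suc i)) us @ block s us i = take (nth_rank s i) us"
    unfolding block_def using append_take_drop_id[of "nth_rank s (Suc i)" "take (nth_rank s i) us"] le by (simp add: min_def)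
  show "nth_sub (snd (flag_of s (y, us))) (Suc i) \<subseteq> nth_sub (snd (flag_of s (y, us))) i"
    unfolding nth_sub_flag_of using le by (intro fvs.span_mono set_take_subset_set_take)
qed

abbreviation (input) "minor H s us i \<equiv> ev_det H (nth_rank s i) (take (nth_rank s i) us)"

text \<open>On each member of the flag two adapted frames differ by one determinant, which
  multiplies the minors for every \<open>H\<close> alike.\<close>

lemma minor_ratio:
  assumes s: "valid_type s" and u: "(y, us) \<in> frames M E s" "(y, ws) \<in> frames M E s" "flag_of s (y, us) = flag_of s (y, ws)"
  shows "minor H s us i * minor H' s ws i = minor H' s us i * minor H s ws i"
proof -
  let ?V = "nth_sub (snd (flag_of s (y, us))) i" and ?d = "nth_rank s i"
  note a = adapted_frame[OF s u(1), of i] and b = adapted_frame[OF s u(2), of i, folded u(3)]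
  have alt: "(\<lambda>xs. if length xs = ?d \<and> set xs \<subseteq> ?V then ev_det H ?d ([] @ xs @ []) else 0) \<in> alternating_forms ?d ?V {0}" for H
    by (rule ev_det_alternating) (use a(3) in auto)
  have "?V \<subseteq> fvs.span (set (take ?d us) \<union> {0})" using a(2) fvs.span_mono[of "set (take ?d us)" "set (take ?d us) \<union> {0}"] by auto
  from alternating_forms_ratio[OF alt[of H'] alt[of H] a(4,1,3) this, of "take ?d ws"]
  show ?thesis using a(1,4) b(1,4) fvs.subspace_0[OF a(3)] by simp
qed

text \<open>The element of \<open>det((U\<^sub>i/U\<^sub>i\<^sub>+\<^sub>1)\<^sup>\<or>)\<close> whose value on a basis is a quotient of two minors of an adapted
  frame, with respect to given vectors \<open>H\<close> of the fibre.\<close>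

definition det_form :: "(nat \<Rightarrow> 'w \<Rightarrow> 'k::field_char_0) \<Rightarrow> nat list \<Rightarrow> (('w \<Rightarrow> 'k) \<Rightarrow> 'k) list \<Rightarrow>
    (('w \<Rightarrow> 'k) \<Rightarrow> 'k) set \<Rightarrow> nat \<Rightarrow> (('w \<Rightarrow> 'k) \<Rightarrow> 'k) list \<Rightarrow> 'k" where
  "det_form H s us V i ws = (if length ws = block_rank s i \<and> set ws \<subseteq> V
     then ev_det H (nth_rank s i) (take (nth_rank s (Suc i)) us @ ws) / minor H s us (Suc i) else 0)"

lemma det_form_alternating:
  assumes s: "valid_type s" and u: "(y, us) \<in> frames M E s"
  shows "det_form H s us (nth_sub (snd (flag_of s (y, us))) i) i \<in> alternating_forms (block_rank s i)
     (nth_sub (snd (flag_of s (y, us))) i) (nth_sub (snd (flag_of s (y, us))) (Suc i))"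
proof -
  let ?V = "nth_sub (snd (flag_of s (y, us))) i" and ?us0 = "take (nth_rank s (Suc i)) us"
  have le: "nth_rank s (Suc i) \<le> nth_rank s i" by (rule nth_rank_antimono[OF s]) simp
  have "(\<lambda>ws. if length ws = block_rank s i \<and> set ws \<subseteq> ?V then ev_det H (nth_rank s i) (?us0 @ ws @ []) else 0)
     \<in> alternating_forms (block_rank s i) ?V (nth_sub (snd (flag_of s (y, us))) (Suc i))"
    by (rule ev_det_alternating)
       (use adapted_frame[OF s u, of i] adapted_frame(2,4)[OF s u, of "Suc i"] le in \<open>simp_all add: block_rank_def\<close>)
  from alternating_forms_combination[OF this this, of "1 / minor H s us (Suc i)" 0]
  have "(\<lambda>ws. (1 / minor H s us (Suc i)) * (if length ws = block_rank s i \<and> set ws \<subseteq> ?V then ev_det H (nth_rank s i) (?us0 @ ws @ []) else 0) +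
      0 * (if length ws = block_rank s i \<and> set ws \<subseteq> ?V then ev_det H (nth_rank s i) (?us0 @ ws @ []) else 0))
     \<in> alternating_forms (block_rank s i) ?V (nth_sub (snd (flag_of s (y, us))) (Suc i))" .
  moreover have "(\<lambda>ws. (1 / minor H s us (Suc i)) * (if length ws = block_rank s i \<and> set ws \<subseteq> ?V then ev_det H (nth_rank s i) (?us0 @ ws @ []) else 0) +
      0 * (if length ws = block_rank s i \<and> set ws \<subseteq> ?V then ev_det H (nth_rank s i) (?us0 @ ws @ []) else 0)) =
      det_form H s us ?V i"
    by (auto simp: det_form_def fun_eq_iff)
  ultimately show ?thesis by (simp only:)
qed

text \<open>Exchanging the first \<open>nth_rank s (Suc i)\<close> vectors of \<open>us\<close> for
  those of \<open>ws\<close> multiplies numerator and denominator by the same factor, so the form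
  depends on the flag only.\<close>

lemma det_form_block:
  assumes s: "valid_type s" and u: "(y, us) \<in> frames M E s" "(y, ws) \<in> frames M E s" "flag_of s (y, us) = flag_of s (y, ws)"
    and nz: "minor H s us (Suc i) \<noteq> 0" "minor H s ws (Suc i) \<noteq> 0"
  shows "det_form H s us (nth_sub (snd (flag_of s (y, us))) i) i (block s ws i) = minor H s ws i / minor H s ws (Suc i)"
proof -
  let ?W = "nth_sub (snd (flag_of s (y, us))) (Suc i)" and ?d = "nth_rank s (Suc i)" and ?D = "nth_rank s i"
  let ?b = "block s ws i"
  have le: "?d \<le> ?D" by (rule nth_rank_antimono[OF s]) simp
  note a = adapted_frame[OF s u(1), of "Suc i"] and b = adapted_frame[OF s u(2), of "Suc i", folded u(3)]
  have lb: "length ?b = block_rank s i" by (rule length_block[OF s]) (use u(2) in \<open>simp add: points_frame_bundle\<close>)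
  have sb: "set ?b \<subseteq> nth_sub (snd (flag_of s (y, us))) i" unfolding u(3) by (rule set_block)
  have 1: "(\<lambda>xs. if length xs = ?d \<and> set xs \<subseteq> ?W then ev_det H ?D ([] @ xs @ ?b) else 0) \<in> alternating_forms ?d ?W {0}"
    by (rule ev_det_alternating) (use a(3) lb le in \<open>auto simp: block_rank_def\<close>)
  have 2: "(\<lambda>xs. if length xs = ?d \<and> set xs \<subseteq> ?W then ev_det H ?d ([] @ xs @ []) else 0) \<in> alternating_forms ?d ?W {0}"
    by (rule ev_det_alternating) (use a(3) in auto)
  have "?W \<subseteq> fvs.span (set (take ?d us) \<union> {0})" using a(2) fvs.span_mono[of "set (take ?d us)" "set (take ?d us) \<union> {0}"] by auto
  from alternating_forms_ratio[OF 1 2 a(4,1,3) this, of "take ?d ws"]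
  have "minor H s us (Suc i) * ev_det H ?D (take ?d ws @ ?b) = ev_det H ?D (take ?d us @ ?b) * minor H s ws (Suc i)"
    using a(1,4) b(1,4) fvs.subspace_0[OF a(3)] by simp
  moreover have "take ?d ws @ ?b = take ?D ws" by (rule adapted_frame(5)[OF s u(2)])
  ultimately have "ev_det H ?D (take ?d us @ ?b) / minor H s us (Suc i) = minor H s ws i / minor H s ws (Suc i)"
    using nz by (simp add: field_simps)
  then show ?thesis unfolding det_form_def using lb sb by simp
qed

text \<open>Summation by parts in the exponents. Since \<open>l\<close> increases, the new exponents
  are natural numbers; this is how the ordering of the parts of the partition enters.\<close>

lemma telescope_powers:
  fixes P :: "nat \<Rightarrow> 'k::field"
  assumes "\<And>i. i \<le> L \<Longrightarrow> P i \<noteq> 0" "\<And>i. i < L \<Longrightarrow> l i \<le> l (Suc i)"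
  shows "(\<Prod>i<Suc L. (P i / P (Suc i)) ^ l i) =
    (\<Prod>i<Suc L. P i ^ (if i = 0 then l 0 else l i - l (i - 1))) / P (Suc L) ^ l L"
  using assms
proof (induction L)
  case (Suc L)
  have "P (Suc L) ^ l (Suc L) = P (Suc L) ^ l L * P (Suc L) ^ (l (Suc L) - l L)"
    using Suc.prems(2)[of L] by (simp add: power_add[symmetric])
  then show ?case using Suc.IH Suc.prems by (subst prod.lessThan_Suc) (simp add: power_divide)
qed (simp add: power_divide)


text \<open>Comparison with vectors dual to the second frame, for which its minor is 1.\<close>

lemma minor_nonzero_transfer:
  fixes M :: "('p, 'k::field_char_0) fspace" and E :: "('p, 'v, 'k) fbundle"
  assumes B: "is_bundle M E" and s: "valid_type s"
    and u: "(y, us) \<in> frames M E s" "(y, ws) \<in> frames M E s" "flag_of s (y, us) = flag_of s (y, ws)"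
    and nz: "minor H s us i \<noteq> 0"
  shows "minor H s ws i \<noteq> 0"
proof -
  have "0 < hd s" using s valid_type_pos[OF s, of 0] by (simp add: valid_type_def hd_conv_nth)
  from dual_sections_exist[OF B u(2) this] obtain h where
    h: "\<And>a b. a < hd s \<Longrightarrow> b < hd s \<Longrightarrow> (ws ! b) (h a y) = (if a = b then 1 else 0)" by blast
  have le: "nth_rank s i \<le> hd s" by (rule nth_rank_le_hd[OF s])
  have "minor (\<lambda>a. h a y) s ws i = 1" by (rule ev_det_dual) (use h le in auto)
  then show ?thesis using minor_ratio[OF s u, of H i "\<lambda>a. h a y"] nz by auto
qed

lemma minor_alg_gen:
  fixes M :: "('p, 'k::field_char_0) fspace" and E :: "('p, 'v, 'k) fbundle"
  assumes s: "valid_type s" and h: "\<And>a. a < hd s \<Longrightarrow> h a \<in> E U"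
  shows "(\<lambda>w. minor (\<lambda>a. h a (fst w)) s (snd w) i) \<in> alg_gen (tuple_gens M E (hd s) U)"
  unfolding ev_det_def ldet_def
proof (intro alg_gen_sum alg_gen_mult alg_gen.const alg_gen_prod)
  fix p b assume p: "p \<in> {p. p permutes {..<nth_rank s i}}" and b: "b \<in> {..<nth_rank s i}"
  have le: "nth_rank s i \<le> hd s" by (rule nth_rank_le_hd[OF s])
  have pb: "p b < hd s" using p b le permutes_in_image[of p "{..<nth_rank s i}" b] by auto
  have "(\<lambda>w. (take (nth_rank s i) (snd w) ! b) (h (p b) (fst w))) = (\<lambda>(y, \<phi>s). (\<phi>s ! b) (h (p b) y))"
    using b by (auto simp: fun_eq_iff)
  moreover have "(\<lambda>(y, \<phi>s). (\<phi>s ! b) (h (p b) y)) \<in> tuple_gens M E (hd s) U"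
    unfolding tuple_gens_def
    by (intro UnI2 CollectI exI[of _ b] exI[of _ "h (p b)"]) (use h[OF pb] b le in auto)
  ultimately show "(\<lambda>w. (take (nth_rank s i) (snd w) ! b) (h (p b) (fst w))) \<in> alg_gen (tuple_gens M E (hd s) U)"
    by (metis alg_gen.gen)
qed

lemma prod_concat_replicate:
  fixes g :: "nat \<Rightarrow> 'k::comm_monoid_mult"
  shows "(\<Prod>r<length (concat (map (\<lambda>i. replicate (l i) i) [0..<L])). g (concat (map (\<lambda>i. replicate (l i) i) [0..<L]) ! r)) =
    (\<Prod>i<L. g i ^ l i)"
proof -
  have pl: "(\<Prod>r<length xs. g (xs ! r)) = prod_list (map g xs)" for xs
    by (induction xs rule: rev_induct) (auto simp: nth_append)
  show ?thesis unfolding pl by (induction L) (auto simp: map_replicate)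
qed

text \<open>Both forms lie in the same determinant line, so it is enough to compare them on the
  block of \<open>us\<close>.\<close>

lemma det_form_proportional:
  fixes M :: "('p, 'k::field_char_0) fspace" and E :: "('p, 'v, 'k) fbundle"
  assumes s: "valid_type s" and u: "(y, us) \<in> frames M E s"
    and nz: "minor H s us (Suc i) \<noteq> 0" "minor H' s us (Suc i) = 1" "minor H' s us i = 1"
  shows "det_form H s us (nth_sub (snd (flag_of s (y, us))) i) i ws =
    minor H s us i / minor H s us (Suc i) * det_form H' s us (nth_sub (snd (flag_of s (y, us))) i) i ws"
proof -
  let ?V = "nth_sub (snd (flag_of s (y, us))) i" and ?V' = "nth_sub (snd (flag_of s (y, us))) (Suc i)"
  note a = adapted_frame[OF s u, of i] and a' = adapted_frame[OF s u, of "Suc i"]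
  have "set (take (nth_rank s i) us) \<subseteq> set (block s us i) \<union> ?V'"
    using a'(1) unfolding a(5)[symmetric] by auto
  then have "?V \<subseteq> fvs.span (set (block s us i) \<union> ?V')" using a(2) fvs.span_mono by blast
  moreover have "length (block s us i) = block_rank s i"
    by (rule length_block[OF s]) (use u in \<open>simp add: points_frame_bundle\<close>)
  ultimately have "det_form H' s us ?V i (block s us i) * det_form H s us ?V i ws =
    det_form H s us ?V i (block s us i) * det_form H' s us ?V i ws"
    by (intro alternating_forms_ratio[OF det_form_alternating[OF s u] det_form_alternating[OF s u]] set_block a(3,6))
  then show ?thesis using det_form_block[OF s u u refl, of H i] det_form_block[OF s u u refl, of H' i] nz by simp
qed

text \<open>The highest weight section: its value on an adapted frame is the product of the minors
  with respect to \<open>h\<close>, sections dual to \<open>\<phi>0\<close> at \<open>y0\<close>,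
  with exponents \<open>mm i\<close>, the successive differences of the parts. It is defined over
  all flags above \<open>U\<close> and shows that evaluation at a frame is not the zero functional
  on the fibre of the Schur power.\<close>

lemma schur_section_exists:
  fixes M :: "('p, 'k::field_char_0) fspace" and E :: "('p, 'v, 'k) fbundle"
  assumes B: "is_bundle M E" and lam: "is_partition lam" "length lam \<ge> 1"
    and p: "(y0, \<phi>0) \<in> frames M E (jump_sequence lam)"
  shows "\<exists>U \<sigma>. openin (opens M) U \<and> y0 \<in> U \<and>
    \<sigma> \<in> schur_line_bundle M E lam {z \<in> points (flag_bundle M E (jump_sequence lam)). fst z \<in> U} \<and>
    \<sigma> (flag_of (jump_sequence lam) (y0, \<phi>0)) (map (block (jump_sequence lam) \<phi>0) (schur_index lam)) \<noteq> 0"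
proof -
  define s where "s = jump_sequence lam"
  define ix where "ix = schur_index lam"
  define L where "L = length s"
  define l where "l i = part lam (s ! i)" for i
  define mm where "mm i = (if i = 0 then l 0 else l i - l (i - 1))" for i
  have s: "valid_type s" unfolding s_def by (rule jump_sequence_valid[OF lam])
  have k0: "0 < hd s" using s valid_type_pos[OF s, of 0] by (simp add: valid_type_def hd_conv_nth)
  have L0: "0 < L" using s unfolding L_def valid_type_def by simp
  have lmono: "l i \<le> l (Suc i)" if "Suc i < L" for i
  proof -
    have s1: "s ! Suc i < s ! i" using valid_type_nth[OF s, of i "Suc i"] that by (simp add: L_def)
    have s2: "s ! i \<le> length lam" "0 < s ! Suc i"
      using nth_rank_le_hd[OF s, of i] that jump_sequence_valid(2)[OF lam] valid_type_pos[OF s, of "Suc i"]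
      by (simp_all add: nth_rank_def L_def s_def)
    have "s ! Suc i - 1 < s ! i - 1 \<and> s ! i - 1 < length lam" using s1 s2 by linarith
    then have "lam ! (s ! i - 1) \<le> lam ! (s ! Suc i - 1)"
      using lam(1) unfolding is_partition_def by blast
    then show ?thesis using s1 s2 unfolding l_def part_def by auto
  qed
  have rankL: "nth_rank s L = 0" unfolding nth_rank_def L_def by simp
  have ix_alt: "ix = concat (map (\<lambda>i. replicate (l i) i) [0..<L])"
    unfolding ix_def schur_index_def Let_def l_def L_def s_def ..
  have isL: "ix ! r < L" if "r < length ix" for r
    using schur_index_bound[of "ix ! r" lam] that unfolding ix_def L_def s_def by simp
  define fr where "fr z = (SOME us. (fst z, us) \<in> frames M E s \<and> flag_of s (fst z, us) = z)" for z
  have fr: "(fst z, fr z) \<in> frames M E s \<and> flag_of s (fst z, fr z) = z" if "z \<in> flags M E s" for z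
    unfolding fr_def by (rule someI_ex) (use adapted_frame_exists[OF s, of "fst z" "snd z" M E] that in simp)
  \<comment> \<open>Dual vectors for the frame chosen at each flag. They make all minors 1 and so
    define the section at every point, though without visible regularity; \<open>e_local\<close>
    allows them to be exchanged for values of sections.\<close>
  define Hz where "Hz z = (SOME H. \<forall>a<hd s. \<forall>b<hd s. (fr z ! b) (H a) = (if a = b then 1 else (0::'k)))" for z
  have Hz: "\<forall>a<hd s. \<forall>b<hd s. (fr z ! b) (Hz z a) = (if a = b then 1 else (0::'k))" if z: "z \<in> flags M E s" for z
  proof -
    from fr[OF z] have "(fst z, fr z) \<in> frames M E s" ..
    from dual_sections_exist[OF B this k0] obtain h where
      "\<forall>a<hd s. \<forall>b<hd s. (fr z ! b) (h a (fst z)) = (if a = b then 1 else (0::'k))" by blast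
    then have "\<exists>H. \<forall>a<hd s. \<forall>b<hd s. (fr z ! b) (H a) = (if a = b then 1 else (0::'k))"
      by (rule exI[of _ "\<lambda>a. h a (fst z)"])
    then show ?thesis unfolding Hz_def by (rule someI_ex)
  qed
  have minor1: "minor H s us i = 1" if "\<And>a b. a < hd s \<Longrightarrow> b < hd s \<Longrightarrow> (us ! b) (H a) = (if a = b then 1 else 0)" for H :: "nat \<Rightarrow> ('v \<Rightarrow> 'k)" and us i
    by (rule ev_det_dual) (use that nth_rank_le_hd[OF s, of i] in auto)
  have same: "minor H s us i \<noteq> 0 \<longleftrightarrow> minor H s (fr z) i \<noteq> 0" if "(fst z, us) \<in> frames M E s" "flag_of s (fst z, us) = z" for H us i z
  proof -
    have "z \<in> flags M E s" using flag_of_in_flags[OF s that(1)] that(2) by simp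
    then show ?thesis using minor_nonzero_transfer[OF B s that(1), of "fr z" H i] minor_nonzero_transfer[OF B s _ that(1), of "fr z" H i]
        fr[of z] that(2) by metis
  qed
  obtain U h where U: "openin (opens M) U" "y0 \<in> U" "\<And>a. a < hd s \<Longrightarrow> h a \<in> E U"
    and hdual: "\<And>a b. a < hd s \<Longrightarrow> b < hd s \<Longrightarrow> (\<phi>0 ! b) (h a y0) = (if a = b then 1 else 0)"
    using dual_sections_exist[OF B p[folded s_def] k0] by blast
  \<comment> \<open>The coefficient of the section with respect to the generator built from
    \<open>H\<close>. Both minors are taken on the same frame, so their ratio depends on the flag
    only.\<close>
  define C where "C H z = (\<Prod>i<L. (minor (\<lambda>a. h a (fst z)) s (fr z) i / minor H s (fr z) i) ^ mm i)" for H z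
  define \<theta> where "\<theta> H z i = det_form H s (fr z) (nth_sub (snd z) i) i" for H z i
  define e where "e z = fscale (C (Hz z) z) (pure_tensor (map (\<lambda>r. \<theta> (Hz z) z (ix ! r)) [0..<length ix]))" for z
  \<comment> \<open>Passing from \<open>Hz z\<close> to \<open>H\<close> multiplies the tensor of
    the \<open>\<theta>\<close> by a product of powers of minors, by telescoping, and divides
    \<open>C\<close> by the same product.\<close>
  have e_local: "e z = fscale (C H z) (pure_tensor (map (\<lambda>r. \<theta> H z (ix ! r)) [0..<length ix]))"
    if z: "z \<in> flags M E s" and nz: "\<And>i. i < L \<Longrightarrow> minor H s (fr z) i \<noteq> 0" for H z
  proof
    fix vs
    from fr[OF z] have f: "(fst z, fr z) \<in> frames M E s" "flag_of s (fst z, fr z) = z" by auto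
    have nz': "minor H s (fr z) i \<noteq> 0" if "i \<le> L" for i using nz[of i] rankL that by (cases "i = L") auto
    have H1: "minor (Hz z) s (fr z) i = 1" for i by (rule minor1) (use Hz[OF z] in auto)
    have pr1: "\<theta> H z i ws = minor H s (fr z) i / minor H s (fr z) (Suc i) * \<theta> (Hz z) z i ws" if "i < L" for i ws
      using det_form_proportional[OF s f(1), of H i "Hz z" ws] nz'[of "Suc i"] that H1 unfolding \<theta>_def f(2) by simp
    show "e z vs = fscale (C H z) (pure_tensor (map (\<lambda>r. \<theta> H z (ix ! r)) [0..<length ix])) vs"
    proof (cases "length vs = length ix")
      case False
      then show ?thesis by (simp add: e_def fscale_def pure_tensor_def)
    next
      case True
      let ?c = "\<lambda>i. minor H s (fr z) i / minor H s (fr z) (Suc i)"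
      obtain L' where L': "L = Suc L'" using L0 by (cases L) auto
      have "(\<Prod>r<length ix. ?c (ix ! r)) = (\<Prod>i<L. ?c i ^ l i)" unfolding ix_alt by (rule prod_concat_replicate)
      also have "\<dots> = (\<Prod>i<L. minor H s (fr z) i ^ mm i)"
        using telescope_powers[of L' "\<lambda>i. minor H s (fr z) i" l] nz' lmono rankL unfolding L' mm_def by simp
      finally have c: "(\<Prod>r<length ix. ?c (ix ! r)) = (\<Prod>i<L. minor H s (fr z) i ^ mm i)" .
      have "C H z * (\<Prod>r<length ix. \<theta> H z (ix ! r) (vs ! r)) =
          C H z * ((\<Prod>r<length ix. ?c (ix ! r)) * (\<Prod>r<length ix. \<theta> (Hz z) z (ix ! r) (vs ! r)))"
        using pr1 isL by (simp add: prod.distrib[symmetric])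
      also have "C H z * ((\<Prod>r<length ix. ?c (ix ! r)) * (\<Prod>r<length ix. \<theta> (Hz z) z (ix ! r) (vs ! r))) =
          (C H z * (\<Prod>i<L. minor H s (fr z) i ^ mm i)) * (\<Prod>r<length ix. \<theta> (Hz z) z (ix ! r) (vs ! r))"
        unfolding c by (simp only: mult.assoc)
      also have "C H z * (\<Prod>i<L. minor H s (fr z) i ^ mm i) = (\<Prod>i<L. minor (\<lambda>a. h a (fst z)) s (fr z) i ^ mm i)"
        unfolding C_def prod.distrib[symmetric] using nz by (intro prod.cong refl) (simp add: power_divide)
      also have "\<dots> = C (Hz z) z" unfolding C_def using H1 by simp
      finally show ?thesis using True by (simp add: e_def fscale_def pure_tensor_upt)
    qed
  qed
  let ?Z = "flag_bundle M E s"
  have pts: "points ?Z = flags M E s" by (rule points_flag_bundle[OF s])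
  have "e \<in> tensor_bundle ?Z (map (det_dual_quotient M E s) ix) {z \<in> points ?Z. fst z \<in> U}"
  proof (rule tensor_bundleI)
    fix z0 assume "z0 \<in> {z \<in> points ?Z. fst z \<in> U}"
    then have z0: "z0 \<in> flags M E s" "fst z0 \<in> U" unfolding pts by auto
    from fr[OF z0(1)] have f0: "(fst z0, fr z0) \<in> frames M E s" ..
    obtain U0 g where U0: "openin (opens M) U0" "fst z0 \<in> U0" "\<And>a. a < hd s \<Longrightarrow> g a \<in> E U0"
      and gdual: "\<And>a b. a < hd s \<Longrightarrow> b < hd s \<Longrightarrow> (fr z0 ! b) (g a (fst z0)) = (if a = b then 1 else 0)"
      using dual_sections_exist[OF B f0 k0] by blast
    define G where "G y = (\<lambda>a. g a y)" for y
    define W where "W = U \<inter> U0"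
    have W: "openin (opens M) W" unfolding W_def using U U0 by blast
    have gW: "g a \<in> E W" if "a < hd s" for a unfolding W_def using is_bundleD(2)[OF B U0(3)[OF that], of "U \<inter> U0"] W W_def by auto
    have hW: "h a \<in> E W" if "a < hd s" for a unfolding W_def using is_bundleD(2)[OF B U(3)[OF that], of "U \<inter> U0"] W W_def by auto
    \<comment> \<open>The sections \<open>g\<close> are dual to the chosen frame at
      \<open>z0\<close>, so their minors are 1 there; this is the locus where they stay
      nonzero.\<close>
    define V where "V = {z \<in> flags M E s. fst z \<in> W \<and> (\<forall>i<L. minor (G (fst z)) s (fr z) i \<noteq> 0)}"
    have ga: "(\<lambda>w. minor (G (fst w)) s (snd w) i) \<in> alg_gen (tuple_gens M E (hd s) W)" for i
      unfolding G_def using gW by (rule minor_alg_gen[OF s, where h = g])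
    have ha: "(\<lambda>w. minor (\<lambda>a. h a (fst w)) s (snd w) i) \<in> alg_gen (tuple_gens M E (hd s) W)" for i
      using hW by (rule minor_alg_gen[OF s, where h = h])
    \<comment> \<open>Nonvanishing of minors does not depend on the adapted frame, so the chosen
      frame can be replaced by the variable one and the preimage is a basic open set.\<close>
    have pre: "{w \<in> frames M E s. flag_of s w \<in> V} = {w \<in> frames M E s. fst w \<in> W \<and> (\<Prod>i<L. minor (G (fst w)) s (snd w) i) \<noteq> 0}"
    proof -
      have "flag_of s w \<in> V \<longleftrightarrow> fst w \<in> W \<and> (\<Prod>i<L. minor (G (fst w)) s (snd w) i) \<noteq> 0" if w: "w \<in> frames M E s" for w
        using same[of "flag_of s w" "snd w"] w flag_of_in_flags[OF s, of "fst w" "snd w" M E] unfolding V_def by (simp add: Ball_def)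
      then show ?thesis by blast
    qed
    have minor_w: "fst w \<in> W" "\<And>i. i \<le> L \<Longrightarrow> minor (G (fst w)) s (snd w) i \<noteq> 0" "\<And>i. i \<le> L \<Longrightarrow> minor (G (fst w)) s (fr (flag_of s w)) i \<noteq> 0"
      "(fst w, fr (flag_of s w)) \<in> frames M E s" "(fst w, snd w) \<in> frames M E s"
      "flag_of s (fst w, fr (flag_of s w)) = flag_of s (fst w, snd w)"
      if w: "w \<in> {w \<in> frames M E s. flag_of s w \<in> V}" for w
    proof -
      show "fst w \<in> W" using w unfolding pre by simp
      have "\<And>i. i < L \<Longrightarrow> minor (G (fst w)) s (snd w) i \<noteq> 0" using w unfolding pre by simp
      then show 1: "\<And>i. i \<le> L \<Longrightarrow> minor (G (fst w)) s (snd w) i \<noteq> 0" using rankL by (metis ev_det_0 le_neq_implies_less zero_neq_one)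
      have wf: "w \<in> frames M E s" using w by simp
      then show "\<And>i. i \<le> L \<Longrightarrow> minor (G (fst w)) s (fr (flag_of s w)) i \<noteq> 0" using 1 same[of "flag_of s w" "snd w"] by simp
      have "flag_of s w \<in> flags M E s" using flag_of_in_flags[OF s, of "fst w" "snd w" M E] wf by simp
      from fr[OF this] wf show "(fst w, fr (flag_of s w)) \<in> frames M E s" "(fst w, snd w) \<in> frames M E s"
        "flag_of s (fst w, fr (flag_of s w)) = flag_of s (fst w, snd w)" by simp_all
    qed
    have Vopen: "openin (opens ?Z) V"
      unfolding flag_bundle_def openin_quotient_fspace pre
      using openin_frame_bundle[OF W alg_gen_prod[of "{..<L}", OF ga]] by (auto simp: V_def)
    have z0V: "z0 \<in> V"
    proof -
      have "minor (G (fst z0)) s (fr z0) i = 1" for i by (rule minor1) (use gdual in \<open>simp add: G_def\<close>)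
      then show ?thesis unfolding V_def W_def using z0 U0(2) by simp
    qed
    have Creg: "(\<lambda>z. C (G (fst z)) z) \<in> regs ?Z V"
      unfolding flag_bundle_def regs_quotient_fspace
    proof (rule regs_frame_bundle[OF W])
      show "(\<lambda>w. \<Prod>i<L. minor (\<lambda>a. h a (fst w)) s (snd w) i ^ mm i) \<in> alg_gen (tuple_gens M E (hd s) W)"
        by (intro alg_gen_prod alg_gen_power ha)
      show "(\<lambda>w. \<Prod>i<L. minor (G (fst w)) s (snd w) i ^ mm i) \<in> alg_gen (tuple_gens M E (hd s) W)"
        by (intro alg_gen_prod alg_gen_power ga)
      fix w assume w: "w \<in> {w \<in> frames M E s. flag_of s w \<in> V}"
      note mw = minor_w[OF w]
      \<comment> \<open>Ratios of minors agree on all adapted frames; this eliminates the chosen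
        frame, about whose variation nothing is known.\<close>
      have "minor (\<lambda>a. h a (fst w)) s (fr (flag_of s w)) i / minor (G (fst w)) s (fr (flag_of s w)) i =
          minor (\<lambda>a. h a (fst w)) s (snd w) i / minor (G (fst w)) s (snd w) i" if "i < L" for i
        using minor_ratio[OF s mw(4,5,6), of "\<lambda>a. h a (fst w)" i "G (fst w)"] mw(2,3)[of i] that by (simp add: field_simps)
      then have "C (G (fst w)) (flag_of s w) = (\<Prod>i<L. (minor (\<lambda>a. h a (fst w)) s (snd w) i / minor (G (fst w)) s (snd w) i) ^ mm i)"
        unfolding C_def by simp
      then show "fst w \<in> W \<and> (\<Prod>i<L. minor (G (fst w)) s (snd w) i ^ mm i) \<noteq> 0 \<and>
        C (G (fst (flag_of s w))) (flag_of s w) = (\<Prod>i<L. minor (\<lambda>a. h a (fst w)) s (snd w) i ^ mm i) / (\<Prod>i<L. minor (G (fst w)) s (snd w) i ^ mm i)"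
        using mw(1,2) by (simp add: power_divide prod_dividef)
    qed auto
    have treg: "(\<lambda>z. \<theta> (G (fst z)) z i) \<in> det_dual_quotient M E s i V" if i: "i < L" for i
      unfolding det_dual_quotient_iff
    proof (intro conjI ballI)
      fix z assume "z \<in> V"
      then have "z \<in> flags M E s" unfolding V_def by simp
      from fr[OF this] have f: "(fst z, fr z) \<in> frames M E s" "flag_of s (fst z, fr z) = z" by auto
      show "\<theta> (G (fst z)) z i \<in> alternating_forms (block_rank s i) (nth_sub (snd z) i) (nth_sub (snd z) (Suc i))"
        using det_form_alternating[OF s f(1), of "G (fst z)" i] unfolding f(2) \<theta>_def .
    next
      show "(\<lambda>z. \<theta> (G (fst (flag_of s z))) (flag_of s z) i (block s (snd z) i)) \<in> regs (frame_bundle M E (hd s)) {z \<in> frames M E s. flag_of s z \<in> V}"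
      proof (rule regs_frame_bundle[OF W ga[of i] ga[of "Suc i"]])
        fix w assume w: "w \<in> {w \<in> frames M E s. flag_of s w \<in> V}"
        note mw = minor_w[OF w]
        have "\<theta> (G (fst w)) (flag_of s w) i (block s (snd w) i) = minor (G (fst w)) s (snd w) i / minor (G (fst w)) s (snd w) (Suc i)"
          using det_form_block[OF s mw(4,5,6), of "G (fst w)" i] mw(2,3)[of "Suc i"] i unfolding mw(6) \<theta>_def by simp
        then show "fst w \<in> W \<and> minor (G (fst w)) s (snd w) (Suc i) \<noteq> 0 \<and>
          \<theta> (G (fst (flag_of s w))) (flag_of s w) i (block s (snd w) i) = minor (G (fst w)) s (snd w) i / minor (G (fst w)) s (snd w) (Suc i)"
          using mw(1) mw(2)[of "Suc i"] i by simp
      qed auto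
    qed
    have VU: "V \<subseteq> {z \<in> points ?Z. fst z \<in> U}" unfolding V_def W_def pts by auto
    have eV: "e z = fscale (C (G (fst z)) z) (pure_tensor (map (\<lambda>r. \<theta> (G (fst z)) z (ix ! r)) [0..<length ix]))" if "z \<in> V" for z
      by (rule e_local) (use that in \<open>auto simp: V_def\<close>)
    show "\<exists>V (m::nat) a \<sigma>. openin (opens ?Z) V \<and> z0 \<in> V \<and> V \<subseteq> {z \<in> points ?Z. fst z \<in> U} \<and>
       (\<forall>j<m. a j \<in> regs ?Z V \<and> (\<forall>i<length (map (det_dual_quotient M E s) ix). \<sigma> j i \<in> (map (det_dual_quotient M E s) ix ! i) V)) \<and>
       (\<forall>y\<in>V. e y = (\<Sum>j<m. fscale (a j y) (pure_tensor (map (\<lambda>i. \<sigma> j i y) [0..<length (map (det_dual_quotient M E s) ix)]))))"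
      by (rule exI[of _ V], rule exI[of _ 1], rule exI[of _ "\<lambda>_ z. C (G (fst z)) z"], rule exI[of _ "\<lambda>_ r z. \<theta> (G (fst z)) z (ix ! r)"])
         (use Vopen z0V VU Creg treg isL eV in simp)
  qed
  moreover have "e (flag_of s (y0, \<phi>0)) (map (block s \<phi>0) ix) \<noteq> 0"
  proof -
    let ?z = "flag_of s (y0, \<phi>0)" and ?H = "\<lambda>a. h a y0"
    have p': "(y0, \<phi>0) \<in> frames M E s" using p by (simp add: s_def)
    have zf: "?z \<in> flags M E s" by (rule flag_of_in_flags[OF s p'])
    from fr[OF zf] have f: "(y0, fr ?z) \<in> frames M E s" "flag_of s (y0, fr ?z) = ?z" by simp_all
    have 1: "minor ?H s \<phi>0 i = 1" for i by (rule minor1) (rule hdual)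
    have nz: "minor ?H s (fr ?z) i \<noteq> 0" for i using same[of ?z \<phi>0 ?H i] p' 1[of i] by simp
    have "\<theta> ?H ?z i (block s \<phi>0 i) = 1" for i
      using det_form_block[OF s f(1) p' f(2), of ?H i] nz 1 unfolding f(2) \<theta>_def by simp
    moreover have "C ?H ?z = 1" unfolding C_def using nz by simp
    ultimately have "e ?z (map (block s \<phi>0) ix) = 1"
      using e_local[OF zf, of ?H] nz by (simp add: fscale_def pure_tensor_upt)
    then show ?thesis by simp
  qed
  ultimately show ?thesis
    unfolding schur_line_bundle_alt s_def[symmetric] ix_def[symmetric] using U(1,2)
    by (intro exI[of _ U] exI[of _ e] conjI)
qed


section \<open>Projective varieties and their cones\<close>

lemma zopenI:
  assumes "W \<subseteq> T" "\<And>p. p \<in> W \<Longrightarrow> \<exists>Q. Q \<in> polyfun n \<and> Q p \<noteq> 0 \<and> (\<forall>x\<in>T. Q x \<noteq> 0 \<longrightarrow> x \<in> W)"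
  shows "zopen n T W"
  unfolding zopen_def
proof (intro conjI ballI assms(1))
  fix p assume "p \<in> W"
  from assms(2)[OF this] obtain Q where "Q \<in> polyfun n" "Q p \<noteq> 0 \<and> (\<forall>x\<in>T. Q x \<noteq> 0 \<longrightarrow> x \<in> W)"
    by (elim exE conjE) (rule that, assumption, rule conjI)
  then show "\<exists>Q\<in>polyfun n. Q p \<noteq> 0 \<and> (\<forall>x\<in>T. Q x \<noteq> 0 \<longrightarrow> x \<in> W)" by (intro bexI[of _ Q])
qed

lemma zopen_subset: "zopen n T W \<Longrightarrow> W \<subseteq> T"
  unfolding zopen_def by blast

lemma zopen_nonzero: "Q \<in> polyfun n \<Longrightarrow> zopen n T {x\<in>T. Q x \<noteq> 0}"
  by (rule zopenI) (auto intro!: exI[of _ Q])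

lemma zopen_restrict:
  assumes "zopen n T W" "T' \<subseteq> T" shows "zopen n T' {x\<in>T'. x \<in> W}"
proof (rule zopenI)
  fix p assume "p \<in> {x\<in>T'. x \<in> W}"
  then have "p \<in> W" by simp
  then obtain Q where "Q \<in> polyfun n" "Q p \<noteq> 0" "\<And>x. x \<in> T \<Longrightarrow> Q x \<noteq> 0 \<Longrightarrow> x \<in> W"
    by (rule zopenE[OF assms(1)]) (rule that)
  then show "\<exists>Q. Q \<in> polyfun n \<and> Q p \<noteq> 0 \<and> (\<forall>x\<in>T'. Q x \<noteq> 0 \<longrightarrow> x \<in> {x\<in>T'. x \<in> W})"
    using assms(2) by (intro exI[of _ Q]) auto
qed auto

lemma polyfun_cmult: "p \<in> polyfun n \<Longrightarrow> (\<lambda>x. c * p x) \<in> polyfun n"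
  by (rule polyfun_mult[OF polyfun_const])

lemma openin_affine_fspace: "openin (opens (affine_fspace n)) U \<longleftrightarrow> zopen n (coord_space n) U"
proof
  let ?B = "{{z \<in> D. h z \<noteq> 0} |D h. (D, h) \<in> {(coord_space n, p) |p. p \<in> polyfun n}}"
  assume "openin (opens (affine_fspace n)) U"
  then have "generate_topology_on ?B U"
    unfolding affine_fspace_def opens_generated_space openin_topology_generated_by_iff .
  then show "zopen n (coord_space n) U"
  proof (induction rule: generate_topology_on.induct)
    case (Basis s)
    then obtain p where "p \<in> polyfun n" "s = {z \<in> coord_space n. p z \<noteq> 0}" by blast
    then show ?case by (simp only: zopen_nonzero)
  qed (auto intro: zopen_empty zopen_Int zopen_Union)
next
  assume U: "zopen n (coord_space n) U"
  show "openin (opens (affine_fspace n)) U"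
  proof (subst openin_subopen, intro ballI)
    fix x assume x: "x \<in> U"
    obtain Q where Q: "Q \<in> polyfun n" "Q x \<noteq> 0" "\<And>y. y \<in> coord_space n \<Longrightarrow> Q y \<noteq> 0 \<Longrightarrow> y \<in> U"
      by (rule zopenE[OF U x], rule that)
    have "openin (opens (affine_fspace n)) {z \<in> coord_space n. Q z \<noteq> 0}"
      unfolding affine_fspace_def opens_generated_space
      by (rule topology_generated_by_Basis) (use Q(1) in blast)
    then show "\<exists>W. openin (opens (affine_fspace n)) W \<and> x \<in> W \<and> W \<subseteq> U"
      using Q x zopen_subset[OF U] by (intro exI[of _ "{z \<in> coord_space n. Q z \<noteq> 0}"]) auto
  qed
qed

lemma points_affine_fspace: "points (affine_fspace n) = (coord_space n :: (nat \<Rightarrow> 'k::field) set)"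
proof
  show "points (affine_fspace n) \<subseteq> (coord_space n :: (nat \<Rightarrow> 'k) set)"
    unfolding points_def using openin_topspace[of "opens (affine_fspace n)"]
    by (intro zopen_subset[of n]) (simp only: openin_affine_fspace)
  show "(coord_space n :: (nat \<Rightarrow> 'k) set) \<subseteq> points (affine_fspace n)"
    unfolding points_def by (rule openin_subset) (simp add: openin_affine_fspace zopen_self)
qed

lemma regs_affine_fspace:
  assumes "U \<subseteq> coord_space n" shows "f \<in> regs (affine_fspace n) U \<longleftrightarrow> zreg n U f"
proof
  assume f: "f \<in> regs (affine_fspace n) U"
  show "zreg n U f"
  proof (rule zregI)
    fix p assume p: "p \<in> U"
    obtain D g h where D: "(D, g) \<in> {(coord_space n, p) |p. p \<in> polyfun n}" "(D, h) \<in> {(coord_space n, p) |p. p \<in> polyfun n}"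
      "p \<in> D" "h p \<noteq> 0" "\<And>w. w \<in> U \<Longrightarrow> w \<in> D \<Longrightarrow> h w \<noteq> 0 \<Longrightarrow> f w = g w / h w"
      by (rule regs_generated_spaceE[OF f[unfolded affine_fspace_def] p], rule that)
    then show "\<exists>P Q. P \<in> polyfun n \<and> Q \<in> polyfun n \<and> Q p \<noteq> 0 \<and> (\<forall>x\<in>U. Q x \<noteq> 0 \<longrightarrow> f x = P x / Q x)"
      using assms by (intro exI[of _ g] exI[of _ h]) auto
  qed
next
  assume f: "zreg n U f"
  show "f \<in> regs (affine_fspace n) U"
    unfolding affine_fspace_def
  proof (rule regs_generated_spaceI)
    fix z assume z: "z \<in> U"
    obtain P Q where "P \<in> polyfun n" "Q \<in> polyfun n" "Q z \<noteq> 0" "\<And>x. x \<in> U \<Longrightarrow> Q x \<noteq> 0 \<Longrightarrow> f x = P x / Q x"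
      by (rule zregE[OF f z], rule that)
    then show "\<exists>D g h. (D, g) \<in> {(coord_space n, p) |p. p \<in> polyfun n} \<and> (D, h) \<in> {(coord_space n, p) |p. p \<in> polyfun n} \<and>
      z \<in> D \<and> h z \<noteq> 0 \<and> (\<forall>w\<in>U \<inter> D. h w \<noteq> 0 \<longrightarrow> f w = g w / h w)"
      using assms z by (intro exI[of _ "coord_space n"] exI[of _ P] exI[of _ Q]) auto
  qed
qed

lemma openin_sub_affine:
  assumes "T \<subseteq> coord_space n"
  shows "openin (opens (sub_fspace (affine_fspace n) T)) U \<longleftrightarrow> zopen n T U"
  unfolding openin_sub_fspace openin_affine_fspace
proof
  assume "\<exists>V. zopen n (coord_space n) V \<and> U = V \<inter> T"
  then obtain V where V: "zopen n (coord_space n) V" "U = V \<inter> T" by blast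
  have "{x\<in>T. x \<in> V} = U" using V(2) by auto
  then show "zopen n T U" using zopen_restrict[OF V(1) assms] by simp
next
  assume U: "zopen n T U"
  \<comment> \<open>The union of all basic open sets whose trace on \<open>T\<close> lies in
    \<open>U\<close> is an open set with trace \<open>U\<close>.\<close>
  define K where "K = {{x \<in> coord_space n. Q x \<noteq> 0} |Q. Q \<in> polyfun n \<and> (\<forall>y\<in>T. Q y \<noteq> 0 \<longrightarrow> y \<in> U)}"
  have "zopen n (coord_space n) (\<Union>K)"
  proof (rule zopen_Union)
    fix W assume "W \<in> K"
    then obtain Q where "W = {x \<in> coord_space n. Q x \<noteq> 0}" "Q \<in> polyfun n" unfolding K_def by blast
    then show "zopen n (coord_space n) W" by (simp only: zopen_nonzero)
  qed
  moreover have "U = \<Union>K \<inter> T"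
  proof (intro equalityI subsetI)
    fix x assume x: "x \<in> U"
    obtain Q where Q: "Q \<in> polyfun n" "Q x \<noteq> 0" "\<And>y. y \<in> T \<Longrightarrow> Q y \<noteq> 0 \<Longrightarrow> y \<in> U"
      by (rule zopenE[OF U x], rule that)
    have "{x \<in> coord_space n. Q x \<noteq> 0} \<in> K" unfolding K_def using Q by (intro CollectI exI[of _ Q]) simp
    then show "x \<in> \<Union>K \<inter> T" using Q x zopen_subset[OF U] assms by (intro IntI UnionI[of "{x \<in> coord_space n. Q x \<noteq> 0}"]) auto
  qed (auto simp: K_def)
  ultimately show "\<exists>V. zopen n (coord_space n) V \<and> U = V \<inter> T" by blast
qed

lemma regs_sub_affine:
  assumes T: "T \<subseteq> coord_space n" and U: "zopen n T U"
  shows "f \<in> regs (sub_fspace (affine_fspace n) T) U \<longleftrightarrow> zreg n U f"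
  unfolding regs_sub_fspace openin_affine_fspace
proof
  assume f: "\<forall>x\<in>U. \<exists>V g. zopen n (coord_space n) V \<and> x \<in> V \<and> g \<in> regs (affine_fspace n) V \<and> (\<forall>y\<in>V \<inter> U. f y = g y)"
  have UT: "U \<subseteq> coord_space n" using zopen_subset[OF U] T by blast
  show "zreg n U f"
  proof (rule zreg_local[OF UT])
    fix p assume "p \<in> U"
    with f obtain V g where V: "zopen n (coord_space n) V" "p \<in> V" "g \<in> regs (affine_fspace n) V" "\<forall>y\<in>V \<inter> U. f y = g y" by blast
    have "zreg n V g" using V(3) regs_affine_fspace[OF zopen_subset[OF V(1)]] by blast
    then have "zreg n (V \<inter> U) g" by (rule zreg_subset) simp
    then have "zreg n (V \<inter> U) f" by (rule zreg_cong) (use V(4) in simp)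
    then show "\<exists>V. zopen n (coord_space n) V \<and> p \<in> V \<and> zreg n (V \<inter> U) f" using V by blast
  qed
next
  assume f: "zreg n U f"
  show "\<forall>x\<in>U. \<exists>V g. zopen n (coord_space n) V \<and> x \<in> V \<and> g \<in> regs (affine_fspace n) V \<and> (\<forall>y\<in>V \<inter> U. f y = g y)"
  proof
    fix z assume z: "z \<in> U"
    obtain P Q where PQ: "P \<in> polyfun n" "Q \<in> polyfun n" "Q z \<noteq> 0" "\<And>x. x \<in> U \<Longrightarrow> Q x \<noteq> 0 \<Longrightarrow> f x = P x / Q x"
      by (rule zregE[OF f z], rule that)
    let ?V = "{x \<in> coord_space n. Q x \<noteq> 0}"
    have "zreg n ?V (\<lambda>x. P x / Q x)" by (intro zreg_divide zreg_polyfun PQ(1,2))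
    then have "(\<lambda>x. P x / Q x) \<in> regs (affine_fspace n) ?V" by (subst regs_affine_fspace) auto
    then show "\<exists>V g. zopen n (coord_space n) V \<and> z \<in> V \<and> g \<in> regs (affine_fspace n) V \<and> (\<forall>y\<in>V \<inter> U. f y = g y)"
      using PQ z zopen_subset[OF U] T zopen_nonzero[OF PQ(2), of "coord_space n"]
      by (intro exI[of _ ?V] exI[of _ "\<lambda>x. P x / Q x"]) auto
  qed
qed

section \<open>Projective space in homogeneous coordinates\<close>

abbreviation (input) "line x \<equiv> fvs.span {x}"

abbreviation (input) "punctured N \<equiv> coord_space (Suc N) - {0}"

lemma line_fscale: "t \<noteq> 0 \<Longrightarrow> line (fscale t x) = line (x :: nat \<Rightarrow> 'k::field)"
  unfolding fvs.span_singleton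
proof (intro equalityI subsetI)
  fix y assume t: "t \<noteq> 0" "y \<in> range (\<lambda>k. fscale k x)"
  then obtain k where "y = fscale k x" by blast
  then have "y = fscale (k / t) (fscale t x)" using t(1) by (simp add: fscale_def)
  then show "y \<in> range (\<lambda>k. fscale k (fscale t x))" by blast
qed (auto simp: fscale_def mult.assoc[symmetric])

lemma line_eqD:
  assumes "line x = line y" "y \<noteq> (0 :: nat \<Rightarrow> 'k::field)"
  obtains t where "t \<noteq> 0" "y = fscale t x"
proof -
  have "y \<in> line x" unfolding assms(1) by (rule fvs.span_base) simp
  then obtain t where t: "y = fscale t x" unfolding fvs.span_singleton by blast
  have "t \<noteq> 0" using t assms(2) by (auto simp: fscale_def fun_eq_iff)
  then show ?thesis using t that by blast
qed

lemma openin_proj_fspace: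
  "openin (opens (proj_fspace N)) U \<longleftrightarrow> U \<subseteq> {l. \<exists>v \<in> punctured N. l = line (v :: nat \<Rightarrow> 'k::field)} \<and>
     zopen (Suc N) (punctured N) {v \<in> punctured N. line v \<in> U}"
  unfolding proj_fspace_def openin_quotient_fspace
  by (simp add: openin_sub_affine[of "punctured N" "Suc N"] points_sub_fspace points_affine_fspace Int_absorb1)

lemma regs_proj_fspace:
  assumes "openin (opens (proj_fspace N)) U"
  shows "f \<in> regs (proj_fspace N) U \<longleftrightarrow> zreg (Suc N) {v \<in> punctured N. line v \<in> U} (\<lambda>v. f (line (v :: nat \<Rightarrow> 'k::field)))"
proof -
  have 1: "zopen (Suc N) (punctured N) {v \<in> punctured N. line v \<in> U}" using assms unfolding openin_proj_fspace by blast
  have 2: "points (sub_fspace (affine_fspace (Suc N)) (punctured N)) = (punctured N :: (nat \<Rightarrow> 'k) set)"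
    by (simp add: points_sub_fspace points_affine_fspace Int_absorb1)
  show ?thesis unfolding proj_fspace_def regs_quotient_fspace 2
    by (rule regs_sub_affine[OF _ 1]) blast
qed

text \<open>The representative in the chart where the \<open>b\<close>-th coordinate is 1;
  unspecified outside that chart.\<close>

definition normalise :: "nat \<Rightarrow> (nat \<Rightarrow> 'k::field) set \<Rightarrow> nat \<Rightarrow> 'k" where
  "normalise b l = (SOME y. y \<in> l \<and> y b = 1)"

lemma normalise_line:
  assumes "x b \<noteq> 0" shows "normalise b (line x) = (\<lambda>i. x i / x b)"
proof -
  let ?y = "\<lambda>i. x i / x b"
  have "?y = fscale (1 / x b) x" by (simp add: fscale_def)
  then have "?y \<in> line x" unfolding fvs.span_singleton by (rule range_eqI)
  then have "?y \<in> line x \<and> ?y b = 1" using assms by simp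
  then have "normalise b (line x) \<in> line x \<and> normalise b (line x) b = 1"
    unfolding normalise_def by (rule someI[of "\<lambda>y. y \<in> line x \<and> y b = 1"])
  then obtain k where k: "normalise b (line x) = fscale k x" "k * x b = 1"
    unfolding fvs.span_singleton by (auto simp: fscale_def)
  then have "k = 1 / x b" using assms by (simp add: field_simps)
  then show ?thesis using k(1) by (simp add: fscale_def)
qed

lemma zreg_normalised:
  fixes P :: "(nat \<Rightarrow> 'k::field) \<Rightarrow> 'k"
  assumes P: "P \<in> polyfun n" and b: "b < n" and U: "\<And>x. x \<in> U \<Longrightarrow> x b \<noteq> 0"
  shows "zreg n U (\<lambda>x. P (\<lambda>i. x i / x b))"
proof (rule zreg_alg_gen[of P "{(\<lambda>x. x i) |i. i < n}"])
  show "P \<in> alg_gen {(\<lambda>x. x i) |i. i < n}" using P unfolding polyfun_def .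
  fix s :: "(nat \<Rightarrow> 'k) \<Rightarrow> 'k" assume "s \<in> {(\<lambda>x. x i) |i. i < n}"
  then obtain i where i: "i < n" "s = (\<lambda>x. x i)" by blast
  have "zreg n {x\<in>U. x b \<noteq> 0} (\<lambda>x. x i / x b)" by (intro zreg_divide zreg_polyfun polyfun_var i(1) b)
  then have "zreg n U (\<lambda>x. x i / x b)" by (rule zreg_subset) (use U in auto)
  then show "zreg n U (\<lambda>x. s (\<lambda>i. x i / x b))" unfolding i(2) .
qed

locale projective_cone =
  fixes N :: nat and X :: "(nat \<Rightarrow> 'k::{alg_closed_field, field_char_0}) set set"
  assumes closed: "closedin (opens (proj_fspace N)) X"
begin

abbreviation "nv \<equiv> Suc N"
abbreviation "M \<equiv> proj_subvariety N X"

definition cone :: "(nat \<Rightarrow> 'k) set" where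
  "cone = {x \<in> punctured N. line x \<in> X}"

lemma cone_fscale: assumes "x \<in> cone" "t \<noteq> 0" shows "fscale t x \<in> cone"
  using assms line_fscale[OF assms(2), of x] unfolding cone_def coord_space_def
  by (auto simp: fscale_def fun_eq_iff)

lemma X_line: assumes "l \<in> X" obtains x where "x \<in> cone" "l = line x"
proof -
  have "topspace (opens (proj_fspace N)) \<subseteq> {l. \<exists>v \<in> punctured N. l = line (v :: nat \<Rightarrow> 'k)}"
    using openin_topspace[of "opens (proj_fspace N)"] unfolding openin_proj_fspace by blast
  then show ?thesis using closedin_subset[OF closed] assms that unfolding cone_def by blast
qed

lemma outside_open: "zopen nv (punctured N) {x \<in> punctured N. line x \<notin> X}"
proof -
  have "openin (opens (proj_fspace N)) (topspace (opens (proj_fspace N)) - X)" using closed by (simp add: closedin_def)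
  moreover have "line x \<in> topspace (opens (proj_fspace N))" if "x \<in> punctured N" for x :: "nat \<Rightarrow> 'k"
  proof -
    have "openin (opens (proj_fspace N)) {l. \<exists>v \<in> punctured N. l = line (v :: nat \<Rightarrow> 'k)}"
      unfolding openin_proj_fspace
    proof
      have "{v \<in> punctured N. line v \<in> {l. \<exists>v \<in> punctured N. l = line (v :: nat \<Rightarrow> 'k)}} = punctured N" by blast
      then show "zopen nv (punctured N) {v \<in> punctured N. line v \<in> {l. \<exists>v \<in> punctured N. l = line (v :: nat \<Rightarrow> 'k)}}"
        using zopen_self[of nv "punctured N :: (nat \<Rightarrow> 'k) set"] by (simp only:)
    qed blast
    then show ?thesis using that openin_subset by blast
  qed
  ultimately have "zopen nv (punctured N) {x \<in> punctured N. line x \<in> topspace (opens (proj_fspace N)) - X}"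
    "{x \<in> punctured N. line x \<in> topspace (opens (proj_fspace N)) - X} = {x \<in> punctured N. line x \<notin> X}"
    unfolding openin_proj_fspace by blast+
  then show ?thesis by (simp only:)
qed

lemma openin_M: "openin (opens M) U \<longleftrightarrow> U \<subseteq> X \<and> zopen nv cone {x\<in>cone. line x \<in> U}"
  unfolding proj_subvariety_def openin_sub_fspace
proof (intro iffI conjI)
  assume "\<exists>V. openin (opens (proj_fspace N)) V \<and> U = V \<inter> X"
  then obtain V where V: "openin (opens (proj_fspace N)) V" "U = V \<inter> X" by blast
  then show "U \<subseteq> X" by blast
  have "zopen nv (punctured N) {v \<in> punctured N. line v \<in> V}" using V(1) unfolding openin_proj_fspace by blast
  from zopen_restrict[OF this, of cone] have "zopen nv cone {x \<in> cone. x \<in> {v \<in> punctured N. line v \<in> V}}"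
    by (auto simp: cone_def)
  moreover have "{x \<in> cone. x \<in> {v \<in> punctured N. line v \<in> V}} = {x\<in>cone. line x \<in> U}" using V(2) by (auto simp: cone_def)
  ultimately show "zopen nv cone {x\<in>cone. line x \<in> U}" by simp
next
  assume U: "U \<subseteq> X \<and> zopen nv cone {x\<in>cone. line x \<in> U}"
  \<comment> \<open>Adding the complement of \<open>X\<close>, which is open, makes \<open>U\<close>
    the trace of an open set of projective space.\<close>
  define V where "V = {l. \<exists>v \<in> punctured N. l = line v \<and> l \<notin> X} \<union> U"
  have pre: "{v \<in> punctured N. line v \<in> V} = {x \<in> punctured N. line x \<notin> X} \<union> {x\<in>cone. line x \<in> U}"
    using U unfolding V_def cone_def by blast
  have "zopen nv (punctured N) {v \<in> punctured N. line v \<in> V}"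
  proof (rule zopenI)
    fix p assume p: "p \<in> {v \<in> punctured N. line v \<in> V}"
    show "\<exists>Q. Q \<in> polyfun nv \<and> Q p \<noteq> 0 \<and> (\<forall>x\<in>punctured N. Q x \<noteq> 0 \<longrightarrow> x \<in> {v \<in> punctured N. line v \<in> V})"
    proof (cases "line p \<in> X")
      case False
      then have "p \<in> {x \<in> punctured N. line x \<notin> X}" using p by simp
      then obtain Q where "Q \<in> polyfun nv" "Q p \<noteq> 0" "\<And>x. x \<in> punctured N \<Longrightarrow> Q x \<noteq> 0 \<Longrightarrow> x \<in> {x \<in> punctured N. line x \<notin> X}"
        by (rule zopenE[OF outside_open]) (rule that)
      then show ?thesis unfolding pre by (intro exI[of _ Q]) auto
    next
      case True
      then have "p \<in> {x\<in>cone. line x \<in> U}" using p unfolding pre by blast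
      then obtain Q where "Q \<in> polyfun nv" "Q p \<noteq> 0" "\<And>x. x \<in> cone \<Longrightarrow> Q x \<noteq> 0 \<Longrightarrow> x \<in> {x\<in>cone. line x \<in> U}"
        by (rule zopenE[OF conjunct2[OF U]]) (rule that)
      then show ?thesis unfolding pre by (intro exI[of _ Q]) (auto simp: cone_def)
    qed
  qed auto
  moreover have "V \<subseteq> {l. \<exists>v \<in> punctured N. l = line v}"
  proof
    fix l assume "l \<in> V"
    then consider "\<exists>v \<in> punctured N. l = line v" | "l \<in> X" using U unfolding V_def by blast
    then show "l \<in> {l. \<exists>v \<in> punctured N. l = line v}"
    proof cases
      case 2
      then obtain x where "x \<in> cone" "l = line x" by (rule X_line)
      then show ?thesis unfolding cone_def by blast
    qed simp
  qed
  moreover have "U = V \<inter> X" using U unfolding V_def by blast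
  ultimately show "\<exists>V. openin (opens (proj_fspace N)) V \<and> U = V \<inter> X" unfolding openin_proj_fspace by blast
qed

lemma line_X: "x \<in> cone \<Longrightarrow> line x \<in> X" by (simp add: cone_def)

lemma nonzero_coordinate: assumes "x \<in> cone" obtains b where "b < nv" "x b \<noteq> 0"
proof -
  have "x \<noteq> 0" "\<And>i. i \<ge> nv \<Longrightarrow> x i = 0" using assms by (auto simp: cone_def coord_space_def)
  then show ?thesis using that by (metis ext linorder_not_le zero_fun_def)
qed

lemma points_M: "points M = X"
proof -
  have "openin (opens M) X" 
  proof -
    have "{x\<in>cone. line x \<in> X} = cone" unfolding cone_def by blast
    then show ?thesis unfolding openin_M using zopen_self[of nv cone] by (simp only: subset_refl)
  qed
  moreover have "topspace (opens M) \<subseteq> X" using openin_topspace[of "opens M"] unfolding openin_M by blast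
  ultimately show ?thesis unfolding points_def using openin_subset by blast
qed

text \<open>A fraction on the cone need not be homogeneous. Evaluating it at normalised
  representatives turns it into a function on an open set of projective space.\<close>

lemma regs_M:
  assumes U: "openin (opens M) U"
  shows "f \<in> regs M U \<longleftrightarrow> zreg nv {x\<in>cone. line x \<in> U} (\<lambda>x. f (line x))"
  unfolding proj_subvariety_def regs_sub_fspace
proof
  assume f: "\<forall>l\<in>U. \<exists>V g. openin (opens (proj_fspace N)) V \<and> l \<in> V \<and> g \<in> regs (proj_fspace N) V \<and> (\<forall>y\<in>V \<inter> U. f y = g y)"
  show "zreg nv {x\<in>cone. line x \<in> U} (\<lambda>x. f (line x))"
  proof (rule zreg_local[of _ "punctured N"])
    fix p assume p: "p \<in> {x\<in>cone. line x \<in> U}"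
    with f obtain V g where V: "openin (opens (proj_fspace N)) V" "line p \<in> V" "g \<in> regs (proj_fspace N) V" "\<forall>y\<in>V \<inter> U. f y = g y" by blast
    let ?V = "{v \<in> punctured N. line v \<in> V}"
    have "zreg nv ?V (\<lambda>x. g (line x))" using V(3) regs_proj_fspace[OF V(1)] by blast
    then have "zreg nv (?V \<inter> {x\<in>cone. line x \<in> U}) (\<lambda>x. g (line x))" by (rule zreg_subset) simp
    then have "zreg nv (?V \<inter> {x\<in>cone. line x \<in> U}) (\<lambda>x. f (line x))" by (rule zreg_cong) (use V(4) in simp)
    moreover have "zopen nv (punctured N) ?V" "p \<in> ?V" using V p unfolding openin_proj_fspace by (auto simp: cone_def)
    ultimately show "\<exists>V. zopen nv (punctured N) V \<and> p \<in> V \<and> zreg nv (V \<inter> {x\<in>cone. line x \<in> U}) (\<lambda>x. f (line x))" by blast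
  qed (auto simp: cone_def)
next
  assume f: "zreg nv {x\<in>cone. line x \<in> U} (\<lambda>x. f (line x))"
  show "\<forall>l\<in>U. \<exists>V g. openin (opens (proj_fspace N)) V \<and> l \<in> V \<and> g \<in> regs (proj_fspace N) V \<and> (\<forall>y\<in>V \<inter> U. f y = g y)"
  proof
    fix l assume l: "l \<in> U"
    then have "l \<in> X" using U unfolding openin_M by blast
    then obtain x where x: "x \<in> cone" "l = line x" by (rule X_line)
    obtain b where b: "b < nv" "x b \<noteq> 0" by (rule nonzero_coordinate[OF x(1)])
    have norm: "(\<lambda>i. y i / y b) = fscale (1 / y b) y" for y :: "nat \<Rightarrow> 'k" by (simp add: fscale_def)
    have nrm: "(\<lambda>i. y i / y b) \<in> cone \<and> line (\<lambda>i. y i / y b) = line y" if "y \<in> cone" "y b \<noteq> 0" for y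
      unfolding norm using that cone_fscale[of y "1 / y b"] line_fscale[of "1 / y b" y] by simp
    have "(\<lambda>i. x i / x b) \<in> {x\<in>cone. line x \<in> U}" using nrm[OF x(1) b(2)] l x(2) by simp
    then obtain P Q where PQ: "P \<in> polyfun nv" "Q \<in> polyfun nv" "Q (\<lambda>i. x i / x b) \<noteq> 0"
      "\<And>y. y \<in> {x\<in>cone. line x \<in> U} \<Longrightarrow> Q y \<noteq> 0 \<Longrightarrow> f (line y) = P y / Q y"
      by (rule zregE[OF f]) (rule that)
    define V where "V = {line y |y. y \<in> punctured N \<and> y b \<noteq> 0 \<and> Q (\<lambda>i. y i / y b) \<noteq> 0}"
    define g where "g l = P (normalise b l) / Q (normalise b l)" for l
    have pre: "{v \<in> punctured N. line v \<in> V} = {y \<in> {y \<in> punctured N. y b \<noteq> 0}. Q (\<lambda>i. y i / y b) \<noteq> 0}"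
    proof (intro equalityI subsetI)
      fix v assume "v \<in> {v \<in> punctured N. line v \<in> V}"
      then obtain y where v: "v \<in> punctured N" and y: "line y = line v" "y \<in> punctured N" "y b \<noteq> 0" "Q (\<lambda>i. y i / y b) \<noteq> 0"
        unfolding V_def by force
      have "v \<noteq> 0" using v by simp
      then obtain t where "t \<noteq> 0" "v = fscale t y" by (rule line_eqD[OF y(1)])
      then show "v \<in> {y \<in> {y \<in> punctured N. y b \<noteq> 0}. Q (\<lambda>i. y i / y b) \<noteq> 0}" using v y by (simp add: fscale_def)
    qed (auto simp: V_def)
    have z: "zopen nv (punctured N) {y \<in> punctured N. y b \<noteq> 0}" by (rule zopen_nonzero[OF polyfun_var[OF b(1)]])
    have rP: "zreg nv {y \<in> punctured N. y b \<noteq> 0} (\<lambda>x. P (\<lambda>i. x i / x b))" and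
      rQ: "zreg nv {y \<in> punctured N. y b \<noteq> 0} (\<lambda>x. Q (\<lambda>i. x i / x b))"
      by (intro zreg_normalised PQ b(1); simp)+
    have Vo: "openin (opens (proj_fspace N)) V"
      unfolding openin_proj_fspace pre using zreg_nonzero_open[OF z rQ] by (auto simp: V_def)
    have "zreg nv {v \<in> punctured N. line v \<in> V} (\<lambda>x. P (\<lambda>i. x i / x b) / Q (\<lambda>i. x i / x b))"
      unfolding pre by (rule zreg_divide[OF rP rQ])
    then have "zreg nv {v \<in> punctured N. line v \<in> V} (\<lambda>x. g (line x))"
      by (rule zreg_cong) (simp only: pre, simp add: g_def normalise_line)
    then have "g \<in> regs (proj_fspace N) V" using regs_proj_fspace[OF Vo] by blast
    moreover have "l \<in> V" unfolding V_def x(2) using x(1) b PQ(3) by (auto simp: cone_def)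
    moreover have "f l' = g l'" if "l' \<in> V \<inter> U" for l'
    proof -
      obtain y where y: "l' = line y" "y \<in> punctured N" "y b \<noteq> 0" "Q (\<lambda>i. y i / y b) \<noteq> 0" "l' \<in> U" using \<open>l' \<in> V \<inter> U\<close> unfolding V_def by blast
      then have "y \<in> cone" using U unfolding openin_M cone_def by blast
      from nrm[OF this y(3)] show ?thesis using PQ(4)[of "\<lambda>i. y i / y b"] y by (simp add: g_def normalise_line)
    qed
    ultimately show "\<exists>V g. openin (opens (proj_fspace N)) V \<and> l \<in> V \<and> g \<in> regs (proj_fspace N) V \<and> (\<forall>y\<in>V \<inter> U. f y = g y)" using Vo by blast
  qed
qed

lemma zmor_line: assumes "T \<subseteq> cone" shows "zmor nv T M line"
  unfolding zmor_def points_M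
proof (intro conjI allI impI ballI)
  fix x assume "x \<in> T" then show "line x \<in> X" using assms line_X by blast
next
  fix U assume U: "openin (opens M) U"
  then have "zopen nv cone {x\<in>cone. line x \<in> U}" unfolding openin_M by blast
  from zopen_restrict[OF this assms] show "zopen nv T {x\<in>T. line x \<in> U}"
    by (rule back_subst[of "zopen nv T"]) (use assms in auto)
next
  fix U g assume "openin (opens M) U" "g \<in> regs M U"
  then have "zreg nv {x\<in>cone. line x \<in> U} (\<lambda>x. g (line x))" using regs_M by blast
  then show "zreg nv {x\<in>T. line x \<in> U} (\<lambda>x. g (line x))" by (rule zreg_subset) (use assms in auto)
qed

lemma fspace_ok_M: "fspace_ok M"
  unfolding proj_subvariety_def proj_fspace_def
  by (intro fspace_ok_sub_fspace fspace_ok_quotient_fspace)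
     (auto simp: affine_fspace_def intro!: fspace_ok_generated_space intro: polyfun_cmult)

end


section \<open>Tangent vectors of complete intersections\<close>

lemma dird_sum_fun:
  assumes "\<And>i. i \<in> A \<Longrightarrow> p i \<in> polyfun n"
  shows "dird (\<lambda>x. \<Sum>i\<in>A. p i x) x v = (\<Sum>i\<in>A. dird (p i) x v)"
  using assms
proof (induction A rule: infinite_finite_induct)
  case (insert i A)
  then have "dird (\<lambda>x. p i x + (\<Sum>i\<in>A. p i x)) x v = dird (p i) x v + dird (\<lambda>x. \<Sum>i\<in>A. p i x) x v"
    by (intro dird_add polyfun_sum) auto
  then show ?case using insert by simp
qed (simp_all add: dird_const)

lemma dird_fscale_point:
  fixes P :: "(nat \<Rightarrow> 'k::field_char_0) \<Rightarrow> 'k"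
  assumes P: "P \<in> polyfun n" and t: "t \<noteq> 0"
  shows "(\<lambda>y. P (fscale (1 / t) y)) \<in> polyfun n"
    "dird (\<lambda>y. P (fscale (1 / t) y)) (fscale t x) v = dird P x v / t"
proof -
  show "(\<lambda>y. P (fscale (1 / t) y)) \<in> polyfun n"
    unfolding fscale_def by (rule polyfun_subst[OF P]) (intro polyfun_mult polyfun_const polyfun_var)
  obtain c where c: "\<And>s. P (\<lambda>i. x i + s * v i) = poly c s" using polyfun_on_line[OF P] by blast
  have "dird (\<lambda>y. P (fscale (1 / t) y)) (fscale t x) v = coeff (pcompose c [:0, 1 / t:]) 1"
  proof (rule dird_eq)
    fix s
    have "fscale (1 / t) (\<lambda>i. fscale t x i + s * v i) = (\<lambda>i. x i + (s / t) * v i)"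
      using t by (simp add: fscale_def fun_eq_iff field_simps)
    then show "P (fscale (1 / t) (\<lambda>i. fscale t x i + s * v i)) = poly (pcompose c [:0, 1 / t:]) s"
      using c[of "s / t"] by (simp add: poly_pcompose)
  qed
  also have "coeff (pcompose c [:0, 1 / t:]) 1 = coeff c 1 / t"
  proof -
    have "pcompose c [:0, 1 / t:] = (\<Sum>i\<le>degree c. monom (coeff c i * (1 / t) ^ i) i)"
      by (rule poly_eq_all) (simp add: poly_pcompose poly_altdef[of c] poly_sum poly_monom power_mult_distrib power_divide mult_ac)
    then have "coeff (pcompose c [:0, 1 / t:]) 1 = (\<Sum>i\<le>degree c. if i = 1 then coeff c 1 * (1 / t) else 0)"
      by (simp add: coeff_sum if_distrib cong: if_cong)
    then show ?thesis by (auto simp: coeff_eq_0)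
  qed
  finally show "dird (\<lambda>y. P (fscale (1 / t) y)) (fscale t x) v = dird P x v / t" using dird_eq[OF c] by simp
qed

definition quotient_deriv :: "(nat \<Rightarrow> 'k::field_char_0) \<Rightarrow> (nat \<Rightarrow> 'k) \<Rightarrow> ((nat \<Rightarrow> 'k) \<Rightarrow> 'k) \<Rightarrow> ((nat \<Rightarrow> 'k) \<Rightarrow> 'k) \<Rightarrow> 'k" where
  "quotient_deriv x v P Q = (dird P x v * Q x - P x * dird Q x v) / (Q x)\<^sup>2"

locale projective_complete_intersection = projective_cone N X
  for N :: nat and X :: "(nat \<Rightarrow> 'k::{alg_closed_field, field_char_0}) set set" +
  fixes c :: nat and f :: "nat \<Rightarrow> (nat \<Rightarrow> 'k) \<Rightarrow> 'k" and d :: "nat \<Rightarrow> nat"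
  assumes forms: "\<And>j. j < c \<Longrightarrow> 0 < d j \<and> homogeneous (Suc N) (d j) (f j)"
    and ideal: "vanishing_ideal N X = {\<Sum>i<c. a i * f i |a. \<forall>i<c. a i \<in> polyfun (Suc N)}"
begin

lemma forms_polyfun: "j < c \<Longrightarrow> f j \<in> polyfun nv"
  using forms by (simp add: homogeneous_def)

lemma idealE:
  assumes "p \<in> vanishing_ideal N X"
  obtains a where "\<And>i. i < c \<Longrightarrow> a i \<in> polyfun nv" "\<And>x. p x = (\<Sum>i<c. a i x * f i x)"
proof -
  obtain a where "p = (\<Sum>i<c. a i * f i)" "\<forall>i<c. a i \<in> polyfun nv" using assms unfolding ideal by blast
  then show ?thesis by (intro that[of a]) (auto simp: sum_fun_apply)
qed

lemma vanishing_idealI: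
  assumes "p \<in> polyfun nv" "\<And>x. x \<in> cone \<Longrightarrow> p x = 0" "p 0 = 0" shows "p \<in> vanishing_ideal N X"
  unfolding vanishing_ideal_def
proof (intro CollectI conjI ballI assms(1))
  fix l v assume "l \<in> X" "v \<in> l"
  then obtain x where x: "x \<in> cone" "l = line x" by (elim X_line)
  then obtain t where t: "v = fscale t x" using \<open>v \<in> l\<close> unfolding fvs.span_singleton by blast
  show "p v = 0"
  proof (cases "t = 0")
    case True
    then have "v = 0" using t by (simp add: fscale_def fun_eq_iff)
    then show ?thesis using assms(3) by simp
  next
    case False
    then show ?thesis unfolding t using assms(2) cone_fscale[OF x(1)] by blast
  qed
qed

text \<open>A point off the cone is separated from it by a polynomial of the vanishing ideal, and
  the \<open>f j\<close> generate that ideal.\<close>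

lemma cone_eq: "cone = {x \<in> punctured N. \<forall>j<c. f j x = 0}"
proof (intro equalityI subsetI)
  fix x assume x: "x \<in> cone"
  have "f j x = 0" if j: "j < c" for j
  proof -
    have "f j = (\<Sum>i<c. (\<lambda>_. if i = j then 1 else 0) * f i)"
    proof
      fix y
      have "(\<Sum>i<c. (if i = j then 1 else 0) * f i y) = (\<Sum>i<c. if i = j then f j y else 0)" by (intro sum.cong) auto
      then show "f j y = (\<Sum>i<c. (\<lambda>_. if i = j then 1 else 0) * f i) y" using j by (simp add: sum_fun_apply)
    qed
    then have "f j \<in> vanishing_ideal N X" unfolding ideal
      by (intro CollectI exI[of _ "\<lambda>i _. if i = j then 1 else 0"] conjI) (auto intro: polyfun_const)
    moreover have "x \<in> line x" by (rule fvs.span_base) simp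
    ultimately show ?thesis using line_X[OF x] unfolding vanishing_ideal_def by blast
  qed
  then show "x \<in> {x \<in> punctured N. \<forall>j<c. f j x = 0}" using x by (simp add: cone_def)
next
  fix x assume x: "x \<in> {x \<in> punctured N. \<forall>j<c. f j x = 0}"
  show "x \<in> cone"
  proof (rule ccontr)
    assume "x \<notin> cone"
    then have "x \<in> {x \<in> punctured N. line x \<notin> X}" using x by (simp add: cone_def)
    then obtain Q where Q: "Q \<in> polyfun nv" "Q x \<noteq> 0" "\<And>y. y \<in> punctured N \<Longrightarrow> Q y \<noteq> 0 \<Longrightarrow> y \<in> {x \<in> punctured N. line x \<notin> X}"
      by (rule zopenE[OF outside_open]) (rule that)
    obtain b where b: "b < nv" "x b \<noteq> 0"
    proof -
      have "x \<noteq> 0" "\<And>i. i \<ge> nv \<Longrightarrow> x i = 0" using x by (auto simp: coord_space_def)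
      then show ?thesis using that by (metis ext linorder_not_le zero_fun_def)
    qed
    \<comment> \<open>Every line contains 0, so members of the ideal must vanish there; the factor
      \<open>y b\<close> ensures this.\<close>
    have "(\<lambda>y. Q y * y b) \<in> vanishing_ideal N X"
      by (intro vanishing_idealI polyfun_mult Q(1) polyfun_var b(1)) (use Q(3) in \<open>auto simp: cone_def\<close>)
    then obtain a where "\<And>y. Q y * y b = (\<Sum>i<c. a i y * f i y)" by (rule idealE) (rule that)
    then have "Q x * x b = 0" using x by simp
    then show False using Q(2) b(2) by simp
  qed
qed

definition tangential :: "(nat \<Rightarrow> 'k) \<Rightarrow> (nat \<Rightarrow> 'k) \<Rightarrow> bool" where
  "tangential x v \<longleftrightarrow> (\<forall>j<c. dird (f j) x v = 0)"

text \<open>After multiplication by \<open>Q\<close> and a coordinate, \<open>P\<close> lies in the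
  ideal generated by the \<open>f j\<close>, whose derivatives along \<open>v\<close> are 0 at
  \<open>x\<close>. Both factors are nonzero at \<open>x\<close>, so the Leibniz rule isolates the
  derivative of \<open>P\<close>.\<close>

lemma dird_vanishing:
  assumes x: "x \<in> cone" "tangential x v" and P: "P \<in> polyfun nv" "Q \<in> polyfun nv" "Q x \<noteq> 0"
    and van: "\<And>y. y \<in> cone \<Longrightarrow> Q y \<noteq> 0 \<Longrightarrow> P y = 0"
  shows "dird P x v = 0"
proof -
  obtain b where b: "b < nv" "x b \<noteq> 0" by (rule nonzero_coordinate[OF x(1)])
  have Qb: "(\<lambda>y. Q y * y b) \<in> polyfun nv" by (intro polyfun_mult P polyfun_var b(1))
  have "(\<lambda>y. P y * (Q y * y b)) \<in> vanishing_ideal N X"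
    by (rule vanishing_idealI[OF polyfun_mult[OF P(1) Qb]]) (use van in auto)
  then obtain a where a: "\<And>i. i < c \<Longrightarrow> a i \<in> polyfun nv" "\<And>y. P y * (Q y * y b) = (\<Sum>i<c. a i y * f i y)"
    by (rule idealE) (rule that)
  have "dird (\<lambda>y. P y * (Q y * y b)) x v = (\<Sum>i<c. dird (\<lambda>y. a i y * f i y) x v)"
    unfolding a(2) by (rule dird_sum_fun[of _ _ nv]) (auto intro: polyfun_mult a(1) forms_polyfun)
  also have "\<dots> = 0"
  proof (intro sum.neutral ballI)
    fix i assume "i \<in> {..<c}"
    then show "dird (\<lambda>y. a i y * f i y) x v = 0"
      using dird_mult[OF a(1) forms_polyfun, of i i x v] x unfolding tangential_def cone_eq by simp
  qed
  finally have "P x * dird (\<lambda>y. Q y * y b) x v + (Q x * x b) * dird P x v = 0"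
    by (simp only: dird_mult[OF P(1) Qb])
  moreover have "P x = 0" by (rule van[OF x(1) P(3)])
  ultimately show ?thesis using P(3) b(2) by simp
qed

text \<open>A representation of \<open>g\<close> as a fraction near \<open>line x\<close>. Requiring
  it wherever \<open>Q\<close> is nonzero absorbs the neighbourhood into the denominator.\<close>

definition fraction_at :: "(nat \<Rightarrow> 'k) \<Rightarrow> ((nat \<Rightarrow> 'k) set \<Rightarrow> 'k) \<Rightarrow> ((nat \<Rightarrow> 'k) \<Rightarrow> 'k) \<Rightarrow> ((nat \<Rightarrow> 'k) \<Rightarrow> 'k) \<Rightarrow> bool" where
  "fraction_at x g P Q \<longleftrightarrow> P \<in> polyfun nv \<and> Q \<in> polyfun nv \<and> Q x \<noteq> 0 \<and> (\<forall>y\<in>cone. Q y \<noteq> 0 \<longrightarrow> g (line y) * Q y = P y)"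

lemma fraction_atD:
  assumes "fraction_at x g P Q"
  shows "P \<in> polyfun nv" "Q \<in> polyfun nv" "Q x \<noteq> 0" "\<And>y. y \<in> cone \<Longrightarrow> Q y \<noteq> 0 \<Longrightarrow> g (line y) * Q y = P y"
  using assms unfolding fraction_at_def by blast+

lemma fraction_local:
  assumes U: "openin (opens M) U" "g \<in> regs M U" and p: "p \<in> cone" "line p \<in> U"
  obtains P Q where "Q p \<noteq> 0" "\<And>x. Q x \<noteq> 0 \<Longrightarrow> fraction_at x g P Q" "\<And>x. x \<in> cone \<Longrightarrow> Q x \<noteq> 0 \<Longrightarrow> line x \<in> U"
    "P \<in> polyfun nv" "Q \<in> polyfun nv"
proof -
  have z: "zopen nv cone {x\<in>cone. line x \<in> U}" using U(1) unfolding openin_M by blast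
  have r: "zreg nv {x\<in>cone. line x \<in> U} (\<lambda>x. g (line x))" using regs_M[OF U(1)] U(2) by blast
  have p': "p \<in> {x\<in>cone. line x \<in> U}" using p by simp
  obtain R where R: "R \<in> polyfun nv" "R p \<noteq> 0" "\<And>y. y \<in> cone \<Longrightarrow> R y \<noteq> 0 \<Longrightarrow> y \<in> {x\<in>cone. line x \<in> U}"
    by (rule zopenE[OF z p']) (rule that)
  obtain P Q where PQ: "P \<in> polyfun nv" "Q \<in> polyfun nv" "Q p \<noteq> 0"
    "\<And>y. y \<in> {x\<in>cone. line x \<in> U} \<Longrightarrow> Q y \<noteq> 0 \<Longrightarrow> g (line y) = P y / Q y"
    by (rule zregE[OF r p']) (rule that)
  have p1: "(\<lambda>y. P y * R y) \<in> polyfun nv" "(\<lambda>y. Q y * R y) \<in> polyfun nv" by (intro polyfun_mult PQ R)+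
  show ?thesis
  proof (rule that[of "\<lambda>y. Q y * R y" "\<lambda>y. P y * R y"])
    show "Q p * R p \<noteq> 0" using PQ R by simp
    show "fraction_at x g (\<lambda>y. P y * R y) (\<lambda>y. Q y * R y)" if "Q x * R x \<noteq> 0" for x
      unfolding fraction_at_def using p1 that PQ(4) R(3) by (auto simp: field_simps)
    show "line x \<in> U" if "x \<in> cone" "Q x * R x \<noteq> 0" for x using that R(3) by auto
  qed (rule p1)+
qed

lemma fraction_exists:
  assumes "regular_at M (line x) g" "x \<in> cone"
  shows "\<exists>P Q. fraction_at x g P Q"
proof -
  obtain U where "openin (opens M) U" "line x \<in> U" "g \<in> regs M U" using assms(1) unfolding regular_at_def by blast
  from fraction_local[OF this(1,3) assms(2) this(2)] show ?thesis by metis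
qed

text \<open>The cross difference of two fractions for the same germ vanishes on the cone near
  \<open>x\<close>, hence has derivative 0 along a tangential \<open>v\<close>.\<close>

lemma quotient_deriv_unique:
  assumes x: "x \<in> cone" "tangential x v" and g: "fraction_at x g P Q" and h: "fraction_at x h P' Q'"
    and U: "openin (opens M) U" "line x \<in> U" "\<And>l. l \<in> U \<Longrightarrow> g l = h l"
  shows "quotient_deriv x v P Q = quotient_deriv x v P' Q'"
proof -
  note g = fraction_atD[OF g] and h = fraction_atD[OF h]
  have z: "zopen nv cone {x\<in>cone. line x \<in> U}" using U(1) unfolding openin_M by blast
  have x': "x \<in> {x\<in>cone. line x \<in> U}" using x U(2) by simp
  obtain R where R: "R \<in> polyfun nv" "R x \<noteq> 0" "\<And>y. y \<in> cone \<Longrightarrow> R y \<noteq> 0 \<Longrightarrow> y \<in> {x\<in>cone. line x \<in> U}"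
    by (rule zopenE[OF z x']) (rule that)
  have "dird (\<lambda>y. P y * Q' y - P' y * Q y) x v = 0"
  proof (rule dird_vanishing[OF x, where Q = "\<lambda>y. Q y * Q' y * R y"])
    show "P y * Q' y - P' y * Q y = 0" if y: "y \<in> cone" "Q y * Q' y * R y \<noteq> 0" for y
    proof -
      have "g (line y) = h (line y)" using R(3)[of y] y U(3) by auto
      then show ?thesis using g(4)[of y] h(4)[of y] y by (auto simp: algebra_simps simp flip: g(4) h(4))
    qed
    show "Q x * Q' x * R x \<noteq> 0" using g(3) h(3) R(2) by simp
  qed (intro polyfun_intros g(1,2) h(1,2) R(1))+
  moreover have "dird (\<lambda>y. P y * Q' y - P' y * Q y) x v =
      (P x * dird Q' x v + Q' x * dird P x v) - (P' x * dird Q x v + Q x * dird P' x v)"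
  proof -
    have "dird (\<lambda>y. P y * Q' y + -1 * (P' y * Q y)) x v = dird (\<lambda>y. P y * Q' y) x v + dird (\<lambda>y. -1 * (P' y * Q y)) x v"
      by (rule dird_add[where n = nv]; intro polyfun_mult polyfun_const g(1,2) h(1,2))
    moreover have "dird (\<lambda>y. -1 * (P' y * Q y)) x v = - dird (\<lambda>y. P' y * Q y) x v"
      using dird_mult[OF polyfun_const polyfun_mult[OF h(1) g(2)], of "-1" x v] by (simp add: dird_const)
    ultimately show ?thesis by (simp add: dird_mult[OF g(1) h(2)] dird_mult[OF h(1) g(2)])
  qed
  ultimately have eq: "Q' x * dird P x v - P' x * dird Q x v = Q x * dird P' x v - P x * dird Q' x v"
    by (simp add: algebra_simps)
  define a where "a = g (line x)"
  have Px: "P x = a * Q x" "P' x = a * Q' x" using g(3) h(3) g(4)[OF x(1)] h(4)[OF x(1)] U(3)[OF U(2)] unfolding a_def by auto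
  have "quotient_deriv x v P Q = (dird P x v - a * dird Q x v) / Q x"
    unfolding quotient_deriv_def Px using g(3) by (simp add: field_simps power2_eq_square)
  also have "\<dots> = (dird P' x v - a * dird Q' x v) / Q' x"
    using eq g(3) h(3) unfolding Px by (simp add: field_simps)
  also have "\<dots> = quotient_deriv x v P' Q'"
    unfolding quotient_deriv_def Px using h(3) by (simp add: field_simps power2_eq_square)
  finally show ?thesis .
qed

text \<open>The derivation of germs at \<open>line x\<close> given by \<open>v\<close>; for
  tangential \<open>v\<close> the choice of the fraction is immaterial. It depends on
  \<open>x\<close> and not only on its line.\<close>

definition tangent_vec :: "(nat \<Rightarrow> 'k) \<Rightarrow> (nat \<Rightarrow> 'k) \<Rightarrow> ((nat \<Rightarrow> 'k) set \<Rightarrow> 'k) \<Rightarrow> 'k" where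
  "tangent_vec x v g = (if regular_at M (line x) g
     then (let (P, Q) = (SOME (P, Q). fraction_at x g P Q) in quotient_deriv x v P Q) else 0)"

lemma regular_atE:
  assumes "regular_at M l g" obtains U where "openin (opens M) U" "l \<in> U" "g \<in> regs M U"
  using assms unfolding regular_at_def by blast

lemma tangent_vec_eq:
  assumes x: "x \<in> cone" "tangential x v" and g: "regular_at M (line x) g" "fraction_at x g P Q"
  shows "tangent_vec x v g = quotient_deriv x v P Q"
proof -
  define z where "z = (SOME (P, Q). fraction_at x g P Q)"
  have "case z of (P, Q) \<Rightarrow> fraction_at x g P Q" unfolding z_def by (rule someI[of _ "(P, Q)"]) (use g(2) in simp)
  then have z: "fraction_at x g (fst z) (snd z)" by (simp add: case_prod_beta)
  obtain U where "openin (opens M) U" "line x \<in> U" by (rule regular_atE[OF g(1)])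
  then have "quotient_deriv x v (fst z) (snd z) = quotient_deriv x v P Q" by (rule quotient_deriv_unique[OF x z g(2)]) simp
  then show ?thesis unfolding tangent_vec_def z_def[symmetric] using g(1) by (simp add: case_prod_beta)
qed

lemma regular_at_iff_zreg:
  "regular_at M l g \<longleftrightarrow> (\<exists>U. openin (opens M) U \<and> l \<in> U \<and> zreg nv {x\<in>cone. line x \<in> U} (\<lambda>x. g (line x)))"
  unfolding regular_at_def using regs_M by blast

lemma regular_at_op:
  assumes "regular_at M l g" "regular_at M l h"
    and op: "\<And>U. zreg nv U (\<lambda>x. g (line x)) \<Longrightarrow> zreg nv U (\<lambda>x. h (line x)) \<Longrightarrow> zreg nv U (\<lambda>x. k (line x))"
  shows "regular_at M l k"
proof -
  obtain U where U: "openin (opens M) U" "l \<in> U" "zreg nv {x\<in>cone. line x \<in> U} (\<lambda>x. g (line x))"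
    using assms(1) unfolding regular_at_iff_zreg by blast
  obtain V where V: "openin (opens M) V" "l \<in> V" "zreg nv {x\<in>cone. line x \<in> V} (\<lambda>x. h (line x))"
    using assms(2) unfolding regular_at_iff_zreg by blast
  have "zreg nv {x\<in>cone. line x \<in> U \<inter> V} (\<lambda>x. k (line x))"
    by (rule op; rule zreg_subset[OF U(3)] zreg_subset[OF V(3)]) auto
  moreover have "openin (opens M) (U \<inter> V)" using U V by blast
  ultimately show ?thesis unfolding regular_at_iff_zreg using U(2) V(2) by blast
qed

lemma regular_at_add: "regular_at M l g \<Longrightarrow> regular_at M l h \<Longrightarrow> regular_at M l (g + h)"
  by (rule regular_at_op[of l g h]) (simp_all add: zreg_add)

lemma regular_at_mult: "regular_at M l g \<Longrightarrow> regular_at M l h \<Longrightarrow> regular_at M l (g * h)"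
  by (rule regular_at_op[of l g h]) (simp_all add: zreg_mult)

lemma regular_at_fscale: "regular_at M l g \<Longrightarrow> regular_at M l (fscale a g)"
  by (rule regular_at_op[of l g g]) (simp_all add: fscale_def zreg_mult zreg_const)

lemma tangent_vec_tangent:
  assumes x: "x \<in> cone" "tangential x v" shows "tangent_vec x v \<in> tangent_space M (line x)"
  unfolding tangent_space_def
proof (intro CollectI conjI allI impI)
  fix g assume "\<not> regular_at M (line x) g" then show "tangent_vec x v g = 0" by (simp add: tangent_vec_def)
next
  fix g h assume "regular_at M (line x) g \<and> regular_at M (line x) h \<and> (\<exists>U. openin (opens M) U \<and> line x \<in> U \<and> (\<forall>y\<in>U. g y = h y))"
  then obtain U where gh: "regular_at M (line x) g" "regular_at M (line x) h"
    and U: "openin (opens M) U" "line x \<in> U" "\<And>y. y \<in> U \<Longrightarrow> g y = h y" by blast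
  obtain P Q where P: "fraction_at x g P Q" using fraction_exists[OF gh(1) x(1)] by blast
  obtain P' Q' where P': "fraction_at x h P' Q'" using fraction_exists[OF gh(2) x(1)] by blast
  show "tangent_vec x v g = tangent_vec x v h"
    unfolding tangent_vec_eq[OF x gh(1) P] tangent_vec_eq[OF x gh(2) P'] by (rule quotient_deriv_unique[OF x P P' U])
next
  fix g h assume "regular_at M (line x) g \<and> regular_at M (line x) h"
  then have gh: "regular_at M (line x) g" "regular_at M (line x) h" by auto
  obtain P Q where P: "fraction_at x g P Q" using fraction_exists[OF gh(1) x(1)] by blast
  obtain P' Q' where P': "fraction_at x h P' Q'" using fraction_exists[OF gh(2) x(1)] by blast
  note p = fraction_atD[OF P] and p' = fraction_atD[OF P']
  have e: "tangent_vec x v g = quotient_deriv x v P Q" "tangent_vec x v h = quotient_deriv x v P' Q'"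
    by (rule tangent_vec_eq[OF x gh(1) P], rule tangent_vec_eq[OF x gh(2) P'])
  have "fraction_at x (g + h) (\<lambda>y. P y * Q' y + P' y * Q y) (\<lambda>y. Q y * Q' y)"
    unfolding fraction_at_def using p(3) p'(3)
    by (intro conjI ballI impI polyfun_intros p(1,2) p'(1,2))
       (auto simp: algebra_simps simp flip: p(4) p'(4))
  from tangent_vec_eq[OF x regular_at_add[OF gh] this]
  show "tangent_vec x v (g + h) = tangent_vec x v g + tangent_vec x v h"
    using p(3) p'(3) unfolding e quotient_deriv_def
      dird_add[OF polyfun_mult[OF p(1) p'(2)] polyfun_mult[OF p'(1) p(2)]] dird_mult[OF p(1) p'(2)] dird_mult[OF p'(1) p(2)] dird_mult[OF p(2) p'(2)]
    by (simp add: field_simps power2_eq_square)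
  have "fraction_at x (g * h) (\<lambda>y. P y * P' y) (\<lambda>y. Q y * Q' y)"
    unfolding fraction_at_def using p(3) p'(3)
    by (intro conjI ballI impI polyfun_intros p(1,2) p'(1,2))
       (auto simp: algebra_simps simp flip: p(4) p'(4))
  note gh' = tangent_vec_eq[OF x regular_at_mult[OF gh] this]
  have v: "g (line x) = P x / Q x" "h (line x) = P' x / Q' x"
    using p(3) p'(3) p(4)[OF x(1) p(3)] p'(4)[OF x(1) p'(3)] by (simp_all add: field_simps)
  show "tangent_vec x v (g * h) = g (line x) * tangent_vec x v h + h (line x) * tangent_vec x v g"
    using p(3) p'(3) unfolding gh' e v quotient_deriv_def dird_mult[OF p(1) p'(1)] dird_mult[OF p(2) p'(2)]
    by (simp add: field_simps power2_eq_square)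
next
  fix a g assume g: "regular_at M (line x) g"
  obtain P Q where P: "fraction_at x g P Q" using fraction_exists[OF g x(1)] by blast
  note p = fraction_atD[OF P]
  have fs: "fscale a g l = a * g l" for l by (simp add: fscale_def)
  have "fraction_at x (fscale a g) (\<lambda>y. a * P y) Q"
    unfolding fraction_at_def using p(3)
    by (intro conjI ballI impI polyfun_intros p(1,2)) (auto simp: fs simp flip: p(4))
  from tangent_vec_eq[OF x regular_at_fscale[OF g] this]
  show "tangent_vec x v (fscale a g) = a * tangent_vec x v g"
    unfolding tangent_vec_eq[OF x g P] quotient_deriv_def dird_mult[OF polyfun_const p(1)] dird_const
    by (simp add: algebra_simps)
qed

lemma tangential_combination:
  "(\<And>s. s \<in> S \<Longrightarrow> tangential x (v s)) \<Longrightarrow> tangential x (\<lambda>i. \<Sum>s\<in>S. a s * v s i)"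
  unfolding tangential_def by (simp add: dird_sum[OF forms_polyfun])

lemma tangent_vec_combination:
  assumes x: "x \<in> cone" and v: "\<And>s. s \<in> S \<Longrightarrow> tangential x (v s)"
  shows "tangent_vec x (\<lambda>i. \<Sum>s\<in>S. a s * v s i) g = (\<Sum>s\<in>S. a s * tangent_vec x (v s) g)"
proof (cases "regular_at M (line x) g")
  case True
  obtain P Q where P: "fraction_at x g P Q" using fraction_exists[OF True x(1)] by blast
  note p = fraction_atD[OF P]
  have "(\<Sum>s\<in>S. a s * tangent_vec x (v s) g) = (\<Sum>s\<in>S. a s * quotient_deriv x (v s) P Q)"
    by (intro sum.cong refl) (simp add: tangent_vec_eq[OF x v True P])
  also have "\<dots> = quotient_deriv x (\<lambda>i. \<Sum>s\<in>S. a s * v s i) P Q"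
    unfolding quotient_deriv_def dird_sum[OF p(1)] dird_sum[OF p(2)]
    by (simp add: sum_distrib_left sum_distrib_right sum_subtractf[symmetric] sum_divide_distrib algebra_simps)
  finally show ?thesis using tangent_vec_eq[OF x tangential_combination[OF v] True P, where a1 = a] by simp
qed (simp add: tangent_vec_def)

text \<open>A fraction at \<open>x\<close> becomes one at \<open>fscale t x\<close> by composition
  with the inverse scaling, and the chain rule produces the factor \<open>1 / t\<close>.\<close>

lemma tangent_vec_fscale:
  assumes x: "x \<in> cone" "tangential x v" "tangential (fscale t x) v" and t: "t \<noteq> 0"
  shows "tangent_vec (fscale t x) v g = tangent_vec x v g / t"
proof (cases "regular_at M (line x) g")
  case True
  obtain P Q where P: "fraction_at x g P Q" using fraction_exists[OF True x(1)] by blast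
  note p = fraction_atD[OF P]
  have "fraction_at (fscale t x) g (\<lambda>y. P (fscale (1 / t) y)) (\<lambda>y. Q (fscale (1 / t) y))"
    unfolding fraction_at_def
  proof (intro conjI ballI impI)
    have "fscale (1 / t) (fscale t x) = x" using t by (simp add: fscale_def)
    then show "Q (fscale (1 / t) (fscale t x)) \<noteq> 0" using p(3) by simp
    fix y assume "y \<in> cone" "Q (fscale (1 / t) y) \<noteq> 0"
    then show "g (line y) * Q (fscale (1 / t) y) = P (fscale (1 / t) y)"
      using p(4)[OF cone_fscale[of y "1 / t"]] t line_fscale[of "1 / t" y] by simp
  qed (intro dird_fscale_point p t)+
  from tangent_vec_eq[OF cone_fscale[OF x(1) t] x(3) _ this] True line_fscale[OF t, of x]
  have "tangent_vec (fscale t x) v g = quotient_deriv (fscale t x) v (\<lambda>y. P (fscale (1 / t) y)) (\<lambda>y. Q (fscale (1 / t) y))" by simp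
  moreover have "fscale (1 / t) (fscale t x) = x" using t by (simp add: fscale_def)
  ultimately show ?thesis unfolding tangent_vec_eq[OF x(1,2) True P] quotient_deriv_def
    using t by (simp add: dird_fscale_point(2)[OF p(1) t] dird_fscale_point(2)[OF p(2) t] field_simps)
qed (simp add: tangent_vec_def line_fscale[OF t])

lemma chart_open:
  assumes "b < nv" "Q \<in> polyfun nv"
  shows "openin (opens M) {line y |y. y \<in> cone \<and> y b \<noteq> 0 \<and> Q (\<lambda>i. y i / y b) \<noteq> 0}"
    "{x\<in>cone. line x \<in> {line y |y. y \<in> cone \<and> y b \<noteq> 0 \<and> Q (\<lambda>i. y i / y b) \<noteq> 0}} = {y\<in>cone. y b \<noteq> 0 \<and> Q (\<lambda>i. y i / y b) \<noteq> 0}"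
proof -
  let ?U = "{line y |y. y \<in> cone \<and> y b \<noteq> 0 \<and> Q (\<lambda>i. y i / y b) \<noteq> 0}"
  show pre: "{x\<in>cone. line x \<in> ?U} = {y\<in>cone. y b \<noteq> 0 \<and> Q (\<lambda>i. y i / y b) \<noteq> 0}"
  proof (intro equalityI subsetI)
    fix v assume "v \<in> {x\<in>cone. line x \<in> ?U}"
    then obtain y where v: "v \<in> cone" and y: "line y = line v" "y b \<noteq> 0" "Q (\<lambda>i. y i / y b) \<noteq> 0" by force
    have "v \<noteq> 0" using v by (simp add: cone_def)
    then obtain t where "t \<noteq> 0" "v = fscale t y" by (rule line_eqD[OF y(1)])
    then show "v \<in> {y\<in>cone. y b \<noteq> 0 \<and> Q (\<lambda>i. y i / y b) \<noteq> 0}" using v y by (simp add: fscale_def)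
  qed auto
  have z: "zopen nv cone {y \<in> cone. y b \<noteq> 0}" by (rule zopen_nonzero[OF polyfun_var[OF assms(1)]])
  have "zreg nv {y \<in> cone. y b \<noteq> 0} (\<lambda>x. Q (\<lambda>i. x i / x b))" by (intro zreg_normalised assms) simp
  from zreg_nonzero_open[OF z this] show "openin (opens M) ?U"
    unfolding openin_M pre by (auto intro: line_X)
qed

lemma regular_at_chart:
  assumes b: "b < nv" and x: "x \<in> cone" "x b \<noteq> 0" and P: "P \<in> polyfun nv"
  shows "regular_at M (line x) (\<lambda>l. P (normalise b l))"
  unfolding regular_at_iff_zreg
proof (intro exI conjI)
  note o = chart_open[OF b polyfun_const[of 1]]
  show "openin (opens M) {line y |y. y \<in> cone \<and> y b \<noteq> 0 \<and> (1::'k) \<noteq> 0}" by (rule o(1))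
  show "line x \<in> {line y |y. y \<in> cone \<and> y b \<noteq> 0 \<and> (1::'k) \<noteq> 0}" using x by auto
  show "zreg nv {x \<in> cone. line x \<in> {line y |y. y \<in> cone \<and> y b \<noteq> 0 \<and> (1::'k) \<noteq> 0}} (\<lambda>x. P (normalise b (line x)))"
    unfolding o(2)
    by (rule zreg_cong[OF zreg_normalised[OF P b]]) (auto simp: normalise_line)
qed

text \<open>The kernel in the Euler sequence, found by testing on the functions
  \<open>y i / y b\<close>: their derivatives vanish only if \<open>v\<close> is proportional to
  \<open>x\<close>.\<close>

lemma tangent_vec_kernel:
  assumes x: "x \<in> cone" "tangential x v" and 0: "\<And>g. tangent_vec x v g = 0"
  shows "\<exists>\<beta>. \<forall>i<nv. v i = \<beta> * x i"
proof -
  obtain b where b: "b < nv" "x b \<noteq> 0" by (rule nonzero_coordinate[OF x(1)])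
  have "v i = v b / x b * x i" if i: "i < nv" for i
  proof -
    have r: "regular_at M (line x) (\<lambda>l. normalise b l i)" by (rule regular_at_chart[OF b(1) x(1) b(2) polyfun_var[OF i]])
    have "fraction_at x (\<lambda>l. normalise b l i) (\<lambda>y. y i) (\<lambda>y. y b)"
      unfolding fraction_at_def using b by (auto intro: polyfun_var i simp: normalise_line)
    from tangent_vec_eq[OF x r this] 0 b(2) show ?thesis
      by (simp add: quotient_deriv_def dird_var field_simps)
  qed
  then show ?thesis by blast
qed

text \<open>The derivation vanishes on polynomials in the chart coordinates, and every germ is a
  quotient of two such polynomials.\<close>

lemma tangent_determined:
  assumes x: "x \<in> cone" "b < nv" "x b \<noteq> 0" and D: "D \<in> tangent_space M (line x)"
    and 0: "\<And>i. i < nv \<Longrightarrow> D (\<lambda>l. normalise b l i) = 0"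
  shows "D g = 0"
proof (cases "regular_at M (line x) g")
  case False then show ?thesis using D unfolding tangent_space_def by blast
next
  case True
  have D2: "D g = D h" if "regular_at M (line x) g" "regular_at M (line x) h" "openin (opens M) U" "line x \<in> U" "\<And>y. y \<in> U \<Longrightarrow> g y = h y" for g h U
    using D that unfolding tangent_space_def by blast
  have Da: "D (g + h) = D g + D h" if "regular_at M (line x) g" "regular_at M (line x) h" for g h
    using D that unfolding tangent_space_def by blast
  have Ds: "D (fscale a g) = a * D g" if "regular_at M (line x) g" for g a
    using D that unfolding tangent_space_def by blast
  have Dm: "D (g * h) = g (line x) * D h + h (line x) * D g" if "regular_at M (line x) g" "regular_at M (line x) h" for g h
    using D that unfolding tangent_space_def by blast
  let ?n = "\<lambda>P l. P (normalise b l)"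
  have reg: "regular_at M (line x) (?n P)" if "P \<in> polyfun nv" for P by (rule regular_at_chart[OF x(2,1,3) that])
  have DP: "D (?n P) = 0" if "P \<in> polyfun nv" for P
    using that
  proof (induction rule: polyfun_induct)
    case (const a)
    have r: "regular_at M (line x) (\<lambda>_. 1)" using reg[OF polyfun_const[of 1]] .
    have "D ((\<lambda>_. 1) * (\<lambda>_. 1)) = D (\<lambda>_. 1) + D (\<lambda>_. 1)" using Dm[OF r r] by simp
    then have "D (\<lambda>_. 1) = 0" by (simp add: times_fun_def)
    moreover have "fscale a (\<lambda>_ :: (nat \<Rightarrow> 'k) set. 1) = (\<lambda>_. a)" by (simp add: fscale_def)
    ultimately show ?case using Ds[OF r, of a] by simp
  next
    case (var i)
    then show ?case by (rule 0)
  next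
    case (add P Q)
    then show ?case using Da[OF reg[OF add(1)] reg[OF add(2)]] by (simp add: plus_fun_def)
  next
    case (mult P Q)
    then show ?case using Dm[OF reg[OF mult(1)] reg[OF mult(2)]] by (simp add: times_fun_def)
  qed
  have norm: "(\<lambda>i. y i / y b) = fscale (1 / y b) y" for y :: "nat \<Rightarrow> 'k" by (simp add: fscale_def)
  have nrm: "(\<lambda>i. y i / y b) \<in> cone \<and> line (\<lambda>i. y i / y b) = line y" if "y \<in> cone" "y b \<noteq> 0" for y
    unfolding norm using that cone_fscale[of y "1 / y b"] line_fscale[of "1 / y b" y] by simp
  let ?x = "\<lambda>i. x i / x b"
  have x': "?x \<in> cone" "line ?x = line x" using nrm[OF x(1,3)] by auto
  obtain P Q where PQ: "fraction_at ?x g P Q" using fraction_exists[of ?x g] x' True by auto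
  note p = fraction_atD[OF PQ]
  \<comment> \<open>The Leibniz rule for \<open>g * Q = P\<close> isolates \<open>D g\<close>,
    because \<open>Q\<close> is nonzero at the normalised point.\<close>
  have "D (g * ?n Q) = D (?n P)"
  proof (rule D2[OF regular_at_mult[OF True reg[OF p(2)]] reg[OF p(1)] chart_open(1)[OF x(2) p(2)]])
    show "line x \<in> {line y |y. y \<in> cone \<and> y b \<noteq> 0 \<and> Q (\<lambda>i. y i / y b) \<noteq> 0}" using x p(3) by blast
    fix l assume "l \<in> {line y |y. y \<in> cone \<and> y b \<noteq> 0 \<and> Q (\<lambda>i. y i / y b) \<noteq> 0}"
    then obtain y where y: "l = line y" "y \<in> cone" "y b \<noteq> 0" "Q (\<lambda>i. y i / y b) \<noteq> 0" by blast
    show "(g * ?n Q) l = ?n P l" using p(4)[of "\<lambda>i. y i / y b"] nrm[OF y(2,3)] y by (simp add: normalise_line)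
  qed
  then have "g (line x) * D (?n Q) + ?n Q (line x) * D g = D (?n P)" using Dm[OF True reg[OF p(2)]] by simp
  then have "?n Q (line x) * D g = 0" using DP[OF p(1)] DP[OF p(2)] by simp
  then show ?thesis using p(3) x(3) by (simp add: normalise_line)
qed

end


lemma tangent_spaceD:
  assumes "D \<in> tangent_space M x"
  shows "\<not> regular_at M x f \<Longrightarrow> D f = 0"
    "regular_at M x f \<Longrightarrow> regular_at M x g \<Longrightarrow> openin (opens M) U \<Longrightarrow> x \<in> U \<Longrightarrow> \<forall>y\<in>U. f y = g y \<Longrightarrow> D f = D g"
    "regular_at M x f \<Longrightarrow> regular_at M x g \<Longrightarrow> D (f + g) = D f + D g"
    "regular_at M x f \<Longrightarrow> D (fscale a f) = a * D f"
    "regular_at M x f \<Longrightarrow> regular_at M x g \<Longrightarrow> D (f * g) = f x * D g + g x * D f"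
proof -
  note D = assms[unfolded tangent_space_def, THEN CollectD]
  show "\<not> regular_at M x f \<Longrightarrow> D f = 0" using D by (elim conjE) simp
  show "regular_at M x f \<Longrightarrow> regular_at M x g \<Longrightarrow> openin (opens M) U \<Longrightarrow> x \<in> U \<Longrightarrow> \<forall>y\<in>U. f y = g y \<Longrightarrow> D f = D g"
    using D[THEN conjunct2, THEN conjunct1] by blast
  show "regular_at M x f \<Longrightarrow> regular_at M x g \<Longrightarrow> D (f + g) = D f + D g" using D by (elim conjE) simp
  show "regular_at M x f \<Longrightarrow> D (fscale a f) = a * D f" using D by (elim conjE) simp
  show "regular_at M x f \<Longrightarrow> regular_at M x g \<Longrightarrow> D (f * g) = f x * D g + g x * D f" using D by (elim conjE) simp
qed

lemma fscale_apply: "fscale a g z = a * g z"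
  by (simp add: fscale_def)

lemma subspace_tangent_space: "fvs.subspace (tangent_space M x)"
  unfolding fvs.subspace_def
proof (intro conjI ballI allI)
  show "0 \<in> tangent_space M x" unfolding tangent_space_def by simp
next
  fix D D' assume D: "D \<in> tangent_space M x" "D' \<in> tangent_space M x"
  note D1 = tangent_spaceD[OF D(1)] and D2 = tangent_spaceD[OF D(2)]
  have p: "(D + D') h = D h + D' h" for h by simp
  show "D + D' \<in> tangent_space M x"
    unfolding tangent_space_def p
  proof (intro CollectI conjI allI impI)
    fix f g assume "regular_at M x f \<and> regular_at M x g \<and> (\<exists>U. openin (opens M) U \<and> x \<in> U \<and> (\<forall>y\<in>U. f y = g y))"
    then obtain U where U: "regular_at M x f" "regular_at M x g" "openin (opens M) U" "x \<in> U" "\<forall>y\<in>U. f y = g y" by blast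
    show "D f + D' f = D g + D' g" unfolding D1(2)[OF U] D2(2)[OF U] ..
  qed (simp_all add: D1(1,3,4,5) D2(1,3,4,5) algebra_simps)
next
  fix c D assume "D \<in> tangent_space M x"
  note D = tangent_spaceD[OF this]
  show "fscale c D \<in> tangent_space M x"
    unfolding tangent_space_def fscale_apply[of c D]
  proof (intro CollectI conjI allI impI)
    fix f g assume "regular_at M x f \<and> regular_at M x g \<and> (\<exists>U. openin (opens M) U \<and> x \<in> U \<and> (\<forall>y\<in>U. f y = g y))"
    then obtain U where U: "regular_at M x f" "regular_at M x g" "openin (opens M) U" "x \<in> U" "\<forall>y\<in>U. f y = g y" by blast
    show "c * D f = c * D g" unfolding D(2)[OF U] ..
  qed (simp_all add: D(1,3,4,5) algebra_simps)
qed

context projective_complete_intersection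
begin

text \<open>A tangent vector is determined by its values on the coordinates of a chart, so the dimension of the
  tangent space is not the junk value \<open>0\<close> of infinite-dimensional spaces.\<close>

lemma tangent_space_independent_finite:
  assumes x: "x \<in> cone" and B: "B \<subseteq> tangent_space M (line x)" "fvs.independent B"
  shows "finite B"
proof (rule ccontr)
  assume "infinite B"
  then obtain I where I: "finite I" "card I = Suc nv" "I \<subseteq> B" using infinite_arbitrarily_large by blast
  obtain b where b: "b < nv" "x b \<noteq> 0" by (rule nonzero_coordinate[OF x])
  define u where "u i = (\<lambda>l :: (nat \<Rightarrow> 'k) set. normalise b l i)" for i
  define F where "F D = (\<lambda>i. if i < nv then D (u i) else 0)" for D :: "((nat \<Rightarrow> 'k) set \<Rightarrow> 'k) \<Rightarrow> 'k"
  have c1: "card (unit_vec ` {..<nv} :: (nat \<Rightarrow> 'k) set) < card I" using card_image_le[of "{..<nv}" "unit_vec :: nat \<Rightarrow> nat \<Rightarrow> 'k"] I(2) by simp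
  have c2: "F D \<in> fvs.span (unit_vec ` {..<nv})" for D
  proof -
    have "F D j = (\<Sum>i<nv. fscale (D (u i)) (unit_vec i)) j" for j
    proof -
      have "(\<Sum>i<nv. D (u i) * (if j = i then 1 else 0)) = (\<Sum>i<nv. if j = i then D (u i) else 0)" by (intro sum.cong) auto
      then show ?thesis by (simp add: F_def sum_fun_apply fscale_def unit_vec_def)
    qed
    then have "F D = (\<Sum>i<nv. fscale (D (u i)) (unit_vec i))" by blast
    then show ?thesis by (simp only:) (intro fvs.span_sum fvs.span_scale fvs.span_base, simp)
  qed
  from dependent_family[where f = F, OF I(1) finite_imageI[OF finite_lessThan] c1 c2]
  obtain a where a: "\<exists>D\<in>I. a D \<noteq> 0" "\<forall>j. (\<Sum>D\<in>I. a D * F D j) = 0" by (elim exE conjE) (rule that)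
  let ?D = "\<Sum>D\<in>I. fscale (a D) D"
  have "?D \<in> tangent_space M (line x)"
    using I(3) B(1) by (intro fvs.subspace_sum fvs.subspace_scale subspace_tangent_space) auto
  moreover have "?D (\<lambda>l. normalise b l i) = 0" if "i < nv" for i
    using spec[OF a(2), of i] that by (simp add: sum_fun_apply fscale_def F_def u_def)
  ultimately have "?D g = 0" for g by (rule tangent_determined[OF x b])
  then have "?D = 0" by (simp add: fun_eq_iff)
  then have "\<forall>D\<in>I. a D = 0" using fvs.independentD[OF B(2) I(1,3)] by blast
  then show False using a(1) by blast
qed

text \<open>If all partial derivatives vanished, every vector would be tangential and the tangent
  space would have dimension at least \<open>N\<close>, more than the dimension of \<open>X\<close>
  allows at a regular point.\<close>

lemma smooth_partial_nonzero:
  assumes sm: "smooth_fspace M" and dim: "has_dim (opens M) m" "m + c = N" "1 \<le> c" and x: "x \<in> cone"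
  shows "\<exists>j<c. \<exists>b<nv. partial (f j) b x \<noteq> 0"
proof (rule ccontr)
  assume "\<not> ?thesis"
  then have tang: "tangential x v" for v
    unfolding tangential_def by (auto simp: dird_partial[OF forms_polyfun] intro!: sum.neutral)
  let ?V = "tangent_space M (line x)"
  obtain r where r: "has_local_dim (opens M) (line x) r" "fvs.dim ?V = r"
    using sm line_X[OF x] unfolding smooth_fspace_def points_M by blast
  obtain B where B: "B \<subseteq> ?V" "fvs.independent B" "?V \<subseteq> fvs.span B" "card B = fvs.dim ?V" by (rule fvs.basis_exists)
  obtain b where b: "b < nv" "x b \<noteq> 0" by (rule nonzero_coordinate[OF x])
  \<comment> \<open>The \<open>N\<close> unit vectors other than the \<open>b\<close>-th one are
    used: as \<open>x b\<close> is not 0, no nontrivial combination of them is a multiple of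
    \<open>x\<close>.\<close>
  have "N \<le> r"
  proof (rule ccontr)
    assume "\<not> N \<le> r"
    then have c1: "card B < card ({..<nv} - {b})" using B(4) r(2) b(1) by simp
    have c2: "tangent_vec x (unit_vec i) \<in> fvs.span B" for i using tangent_vec_tangent[OF x tang] B(3) by blast
    from dependent_family[OF _ tangent_space_independent_finite[OF x B(1,2)] c1 c2]
    have "\<exists>a. (\<exists>i\<in>{..<nv} - {b}. a i \<noteq> 0) \<and> (\<forall>g. (\<Sum>i\<in>{..<nv} - {b}. a i * tangent_vec x (unit_vec i) g) = 0)" by simp
    then obtain a where a: "\<exists>i\<in>{..<nv} - {b}. a i \<noteq> 0" "\<forall>g. (\<Sum>i\<in>{..<nv} - {b}. a i * tangent_vec x (unit_vec i) g) = 0"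
      by (elim exE conjE) (rule that)
    have "tangent_vec x (\<lambda>j. \<Sum>i\<in>{..<nv} - {b}. a i * unit_vec i j) g = 0" for g
      using tangent_vec_combination[OF x, of "{..<nv} - {b}" unit_vec a g] tang a(2) by simp
    from tangent_vec_kernel[OF x tang this] obtain \<beta> where
      \<beta>: "\<And>j. j < nv \<Longrightarrow> (\<Sum>i\<in>{..<nv} - {b}. a i * unit_vec i j) = \<beta> * x j" by blast
    have s: "(\<Sum>i\<in>{..<nv} - {b}. a i * unit_vec i j) = (if j < nv \<and> j \<noteq> b then a j else 0)" for j
    proof -
      have "(\<Sum>i\<in>{..<nv} - {b}. a i * unit_vec i j) = (\<Sum>i\<in>{..<nv} - {b}. if j = i then a i else 0)"
        by (intro sum.cong) (auto simp: unit_vec_def)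
      then show ?thesis by auto
    qed
    have "\<beta> = 0" using \<beta>[OF b(1)] b(2) unfolding s by simp
    then have "a j = 0" if "j < nv" "j \<noteq> b" for j using \<beta>[of j] that unfolding s by simp
    then show False using a(1) by auto
  qed
  then have "Suc m \<le> r" using dim by simp
  moreover obtain C where "irreducible_chain (opens M) r C" using r(1) unfolding has_local_dim_def by blast
  \<comment> \<open>An initial segment of a chain is again a chain.\<close>
  ultimately have "irreducible_chain (opens M) (Suc m) C" unfolding irreducible_chain_def by auto
  then show False using dim(1) unfolding has_dim_def by blast
qed

end


section \<open>The cotangent bundle\<close>

lemma is_bundle_cotangent_bundle:
  fixes M :: "('p, 'k::field) fspace"
  assumes M: "fspace_ok M" shows "is_bundle M (cotangent_bundle M)"
  unfolding is_bundle_def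
proof (intro conjI allI impI M)
  fix U V s assume s: "s \<in> cotangent_bundle M U" and V: "V \<subseteq> U" "openin (opens M) V"
  show "s \<in> cotangent_bundle M V" unfolding cotangent_bundle_def
  proof (intro CollectI ballI)
    fix x assume "x \<in> V"
    then have x: "x \<in> U" using V by blast
    from s obtain W and m :: nat and a g where W: "openin (opens M) W" "x \<in> W" "W \<subseteq> U"
      "\<forall>i<m. a i \<in> regs M W \<and> g i \<in> regs M W" "\<forall>y\<in>W. s y = (\<Sum>i<m. fscale (a i y) (differential M (g i) y))"
      using x unfolding cotangent_bundle_def by blast
    have "a i \<in> regs M (W \<inter> V) \<and> g i \<in> regs M (W \<inter> V)" if "i < m" for i
      using W(4) that fspace_okD(1)[OF M, of _ W "W \<inter> V"] by blast
    then show "\<exists>W (m::nat) a g. openin (opens M) W \<and> x \<in> W \<and> W \<subseteq> V \<and> (\<forall>i<m. a i \<in> regs M W \<and> g i \<in> regs M W) \<and>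
      (\<forall>y\<in>W. s y = (\<Sum>i<m. fscale (a i y) (differential M (g i) y)))"
      using W V \<open>x \<in> V\<close> by (intro exI[of _ "W \<inter> V"] exI[of _ m] exI[of _ a] exI[of _ g]) auto
  qed
next
  fix U s t assume s: "s \<in> cotangent_bundle M U" and t: "t \<in> cotangent_bundle M U"
  show "(\<lambda>y. s y + t y) \<in> cotangent_bundle M U" unfolding cotangent_bundle_def
  proof (intro CollectI ballI)
    fix x assume x: "x \<in> U"
    from s obtain W and m :: nat and a g where W: "openin (opens M) W" "x \<in> W" "W \<subseteq> U"
      "\<forall>i<m. a i \<in> regs M W \<and> g i \<in> regs M W" "\<forall>y\<in>W. s y = (\<Sum>i<m. fscale (a i y) (differential M (g i) y))"
      using x unfolding cotangent_bundle_def by blast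
    from t obtain W' and m' :: nat and a' g' where W': "openin (opens M) W'" "x \<in> W'" "W' \<subseteq> U"
      "\<forall>i<m'. a' i \<in> regs M W' \<and> g' i \<in> regs M W'" "\<forall>y\<in>W'. t y = (\<Sum>i<m'. fscale (a' i y) (differential M (g' i) y))"
      using x unfolding cotangent_bundle_def by blast
    define A where "A i = (if i < m then a i else a' (i - m))" for i
    define G where "G i = (if i < m then g i else g' (i - m))" for i
    have r: "A i \<in> regs M (W \<inter> W') \<and> G i \<in> regs M (W \<inter> W')" if "i < m + m'" for i
    proof -
      have "A i \<in> regs M W \<and> G i \<in> regs M W \<or> A i \<in> regs M W' \<and> G i \<in> regs M W'"
        using W(4) W'(4) that unfolding A_def G_def by (cases "i < m") auto
      then show ?thesis using fspace_okD(1)[OF M, of _ W "W \<inter> W'"] fspace_okD(1)[OF M, of _ W' "W \<inter> W'"] by blast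
    qed
    have "s y + t y = (\<Sum>i<m+m'. fscale (A i y) (differential M (G i) y))" if y: "y \<in> W \<inter> W'" for y
    proof -
      have "(\<Sum>i<m+m'. fscale (A i y) (differential M (G i) y)) =
          (\<Sum>i<m. fscale (A i y) (differential M (G i) y)) + (\<Sum>i<m'. fscale (A (m + i) y) (differential M (G (m + i)) y))"
        by (induction m') (simp_all add: add.assoc)
      then show ?thesis using W(5) W'(5) y unfolding A_def G_def by simp
    qed
    then show "\<exists>W (m::nat) a g. openin (opens M) W \<and> x \<in> W \<and> W \<subseteq> U \<and> (\<forall>i<m. a i \<in> regs M W \<and> g i \<in> regs M W) \<and>
      (\<forall>y\<in>W. s y + t y = (\<Sum>i<m. fscale (a i y) (differential M (g i) y)))"
      using W W' r by (intro exI[of _ "W \<inter> W'"] exI[of _ "m + m'"] exI[of _ A] exI[of _ G]) auto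
  qed
next
  fix U s c assume s: "s \<in> cotangent_bundle M U"
  show "(\<lambda>y. fscale c (s y)) \<in> cotangent_bundle M U" unfolding cotangent_bundle_def
  proof (intro CollectI ballI)
    fix x assume x: "x \<in> U"
    from s obtain W and m :: nat and a g where W: "openin (opens M) W" "x \<in> W" "W \<subseteq> U"
      "\<forall>i<m. a i \<in> regs M W \<and> g i \<in> regs M W" "\<forall>y\<in>W. s y = (\<Sum>i<m. fscale (a i y) (differential M (g i) y))"
      using x unfolding cotangent_bundle_def by blast
    have "fscale c (s y) = (\<Sum>i<m. fscale (c * a i y) (differential M (g i) y))" if "y \<in> W" for y
      using W(5) that by (simp add: fvs.scale_sum_right)
    then show "\<exists>W (m::nat) a g. openin (opens M) W \<and> x \<in> W \<and> W \<subseteq> U \<and> (\<forall>i<m. a i \<in> regs M W \<and> g i \<in> regs M W) \<and>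
      (\<forall>y\<in>W. fscale c (s y) = (\<Sum>i<m. fscale (a i y) (differential M (g i) y)))"
      using W fspace_okD(2)[OF M, of _ W c] by (intro exI[of _ W] exI[of _ m] exI[of _ "\<lambda>i y. c * a i y"] exI[of _ g]) auto
  qed
qed

context projective_complete_intersection
begin

abbreviation "Om \<equiv> cotangent_bundle M"

lemma is_bundle_Om: "is_bundle M Om"
  by (rule is_bundle_cotangent_bundle[OF fspace_ok_M])

text \<open>A single fraction for \<open>g\<close> serves all points near \<open>p\<close>, so the
  quotient rule is itself a fraction of polynomials in \<open>x\<close>.\<close>

lemma zreg_tangent_vec:
  assumes T: "T \<subseteq> cone" "\<And>x. x \<in> T \<Longrightarrow> tangential x v" and U: "openin (opens M) U" "g \<in> regs M U"
  shows "zreg nv {x\<in>T. line x \<in> U} (\<lambda>x. tangent_vec x v g)"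
proof (rule zregI)
  fix p assume "p \<in> {x\<in>T. line x \<in> U}"
  then have p: "p \<in> cone" "line p \<in> U" using T by auto
  obtain P Q where PQ: "Q p \<noteq> 0" "\<And>x. Q x \<noteq> 0 \<Longrightarrow> fraction_at x g P Q" "\<And>x. x \<in> cone \<Longrightarrow> Q x \<noteq> 0 \<Longrightarrow> line x \<in> U"
    "P \<in> polyfun nv" "Q \<in> polyfun nv" by (rule fraction_local[OF U p], rule that)
  have "tangent_vec x v g = (dird P x v * Q x - P x * dird Q x v) / (Q x)\<^sup>2" if x: "x \<in> T" "Q x \<noteq> 0" for x
  proof -
    have xc: "x \<in> cone" using x(1) T(1) by blast
    have "regular_at M (line x) g" unfolding regular_at_def using U PQ(3)[OF xc x(2)] by blast
    from tangent_vec_eq[OF xc T(2)[OF x(1)] this PQ(2)[OF x(2)]] show ?thesis unfolding quotient_deriv_def .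
  qed
  moreover have "(\<lambda>x. dird P x v * Q x - P x * dird Q x v) \<in> polyfun nv"
    by (rule polyfun_diff[OF polyfun_mult[OF polyfun_dird[OF PQ(4)] PQ(5)] polyfun_mult[OF PQ(4) polyfun_dird[OF PQ(5)]]])
  moreover have "(\<lambda>x. (Q x)\<^sup>2) \<in> polyfun nv" by (rule polyfun_power[OF PQ(5)])
  ultimately show "\<exists>A B. A \<in> polyfun nv \<and> B \<in> polyfun nv \<and> B p \<noteq> 0 \<and> (\<forall>x\<in>{x\<in>T. line x \<in> U}. B x \<noteq> 0 \<longrightarrow> tangent_vec x v g = A x / B x)"
    using PQ(1) by (intro exI[of _ "\<lambda>x. dird P x v * Q x - P x * dird Q x v"] exI[of _ "\<lambda>x. (Q x)\<^sup>2"]) simp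
qed

lemma zreg_cotangent:
  assumes T: "T \<subseteq> cone" "\<And>x. x \<in> T \<Longrightarrow> tangential x v" and s: "s \<in> Om U"
  shows "zreg nv {x\<in>T. line x \<in> U} (\<lambda>x. s (line x) (tangent_vec x v))"
proof (rule zreg_local[of _ T])
  fix p assume p: "p \<in> {x\<in>T. line x \<in> U}"
  obtain W and m :: nat and a g where W: "openin (opens M) W" "line p \<in> W" "W \<subseteq> U"
    "\<forall>i<m. a i \<in> regs M W \<and> g i \<in> regs M W" "\<forall>y\<in>W. s y = (\<Sum>i<m. fscale (a i y) (differential M (g i) y))"
    using s p unfolding cotangent_bundle_def by blast
  have "zreg nv {x\<in>T. line x \<in> W} (\<lambda>x. \<Sum>i<m. a i (line x) * tangent_vec x v (g i))"
    using W(1,4) by (intro zreg_sum zreg_mult zmorD(3)[OF zmor_line[OF T(1)]] zreg_tangent_vec T) auto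
  then have "zreg nv ({x\<in>T. line x \<in> W} \<inter> {x\<in>T. line x \<in> U}) (\<lambda>x. \<Sum>i<m. a i (line x) * tangent_vec x v (g i))"
    by (rule zreg_subset) simp
  then have "zreg nv ({x\<in>T. line x \<in> W} \<inter> {x\<in>T. line x \<in> U}) (\<lambda>x. s (line x) (tangent_vec x v))"
  proof (rule zreg_cong)
    fix x assume x: "x \<in> {x\<in>T. line x \<in> W} \<inter> {x\<in>T. line x \<in> U}"
    then have "tangent_vec x v \<in> tangent_space M (line x)" using T by (intro tangent_vec_tangent) auto
    then show "(\<Sum>i<m. a i (line x) * tangent_vec x v (g i)) = s (line x) (tangent_vec x v)"
      using W(5) x by (simp add: sum_fun_apply fscale_apply differential_def)
  qed
  then show "\<exists>V. zopen nv T V \<and> p \<in> V \<and> zreg nv (V \<inter> {x\<in>T. line x \<in> U}) (\<lambda>x. s (line x) (tangent_vec x v))"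
    using zmorD(2)[OF zmor_line[OF T(1)] W(1)] W(2) p by blast
qed auto

lemma differential_in_fibre:
  assumes "regular_at M l g" shows "differential M g l \<in> fibre M Om l"
proof -
  obtain U where U: "openin (opens M) U" "l \<in> U" "g \<in> regs M U" using assms unfolding regular_at_def by blast
  have "(\<lambda>_. 1) \<in> regs M U" unfolding regs_M[OF U(1)] by (rule zreg_const)
  moreover have "differential M g y = (\<Sum>i<(1::nat). fscale 1 (differential M g y))" for y by simp
  ultimately have "differential M g \<in> Om U" unfolding cotangent_bundle_def
    by (intro CollectI ballI exI[of _ U] exI[of _ 1] exI[of _ "\<lambda>_ _. 1"] exI[of _ "\<lambda>_. g"]) (use U in auto)
  then show ?thesis by (rule fibre_mem) (rule U)+
qed

text \<open>Evaluation at the tangent vector, cut off outside the fibre as \<open>dual_fibre\<close>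
  requires.\<close>

definition covector :: "(nat \<Rightarrow> 'k) \<Rightarrow> (nat \<Rightarrow> 'k) \<Rightarrow> ((((nat \<Rightarrow> 'k) set \<Rightarrow> 'k) \<Rightarrow> 'k) \<Rightarrow> 'k) \<Rightarrow> 'k" where
  "covector x v e = (if e \<in> fibre M Om (line x) then e (tangent_vec x v) else 0)"

lemma covector_dual: "covector x v \<in> dual_fibre M Om (line x)"
  unfolding covector_def[abs_def] by (rule dual_fibreI[OF is_bundle_Om]) (simp_all add: fscale_apply)

text \<open>Differentials of regular functions lie in the fibre and detect tangent vectors, so a
  relation between the covectors is one between the tangent vectors.\<close>

lemma covectors_independent:
  assumes x: "x \<in> cone" and v: "\<And>a. a < k \<Longrightarrow> tangential x (v a)"
    and ind: "\<And>\<alpha> \<beta>. \<forall>i<nv. (\<Sum>a<k. \<alpha> a * v a i) = \<beta> * x i \<Longrightarrow> \<forall>a<k. \<alpha> a = 0"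
    and 0: "\<And>e. (\<Sum>a<k. \<alpha> a * covector x (v a) e) = 0"
  shows "\<forall>a<k. \<alpha> a = 0"
proof -
  have "tangent_vec x (\<lambda>i. \<Sum>a<k. \<alpha> a * v a i) g = 0" for g
  proof (cases "regular_at M (line x) g")
    case True
    have "differential M g (line x) (tangent_vec x (v a)) = tangent_vec x (v a) g" if "a < k" for a
      using tangent_vec_tangent[OF x v[OF that]] by (simp add: differential_def)
    then have "(\<Sum>a<k. \<alpha> a * tangent_vec x (v a) g) = 0"
      using 0[of "differential M g (line x)"] differential_in_fibre[OF True] by (simp add: covector_def)
    then show ?thesis using tangent_vec_combination[OF x, of "{..<k}" v \<alpha> g] v by simp
  qed (simp add: tangent_vec_def)
  from tangent_vec_kernel[OF x _ this] tangential_combination[of "{..<k}" x v \<alpha>] v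
  show ?thesis using ind by blast
qed

lemma zmor_covectors:
  assumes T: "T \<subseteq> cone" and v: "\<And>x a. x \<in> T \<Longrightarrow> a < k \<Longrightarrow> tangential x (v a)"
    and ind: "\<And>x \<alpha> \<beta>. x \<in> T \<Longrightarrow> \<forall>i<nv. (\<Sum>a<k. \<alpha> a * v a i) = \<beta> * x i \<Longrightarrow> \<forall>a<k. \<alpha> a = 0"
  shows "zmor nv T (frame_bundle M Om k) (\<lambda>x. (line x, map (\<lambda>a. covector x (v a)) [0..<k]))"
proof (rule zmor_frame_bundle[OF zmor_line[OF T]])
  fix x assume x: "x \<in> T"
  then have xc: "x \<in> cone" using T by blast
  have indep: "\<forall>a<k. \<alpha> a = 0" if "\<And>e. (\<Sum>a<k. \<alpha> a * covector x (v a) e) = 0" for \<alpha>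
  proof (rule covectors_independent[OF xc])
    show "\<And>a. a < k \<Longrightarrow> tangential x (v a)" by (rule v[OF x])
    show "\<And>\<alpha> \<beta>. \<forall>i<nv. (\<Sum>a<k. \<alpha> a * v a i) = \<beta> * x i \<Longrightarrow> \<forall>a<k. \<alpha> a = 0" by (rule ind[OF x])
    show "\<And>e. (\<Sum>a<k. \<alpha> a * covector x (v a) e) = 0" by (rule that)
  qed
  have inj: "inj_on (\<lambda>a. covector x (v a)) {..<k}"
  proof (rule inj_onI, rule ccontr)
    fix a b assume ab: "a \<in> {..<k}" "b \<in> {..<k}" "covector x (v a) = covector x (v b)" "a \<noteq> b"
    define \<alpha> where "\<alpha> l = (if l = a then 1 else if l = b then -1 else (0::'k))" for l
    have "(\<Sum>l<k. \<alpha> l * covector x (v l) e) = 0" for e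
    proof -
      have "(\<Sum>l<k. \<alpha> l * covector x (v l) e) = (\<Sum>l\<in>{a, b}. \<alpha> l * covector x (v l) e)"
        by (rule sum.mono_neutral_right) (use ab in \<open>auto simp: \<alpha>_def\<close>)
      then show ?thesis using ab(3,4) by (simp add: \<alpha>_def)
    qed
    from indep[OF this] ab(1) show False by (auto simp: \<alpha>_def)
  qed
  have "fvs.independent ((\<lambda>a. covector x (v a)) ` {..<k})"
  proof
    assume "fvs.dependent ((\<lambda>a. covector x (v a)) ` {..<k})"
    then have "\<exists>h. (\<exists>w\<in>(\<lambda>a. covector x (v a)) ` {..<k}. h w \<noteq> 0) \<and> (\<Sum>w\<in>(\<lambda>a. covector x (v a)) ` {..<k}. fscale (h w) w) = 0"
      by (simp only: fvs.dependent_finite[OF finite_imageI[OF finite_lessThan]])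
    then obtain h where h: "\<exists>w\<in>(\<lambda>a. covector x (v a)) ` {..<k}. h w \<noteq> 0"
      "(\<Sum>w\<in>(\<lambda>a. covector x (v a)) ` {..<k}. fscale (h w) w) = 0" by (elim exE conjE) (rule that)
    have "(\<Sum>a<k. h (covector x (v a)) * covector x (v a) e) = 0" for e
    proof -
      have "(\<Sum>a<k. fscale (h (covector x (v a))) (covector x (v a))) e = 0" using h(2) by (simp add: sum.reindex[OF inj])
      then show ?thesis by (simp add: sum_fun_apply fscale_apply)
    qed
    then have "\<forall>a<k. h (covector x (v a)) = 0" by (rule indep[of "\<lambda>a. h (covector x (v a))"])
    then show False using h(1) by (simp only: bex_simps lessThan_iff) blast
  qed
  moreover have s: "set (map (\<lambda>a. covector x (v a)) [0..<k]) = (\<lambda>a. covector x (v a)) ` {..<k}" by (simp only: set_map set_upt atLeast0LessThan)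
  moreover have "distinct (map (\<lambda>a. covector x (v a)) [0..<k])" using inj by (simp only: distinct_map distinct_upt set_upt atLeast0LessThan simp_thms)
  moreover have "(\<lambda>a. covector x (v a)) ` {..<k} \<subseteq> dual_fibre M Om (line x)" by (rule image_subsetI) (rule covector_dual)
  ultimately show "(line x, map (\<lambda>a. covector x (v a)) [0..<k]) \<in> points (frame_bundle M Om k)"
    unfolding points_frame_bundle points_M s using line_X[OF xc] by simp
next
  fix U s j assume U: "openin (opens M) U" "s \<in> Om U" "j < k"
  have "zreg nv {x\<in>T. line x \<in> U} (\<lambda>x. s (line x) (tangent_vec x (v j)))"
    by (rule zreg_cotangent[OF T v U(2)]) (use U(3) in auto)
  then show "zreg nv {x\<in>T. line x \<in> U} (\<lambda>x. (map (\<lambda>a. covector x (v a)) [0..<k] ! j) (s (line x)))"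
  proof (rule zreg_cong)
    fix x assume "x \<in> {x\<in>T. line x \<in> U}"
    then have "s (line x) \<in> fibre M Om (line x)" using fibre_mem[of s Om U M "line x"] U by simp
    then show "s (line x) (tangent_vec x (v j)) = (map (\<lambda>a. covector x (v a)) [0..<k] ! j) (s (line x))"
      using U(3) by (simp add: covector_def)
  qed
qed

end


section \<open>Functions on the cone defined by Schur powers\<close>

lemma flag_of_scale:
  assumes "c \<noteq> 0" shows "flag_of s (y, map (fscale c) us) = flag_of s (y, us)"
proof -
  have "fvs.span (set (take m (map (fscale c) us))) = fvs.span (set (take m us))" for m
    using fvs.span_image_scale[of "set (take m us)" "\<lambda>_. c"] assms by (simp add: take_map)
  then show ?thesis by (simp add: flag_of_def)
qed

lemma valid_type_1: "valid_type [1]"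
  by (simp add: valid_type_def)

text \<open>A section of a power of O(1) that is nonzero at the point belonging to \<open>p\<close>
  is evaluated at the functionals \<open>\<phi> x\<close>; it is homogeneous of degree
  \<open>m\<close> in them.\<close>

lemma ample_bundle_functions:
  fixes M :: "('p, 'k::field_char_0) fspace" and S :: "('p, 'v, 'k) fbundle"
  assumes ample: "ample_bundle M S" and \<Theta>: "zmor n T (frame_bundle M S 1) (\<lambda>x. (y x, [\<phi> x]))" and p: "p \<in> T"
  shows "\<exists>m H. 1 \<le> m \<and> zreg n T H \<and> H p \<noteq> 0 \<and>
    (\<forall>x\<in>T. \<forall>x'\<in>T. \<forall>c. c \<noteq> 0 \<longrightarrow> y x' = y x \<longrightarrow> \<phi> x' = fscale c (\<phi> x) \<longrightarrow> H x' = c ^ m * H x)"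
proof -
  let ?Z = "flag_bundle M S [1]"
  define F where "F x = flag_of [1] (y x, [\<phi> x])" for x
  have fr: "(y x, [\<phi> x]) \<in> points (frame_bundle M S (hd [1]))" if "x \<in> T" for x using zmorD(1)[OF \<Theta> that] by simp
  have FZ: "F x \<in> points ?Z" if "x \<in> T" for x
    unfolding F_def points_flag_bundle[OF valid_type_1] by (rule flag_of_in_flags[OF valid_type_1 fr[OF that]])
  obtain m \<sigma> where m: "1 \<le> m" and \<sigma>0: "\<sigma> \<in> tensor_bundle ?Z (replicate m (det_dual_quotient M S [1] 0)) (points ?Z)" "\<sigma> (F p) \<noteq> 0"
    using ample FZ[OF p] unfolding ample_bundle_def ample_line_bundle_def proj_bundle_def serre_line_bundle_def by blast
  have \<sigma>: "\<sigma> \<in> tensor_bundle ?Z (map (det_dual_quotient M S [1]) (replicate m 0)) (points ?Z)" using \<sigma>0(1) by (simp add: map_replicate)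
  define H where "H x = \<sigma> (F x) (map (block [1] [\<phi> x]) (replicate m 0))" for x
  have \<Theta>': "zmor n T (frame_bundle M S (hd [1])) (\<lambda>x. (y x, [\<phi> x]))" using \<Theta> by simp
  have "zreg n {x\<in>T. F x \<in> points ?Z} H"
    using zreg_tensor_on_frames[OF valid_type_1 \<Theta>' \<sigma>] unfolding H_def[abs_def] F_def[abs_def] by simp
  moreover have "{x\<in>T. F x \<in> points ?Z} = T" using FZ by blast
  ultimately have zr: "zreg n T H" by simp
  have K: "(\<Sum>i\<leftarrow>replicate m 0. block_rank [1] i) = m"
    by (simp add: map_replicate sum_list_replicate block_rank_def nth_rank_def)
  have sc: "H x' = c ^ m * H x" if x: "x \<in> T" "c \<noteq> 0" "y x' = y x" "\<phi> x' = fscale c (\<phi> x)" for x x' c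
  proof -
    have "F x' = F x" unfolding F_def using flag_of_scale[OF x(2), of "[1]" "y x" "[\<phi> x]"] x(3,4) by simp
    then show ?thesis
      using tensor_scale_frame[OF valid_type_1 fr[OF x(1)] \<sigma> FZ[OF x(1), unfolded F_def], of c] x(4) unfolding H_def K F_def by simp
  qed
  \<comment> \<open>The section is nonzero at the point as a function on lists of arguments. Entries
    are either multiples of \<open>\<phi> p\<close> or outside the domain where the forms can be
    nonzero, so the value at \<open>\<phi> p\<close> decides.\<close>
  have "H p \<noteq> 0"
  proof
    assume H0: "H p = 0"
    let ?r = "replicate m (0::nat)"
    from tensor_value[OF \<sigma> FZ[OF p]] obtain l :: nat and a \<omega> where
      tv: "\<forall>j<l. \<forall>i<length ?r. \<omega> j i \<in> alternating_forms (block_rank [1] (?r ! i)) (nth_sub (snd (F p)) (?r ! i)) (nth_sub (snd (F p)) (Suc (?r ! i)))"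
        "\<forall>vs. length vs = length ?r \<longrightarrow> \<sigma> (F p) vs = (\<Sum>j<l. a j * (\<Prod>i<length ?r. \<omega> j i (vs ! i)))"
        "\<forall>vs. length vs \<noteq> length ?r \<longrightarrow> \<sigma> (F p) vs = 0" by (elim exE conjE) (rule that)
    have \<omega>: "\<omega> j i \<in> alternating_forms (block_rank [1] 0) (nth_sub (snd (F p)) 0) (nth_sub (snd (F p)) (Suc 0))" if "j < l" "i < m" for j i
      using tv(1) that by (simp del: One_nat_def)
    have val: "\<sigma> (F p) vs = (\<Sum>j<l. a j * (\<Prod>i<m. \<omega> j i (vs ! i)))" if "length vs = m" for vs using tv(2) that by simp
    have val0: "\<sigma> (F p) vs = 0" if "length vs \<noteq> m" for vs using tv(3) that by simp
    let ?V = "fvs.span {\<phi> p}"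
    have V: "nth_sub (snd (F p)) 0 = ?V" "block_rank [1] 0 = 1" by (simp_all add: F_def nth_sub_def flag_of_def block_rank_def nth_rank_def)
    have B: "block [1] [\<phi> p] 0 = [\<phi> p]" by (simp add: block_def nth_rank_def)
    have Hp: "(\<Sum>j<l. a j * (\<Prod>i<m. \<omega> j i [\<phi> p])) = 0"
      using H0 val[of "map (block [1] [\<phi> p]) (replicate m 0)"] unfolding H_def by (simp add: map_replicate B[unfolded One_nat_def])
    have "\<sigma> (F p) vs = 0" for vs
    proof (cases "length vs = m")
      case False then show ?thesis by (rule val0)
    next
      case True
      show ?thesis
      proof (cases "\<forall>i<m. \<exists>b. vs ! i = [fscale b (\<phi> p)]")
        case True
        then obtain b where b: "\<And>i. i < m \<Longrightarrow> vs ! i = [fscale (b i) (\<phi> p)]" by metis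
        have "\<omega> j i (vs ! i) = b i * \<omega> j i [\<phi> p]" if "j < l" "i < m" for j i
          using alternating_forms_scale[OF \<omega>[OF that, unfolded V], of "[\<phi> p]" "b i"] b[OF that(2)]
          by (simp add: fvs.span_base)
        then have "\<sigma> (F p) vs = (\<Sum>j<l. a j * ((\<Prod>i<m. b i) * (\<Prod>i<m. \<omega> j i [\<phi> p])))"
          unfolding val[OF \<open>length vs = m\<close>] by (simp add: prod.distrib)
        also have "\<dots> = (\<Prod>i<m. b i) * (\<Sum>j<l. a j * (\<Prod>i<m. \<omega> j i [\<phi> p]))" by (simp add: sum_distrib_left mult_ac)
        finally show ?thesis using Hp by simp
      next
        case False
        then obtain i where i: "i < m" "\<And>b. vs ! i \<noteq> [fscale b (\<phi> p)]" by blast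
        have n: "\<not> (length (vs ! i) = 1 \<and> set (vs ! i) \<subseteq> ?V)"
        proof
          assume "length (vs ! i) = 1 \<and> set (vs ! i) \<subseteq> ?V"
          then obtain u where "vs ! i = [u]" "u \<in> ?V" by (cases "vs ! i") auto
          then show False using i(2) unfolding fvs.span_singleton by blast
        qed
        have "\<omega> j i (vs ! i) = 0" if "j < l" for j
          using \<omega>[OF that i(1), unfolded V] n unfolding alternating_forms_def by blast
        then have z: "(\<Prod>i<m. \<omega> j i (vs ! i)) = 0" if "j < l" for j using i(1) that by (intro prod_zero) auto
        show ?thesis unfolding val[OF \<open>length vs = m\<close>]
          by (intro sum.neutral ballI) (simp only: z lessThan_iff mult_zero_right)
      qed
    qed
    then have "\<sigma> (F p) = 0" by (simp add: fun_eq_iff)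
    then show False using \<sigma>0(2) by simp
  qed
  then show ?thesis using m zr sc by (intro exI[of _ m] exI[of _ H]) auto
qed

text \<open>The linear forms \<open>\<phi>\<close> evaluate sections of the Schur power at the flag and the adapted frame given by
  \<open>us\<close>; the exponent is the size of the partition.\<close>

lemma schur_power_functionals:
  fixes M :: "('p, 'k::field_char_0) fspace" and E :: "('p, 'v, 'k) fbundle"
  assumes B: "is_bundle M E" and lam: "is_partition lam" "length lam \<ge> 1"
    and y: "zmor n T M y" and \<Psi>: "zmor n T (frame_bundle M E (length lam)) (\<lambda>x. (y x, us x))"
  shows "\<exists>\<phi>. zmor n T (frame_bundle M (schur_power M E lam) 1) (\<lambda>x. (y x, [\<phi> x])) \<and>
    (\<forall>x\<in>T. \<forall>x'. \<forall>c. c \<noteq> 0 \<longrightarrow> y x' = y x \<longrightarrow> us x' = map (fscale c) (us x) \<longrightarrow>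
      \<phi> x' = fscale (c ^ (\<Sum>i\<leftarrow>schur_index lam. block_rank (jump_sequence lam) i)) (\<phi> x))"
proof -
  let ?s = "jump_sequence lam" and ?ix = "schur_index lam" and ?S = "schur_power M E lam"
  let ?Z = "flag_bundle M E ?s"
  note s = jump_sequence_valid[OF lam]
  have BS: "is_bundle M ?S" by (rule is_bundle_schur_power[OF B s(1)])
  define K where "K = (\<Sum>i\<leftarrow>?ix. block_rank ?s i)"
  define F where "F x = flag_of ?s (y x, us x)" for x
  define bl where "bl x = map (block ?s (us x)) ?ix" for x
  \<comment> \<open>Elements of a fibre of the direct image are functions on pairs of a flag and a
    list of arguments, so a section is evaluated at the pair given by the frame.\<close>
  define \<phi> where "\<phi> x = (\<lambda>e. if e \<in> fibre M ?S (y x) then e (F x, bl x) else 0)" for x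
  have \<Psi>': "zmor n T (frame_bundle M E (hd ?s)) (\<lambda>x. (y x, us x))" using \<Psi> s(2) by simp
  have fr: "(y x, us x) \<in> points (frame_bundle M E (hd ?s))" if "x \<in> T" for x by (rule zmorD(1)[OF \<Psi>' that])
  have FZ: "F x \<in> points ?Z" "fst (F x) = y x" if "x \<in> T" for x
    using flag_of_in_flags[OF s(1) fr[OF that]] unfolding F_def points_flag_bundle[OF s(1)] by (simp_all add: flag_of_def)
  define R where "R \<sigma> = (\<lambda>y (z, v). if z \<in> points ?Z \<and> fst z = y then \<sigma> z v else 0)"
    for \<sigma> :: "'p \<times> (('v \<Rightarrow> 'k) \<Rightarrow> 'k) set list \<Rightarrow> (('v \<Rightarrow> 'k) \<Rightarrow> 'k) list list \<Rightarrow> 'k"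
  have RF: "R \<sigma> (y x) (F x, w) = \<sigma> (F x) w" if "x \<in> T" for \<sigma> x w using FZ[OF that] by (simp add: R_def)
  have Sec: "t \<in> ?S U \<longleftrightarrow> (\<exists>\<sigma>\<in>schur_line_bundle M E lam {z \<in> points ?Z. fst z \<in> U}. t = R \<sigma>)" for t U
    unfolding schur_power_def direct_image_def R_def by auto
  have dual: "\<phi> x \<in> dual_fibre M ?S (y x)" for x
    unfolding \<phi>_def by (rule dual_fibreI[OF BS]) (simp_all add: fscale_apply)
  \<comment> \<open>Only a nonzero functional defines a point of the projective bundle.\<close>
  have nz: "\<phi> x \<noteq> 0" if x: "x \<in> T" for x
  proof -
    from schur_section_exists[OF B lam fr[OF x]] obtain U \<sigma> where U: "openin (opens M) U" "y x \<in> U"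
      "\<sigma> \<in> schur_line_bundle M E lam {z \<in> points ?Z. fst z \<in> U}" "\<sigma> (F x) (bl x) \<noteq> 0" unfolding F_def bl_def by blast
    have "R \<sigma> \<in> ?S U" unfolding Sec using U(3) by blast
    then have "R \<sigma> (y x) \<in> fibre M ?S (y x)" using fibre_mem[of "R \<sigma>" ?S U M "y x"] U(1,2) by simp
    then have "\<phi> x (R \<sigma> (y x)) \<noteq> 0" unfolding \<phi>_def using RF[OF x] U(4) by simp
    then show ?thesis by (auto simp: fun_eq_iff)
  qed
  have "zmor n T (frame_bundle M ?S 1) (\<lambda>x. (y x, [\<phi> x]))"
  proof (rule zmor_frame_bundle[OF y])
    fix x assume x: "x \<in> T"
    have "fvs.independent {\<phi> x}" using nz[OF x] by (simp add: fvs.dependent_single)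
    then show "(y x, [\<phi> x]) \<in> points (frame_bundle M ?S 1)"
      unfolding points_frame_bundle using dual[of x] zmorD(1)[OF y x] by simp
  next
    fix U t j assume U: "openin (opens M) U" "t \<in> ?S U" "j < (1::nat)"
    then obtain \<sigma> where \<sigma>: "\<sigma> \<in> schur_line_bundle M E lam {z \<in> points ?Z. fst z \<in> U}" "t = R \<sigma>" unfolding Sec by blast
    have "zreg n {x\<in>T. F x \<in> {z \<in> points ?Z. fst z \<in> U}} (\<lambda>x. \<sigma> (F x) (bl x))"
      using zreg_tensor_on_frames[OF s(1) \<Psi>' \<sigma>(1)[unfolded schur_line_bundle_alt]] unfolding F_def bl_def by simp
    moreover have "{x\<in>T. F x \<in> {z \<in> points ?Z. fst z \<in> U}} = {x\<in>T. y x \<in> U}" using FZ by auto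
    ultimately have "zreg n {x\<in>T. y x \<in> U} (\<lambda>x. \<sigma> (F x) (bl x))" by simp
    then show "zreg n {x\<in>T. y x \<in> U} (\<lambda>x. ([\<phi> x] ! j) (t (y x)))"
    proof (rule zreg_cong)
      fix x assume x: "x \<in> {x\<in>T. y x \<in> U}"
      then have "t (y x) \<in> fibre M ?S (y x)" using fibre_mem[of t ?S U M "y x"] U by simp
      then show "\<sigma> (F x) (bl x) = ([\<phi> x] ! j) (t (y x))" using x U(3) RF[of x \<sigma>] unfolding \<phi>_def \<sigma>(2) by simp
    qed
  qed
  moreover have "\<phi> x' = fscale (c ^ K) (\<phi> x)" if x: "x \<in> T" "c \<noteq> 0" "y x' = y x" "us x' = map (fscale c) (us x)" for x x' c
  proof
    fix e
    have F': "F x' = F x" unfolding F_def x(3,4) by (rule flag_of_scale[OF x(2)])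
    show "\<phi> x' e = fscale (c ^ K) (\<phi> x) e"
    proof (cases "e \<in> fibre M ?S (y x)")
      case True
      then obtain t U where t: "e = t (y x)" "openin (opens M) U" "y x \<in> U" "t \<in> ?S U" unfolding fibre_def by blast
      then obtain \<sigma> where \<sigma>: "\<sigma> \<in> schur_line_bundle M E lam {z \<in> points ?Z. fst z \<in> U}" "t = R \<sigma>" unfolding Sec by blast
      have "F x \<in> {z \<in> points ?Z. fst z \<in> U}" using FZ[OF x(1)] t(3) by simp
      from tensor_scale_frame[OF s(1) fr[OF x(1)] \<sigma>(1)[unfolded schur_line_bundle_alt] this[unfolded F_def], of c]
      have "\<sigma> (F x) (bl x') = c ^ K * \<sigma> (F x) (bl x)" unfolding bl_def x(4) F_def K_def .
      then show ?thesis using True RF[OF x(1), of \<sigma>] unfolding \<phi>_def x(3) F' t(1) \<sigma>(2) by (simp add: fscale_apply)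
    qed (simp add: \<phi>_def x(3) fscale_apply)
  qed
  ultimately show ?thesis unfolding K_def[symmetric] by (intro exI[of _ \<phi>]) blast
qed

context projective_complete_intersection
begin

lemma covector_fscale:
  assumes x: "x \<in> cone" "tangential x v" "tangential (fscale t x) v" and t: "t \<noteq> 0"
  shows "covector (fscale t x) v = fscale (1 / t) (covector x v)"
proof
  fix e
  have l: "line (fscale t x) = line x" by (rule line_fscale[OF t])
  show "covector (fscale t x) v e = fscale (1 / t) (covector x v) e"
  proof (cases "e \<in> fibre M Om (line x)")
    case True
    then obtain s U where s: "e = s (line x)" "openin (opens M) U" "line x \<in> U" "s \<in> Om U" unfolding fibre_def by blast
    then obtain W and m :: nat and a g where
      e: "\<forall>y\<in>W. s y = (\<Sum>i<m. fscale (a i y) (differential M (g i) y))" "line x \<in> W" unfolding cotangent_bundle_def by blast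
    have D: "tangent_vec x v \<in> tangent_space M (line x)" "tangent_vec (fscale t x) v \<in> tangent_space M (line x)"
      using tangent_vec_tangent[OF x(1,2)] tangent_vec_tangent[OF cone_fscale[OF x(1) t] x(3)] unfolding l by auto
    have "e (tangent_vec (fscale t x) v) = e (tangent_vec x v) / t"
      using e D by (simp add: s(1) sum_fun_apply fscale_apply differential_def tangent_vec_fscale[OF x t] sum_divide_distrib)
    then show ?thesis using True by (simp add: covector_def l fscale_apply)
  qed (simp add: covector_def l fscale_apply)
qed

lemma schur_power_not_ample:
  assumes sm: "smooth_fspace M" and dim: "has_dim (opens M) m" "m + c = N" "1 \<le> c"
    and lam: "is_partition lam" "length lam \<ge> 1" and k: "(1 + length lam) * c < N"
  shows "\<not> ample_bundle M (schur_power M Om lam)"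
proof
  assume ample: "ample_bundle M (schur_power M Om lam)"
  let ?k = "length lam"
  have "\<exists>j<c. \<exists>b<nv. partial (f j) b y \<noteq> 0" if "y \<in> coord_space nv" "y \<noteq> 0" "\<forall>j<c. f j y = 0" for y
    by (rule smooth_partial_nonzero[OF sm dim]) (use that in \<open>simp add: cone_eq\<close>)
  then have "\<exists>v G. finite G \<and> card G + 1 < nv \<and> (\<forall>g\<in>G. \<exists>e>0. homogeneous nv e g) \<and>
    (\<forall>x\<in>cone_zeros nv G. (\<forall>j<c. f j x = 0) \<and> (\<forall>j<c. \<forall>a<?k. dird (f j) x (v a) = 0) \<and>
      (\<forall>\<alpha> \<beta>. (\<forall>i<nv. (\<Sum>a<?k. \<alpha> a * v a i) = \<beta> * x i) \<longrightarrow> (\<forall>a<?k. \<alpha> a = 0)))"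
    by (intro tangent_vectors_exist[where d = d]) (use forms dim(3) k in auto)
  then obtain v G where G: "finite G" "card G + 1 < nv" "\<forall>g\<in>G. \<exists>e>0. homogeneous nv e g"
    and T: "\<forall>x\<in>cone_zeros nv G. (\<forall>j<c. f j x = 0) \<and> (\<forall>j<c. \<forall>a<?k. dird (f j) x (v a) = 0) \<and>
      (\<forall>\<alpha> \<beta>. (\<forall>i<nv. (\<Sum>a<?k. \<alpha> a * v a i) = \<beta> * x i) \<longrightarrow> (\<forall>a<?k. \<alpha> a = 0))"
    by (elim exE conjE) (rule that)
  define T where "T = cone_zeros nv G"
  obtain e where e: "\<And>g. g \<in> G \<Longrightarrow> homogeneous nv (e g) g \<and> 0 < e g" using G(3) by metis
  have Tc: "T \<subseteq> cone" using T unfolding T_def cone_eq cone_zeros_def by auto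
  have Tt: "fscale t x \<in> T" if "x \<in> T" "t \<noteq> 0" for x t
    unfolding T_def by (rule cone_zeros_fscale[of G nv e]) (use e that T_def in auto)
  have tang: "tangential x (v a)" if "x \<in> T" "a < ?k" for x a using T that unfolding T_def tangential_def by blast
  have ind: "\<forall>a<?k. \<alpha> a = 0" if "x \<in> T" "\<forall>i<nv. (\<Sum>a<?k. \<alpha> a * v a i) = \<beta> * x i" for x \<alpha> \<beta>
    using T that unfolding T_def by blast
  define us where "us x = map (\<lambda>a. covector x (v a)) [0..<?k]" for x
  have \<Psi>: "zmor nv T (frame_bundle M Om ?k) (\<lambda>x. (line x, us x))" unfolding us_def by (rule zmor_covectors[OF Tc tang ind])
  define K where "K = (\<Sum>i\<leftarrow>schur_index lam. block_rank (jump_sequence lam) i)"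
  have "\<exists>\<phi>. zmor nv T (frame_bundle M (schur_power M Om lam) 1) (\<lambda>x. (line x, [\<phi> x])) \<and>
    (\<forall>x\<in>T. \<forall>x'. \<forall>c. c \<noteq> 0 \<longrightarrow> line x' = line x \<longrightarrow> us x' = map (fscale c) (us x) \<longrightarrow> \<phi> x' = fscale (c ^ K) (\<phi> x))"
    unfolding K_def by (rule schur_power_functionals[OF is_bundle_Om lam zmor_line[OF Tc] \<Psi>])
  then obtain \<phi> where "zmor nv T (frame_bundle M (schur_power M Om lam) 1) (\<lambda>x. (line x, [\<phi> x])) \<and>
    (\<forall>x\<in>T. \<forall>x'. \<forall>c. c \<noteq> 0 \<longrightarrow> line x' = line x \<longrightarrow> us x' = map (fscale c) (us x) \<longrightarrow> \<phi> x' = fscale (c ^ K) (\<phi> x))" ..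
  note \<phi> = conjunct1[OF this] conjunct2[OF this]
  have K: "0 < K" unfolding K_def by (rule schur_weight_pos[OF lam])
  show False
  proof (rule no_negative_degree_functions[OF G(1,2) e])
    fix p assume "p \<in> cone_zeros nv G"
    then have p: "p \<in> T" unfolding T_def .
    obtain m H where H: "1 \<le> m" "zreg nv T H" "H p \<noteq> 0"
      "\<forall>x\<in>T. \<forall>x'\<in>T. \<forall>c. c \<noteq> 0 \<longrightarrow> line x' = line x \<longrightarrow> \<phi> x' = fscale c (\<phi> x) \<longrightarrow> H x' = c ^ m * H x"
      using ample_bundle_functions[OF ample \<phi>(1) p] by (elim exE conjE) (rule that)
    \<comment> \<open>Three homogeneities are composed: degree -1 of the covectors in
      \<open>x\<close>, degree \<open>K\<close> of the functional in the frame and degree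
      \<open>m\<close> of the section in the functional.\<close>
    have "H (fscale t x) * t ^ (K * m) = H x" if x: "x \<in> T" "t \<noteq> 0" for x t
    proof -
      have "us (fscale t x) = map (fscale (1 / t)) (us x)"
        unfolding us_def using covector_fscale[OF _ tang[OF x(1)] tang[OF Tt[OF x]] x(2)] Tc x(1) by auto
      then have "\<phi> (fscale t x) = fscale ((1 / t) ^ K) (\<phi> x)"
        using \<phi>(2) x line_fscale[OF x(2), of x] by simp
      then have "H (fscale t x) = ((1 / t) ^ K) ^ m * H x"
        using H(4) x Tt[OF x] line_fscale[OF x(2), of x] by simp
      then show ?thesis using x(2) by (simp add: power_mult[symmetric] power_one_over)
    qed
    then show "\<exists>w H. 0 < w \<and> zreg nv (cone_zeros nv G) H \<and>
      (\<forall>x\<in>cone_zeros nv G. \<forall>t. t \<noteq> 0 \<longrightarrow> H (fscale t x) * t ^ w = H x) \<and> H p \<noteq> 0"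
      using H(1,2,3) K unfolding T_def by (intro exI[of _ "K * m"] exI[of _ H]) simp
  qed
qed

end

theorem mainTheorem3:
  fixes X :: "(nat \<Rightarrow> 'k::{alg_closed_field, field_char_0}) set set"
    and N c :: nat and lam :: "nat list"
  assumes "c \<ge> 1"
    and "complete_intersection N c X"
    and "smooth_fspace (proj_subvariety N X)"
    and "is_partition lam" and "length lam \<ge> 1"
    and "(1 + length lam) * c < N"
  shows "\<not> ample_bundle (proj_subvariety N X)
            (schur_power (proj_subvariety N X) (cotangent_bundle (proj_subvariety N X)) lam)"
proof -
  obtain n f d where n: "has_dim (opens (proj_subvariety N X)) n" "n + c = N"
    and f: "\<forall>i<c. 0 < d i \<and> homogeneous (Suc N) (d i) (f i)"
      "vanishing_ideal N X = {\<Sum>i<c. a i * f i |a. \<forall>i<c. a i \<in> polyfun (Suc N)}"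
    using assms(2) unfolding complete_intersection_def by (elim exE conjE) (rule that)
  interpret projective_complete_intersection N X c f d
    by unfold_locales (use assms(2) f in \<open>auto simp: complete_intersection_def\<close>)
  show ?thesis by (rule schur_power_not_ample[OF assms(3) n assms(1,4-6)])
qed

end
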